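(* Let $(P[[h]],\circ_\lambda^h,\Delta_h)$ be a conformal formal deformation of a commutative and cocommutative antisymmetric infinitesimal (ASI) conformal bialgebra $(P,\cdot_\lambda\cdot,\Delta)$, with $$a\circ_\lambda^hb=a_\lambda b+\sum_{i\ge1}h^i\{a_\lambda b\}_{\mu_i},\qquad \Delta_h(a)=\Delta(a)+\sum_{i\ge1}\Delta_i(a)h^i,\qquad a,b\in P.$$ Define $$[a_\lambda b]:=\frac{a\circ_\lambda^hb-b\circ_{-\lambda-\partial}^ha}{h}\ (\mathrm{mod}\ h)=\{a_\lambda b\}_{\mu_1}-\{b_{-\lambda-\partial}a\}_{\mu_1},\qquad \delta(a):=\frac{\Delta_h(a)-\tau\Delta_h(a)}{h}\ (\mathrm{mod}\ h)=\Delta_1(a)-\tau\Delta_1(a).$$ Then $(P,[\cdot_\lambda\cdot],\cdot_\lambda\cdot,\delta,\Delta)$ is a Poisson conformal bialgebra.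
   Context: Let $\mathbf k$ be a field of characteristic $0$, $\mathbf K=\mathbf k[[h]]$. All $\mathbf k[\partial]$-modules (before adjoining $h$) are assumed finitely generated; $\otimes$ is over $\mathbf k$ unless indicated, $I$ is the identity, $\tau(u\otimes v)=v\otimes u$. An associative conformal algebra is a $\mathbf k[\partial]$-module $P$ with a $\mathbf k$-bilinear map $P\times P\to P[\lambda]$, $(a,b)\mapsto a_\lambda b$, with $(\partial a)_\lambda b=-\lambda a_\lambda b$, $a_\lambda(\partial b)=(\partial+\lambda)a_\lambda b$, $(a_\lambda b)_{\lambda+\mu}c=a_\lambda(b_\mu c)$; it is commutative if $a_\lambda b=b_{-\lambda-\partial}a$. (If $b_\nu a=\sum_k\nu^kc_k$, then $b_{-\lambda-\partial}a=\sum_k(-\lambda-\partial)^kc_k$.) A Lie conformal algebra is a $\mathbf k[\partial]$-module $P$ with a $\mathbf k$-bilinear map $[\cdot_\lambda\cdot]:P\times P\to P[\lambda]$ with $[(\partial a)_\lambda b]=-\lambda[a_\lambda b]$, $[a_\lambda(\partial b)]=(\partial+\lambda)[a_\lambda b]$, $[a_\lambda b]=-[b_{-\lambda-\partial}a]$, $[a_\lambda[b_\mu c]]=[[a_\lambda b]_{\lambda+\mu}c]+[b_\mu[a_\lambda c]]$. A Poisson conformal algebra is both a Lie conformal algebra and a commutative associative conformal algebra such that $[a_\lambda(b_\mu c)]=[a_\lambda b]_{\lambda+\mu}c+b_\mu[a_\lambda c]$. Write $\mathfrak{ad}_P(a)_\lambda b=[a_\lambda b]$, $\mathfrak L_P(a)_\lambda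 b=a_\lambda b$, $\mathfrak R_P(a)_\lambda b=b_{-\lambda-\partial}a$. Put $\partial^{\otimes^2}=\partial\otimes I+I\otimes\partial$ (the $\mathbf k[\partial]$-action on $P\otimes P$). If $T_\nu u=\sum_k\nu^kw_k$, then $(T_{-\lambda-\partial^{\otimes^2}}\otimes I)(u\otimes v)=\sum_k(-\lambda-\partial^{\otimes^2})^k(w_k\otimes v)$, similarly in the second factor. Coproducts $P\to P\otimes P$ are $\mathbf k[\partial]$-module homomorphisms. $(P,\Delta)$ is an associative conformal coalgebra if $(I\otimes\Delta)\Delta=(\Delta\otimes I)\Delta$, cocommutative if $\Delta=\tau\Delta$. An ASI conformal bialgebra $(P,\cdot_\lambda\cdot,\Delta)$ is an associative conformal algebra and an associative conformal coalgebra such that $\Delta(a_\lambda b)=(I\otimes\mathfrak L_P(a)_\lambda)\Delta(b)+(\mathfrak R_P(b)_{-\lambda-\partial^{\otimes^2}}\otimes I)\Delta(a)$ and $(\mathfrak L_P(b)_{-\lambda-\partial^{\otimes^2}}\otimes I-I\otimes\mathfrak R_P(b)_{-\lambda-\partial^{\otimes^2}})\Delta(a)+\tau(\mathfrak L_P(a)_\lambda\otimes I-I\otimes\mathfrak R_P(a)_\lambda)\Delta(b)=0$; it is commutative and cocommutative if the algebra is commutative and the coalgebra cocommutative. Deformations. $P[[h]]$ is the topologically free $\mathbf K$-module of formal series $\sum_{i\ge0}v_ih^i$, $v_i\in P$, with the $h$-adic topology; for a $\mathbf k[\partial]$-module $P$ it has the coefficientwise $\mathbf k[\partial]$-action. An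 $h$-adic associative conformal algebra $(P[[h]],\circ^h_\lambda)$ is $P[[h]]$ with a $\mathbf k[\partial]$-module structure and a continuous $\mathbf K$-bilinear $\lambda$-product $P[[h]]\times P[[h]]\to P[[h]][[\lambda]]$ such that for each $n\in\mathbb N$ the quotient $P[[h]]/h^nP[[h]]$ with the induced product is an associative conformal algebra. An $h$-adic associative conformal coalgebra $(P[[h]],\Delta_h)$ is $P[[h]]$ with a $\mathbf k[\partial]$-module structure and a continuous $\mathbf K$-linear $\mathbf k[\partial]$-module homomorphism $\Delta_h:P[[h]]\to P[[h]]\widehat\otimes P[[h]]$ such that $(I\widehat\otimes\Delta_h)\Delta_h=(\Delta_h\widehat\otimes I)\Delta_h$, where $\widehat\otimes$ is the $h$-adic completion of $\otimes_{\mathbf K}$. An $h$-adic ASI conformal bialgebra $(P[[h]],\circ_\lambda^h,\Delta_h)$ consists of both structures such that for each $n\in\mathbb N$ the quotient $P[[h]]/h^nP[[h]]$ with the induced product and coproduct (tensor products over $\mathbf K$) is an ASI conformal bialgebra. A conformal formal deformation of a commutative and cocommutative ASI conformal bialgebra $(P,\cdot_\lambda\cdot,\Delta)$ is an $h$-adic ASI conformal bialgebra such that the displayed expansions in the claim hold, where $\{\cdot_\lambda\cdot\}_{\mu_i}:P\times P\to P[\lambda]$ are $\mathbf k$-bilinear maps ($\mu_i$ is only a label) and $\Delta_i:P\to P\otimes P$ are $\mathbf k[\partial]$-module homomorphisms, $i\ge1$. $(P,\delta)$ is a Lie conformal coalgebra if $\delta=-\tau\delta$ and $(I\otimes\delta)\delta-(\tau\otimes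 I)(I\otimes\delta)\delta=(\delta\otimes I)\delta$. $(P,\delta,\Delta)$ is a Poisson conformal coalgebra if $(P,\delta)$ is a Lie conformal coalgebra, $(P,\Delta)$ a cocommutative associative conformal coalgebra and $(I\otimes\Delta)\delta=(\delta\otimes I)\Delta+(\tau\otimes I)(I\otimes\delta)\Delta$. A Poisson conformal bialgebra is a 5-tuple $(P,[\cdot_\lambda\cdot],\cdot_\lambda\cdot,\delta,\Delta)$ such that $(P,[\cdot_\lambda\cdot],\cdot_\lambda\cdot)$ is a Poisson conformal algebra, $(P,\delta,\Delta)$ is a Poisson conformal coalgebra, $(P,\cdot_\lambda\cdot,\Delta)$ is a commutative and cocommutative ASI conformal bialgebra, and for all $a,b\in P$: (i) $\delta([a_\lambda b])=(\mathfrak{ad}_P(a)_\lambda\otimes I+I\otimes\mathfrak{ad}_P(a)_\lambda)\delta(b)-(\mathfrak{ad}_P(b)_{-\lambda-\partial^{\otimes^2}}\otimes I+I\otimes\mathfrak{ad}_P(b)_{-\lambda-\partial^{\otimes^2}})\delta(a)$; (ii) $\delta(a_\lambda b)=(\mathfrak L_P(a)_\lambda\otimes I)\delta(b)+(\mathfrak L_P(b)_{-\lambda-\partial^{\otimes^2}}\otimes I)\delta(a)+(I\otimes\mathfrak{ad}_P(a)_\lambda)\Delta(b)+(I\otimes\mathfrak{ad}_P(b)_{-\lambda-\partial^{\otimes^2}})\Delta(a)$; (iii) $\Delta([a_\lambda b])=(\mathfrak{ad}_P(a)_\lambda\otimes I+I\otimes\mathfrak{ad}_P(a)_\lambda)\Delta(b)-(I\otimes\mathfrak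 L_P(b)_{-\lambda-\partial^{\otimes^2}})\delta(a)+(\mathfrak L_P(b)_{-\lambda-\partial^{\otimes^2}}\otimes I)\delta(a)$. *)

theory Defs
  imports "HOL-Algebra.UnivPoly" "HOL-Analysis.Function_Topology" "HOL-Analysis.Product_Topology"
begin

section \<open>Modules: homomorphisms, quotients, tensor products\<close>

text \<open>
  Everything is relative to a commutative ring \<open>R\<close>, so that the same definitions serve both
  for a module \<open>P\<close> over the field \<open>k\<close> and for the quotients \<open>P[[h]] / h^n P[[h]]\<close> over
  \<open>k[[h]]\<close>.  The multiplicative part of a module record is irrelevant and left undefined.
\<close>

definition module_maps :: "('r, 's) ring_scheme \<Rightarrow> ('r, 'a, 'm) module_scheme
    \<Rightarrow> ('r, 'b, 'n) module_scheme \<Rightarrow> ('a \<Rightarrow> 'b) set" where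
  "module_maps R M N = {f \<in> carrier M \<rightarrow> carrier N.
     (\<forall>x \<in> carrier M. \<forall>y \<in> carrier M. f (x \<oplus>\<^bsub>M\<^esub> y) = f x \<oplus>\<^bsub>N\<^esub> f y) \<and>
     (\<forall>r \<in> carrier R. \<forall>x \<in> carrier M. f (r \<odot>\<^bsub>M\<^esub> x) = r \<odot>\<^bsub>N\<^esub> f x)}"

definition submodule_span :: "('r, 's) ring_scheme \<Rightarrow> ('r, 'a) module \<Rightarrow> 'a set \<Rightarrow> 'a set" where
  "submodule_span R M S = \<Inter> {H. submodule H R M \<and> S \<subseteq> H}"

definition quot_module :: "('r, 'a) module \<Rightarrow> 'a set \<Rightarrow> ('r, 'a set) module" where
  "quot_module M N = \<lparr>carrier = a_rcosets\<^bsub>M\<^esub> N, monoid.mult = undefined, one = undefined,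
     zero = N, add = set_add M, smult = (\<lambda>r X. \<Union>x\<in>X. N +>\<^bsub>M\<^esub> (r \<odot>\<^bsub>M\<^esub> x))\<rparr>"

definition restrict_scalars :: "('r \<Rightarrow> 'q) \<Rightarrow> ('q, 'a) module \<Rightarrow> ('r, 'a) module" where
  "restrict_scalars \<phi> M = \<lparr>carrier = carrier M, monoid.mult = undefined, one = undefined,
     zero = \<zero>\<^bsub>M\<^esub>, add = add M, smult = (\<lambda>r x. \<phi> r \<odot>\<^bsub>M\<^esub> x)\<rparr>"

definition free_module :: "('r, 's) ring_scheme \<Rightarrow> 'x set \<Rightarrow> ('r, 'x \<Rightarrow> 'r) module" where
  "free_module R X = \<lparr>carrier = {f. (\<forall>x. f x \<in> carrier R) \<and> (\<forall>x. x \<notin> X \<longrightarrow> f x = \<zero>\<^bsub>R\<^esub>) \<and>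
       finite {x. f x \<noteq> \<zero>\<^bsub>R\<^esub>}},
     monoid.mult = undefined, one = undefined, zero = (\<lambda>x. \<zero>\<^bsub>R\<^esub>),
     add = (\<lambda>f g x. f x \<oplus>\<^bsub>R\<^esub> g x), smult = (\<lambda>r f x. r \<otimes>\<^bsub>R\<^esub> f x)\<rparr>"

definition free_gen :: "('r, 's) ring_scheme \<Rightarrow> 'x \<Rightarrow> 'x \<Rightarrow> 'r" where
  "free_gen R x = (\<lambda>y. if y = x then \<one>\<^bsub>R\<^esub> else \<zero>\<^bsub>R\<^esub>)"

definition tensor_rels :: "('r, 's) ring_scheme \<Rightarrow> ('r, 'a) module \<Rightarrow> ('r, 'b) module
    \<Rightarrow> ('a \<times> 'b \<Rightarrow> 'r) set" where
  "tensor_rels R M N = (let F = free_module R (carrier M \<times> carrier N); e = free_gen R in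
     submodule_span R F (
       {e (x \<oplus>\<^bsub>M\<^esub> x', y) \<ominus>\<^bsub>F\<^esub> (e (x, y) \<oplus>\<^bsub>F\<^esub> e (x', y)) | x x' y.
          x \<in> carrier M \<and> x' \<in> carrier M \<and> y \<in> carrier N} \<union>
       {e (x, y \<oplus>\<^bsub>N\<^esub> y') \<ominus>\<^bsub>F\<^esub> (e (x, y) \<oplus>\<^bsub>F\<^esub> e (x, y')) | x y y'.
          x \<in> carrier M \<and> y \<in> carrier N \<and> y' \<in> carrier N} \<union>
       {e (r \<odot>\<^bsub>M\<^esub> x, y) \<ominus>\<^bsub>F\<^esub> r \<odot>\<^bsub>F\<^esub> e (x, y) | r x y.
          r \<in> carrier R \<and> x \<in> carrier M \<and> y \<in> carrier N} \<union>
       {e (x, r \<odot>\<^bsub>N\<^esub> y) \<ominus>\<^bsub>F\<^esub> r \<odot>\<^bsub>F\<^esub> e (x, y) | r x y.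
          r \<in> carrier R \<and> x \<in> carrier M \<and> y \<in> carrier N}))"

definition tensor :: "('r, 's) ring_scheme \<Rightarrow> ('r, 'a) module \<Rightarrow> ('r, 'b) module
    \<Rightarrow> ('r, ('a \<times> 'b \<Rightarrow> 'r) set) module" where
  "tensor R M N = quot_module (free_module R (carrier M \<times> carrier N)) (tensor_rels R M N)"

definition tensor_pure :: "('r, 's) ring_scheme \<Rightarrow> ('r, 'a) module \<Rightarrow> ('r, 'b) module
    \<Rightarrow> 'a \<Rightarrow> 'b \<Rightarrow> ('a \<times> 'b \<Rightarrow> 'r) set" where
  "tensor_pure R M N x y =
     tensor_rels R M N +>\<^bsub>free_module R (carrier M \<times> carrier N)\<^esub> free_gen R (x, y)"

text \<open>
  The linear map \<open>M \<otimes> N \<rightarrow> L\<close> induced by a bilinear map \<open>f\<close>: all representatives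
  \<open>\<Sum> g(x,y) (x,y)\<close> of a tensor have the same value \<open>\<Sum> g(x,y) f x y\<close>.
\<close>

definition tensor_lift :: "('r, 's) ring_scheme \<Rightarrow> ('r, 'c) module \<Rightarrow> ('a \<Rightarrow> 'b \<Rightarrow> 'c)
    \<Rightarrow> ('a \<times> 'b \<Rightarrow> 'r) set \<Rightarrow> 'c" where
  "tensor_lift R L f X = the_elem
     ((\<lambda>g. \<Oplus>\<^bsub>L\<^esub>z \<in> {z. g z \<noteq> \<zero>\<^bsub>R\<^esub>}. g z \<odot>\<^bsub>L\<^esub> f (fst z) (snd z)) ` X)"

text \<open>\<open>f \<otimes> g\<close>, where \<open>C\<close> and \<open>D\<close> are the codomains of \<open>f\<close> and \<open>g\<close>.\<close>

definition tensor_map :: "('r, 's) ring_scheme \<Rightarrow> ('r, 'c) module \<Rightarrow> ('r, 'd) module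
    \<Rightarrow> ('a \<Rightarrow> 'c) \<Rightarrow> ('b \<Rightarrow> 'd) \<Rightarrow> ('a \<times> 'b \<Rightarrow> 'r) set \<Rightarrow> ('c \<times> 'd \<Rightarrow> 'r) set" where
  "tensor_map R C D f g =
     tensor_lift R (tensor R C D) (\<lambda>x y. tensor_pure R C D (f x) (g y))"

definition tensor_flip :: "('r, 's) ring_scheme \<Rightarrow> ('r, 'a) module
    \<Rightarrow> ('a \<times> 'a \<Rightarrow> 'r) set \<Rightarrow> ('a \<times> 'a \<Rightarrow> 'r) set" where
  "tensor_flip R M = tensor_lift R (tensor R M M) (\<lambda>x y. tensor_pure R M M y x)"

text \<open>
  The identification \<open>x \<otimes> (y \<otimes> z) \<mapsto> (x \<otimes> y) \<otimes> z\<close>; identities between elements of the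
  threefold tensor power are stated in \<open>(M \<otimes> M) \<otimes> M\<close>.
\<close>

definition tensor_assoc :: "('r, 's) ring_scheme \<Rightarrow> ('r, 'a) module
    \<Rightarrow> ('a \<times> ('a \<times> 'a \<Rightarrow> 'r) set \<Rightarrow> 'r) set \<Rightarrow> (('a \<times> 'a \<Rightarrow> 'r) set \<times> 'a \<Rightarrow> 'r) set" where
  "tensor_assoc R M = (let T3 = tensor R (tensor R M M) M in
     tensor_lift R T3 (\<lambda>x. tensor_lift R T3 (\<lambda>y z.
       tensor_pure R (tensor R M M) M (tensor_pure R M M x y) z)))"

section \<open>Conformal algebras\<close>

text \<open>
  An \<open>R[\<partial>]\<close>-module is an \<open>R\<close>-module with an endomorphism \<open>D\<close>.  The polynomial module
  \<open>M[\<lambda>]\<close> is \<^term>\<open>up M\<close>, the set of finitely supported coefficient sequences, and a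
  \<open>\<lambda>\<close>-product is a map \<open>f\<close> such that \<open>f a b n\<close> is the coefficient of \<open>\<lambda>^n\<close> in \<open>a\<^sub>\<lambda> b\<close>.
  Polynomials in \<open>\<lambda>, \<mu>\<close> are functions of two indices, the first one for \<open>\<lambda>\<close>.
\<close>

locale diff_module = Module.module R M
  for R :: "('r, 's) ring_scheme" (structure) and M :: "('r, 'a) module" (structure) +
  fixes D :: "'a \<Rightarrow> 'a"
  assumes D_linear: "D \<in> module_maps R M M"

definition finitely_generated_diff_module ::
    "('r, 's) ring_scheme \<Rightarrow> ('r, 'a) module \<Rightarrow> ('a \<Rightarrow> 'a) \<Rightarrow> bool" where
  "finitely_generated_diff_module R M D \<longleftrightarrow> (\<exists>S. finite S \<and> S \<subseteq> carrier M \<and>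
     (\<forall>H. submodule H R M \<and> D ` H \<subseteq> H \<and> S \<subseteq> H \<longrightarrow> H = carrier M))"

text \<open>Multiplication of a polynomial by \<open>\<lambda>\<close>.\<close>

definition times_lambda :: "('r, 'a) module \<Rightarrow> (nat \<Rightarrow> 'a) \<Rightarrow> nat \<Rightarrow> 'a" where
  "times_lambda M p n = (case n of 0 \<Rightarrow> \<zero>\<^bsub>M\<^esub> | Suc m \<Rightarrow> p m)"

definition const_coeff :: "('a, 'm) ring_scheme \<Rightarrow> 'a \<Rightarrow> nat \<Rightarrow> 'a" where
  "const_coeff M x n = (if n = 0 then x else \<zero>\<^bsub>M\<^esub>)"

text \<open>The operator \<open>-\<lambda>-\<partial>\<close> on \<open>M[\<lambda>]\<close>.\<close>

definition neg_lambda_D :: "('r, 'a) module \<Rightarrow> ('a \<Rightarrow> 'a) \<Rightarrow> (nat \<Rightarrow> 'a) \<Rightarrow> nat \<Rightarrow> 'a" where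
  "neg_lambda_D M D p n = (\<ominus>\<^bsub>M\<^esub> times_lambda M p n) \<ominus>\<^bsub>M\<^esub> D (p n)"

text \<open>Substitution of \<open>-\<lambda>-\<partial>\<close> in \<open>\<Sum> \<nu>^k c k\<close>, with result \<open>\<Sum> (-\<lambda>-\<partial>)^k (c k)\<close>.\<close>

definition subst_neg :: "('r, 'a) module \<Rightarrow> ('a \<Rightarrow> 'a) \<Rightarrow> (nat \<Rightarrow> 'a) \<Rightarrow> nat \<Rightarrow> 'a" where
  "subst_neg M D c n =
     (\<Oplus>\<^bsub>M\<^esub>k \<in> {k. c k \<noteq> \<zero>\<^bsub>M\<^esub>}. (neg_lambda_D M D ^^ k) (const_coeff M (c k)) n)"

text \<open>The polynomial \<open>q(\<lambda>+\<mu>)\<close>.\<close>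

definition subst_sum :: "('r, 'a) module \<Rightarrow> (nat \<Rightarrow> 'a) \<Rightarrow> nat \<Rightarrow> nat \<Rightarrow> 'a" where
  "subst_sum M q m n = add_pow M ((m + n) choose m) (q (m + n))"

text \<open>For \<open>p(\<lambda>) = \<Sum> \<lambda>^i p i\<close>, the polynomial \<open>p(\<lambda>)\<^sub>\<lambda>\<^sub>+\<^sub>\<mu> c = \<Sum> \<lambda>^i ((p i)\<^sub>\<lambda>\<^sub>+\<^sub>\<mu> c)\<close>.\<close>

definition lambda_mu_prod :: "('r, 'a) module \<Rightarrow> ('a \<Rightarrow> 'a \<Rightarrow> nat \<Rightarrow> 'a)
    \<Rightarrow> (nat \<Rightarrow> 'a) \<Rightarrow> 'a \<Rightarrow> nat \<Rightarrow> nat \<Rightarrow> 'a" where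
  "lambda_mu_prod M f p c m n = (\<Oplus>\<^bsub>M\<^esub>i \<in> {..m}. subst_sum M (f (p i) c) (m - i) n)"

definition lambda_bilinear :: "('r, 's) ring_scheme \<Rightarrow> ('r, 'a) module
    \<Rightarrow> ('a \<Rightarrow> 'a \<Rightarrow> nat \<Rightarrow> 'a) \<Rightarrow> bool" where
  "lambda_bilinear R M f \<longleftrightarrow>
     (\<forall>a \<in> carrier M. \<forall>n. (\<lambda>b. f a b n) \<in> module_maps R M M) \<and>
     (\<forall>b \<in> carrier M. \<forall>n. (\<lambda>a. f a b n) \<in> module_maps R M M)"

locale lambda_product = diff_module +
  fixes f :: "'a \<Rightarrow> 'a \<Rightarrow> nat \<Rightarrow> 'a"
  assumes bilinear: "lambda_bilinear R M f"
    and polynomial: "\<lbrakk>a \<in> carrier M; b \<in> carrier M\<rbrakk> \<Longrightarrow> f a b \<in> up M"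
    and sesqui_left: "\<lbrakk>a \<in> carrier M; b \<in> carrier M\<rbrakk> \<Longrightarrow>
      f (D a) b n = \<ominus>\<^bsub>M\<^esub> times_lambda M (f a b) n"
    and sesqui_right: "\<lbrakk>a \<in> carrier M; b \<in> carrier M\<rbrakk> \<Longrightarrow>
      f a (D b) n = D (f a b n) \<oplus>\<^bsub>M\<^esub> times_lambda M (f a b) n"

locale assoc_conformal_algebra = lambda_product +
  assumes assoc: "\<lbrakk>a \<in> carrier M; b \<in> carrier M; c \<in> carrier M\<rbrakk> \<Longrightarrow>
      lambda_mu_prod M f (f a b) c m n = f a (f b c n) m"

locale comm_assoc_conformal_algebra = assoc_conformal_algebra +
  assumes comm: "\<lbrakk>a \<in> carrier M; b \<in> carrier M\<rbrakk> \<Longrightarrow> f a b n = subst_neg M D (f b a) n"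

locale lie_conformal_algebra = lambda_product +
  assumes skew: "\<lbrakk>a \<in> carrier M; b \<in> carrier M\<rbrakk> \<Longrightarrow>
      f a b n = \<ominus>\<^bsub>M\<^esub> subst_neg M D (f b a) n"
    and jacobi: "\<lbrakk>a \<in> carrier M; b \<in> carrier M; c \<in> carrier M\<rbrakk> \<Longrightarrow>
      f a (f b c n) m = lambda_mu_prod M f (f a b) c m n \<oplus>\<^bsub>M\<^esub> f b (f a c m) n"

locale poisson_conformal_algebra =
  lie_conformal_algebra R M D br + comm_assoc_conformal_algebra R M D mul
  for R :: "('r, 's) ring_scheme" (structure) and M :: "('r, 'a) module" (structure)
    and D and br and mul +
  assumes leibniz: "\<lbrakk>a \<in> carrier M; b \<in> carrier M; c \<in> carrier M\<rbrakk> \<Longrightarrow>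
      br a (mul b c n) m = lambda_mu_prod M mul (br a b) c m n \<oplus>\<^bsub>M\<^esub> mul b (br a c m) n"

section \<open>Conformal coalgebras\<close>

definition tensor_D :: "('r, 's) ring_scheme \<Rightarrow> ('r, 'a) module \<Rightarrow> ('a \<Rightarrow> 'a)
    \<Rightarrow> ('a \<times> 'a \<Rightarrow> 'r) set \<Rightarrow> ('a \<times> 'a \<Rightarrow> 'r) set" where
  "tensor_D R M D x = tensor_map R M M D id x \<oplus>\<^bsub>tensor R M M\<^esub> tensor_map R M M id D x"

locale coproduct = diff_module +
  fixes \<Delta> :: "'a \<Rightarrow> ('a \<times> 'a \<Rightarrow> 'r) set"
  assumes coprod_linear: "\<Delta> \<in> module_maps R M (tensor R M M)"
    and coprod_D: "a \<in> carrier M \<Longrightarrow> \<Delta> (D a) = tensor_D R M D (\<Delta> a)"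

text \<open>\<open>(\<Delta> \<otimes> I) \<Gamma>\<close>, \<open>(I \<otimes> \<Delta>) \<Gamma>\<close> and \<open>(\<tau> \<otimes> I) (I \<otimes> \<Delta>) \<Gamma>\<close>, with values in \<open>(M \<otimes> M) \<otimes> M\<close>.\<close>

definition coprod_left :: "('r, 's) ring_scheme \<Rightarrow> ('r, 'a) module
    \<Rightarrow> ('a \<Rightarrow> ('a \<times> 'a \<Rightarrow> 'r) set) \<Rightarrow> ('a \<Rightarrow> ('a \<times> 'a \<Rightarrow> 'r) set)
    \<Rightarrow> 'a \<Rightarrow> (('a \<times> 'a \<Rightarrow> 'r) set \<times> 'a \<Rightarrow> 'r) set" where
  "coprod_left R M \<Delta> \<Gamma> a = tensor_map R (tensor R M M) M \<Delta> id (\<Gamma> a)"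

definition coprod_right :: "('r, 's) ring_scheme \<Rightarrow> ('r, 'a) module
    \<Rightarrow> ('a \<Rightarrow> ('a \<times> 'a \<Rightarrow> 'r) set) \<Rightarrow> ('a \<Rightarrow> ('a \<times> 'a \<Rightarrow> 'r) set)
    \<Rightarrow> 'a \<Rightarrow> (('a \<times> 'a \<Rightarrow> 'r) set \<times> 'a \<Rightarrow> 'r) set" where
  "coprod_right R M \<Delta> \<Gamma> a = tensor_assoc R M (tensor_map R M (tensor R M M) id \<Delta> (\<Gamma> a))"

definition coprod_right_flip :: "('r, 's) ring_scheme \<Rightarrow> ('r, 'a) module
    \<Rightarrow> ('a \<Rightarrow> ('a \<times> 'a \<Rightarrow> 'r) set) \<Rightarrow> ('a \<Rightarrow> ('a \<times> 'a \<Rightarrow> 'r) set)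
    \<Rightarrow> 'a \<Rightarrow> (('a \<times> 'a \<Rightarrow> 'r) set \<times> 'a \<Rightarrow> 'r) set" where
  "coprod_right_flip R M \<Delta> \<Gamma> a =
     tensor_map R (tensor R M M) M (tensor_flip R M) id (coprod_right R M \<Delta> \<Gamma> a)"

locale assoc_conformal_coalgebra = coproduct +
  assumes coassoc: "a \<in> carrier M \<Longrightarrow> coprod_right R M \<Delta> \<Delta> a = coprod_left R M \<Delta> \<Delta> a"

locale cocomm_assoc_conformal_coalgebra = assoc_conformal_coalgebra +
  assumes cocomm: "a \<in> carrier M \<Longrightarrow> \<Delta> a = tensor_flip R M (\<Delta> a)"

locale lie_conformal_coalgebra = coproduct +
  assumes coskew: "a \<in> carrier M \<Longrightarrow> \<Delta> a = \<ominus>\<^bsub>tensor R M M\<^esub> tensor_flip R M (\<Delta> a)"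
    and cojacobi: "a \<in> carrier M \<Longrightarrow>
      coprod_right R M \<Delta> \<Delta> a \<ominus>\<^bsub>tensor R (tensor R M M) M\<^esub> coprod_right_flip R M \<Delta> \<Delta> a
        = coprod_left R M \<Delta> \<Delta> a"

locale poisson_conformal_coalgebra =
  lie_conformal_coalgebra R M D \<delta> + cocomm_assoc_conformal_coalgebra R M D \<Delta>
  for R :: "('r, 's) ring_scheme" (structure) and M :: "('r, 'a) module" (structure)
    and D and \<delta> and \<Delta> +
  assumes coleibniz: "a \<in> carrier M \<Longrightarrow> coprod_right R M \<Delta> \<delta> a =
      coprod_left R M \<delta> \<Delta> a \<oplus>\<^bsub>tensor R (tensor R M M) M\<^esub> coprod_right_flip R M \<delta> \<Delta> a"

section \<open>Conformal bialgebras\<close>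

text \<open>
  In \<open>T\<^sub>\<lambda>\<close>, the first argument of \<open>T\<close> is the vector and the second one the power of \<open>\<lambda>\<close>, so
  the left multiplication by \<open>a\<close> and the adjoint action of \<open>a\<close> are \<open>mul a\<close> and \<open>br a\<close>.
  \<open>act_left\<close> is \<open>T\<^sub>\<lambda> \<otimes> I\<close> and \<open>act_left_neg\<close> is \<open>T \<otimes> I\<close> at \<open>-\<lambda>-\<partial>\<otimes>I-I\<otimes>\<partial>\<close>.
\<close>

definition right_mult :: "('r, 'a) module \<Rightarrow> ('a \<Rightarrow> 'a) \<Rightarrow> ('a \<Rightarrow> 'a \<Rightarrow> nat \<Rightarrow> 'a)
    \<Rightarrow> 'a \<Rightarrow> 'a \<Rightarrow> nat \<Rightarrow> 'a" where
  "right_mult M D mul a b = subst_neg M D (mul b a)"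

definition act_left :: "('r, 's) ring_scheme \<Rightarrow> ('r, 'a) module \<Rightarrow> ('a \<Rightarrow> nat \<Rightarrow> 'a)
    \<Rightarrow> ('a \<times> 'a \<Rightarrow> 'r) set \<Rightarrow> nat \<Rightarrow> ('a \<times> 'a \<Rightarrow> 'r) set" where
  "act_left R M T x n = tensor_map R M M (\<lambda>u. T u n) id x"

definition act_right :: "('r, 's) ring_scheme \<Rightarrow> ('r, 'a) module \<Rightarrow> ('a \<Rightarrow> nat \<Rightarrow> 'a)
    \<Rightarrow> ('a \<times> 'a \<Rightarrow> 'r) set \<Rightarrow> nat \<Rightarrow> ('a \<times> 'a \<Rightarrow> 'r) set" where
  "act_right R M T x n = tensor_map R M M id (\<lambda>u. T u n) x"

definition act_left_neg :: "('r, 's) ring_scheme \<Rightarrow> ('r, 'a) module \<Rightarrow> ('a \<Rightarrow> 'a)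
    \<Rightarrow> ('a \<Rightarrow> nat \<Rightarrow> 'a) \<Rightarrow> ('a \<times> 'a \<Rightarrow> 'r) set \<Rightarrow> nat \<Rightarrow> ('a \<times> 'a \<Rightarrow> 'r) set" where
  "act_left_neg R M D T x = subst_neg (tensor R M M) (tensor_D R M D) (act_left R M T x)"

definition act_right_neg :: "('r, 's) ring_scheme \<Rightarrow> ('r, 'a) module \<Rightarrow> ('a \<Rightarrow> 'a)
    \<Rightarrow> ('a \<Rightarrow> nat \<Rightarrow> 'a) \<Rightarrow> ('a \<times> 'a \<Rightarrow> 'r) set \<Rightarrow> nat \<Rightarrow> ('a \<times> 'a \<Rightarrow> 'r) set" where
  "act_right_neg R M D T x = subst_neg (tensor R M M) (tensor_D R M D) (act_right R M T x)"

locale ASI_conformal_bialgebra =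
  assoc_conformal_algebra R M D mul + assoc_conformal_coalgebra R M D \<Delta>
  for R :: "('r, 's) ring_scheme" (structure) and M :: "('r, 'a) module" (structure)
    and D and mul and \<Delta> +
  assumes ASI_mult: "\<lbrakk>a \<in> carrier M; b \<in> carrier M\<rbrakk> \<Longrightarrow>
      \<Delta> (mul a b n) = act_right R M (mul a) (\<Delta> b) n
        \<oplus>\<^bsub>tensor R M M\<^esub> act_left_neg R M D (right_mult M D mul b) (\<Delta> a) n"
    and ASI_anti: "\<lbrakk>a \<in> carrier M; b \<in> carrier M\<rbrakk> \<Longrightarrow>
      (act_left_neg R M D (mul b) (\<Delta> a) n
        \<ominus>\<^bsub>tensor R M M\<^esub> act_right_neg R M D (right_mult M D mul b) (\<Delta> a) n)
      \<oplus>\<^bsub>tensor R M M\<^esub> tensor_flip R M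
        (act_left R M (mul a) (\<Delta> b) n
          \<ominus>\<^bsub>tensor R M M\<^esub> act_right R M (right_mult M D mul a) (\<Delta> b) n)
      = \<zero>\<^bsub>tensor R M M\<^esub>"

locale comm_cocomm_ASI_conformal_bialgebra =
  ASI_conformal_bialgebra R M D mul \<Delta> +
  comm_assoc_conformal_algebra R M D mul +
  cocomm_assoc_conformal_coalgebra R M D \<Delta>
  for R :: "('r, 's) ring_scheme" (structure) and M :: "('r, 'a) module" (structure)
    and D and mul and \<Delta>

locale poisson_conformal_bialgebra =
  poisson_conformal_algebra R M D br mul +
  poisson_conformal_coalgebra R M D \<delta> \<Delta> +
  comm_cocomm_ASI_conformal_bialgebra R M D mul \<Delta>
  for R :: "('r, 's) ring_scheme" (structure) and M :: "('r, 'a) module" (structure)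
    and D and br and mul and \<delta> and \<Delta> +
  assumes cobracket_bracket: "\<lbrakk>a \<in> carrier M; b \<in> carrier M\<rbrakk> \<Longrightarrow>
      \<delta> (br a b n) =
        (act_left R M (br a) (\<delta> b) n \<oplus>\<^bsub>tensor R M M\<^esub> act_right R M (br a) (\<delta> b) n)
        \<ominus>\<^bsub>tensor R M M\<^esub>
        (act_left_neg R M D (br b) (\<delta> a) n
          \<oplus>\<^bsub>tensor R M M\<^esub> act_right_neg R M D (br b) (\<delta> a) n)"
    and cobracket_mult: "\<lbrakk>a \<in> carrier M; b \<in> carrier M\<rbrakk> \<Longrightarrow>
      \<delta> (mul a b n) =
        act_left R M (mul a) (\<delta> b) n
        \<oplus>\<^bsub>tensor R M M\<^esub> act_left_neg R M D (mul b) (\<delta> a) n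
        \<oplus>\<^bsub>tensor R M M\<^esub> act_right R M (br a) (\<Delta> b) n
        \<oplus>\<^bsub>tensor R M M\<^esub> act_right_neg R M D (br b) (\<Delta> a) n"
    and coproduct_bracket: "\<lbrakk>a \<in> carrier M; b \<in> carrier M\<rbrakk> \<Longrightarrow>
      \<Delta> (br a b n) =
        ((act_left R M (br a) (\<Delta> b) n \<oplus>\<^bsub>tensor R M M\<^esub> act_right R M (br a) (\<Delta> b) n)
          \<ominus>\<^bsub>tensor R M M\<^esub> act_right_neg R M D (mul b) (\<delta> a) n)
        \<oplus>\<^bsub>tensor R M M\<^esub> act_left_neg R M D (mul b) (\<delta> a) n"

section \<open>The \<open>h\<close>-adic topology and completion\<close>

definition hadic_sub :: "('r, 's) ring_scheme \<Rightarrow> 'r \<Rightarrow> ('r, 'a) module \<Rightarrow> nat \<Rightarrow> 'a set" where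
  "hadic_sub R h M n = (\<lambda>x. (h [^]\<^bsub>R\<^esub> n) \<odot>\<^bsub>M\<^esub> x) ` carrier M"

definition hadic_quot :: "('r, 's) ring_scheme \<Rightarrow> 'r \<Rightarrow> ('r, 'a) module \<Rightarrow> nat
    \<Rightarrow> ('r, 'a set) module" where
  "hadic_quot R h M n = quot_module M (hadic_sub R h M n)"

definition hadic_coset :: "('r, 's) ring_scheme \<Rightarrow> 'r \<Rightarrow> ('r, 'a) module \<Rightarrow> nat \<Rightarrow> 'a \<Rightarrow> 'a set"
  where "hadic_coset R h M n x = hadic_sub R h M n +>\<^bsub>M\<^esub> x"

definition hadic_topology :: "('r, 's) ring_scheme \<Rightarrow> 'r \<Rightarrow> ('r, 'a) module \<Rightarrow> 'a topology" where
  "hadic_topology R h M = topology_generated_by (\<Union>n. carrier (hadic_quot R h M n))"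

text \<open>
  The inverse limit of the quotients \<open>M / h^n M\<close>; a family of cosets is compatible iff it
  is decreasing.
\<close>

definition hadic_completion :: "('r, 's) ring_scheme \<Rightarrow> 'r \<Rightarrow> ('r, 'a) module
    \<Rightarrow> ('r, nat \<Rightarrow> 'a set) module" where
  "hadic_completion R h M =
     \<lparr>carrier = {x. \<forall>n. x n \<in> carrier (hadic_quot R h M n) \<and> x (Suc n) \<subseteq> x n},
      monoid.mult = undefined, one = undefined, zero = (\<lambda>n. \<zero>\<^bsub>hadic_quot R h M n\<^esub>),
      add = (\<lambda>x y n. x n \<oplus>\<^bsub>hadic_quot R h M n\<^esub> y n),
      smult = (\<lambda>r x n. r \<odot>\<^bsub>hadic_quot R h M n\<^esub> x n)\<rparr>"

text \<open>
  The maps induced on the quotients modulo \<open>h^n\<close> and on the completions by a linear map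
  with values in \<open>N\<close>.
\<close>

definition quot_map :: "('r, 's) ring_scheme \<Rightarrow> 'r \<Rightarrow> ('r, 'b) module \<Rightarrow> nat \<Rightarrow> ('a \<Rightarrow> 'b)
    \<Rightarrow> 'a set \<Rightarrow> 'b set" where
  "quot_map R h N n f X = (\<Union>x\<in>X. hadic_coset R h N n (f x))"

definition completion_map :: "('r, 's) ring_scheme \<Rightarrow> 'r \<Rightarrow> ('r, 'b) module \<Rightarrow> ('a \<Rightarrow> 'b)
    \<Rightarrow> (nat \<Rightarrow> 'a set) \<Rightarrow> nat \<Rightarrow> 'b set" where
  "completion_map R h N f x n = quot_map R h N n f (x n)"

text \<open>\<open>M[[\<lambda>]]\<close>.\<close>

definition lambda_series :: "('r, 'a) module \<Rightarrow> ('r, nat \<Rightarrow> 'a) module" where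
  "lambda_series M = \<lparr>carrier = UNIV \<rightarrow> carrier M, monoid.mult = undefined, one = undefined,
     zero = (\<lambda>n. \<zero>\<^bsub>M\<^esub>), add = (\<lambda>p q n. p n \<oplus>\<^bsub>M\<^esub> q n), smult = (\<lambda>r p n. r \<odot>\<^bsub>M\<^esub> p n)\<rparr>"

text \<open>The structures induced on \<open>M / h^n M\<close>.\<close>

definition quot_prod :: "('r, 's) ring_scheme \<Rightarrow> 'r \<Rightarrow> ('r, 'a) module \<Rightarrow> nat
    \<Rightarrow> ('a \<Rightarrow> 'a \<Rightarrow> nat \<Rightarrow> 'a) \<Rightarrow> 'a set \<Rightarrow> 'a set \<Rightarrow> nat \<Rightarrow> 'a set" where
  "quot_prod R h M n mul A B k = (\<Union>a\<in>A. \<Union>b\<in>B. hadic_coset R h M n (mul a b k))"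

text \<open>
  A coproduct has values in the completion of \<open>M \<otimes> M\<close>, whose \<open>n\<close>-th component lies in
  \<open>(M \<otimes> M) / h^n (M \<otimes> M)\<close>; the latter is mapped to \<open>(M / h^n M) \<otimes> (M / h^n M)\<close>.
\<close>

definition quot_coprod :: "('r, 's) ring_scheme \<Rightarrow> 'r \<Rightarrow> ('r, 'a) module \<Rightarrow> nat
    \<Rightarrow> ('a \<Rightarrow> nat \<Rightarrow> ('a \<times> 'a \<Rightarrow> 'r) set set)
    \<Rightarrow> 'a set \<Rightarrow> ('a set \<times> 'a set \<Rightarrow> 'r) set" where
  "quot_coprod R h M n \<Delta> A = (\<Union>a\<in>A. \<Union>t\<in>\<Delta> a n.
     tensor_map R (hadic_quot R h M n) (hadic_quot R h M n)
       (hadic_coset R h M n) (hadic_coset R h M n) t)"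

section \<open>\<open>h\<close>-adic conformal bialgebras\<close>

text \<open>
  \<open>\<Delta> \<otimes> I\<close> and \<open>I \<otimes> \<Delta>\<close> on the completion of \<open>M \<otimes> M\<close>, with values in the completion of
  \<open>(M \<otimes> M) \<otimes> M\<close>: modulo \<open>h^n\<close> the former is \<open>u \<otimes> v \<mapsto> s \<otimes> v\<close>, where \<open>s\<close> represents
  the \<open>n\<close>-th component of \<open>\<Delta> u\<close>.
\<close>

definition hadic_coprod_left :: "('r, 's) ring_scheme \<Rightarrow> 'r \<Rightarrow> ('r, 'a) module
    \<Rightarrow> ('a \<Rightarrow> nat \<Rightarrow> ('a \<times> 'a \<Rightarrow> 'r) set set) \<Rightarrow> (nat \<Rightarrow> ('a \<times> 'a \<Rightarrow> 'r) set set)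
    \<Rightarrow> nat \<Rightarrow> (('a \<times> 'a \<Rightarrow> 'r) set \<times> 'a \<Rightarrow> 'r) set set" where
  "hadic_coprod_left R h M \<Delta> x n = (let T = tensor R M M; T3 = tensor R T M in
     \<Union>t \<in> x n. tensor_lift R (hadic_quot R h T3 n)
       (\<lambda>u v. \<Union>s \<in> \<Delta> u n. hadic_coset R h T3 n (tensor_pure R T M s v)) t)"

definition hadic_coprod_right :: "('r, 's) ring_scheme \<Rightarrow> 'r \<Rightarrow> ('r, 'a) module
    \<Rightarrow> ('a \<Rightarrow> nat \<Rightarrow> ('a \<times> 'a \<Rightarrow> 'r) set set) \<Rightarrow> (nat \<Rightarrow> ('a \<times> 'a \<Rightarrow> 'r) set set)
    \<Rightarrow> nat \<Rightarrow> (('a \<times> 'a \<Rightarrow> 'r) set \<times> 'a \<Rightarrow> 'r) set set" where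
  "hadic_coprod_right R h M \<Delta> x = (let T = tensor R M M; T3 = tensor R M T in
     completion_map R h (tensor R T M) (tensor_assoc R M)
       (\<lambda>n. \<Union>t \<in> x n. tensor_lift R (hadic_quot R h T3 n)
         (\<lambda>u v. \<Union>s \<in> \<Delta> v n. hadic_coset R h T3 n (tensor_pure R M T u s)) t))"

locale hadic_assoc_conformal_algebra = diff_module +
  fixes h :: 'r and mul :: "'a \<Rightarrow> 'a \<Rightarrow> nat \<Rightarrow> 'a"
  assumes hadic_bilinear: "lambda_bilinear R M mul"
    and hadic_continuous: "continuous_map
      (prod_topology (hadic_topology R h M) (hadic_topology R h M))
      (hadic_topology R h (lambda_series M)) (\<lambda>(a, b). mul a b)"
    and hadic_quot_algebra: "\<And>n. assoc_conformal_algebra R (hadic_quot R h M n)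
      (quot_map R h M n D) (quot_prod R h M n mul)"

locale hadic_assoc_conformal_coalgebra = diff_module +
  fixes h :: 'r and \<Delta> :: "'a \<Rightarrow> nat \<Rightarrow> ('a \<times> 'a \<Rightarrow> 'r) set set"
  assumes hadic_coprod_linear: "\<Delta> \<in> module_maps R M (hadic_completion R h (tensor R M M))"
    and hadic_coprod_continuous: "continuous_map (hadic_topology R h M)
      (hadic_topology R h (hadic_completion R h (tensor R M M))) \<Delta>"
    and hadic_coprod_D: "a \<in> carrier M \<Longrightarrow>
      \<Delta> (D a) = completion_map R h (tensor R M M) (tensor_D R M D) (\<Delta> a)"
    and hadic_coassoc: "a \<in> carrier M \<Longrightarrow>
      hadic_coprod_right R h M \<Delta> (\<Delta> a) = hadic_coprod_left R h M \<Delta> (\<Delta> a)"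

locale hadic_ASI_conformal_bialgebra =
  hadic_assoc_conformal_algebra R M D h mul + hadic_assoc_conformal_coalgebra R M D h \<Delta>
  for R :: "('r, 's) ring_scheme" (structure) and M :: "('r, 'a) module" (structure)
    and D and h and mul and \<Delta> +
  assumes hadic_quot_ASI: "\<And>n. ASI_conformal_bialgebra R (hadic_quot R h M n)
      (quot_map R h M n D) (quot_prod R h M n mul) (quot_coprod R h M n \<Delta>)"

section \<open>Conformal formal deformations\<close>

definition power_series_ring :: "('k, 's) ring_scheme \<Rightarrow> (nat \<Rightarrow> 'k) ring" where
  "power_series_ring k = \<lparr>carrier = UNIV \<rightarrow> carrier k,
     monoid.mult = (\<lambda>f g n. \<Oplus>\<^bsub>k\<^esub>i \<in> {..n}. f i \<otimes>\<^bsub>k\<^esub> g (n - i)), one = const_coeff k \<one>\<^bsub>k\<^esub>,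
     zero = (\<lambda>n. \<zero>\<^bsub>k\<^esub>), add = (\<lambda>f g n. f n \<oplus>\<^bsub>k\<^esub> g n)\<rparr>"

definition power_series_module :: "('k, 'p) module \<Rightarrow> (nat \<Rightarrow> 'k, nat \<Rightarrow> 'p) module" where
  "power_series_module P = \<lparr>carrier = UNIV \<rightarrow> carrier P, monoid.mult = undefined,
     one = undefined, zero = (\<lambda>n. \<zero>\<^bsub>P\<^esub>), add = (\<lambda>v w n. v n \<oplus>\<^bsub>P\<^esub> w n),
     smult = (\<lambda>c v n. \<Oplus>\<^bsub>P\<^esub>i \<in> {..n}. c i \<odot>\<^bsub>P\<^esub> v (n - i))\<rparr>"

definition hvar :: "('k, 's) ring_scheme \<Rightarrow> nat \<Rightarrow> 'k" where
  "hvar k n = (if n = 1 then \<one>\<^bsub>k\<^esub> else \<zero>\<^bsub>k\<^esub>)"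

text \<open>The \<open>k\<close>-linear map from \<open>P \<otimes> P\<close> to \<open>P[[h]] \<otimes> P[[h]]\<close> (the latter over \<open>k[[h]]\<close>).\<close>

definition tensor_embed :: "('k, 's) ring_scheme \<Rightarrow> ('k, 'p) module \<Rightarrow> ('p \<times> 'p \<Rightarrow> 'k) set
    \<Rightarrow> ((nat \<Rightarrow> 'p) \<times> (nat \<Rightarrow> 'p) \<Rightarrow> (nat \<Rightarrow> 'k)) set" where
  "tensor_embed k P = (let K = power_series_ring k; Ph = power_series_module P in
     tensor_lift k (restrict_scalars (const_coeff k) (tensor K Ph Ph))
       (\<lambda>u v. tensor_pure K Ph Ph (const_coeff P u) (const_coeff P v)))"

text \<open>
  The two expansions define \<open>\<mu> i\<close> and \<open>\<Delta>s i\<close> for \<open>i \<ge> 1\<close> only.  The coefficient of \<open>\<lambda>^n h^i\<close>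
  in the product is \<open>mulh a b n i\<close>; the \<open>h\<close>-adically convergent series for \<open>\<Delta>h a\<close> is given by
  its partial sums modulo \<open>h^n\<close>.
\<close>

locale conformal_formal_deformation =
  comm_cocomm_ASI_conformal_bialgebra k P D mul \<Delta> +
  hadic: hadic_ASI_conformal_bialgebra "power_series_ring k" "power_series_module P"
    "\<lambda>v n. D (v n)" "hvar k" mulh \<Delta>h
  for k :: "('k, 's) ring_scheme" (structure) and P :: "('k, 'p) module" (structure)
    and D and mul and \<Delta> and mulh and \<Delta>h +
  fixes \<mu> :: "nat \<Rightarrow> 'p \<Rightarrow> 'p \<Rightarrow> nat \<Rightarrow> 'p" and \<Delta>s :: "nat \<Rightarrow> 'p \<Rightarrow> ('p \<times> 'p \<Rightarrow> 'k) set"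
  assumes mu_bilinear: "i \<ge> 1 \<Longrightarrow> lambda_bilinear k P (\<mu> i)"
    and mu_polynomial: "\<lbrakk>i \<ge> 1; a \<in> carrier P; b \<in> carrier P\<rbrakk> \<Longrightarrow> \<mu> i a b \<in> up P"
    and coprods: "i \<ge> 1 \<Longrightarrow> coproduct k P D (\<Delta>s i)"
    and product_expansion: "\<lbrakk>a \<in> carrier P; b \<in> carrier P\<rbrakk> \<Longrightarrow>
      mulh (const_coeff P a) (const_coeff P b) n i = (if i = 0 then mul a b n else \<mu> i a b n)"
    and coproduct_expansion: "a \<in> carrier P \<Longrightarrow>
      \<Delta>h (const_coeff P a) n =
        (let K = power_series_ring k; Ph = power_series_module P; T = tensor K Ph Ph in
         hadic_coset K (hvar k) T n
           (\<Oplus>\<^bsub>T\<^esub>i \<in> {..<n}. (hvar k [^]\<^bsub>K\<^esub> i) \<odot>\<^bsub>T\<^esub>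
              tensor_embed k P (if i = 0 then \<Delta> a else \<Delta>s i a)))"

text \<open>
  \<open>a \<circ>\<^sub>\<lambda> b - b \<circ>\<^sub>-\<^sub>\<lambda>\<^sub>-\<^sub>\<partial> a\<close> in \<open>P[[h]][[\<lambda>]]\<close>.  The substitution is done separately for
  each power \<open>h^i\<close>, where only finitely many powers of \<open>\<lambda>\<close> occur.
\<close>

definition hadic_commutator :: "('k, 'p) module \<Rightarrow> ('p \<Rightarrow> 'p)
    \<Rightarrow> ((nat \<Rightarrow> 'p) \<Rightarrow> (nat \<Rightarrow> 'p) \<Rightarrow> nat \<Rightarrow> nat \<Rightarrow> 'p)
    \<Rightarrow> (nat \<Rightarrow> 'p) \<Rightarrow> (nat \<Rightarrow> 'p) \<Rightarrow> nat \<Rightarrow> nat \<Rightarrow> 'p" where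
  "hadic_commutator P D mulh a b n =
     (\<lambda>i. mulh a b n i \<ominus>\<^bsub>P\<^esub> subst_neg P D (\<lambda>m. mulh b a m i) n)"

definition hadic_cocommutator :: "('r, 's) ring_scheme \<Rightarrow> 'r \<Rightarrow> ('r, 'a) module
    \<Rightarrow> ('a \<Rightarrow> nat \<Rightarrow> ('a \<times> 'a \<Rightarrow> 'r) set set) \<Rightarrow> 'a \<Rightarrow> nat \<Rightarrow> ('a \<times> 'a \<Rightarrow> 'r) set set" where
  "hadic_cocommutator R h M \<Delta> a = \<Delta> a \<ominus>\<^bsub>hadic_completion R h (tensor R M M)\<^esub>
     completion_map R h (tensor R M M) (tensor_flip R M) (\<Delta> a)"

end

theory Submission imports Defs begin

text \<open>
  The deformed product and coproduct satisfy the axioms of an ASI bialgebra on every quotient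
  \<open>P[[h]] / h^n\<close>, but they need not be commutative or cocommutative.  Put
  \<open>Br(a,b) = a\<^sub>\<lambda> b - b\<^sub>-\<^sub>\<lambda>\<^sub>-\<^sub>\<partial> a\<close> and \<open>d = \<Delta> - \<tau> \<Delta>\<close> for the deformed structures.  In every
  associative conformal algebra over a ring that contains the rational numbers, \<open>Br\<close> satisfies
  the Jacobi identity and the Leibniz rule with respect to the product
  (\<open>commutator_identities\<close>); for every coassociative coproduct, \<open>d\<close> satisfies the dual
  identities (\<open>cocommutator_identities\<close>); and in an ASI bialgebra \<open>d\<close> is a cocycle for \<open>Br\<close>,
  while the two remaining compatibility conditions of a Poisson bialgebra hold up to terms that
  contain both \<open>Br\<close> and \<open>d\<close> (\<open>ASI_commutator_identities\<close>).

  Since the undeformed structure is commutative and cocommutative, \<open>Br = h [\<cdot>,\<cdot>] + O(h^2)\<close> and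
  \<open>d = h \<delta> + O(h^2)\<close>.  In the Jacobi and co-Jacobi identities and in the cocycle condition all
  terms contain two factors \<open>Br\<close> or \<open>d\<close>, and the coefficients of \<open>h^2\<close> give the identities for
  \<open>[\<cdot>,\<cdot>]\<close> and \<open>\<delta>\<close>.  In the Leibniz and co-Leibniz rules and in the other two compatibility
  conditions the terms contain one such factor, the correction terms contain two, and the
  coefficients of \<open>h\<close> give the identities.  So it suffices to work in \<open>M = P[[h]] / h^3\<close>.

  Two tools make this precise.  The relation \<open>has_symbol\<close> says that \<open>z = h^i q + O(h^(i+1))\<close>.  It
  is used in \<open>M\<close> and in the tensor powers of \<open>M\<close> over \<open>k[[h]]\<close>, where leading coefficients are
  unique because the tensor powers map to the truncated power series over those of \<open>P\<close>
  (\<open>h_lift_tensor\<close>, \<open>symbol_unique\<close>); the effect of a linear map on leading coefficients is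
  determined by its effect on constants (\<open>symbol_map\<close>).  The second tool reduces conformal
  identities to ordinary ones.  As positive integers are invertible, a polynomial with coefficients
  in a module is determined by its values at scalars (\<open>polynomial_eqI\<close>), and the value of
  \<open>b\<^sub>-\<^sub>\<lambda>\<^sub>-\<^sub>\<partial> a\<close> at a scalar \<open>r\<close> is the value of \<open>b\<^sub>\<lambda> a\<close> at the operator \<open>-r-\<partial>\<close>
  (\<open>op_eval_subst_neg\<close>).

  That the commutator and the cocommutator of constants are divisible by \<open>h\<close>, with the stated
  quotients modulo \<open>h\<close>, is read off from the expansions (\<open>commutator_divisible\<close>,
  \<open>cocommutator_divisible\<close>).
\<close>

section \<open>Module homomorphisms and quotients\<close>

lemma module_mapsI:
  assumes "\<And>x. x \<in> carrier M \<Longrightarrow> f x \<in> carrier N"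
    and "\<And>x y. \<lbrakk>x \<in> carrier M; y \<in> carrier M\<rbrakk> \<Longrightarrow> f (x \<oplus>\<^bsub>M\<^esub> y) = f x \<oplus>\<^bsub>N\<^esub> f y"
    and "\<And>r x. \<lbrakk>r \<in> carrier R; x \<in> carrier M\<rbrakk> \<Longrightarrow> f (r \<odot>\<^bsub>M\<^esub> x) = r \<odot>\<^bsub>N\<^esub> f x"
  shows "f \<in> module_maps R M N"
  using assms by (auto simp: module_maps_def)

lemma
  assumes "f \<in> module_maps R M N"
  shows module_maps_closed: "x \<in> carrier M \<Longrightarrow> f x \<in> carrier N"
    and module_maps_add: "\<lbrakk>x \<in> carrier M; y \<in> carrier M\<rbrakk> \<Longrightarrow> f (x \<oplus>\<^bsub>M\<^esub> y) = f x \<oplus>\<^bsub>N\<^esub> f y"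
    and module_maps_smult: "\<lbrakk>r \<in> carrier R; x \<in> carrier M\<rbrakk> \<Longrightarrow> f (r \<odot>\<^bsub>M\<^esub> x) = r \<odot>\<^bsub>N\<^esub> f x"
  using assms by (auto simp: module_maps_def)

lemma module_maps_zero:
  assumes M: "Module.module R M" and N: "Module.module R N" and f: "f \<in> module_maps R M N"
  shows "f \<zero>\<^bsub>M\<^esub> = \<zero>\<^bsub>N\<^esub>"
proof -
  interpret M: Module.module R M by fact
  interpret N: Module.module R N by fact
  have "f (\<zero>\<^bsub>R\<^esub> \<odot>\<^bsub>M\<^esub> \<zero>\<^bsub>M\<^esub>) = \<zero>\<^bsub>R\<^esub> \<odot>\<^bsub>N\<^esub> f \<zero>\<^bsub>M\<^esub>"
    by (rule module_maps_smult[OF f]) auto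
  thus ?thesis by (simp add: module_maps_closed[OF f])
qed

lemma module_maps_neg:
  assumes M: "Module.module R M" and N: "Module.module R N" and f: "f \<in> module_maps R M N"
    and x: "x \<in> carrier M"
  shows "f (\<ominus>\<^bsub>M\<^esub> x) = \<ominus>\<^bsub>N\<^esub> f x"
proof -
  interpret M: Module.module R M by fact
  interpret N: Module.module R N by fact
  have "f ((\<ominus>\<^bsub>R\<^esub> \<one>\<^bsub>R\<^esub>) \<odot>\<^bsub>M\<^esub> x) = (\<ominus>\<^bsub>R\<^esub> \<one>\<^bsub>R\<^esub>) \<odot>\<^bsub>N\<^esub> f x"
    by (rule module_maps_smult[OF f]) (auto simp: x)
  thus ?thesis by (simp add: module_maps_closed[OF f] x M.smult_l_minus N.smult_l_minus)
qed

lemma module_maps_minus: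
  assumes M: "Module.module R M" and N: "Module.module R N" and f: "f \<in> module_maps R M N"
    and x: "x \<in> carrier M" and y: "y \<in> carrier M"
  shows "f (x \<ominus>\<^bsub>M\<^esub> y) = f x \<ominus>\<^bsub>N\<^esub> f y"
proof -
  interpret M: Module.module R M by fact
  interpret N: Module.module R N by fact
  show ?thesis using x y
    by (simp add: M.minus_eq N.minus_eq module_maps_add[OF f] module_maps_neg[OF M N f])
qed

lemma module_maps_finsum:
  assumes M: "Module.module R M" and N: "Module.module R N" and f: "f \<in> module_maps R M N"
    and "g \<in> A \<rightarrow> carrier M"
  shows "f (\<Oplus>\<^bsub>M\<^esub>i\<in>A. g i) = (\<Oplus>\<^bsub>N\<^esub>i\<in>A. f (g i))"
proof -
  interpret M: Module.module R M by fact
  interpret N: Module.module R N by fact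
  have *: "g \<in> A \<rightarrow> carrier M \<Longrightarrow> ?thesis" if "finite A" using that
  proof (induction A)
    case empty
    thus ?case by (simp add: module_maps_zero[OF M N f])
  next
    case (insert x F)
    hence gx: "g x \<in> carrier M" "g \<in> F \<rightarrow> carrier M" by auto
    hence fg: "(\<lambda>i. f (g i)) \<in> F \<rightarrow> carrier N" "f (g x) \<in> carrier N"
      using module_maps_closed[OF f] by auto
    show ?case using insert.hyps insert.IH gx fg
      by (simp add: M.finsum_insert N.finsum_insert module_maps_add[OF f] M.finsum_closed)
  qed
  show ?thesis
  proof (cases "finite A")
    case False
    thus ?thesis by (simp add: M.finsum_infinite N.finsum_infinite module_maps_zero[OF M N f])
  qed (use * assms in auto)
qed

lemma module_maps_comp:
  assumes "f \<in> module_maps R L M" and "g \<in> module_maps R M N"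
  shows "(\<lambda>x. g (f x)) \<in> module_maps R L N"
  using assms by (auto simp: module_maps_def Pi_def)

lemma module_maps_id: "(\<lambda>x. x) \<in> module_maps R M M" "id \<in> module_maps R M M"
  by (auto simp: module_maps_def)

lemma module_maps_plus:
  assumes N: "Module.module R N" and M: "Module.module R M"
    and f: "f \<in> module_maps R M N" and g: "g \<in> module_maps R M N"
  shows "(\<lambda>x. f x \<oplus>\<^bsub>N\<^esub> g x) \<in> module_maps R M N"
proof -
  interpret N: Module.module R N by fact
  interpret M: Module.module R M by fact
  note [simp] = module_maps_closed[OF f] module_maps_closed[OF g]
  show ?thesis
    by (rule module_mapsI)
      (auto simp: module_maps_add[OF f] module_maps_add[OF g] module_maps_smult[OF f]
        module_maps_smult[OF g] N.smult_r_distr N.a_ac)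
qed

lemma module_maps_uminus:
  assumes N: "Module.module R N" and M: "Module.module R M" and f: "f \<in> module_maps R M N"
  shows "(\<lambda>x. \<ominus>\<^bsub>N\<^esub> f x) \<in> module_maps R M N"
proof -
  interpret N: Module.module R N by fact
  interpret M: Module.module R M by fact
  note [simp] = module_maps_closed[OF f]
  show ?thesis
    by (rule module_mapsI)
      (auto simp: module_maps_add[OF f] module_maps_smult[OF f] N.smult_r_minus N.minus_add)
qed

lemma module_maps_diff:
  assumes N: "Module.module R N" and M: "Module.module R M"
    and f: "f \<in> module_maps R M N" and g: "g \<in> module_maps R M N"
  shows "(\<lambda>x. f x \<ominus>\<^bsub>N\<^esub> g x) \<in> module_maps R M N"
proof -
  interpret N: Module.module R N by fact
  show ?thesis
    using module_maps_plus[OF N M f module_maps_uminus[OF N M g]] by (simp add: N.minus_eq)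
qed

lemma module_maps_smult_const:
  assumes M: "Module.module R M" and r: "r \<in> carrier R"
  shows "(\<lambda>x. r \<odot>\<^bsub>M\<^esub> x) \<in> module_maps R M M"
proof -
  interpret M: Module.module R M by fact
  show ?thesis
    by (rule module_mapsI)
      (auto simp: r M.smult_r_distr M.smult_assoc1[symmetric] M.R.m_comm)
qed

lemma module_maps_null:
  assumes N: "Module.module R N"
  shows "(\<lambda>x. \<zero>\<^bsub>N\<^esub>) \<in> module_maps R M N"
proof -
  interpret N: Module.module R N by fact
  show ?thesis by (rule module_mapsI) auto
qed

text \<open>
  The module axioms other than the existence of negatives are equations, so they pass to every
  structure onto which a module maps compatibly with the operations.  This avoids any computation
  with sets of representatives when \<open>L\<close> is a quotient.
\<close>

lemma surjective_image_module:
  assumes M: "Module.module R M" and carr: "carrier L = q ` carrier M"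
    and zero: "\<zero>\<^bsub>L\<^esub> = q \<zero>\<^bsub>M\<^esub>"
    and add: "\<And>x y. \<lbrakk>x \<in> carrier M; y \<in> carrier M\<rbrakk> \<Longrightarrow> q x \<oplus>\<^bsub>L\<^esub> q y = q (x \<oplus>\<^bsub>M\<^esub> y)"
    and smult: "\<And>r x. \<lbrakk>r \<in> carrier R; x \<in> carrier M\<rbrakk> \<Longrightarrow> r \<odot>\<^bsub>L\<^esub> q x = q (r \<odot>\<^bsub>M\<^esub> x)"
  shows "Module.module R L"
proof -
  interpret M: Module.module R M by fact
  have "abelian_group L"
  proof (rule abelian_groupI)
    fix x assume "x \<in> carrier L"
    then obtain a where "x = q a" "a \<in> carrier M" using carr by auto
    thus "\<exists>y\<in>carrier L. y \<oplus>\<^bsub>L\<^esub> x = \<zero>\<^bsub>L\<^esub>"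
      by (intro bexI[of _ "q (\<ominus>\<^bsub>M\<^esub> a)"]) (auto simp: carr zero add M.l_neg)
  qed (auto simp: carr zero add M.a_ac)
  thus ?thesis
    by (intro moduleI M.is_cring)
      (auto simp: carr smult add M.smult_l_distr M.smult_r_distr M.smult_assoc1)
qed

context
  fixes R :: "('r, 's) ring_scheme" and M :: "('r, 'a) module" and H
  assumes M: "Module.module R M" and H: "submodule H R M"
begin

interpretation M: Module.module R M by (fact M)

lemma submodule_abelian_subgroup: "abelian_subgroup H M"
  using H by (intro abelian_subgroupI3 additive_subgroup.intro)
    (auto simp: submodule_def M.abelian_group_axioms)

interpretation H: abelian_subgroup H M by (rule submodule_abelian_subgroup)

lemma coset_eq_iff:
  assumes x: "x \<in> carrier M" and y: "y \<in> carrier M"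
  shows "H +>\<^bsub>M\<^esub> x = H +>\<^bsub>M\<^esub> y \<longleftrightarrow> x \<ominus>\<^bsub>M\<^esub> y \<in> H"
  using H.a_rcos_module[OF y x] H.a_repr_independence'[OF _ y] H.a_repr_independenceD[OF x, of y]
  by (metis M.minus_eq)

lemma carrier_quot_module: "carrier (quot_module M H) = (\<lambda>x. H +>\<^bsub>M\<^esub> x) ` carrier M"
  by (auto simp: quot_module_def A_RCOSETS_def')

lemma quot_module_add:
  "\<lbrakk>x \<in> carrier M; y \<in> carrier M\<rbrakk>
    \<Longrightarrow> (H +>\<^bsub>M\<^esub> x) \<oplus>\<^bsub>quot_module M H\<^esub> (H +>\<^bsub>M\<^esub> y) = H +>\<^bsub>M\<^esub> (x \<oplus>\<^bsub>M\<^esub> y)"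
  by (simp add: quot_module_def H.a_rcos_sum)

lemma quot_module_zero: "\<zero>\<^bsub>quot_module M H\<^esub> = H +>\<^bsub>M\<^esub> \<zero>\<^bsub>M\<^esub>"
  by (simp add: quot_module_def M.a_coset_add_zero H.a_subset)

text \<open>
  Operations on quotients are defined as unions over all representatives; they can be computed on
  one representative as soon as the others give the same set.
\<close>

lemma UN_coset_const:
  assumes x: "x \<in> carrier M" and "\<And>x'. \<lbrakk>x' \<in> carrier M; H +>\<^bsub>M\<^esub> x' = H +>\<^bsub>M\<^esub> x\<rbrakk> \<Longrightarrow> F x' = F x"
  shows "(\<Union>x'\<in>H +>\<^bsub>M\<^esub> x. F x') = F x"
proof -
  have "F x' = F x" if "x' \<in> H +>\<^bsub>M\<^esub> x" for x'
    by (rule assms(2)[OF H.a_elemrcos_carrier[OF x that] H.a_repr_independence'[OF that x, symmetric]])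
  moreover have "x \<in> H +>\<^bsub>M\<^esub> x" by (rule H.a_rcos_self[OF x])
  ultimately show ?thesis by blast
qed

lemma quot_module_smult:
  assumes r: "r \<in> carrier R" and x: "x \<in> carrier M"
  shows "r \<odot>\<^bsub>quot_module M H\<^esub> (H +>\<^bsub>M\<^esub> x) = H +>\<^bsub>M\<^esub> (r \<odot>\<^bsub>M\<^esub> x)"
proof -
  have "H +>\<^bsub>M\<^esub> (r \<odot>\<^bsub>M\<^esub> x') = H +>\<^bsub>M\<^esub> (r \<odot>\<^bsub>M\<^esub> x)"
    if x': "x' \<in> carrier M" and "H +>\<^bsub>M\<^esub> x' = H +>\<^bsub>M\<^esub> x" for x'
  proof -
    have "x' \<ominus>\<^bsub>M\<^esub> x \<in> H" using that x coset_eq_iff by blast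
    hence "r \<odot>\<^bsub>M\<^esub> (x' \<ominus>\<^bsub>M\<^esub> x) \<in> H" using H r by (meson submodule.smult_closed)
    moreover have "r \<odot>\<^bsub>M\<^esub> (x' \<ominus>\<^bsub>M\<^esub> x) = r \<odot>\<^bsub>M\<^esub> x' \<ominus>\<^bsub>M\<^esub> r \<odot>\<^bsub>M\<^esub> x"
      by (rule module_maps_minus[OF M M module_maps_smult_const[OF M r] x' x])
    ultimately show ?thesis using coset_eq_iff x x' r by simp
  qed
  thus ?thesis using UN_coset_const[OF x, of "\<lambda>x. H +>\<^bsub>M\<^esub> (r \<odot>\<^bsub>M\<^esub> x)"]
    by (simp add: quot_module_def)
qed

lemma quot_module_module: "Module.module R (quot_module M H)"
  by (rule surjective_image_module[OF M carrier_quot_module quot_module_zero])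
    (simp_all add: quot_module_add quot_module_smult)

lemma coset_module_maps: "(\<lambda>x. H +>\<^bsub>M\<^esub> x) \<in> module_maps R M (quot_module M H)"
  by (rule module_mapsI) (auto simp: carrier_quot_module quot_module_add quot_module_smult)

end

lemma submodule_kernel:
  assumes M: "Module.module R M" and N: "Module.module R N" and f: "f \<in> module_maps R M N"
  shows "submodule {x \<in> carrier M. f x = \<zero>\<^bsub>N\<^esub>} R M"
proof -
  interpret M: Module.module R M by fact
  interpret N: Module.module R N by fact
  show ?thesis
    by (rule M.submoduleI)
      (auto simp: module_maps_add[OF f] module_maps_smult[OF f] module_maps_neg[OF M N f]
        module_maps_zero[OF M N f])
qed

lemma submodule_range:
  assumes M: "Module.module R M" and N: "Module.module R N" and f: "f \<in> module_maps R M N"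
  shows "submodule (f ` carrier M) R N"
proof -
  interpret M: Module.module R M by fact
  interpret N: Module.module R N by fact
  show ?thesis
  proof (rule N.submoduleI)
    show "\<zero>\<^bsub>N\<^esub> \<in> f ` carrier M"
      using module_maps_zero[OF M N f] by (metis M.zero_closed image_eqI)
  next
    fix a assume "a \<in> f ` carrier M"
    then obtain x where "x \<in> carrier M" "a = f x" by auto
    thus "\<ominus>\<^bsub>N\<^esub> a \<in> f ` carrier M"
      using module_maps_neg[OF M N f] by (metis M.a_inv_closed image_eqI)
  next
    fix a b assume "a \<in> f ` carrier M" "b \<in> f ` carrier M"
    then obtain x y where "x \<in> carrier M" "a = f x" "y \<in> carrier M" "b = f y" by auto
    thus "a \<oplus>\<^bsub>N\<^esub> b \<in> f ` carrier M"
      using module_maps_add[OF f] by (metis M.a_closed image_eqI)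
  next
    fix r a assume "r \<in> carrier R" "a \<in> f ` carrier M"
    then obtain x where "x \<in> carrier M" "a = f x" "r \<in> carrier R" by auto
    thus "r \<odot>\<^bsub>N\<^esub> a \<in> f ` carrier M"
      using module_maps_smult[OF f] by (metis M.smult_closed image_eqI)
  qed (use module_maps_closed[OF f] in auto)
qed

lemma submodule_submodule_span:
  assumes M: "Module.module R M" and S: "S \<subseteq> carrier M"
  shows "submodule (submodule_span R M S) R M"
proof -
  interpret M: Module.module R M by fact
  have c: "carrier M \<in> {H. submodule H R M \<and> S \<subseteq> H}" using M.carrier_is_submodule S by auto
  have sub: "submodule H R M" if "H \<in> {H. submodule H R M \<and> S \<subseteq> H}" for H using that by auto
  show ?thesis unfolding submodule_span_def
  proof (rule M.submoduleI)
    show "\<Inter> {H. submodule H R M \<and> S \<subseteq> H} \<subseteq> carrier M" using c by blast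
    show "\<zero>\<^bsub>M\<^esub> \<in> \<Inter> {H. submodule H R M \<and> S \<subseteq> H}"
    proof
      fix H assume "H \<in> {H. submodule H R M \<and> S \<subseteq> H}"
      hence "abelian_subgroup H M" using submodule_abelian_subgroup[OF M] by auto
      thus "\<zero>\<^bsub>M\<^esub> \<in> H" by (simp add: abelian_subgroup_def additive_subgroup.zero_closed)
    qed
  qed (use M.submoduleE(3-5)[OF sub] in blast)+
qed

lemma submodule_span_superset: "S \<subseteq> submodule_span R M S"
  by (auto simp: submodule_span_def)

lemma submodule_span_minimal: "\<lbrakk>submodule H R M; S \<subseteq> H\<rbrakk> \<Longrightarrow> submodule_span R M S \<subseteq> H"
  by (auto simp: submodule_span_def)

section \<open>Free modules\<close>

text \<open>
  The linear extension of \<open>\<phi>\<close> from the generators to the free module.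
\<close>

definition free_lift :: "('r, 's) ring_scheme \<Rightarrow> ('r, 'c) module \<Rightarrow> ('x \<Rightarrow> 'c) \<Rightarrow> ('x \<Rightarrow> 'r) \<Rightarrow> 'c"
  where "free_lift R L \<phi> g = (\<Oplus>\<^bsub>L\<^esub>z \<in> {z. g z \<noteq> \<zero>\<^bsub>R\<^esub>}. g z \<odot>\<^bsub>L\<^esub> \<phi> z)"

context
  fixes R :: "('r, 's) ring_scheme" and X :: "'x set"
  assumes R: "cring R"
begin

interpretation R: cring R by (fact R)

lemma free_module_simps:
  "\<zero>\<^bsub>free_module R X\<^esub> = (\<lambda>x. \<zero>\<^bsub>R\<^esub>)"
  "f \<oplus>\<^bsub>free_module R X\<^esub> g = (\<lambda>x. f x \<oplus>\<^bsub>R\<^esub> g x)"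
  "r \<odot>\<^bsub>free_module R X\<^esub> f = (\<lambda>x. r \<otimes>\<^bsub>R\<^esub> f x)"
  by (simp_all add: free_module_def)

lemma free_module_carrierD:
  assumes "f \<in> carrier (free_module R X)"
  shows "f x \<in> carrier R" "x \<notin> X \<Longrightarrow> f x = \<zero>\<^bsub>R\<^esub>" "finite {x. f x \<noteq> \<zero>\<^bsub>R\<^esub>}"
    "{x. f x \<noteq> \<zero>\<^bsub>R\<^esub>} \<subseteq> X"
  using assms by (auto simp: free_module_def)

lemma free_module_carrierI:
  assumes "\<And>x. f x \<in> carrier R" "\<And>x. x \<notin> X \<Longrightarrow> f x = \<zero>\<^bsub>R\<^esub>" "{x. f x \<noteq> \<zero>\<^bsub>R\<^esub>} \<subseteq> A" "finite A"
  shows "f \<in> carrier (free_module R X)"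
  using assms by (auto simp: free_module_def intro: finite_subset)

lemma free_module_module: "Module.module R (free_module R X)"
proof -
  have add: "(\<lambda>x. f x \<oplus>\<^bsub>R\<^esub> g x) \<in> carrier (free_module R X)"
    if "f \<in> carrier (free_module R X)" "g \<in> carrier (free_module R X)" for f g
    by (rule free_module_carrierI[where A="{x. f x \<noteq> \<zero>\<^bsub>R\<^esub>} \<union> {x. g x \<noteq> \<zero>\<^bsub>R\<^esub>}"])
      (use that[THEN free_module_carrierD(1)] that[THEN free_module_carrierD(2)]
        that[THEN free_module_carrierD(3)] in auto)
  have smult: "(\<lambda>x. r \<otimes>\<^bsub>R\<^esub> f x) \<in> carrier (free_module R X)"
    if "f \<in> carrier (free_module R X)" "r \<in> carrier R" for f r
    by (rule free_module_carrierI[where A="{x. f x \<noteq> \<zero>\<^bsub>R\<^esub>}"])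
      (use that(2) free_module_carrierD[OF that(1)] in auto)
  have neg: "(\<lambda>x. \<ominus>\<^bsub>R\<^esub> f x) \<in> carrier (free_module R X)"
    if "f \<in> carrier (free_module R X)" for f
    by (rule free_module_carrierI[where A="{x. f x \<noteq> \<zero>\<^bsub>R\<^esub>}"])
      (use free_module_carrierD[OF that(1)] in auto)
  note D [simp] = free_module_carrierD(1)
  have "abelian_group (free_module R X)"
  proof (rule abelian_groupI, unfold free_module_simps)
    fix f assume f: "f \<in> carrier (free_module R X)"
    show "\<exists>g\<in>carrier (free_module R X). (\<lambda>x. g x \<oplus>\<^bsub>R\<^esub> f x) = (\<lambda>x. \<zero>\<^bsub>R\<^esub>)"
      by (rule bexI[OF _ neg[OF f]]) (use f in \<open>auto simp: R.l_neg\<close>)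
  qed (auto simp: R.a_ac intro!: add free_module_carrierI[where A="{}"])
  thus ?thesis
    by (intro moduleI R) (auto simp: free_module_simps smult R.l_distr R.r_distr R.m_assoc)
qed

interpretation F: Module.module R "free_module R X" by (rule free_module_module)

lemma free_gen_closed: "x \<in> X \<Longrightarrow> free_gen R x \<in> carrier (free_module R X)"
  by (rule free_module_carrierI[where A="{x}"]) (auto simp: free_gen_def)

text \<open>
  Induction over the support: removing a point from the support leaves a smaller element and a
  multiple of a generator.
\<close>

lemma free_module_induct [consumes 1, case_names zero add]:
  assumes "f \<in> carrier (free_module R X)"
    and zero: "P \<zero>\<^bsub>free_module R X\<^esub>"
    and add: "\<And>g r x. \<lbrakk>g \<in> carrier (free_module R X); r \<in> carrier R; x \<in> X; P g\<rbrakk>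
      \<Longrightarrow> P (g \<oplus>\<^bsub>free_module R X\<^esub> r \<odot>\<^bsub>free_module R X\<^esub> free_gen R x)"
  shows "P f"
proof -
  have "\<lbrakk>f \<in> carrier (free_module R X); {x. f x \<noteq> \<zero>\<^bsub>R\<^esub>} \<subseteq> S\<rbrakk> \<Longrightarrow> P f" if "finite S" for S f
    using that
  proof (induction S arbitrary: f)
    case empty
    hence "f = \<zero>\<^bsub>free_module R X\<^esub>" by (auto simp: free_module_simps)
    thus ?case using zero by simp
  next
    case (insert x S)
    show ?case
    proof (cases "x \<in> X")
      case True
      define g where "g = f(x := \<zero>\<^bsub>R\<^esub>)"
      note fD = free_module_carrierD[OF insert.prems(1)]
      have g: "g \<in> carrier (free_module R X)"
        by (rule free_module_carrierI[OF _ _ _ insert.hyps(1)])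
          (use fD insert.prems(2) in \<open>auto simp: g_def\<close>)
      have "P g" by (rule insert.IH[OF g]) (use insert.prems(2) in \<open>auto simp: g_def\<close>)
      hence "P (g \<oplus>\<^bsub>free_module R X\<^esub> f x \<odot>\<^bsub>free_module R X\<^esub> free_gen R x)"
        using add[OF g _ True] fD by auto
      moreover have "g \<oplus>\<^bsub>free_module R X\<^esub> f x \<odot>\<^bsub>free_module R X\<^esub> free_gen R x = f"
        using fD by (auto simp: free_module_simps g_def free_gen_def fun_eq_iff)
      ultimately show ?thesis by simp
    next
      case False
      hence "f x = \<zero>\<^bsub>R\<^esub>" using free_module_carrierD[OF insert.prems(1)] by auto
      thus ?thesis using insert by blast
    qed
  qed
  thus ?thesis using assms(1) free_module_carrierD(3)[OF assms(1)] by blast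
qed

context
  fixes L :: "('r, 'c) module" and \<phi> :: "'x \<Rightarrow> 'c"
  assumes L: "Module.module R L" and \<phi>: "\<phi> \<in> X \<rightarrow> carrier L"
begin

interpretation L: Module.module R L by (fact L)

lemma phi_closed: "z \<in> X \<Longrightarrow> \<phi> z \<in> carrier L"
  using \<phi> by auto

lemma free_lift_superset:
  assumes g: "g \<in> carrier (free_module R X)"
    and A: "finite A" "{z. g z \<noteq> \<zero>\<^bsub>R\<^esub>} \<subseteq> A" "A \<subseteq> X"
  shows "free_lift R L \<phi> g = (\<Oplus>\<^bsub>L\<^esub>z \<in> A. g z \<odot>\<^bsub>L\<^esub> \<phi> z)"
proof -
  have *: "g z \<in> carrier R" "\<phi> z \<in> carrier L" if "z \<in> A" for z
    using that A(3) phi_closed free_module_carrierD(1)[OF g] by auto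
  show ?thesis
    unfolding free_lift_def
    by (rule L.add.finprod_mono_neutral_cong_left) (use A(1,2) * in auto)
qed

lemma free_lift_module_maps: "free_lift R L \<phi> \<in> module_maps R (free_module R X) L"
proof (rule module_mapsI)
  fix g assume g: "g \<in> carrier (free_module R X)"
  have "g z \<odot>\<^bsub>L\<^esub> \<phi> z \<in> carrier L" if "g z \<noteq> \<zero>\<^bsub>R\<^esub>" for z
    using free_module_carrierD(1,2)[OF g, of z] phi_closed[of z] that by auto
  thus "free_lift R L \<phi> g \<in> carrier L"
    unfolding free_lift_def by (intro L.finsum_closed) auto
next
  fix f g assume f: "f \<in> carrier (free_module R X)" and g: "g \<in> carrier (free_module R X)"
  define A where "A = {z. f z \<noteq> \<zero>\<^bsub>R\<^esub>} \<union> {z. g z \<noteq> \<zero>\<^bsub>R\<^esub>}"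
  have A: "finite A" "A \<subseteq> X"
    using free_module_carrierD(3,4)[OF f] free_module_carrierD(3,4)[OF g] by (auto simp: A_def)
  have fg: "f \<oplus>\<^bsub>free_module R X\<^esub> g \<in> carrier (free_module R X)" using f g by simp
  have *: "f z \<in> carrier R" "g z \<in> carrier R" "\<phi> z \<in> carrier L" if "z \<in> A" for z
    using that A(2) phi_closed free_module_carrierD(1)[OF g] free_module_carrierD(1)[OF f] by auto
  have cl: "(\<lambda>z. f z \<odot>\<^bsub>L\<^esub> \<phi> z) \<in> A \<rightarrow> carrier L" "(\<lambda>z. g z \<odot>\<^bsub>L\<^esub> \<phi> z) \<in> A \<rightarrow> carrier L"
    using * by auto
  have "free_lift R L \<phi> (f \<oplus>\<^bsub>free_module R X\<^esub> g)
      = (\<Oplus>\<^bsub>L\<^esub>z \<in> A. (f z \<oplus>\<^bsub>R\<^esub> g z) \<odot>\<^bsub>L\<^esub> \<phi> z)"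
    by (subst free_lift_superset[OF fg A(1) _ A(2)]) (auto simp: A_def free_module_simps)
  also have "\<dots> = (\<Oplus>\<^bsub>L\<^esub>z \<in> A. f z \<odot>\<^bsub>L\<^esub> \<phi> z \<oplus>\<^bsub>L\<^esub> g z \<odot>\<^bsub>L\<^esub> \<phi> z)"
    by (rule L.finsum_cong') (use * in \<open>auto simp: L.smult_l_distr\<close>)
  also have "\<dots> = (\<Oplus>\<^bsub>L\<^esub>z \<in> A. f z \<odot>\<^bsub>L\<^esub> \<phi> z) \<oplus>\<^bsub>L\<^esub> (\<Oplus>\<^bsub>L\<^esub>z \<in> A. g z \<odot>\<^bsub>L\<^esub> \<phi> z)"
    by (rule L.finsum_addf[OF cl])
  also have "\<dots> = free_lift R L \<phi> f \<oplus>\<^bsub>L\<^esub> free_lift R L \<phi> g"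
    using free_lift_superset[OF f A(1) _ A(2)] free_lift_superset[OF g A(1) _ A(2)]
    by (simp add: A_def)
  finally show "free_lift R L \<phi> (f \<oplus>\<^bsub>free_module R X\<^esub> g)
      = free_lift R L \<phi> f \<oplus>\<^bsub>L\<^esub> free_lift R L \<phi> g" .
next
  fix r f assume r: "r \<in> carrier R" and f: "f \<in> carrier (free_module R X)"
  define A where "A = {z. f z \<noteq> \<zero>\<^bsub>R\<^esub>}"
  have A: "finite A" "A \<subseteq> X" using free_module_carrierD(3,4)[OF f] by (auto simp: A_def)
  have rf: "r \<odot>\<^bsub>free_module R X\<^esub> f \<in> carrier (free_module R X)" using r f by simp
  have *: "f z \<in> carrier R" "\<phi> z \<in> carrier L" if "z \<in> A" for z
    using that A(2) phi_closed free_module_carrierD(1)[OF f] by auto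
  have "free_lift R L \<phi> (r \<odot>\<^bsub>free_module R X\<^esub> f) = (\<Oplus>\<^bsub>L\<^esub>z \<in> A. (r \<otimes>\<^bsub>R\<^esub> f z) \<odot>\<^bsub>L\<^esub> \<phi> z)"
    by (subst free_lift_superset[OF rf A(1) _ A(2)]) (auto simp: A_def free_module_simps r)
  also have "\<dots> = (\<Oplus>\<^bsub>L\<^esub>z \<in> A. r \<odot>\<^bsub>L\<^esub> (f z \<odot>\<^bsub>L\<^esub> \<phi> z))"
    by (rule L.finsum_cong') (use * r in \<open>auto simp: L.smult_assoc1\<close>)
  also have "\<dots> = r \<odot>\<^bsub>L\<^esub> (\<Oplus>\<^bsub>L\<^esub>z \<in> A. f z \<odot>\<^bsub>L\<^esub> \<phi> z)"
    by (rule L.finsum_smult_ldistr[symmetric]) (use A * r in auto)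
  finally show "free_lift R L \<phi> (r \<odot>\<^bsub>free_module R X\<^esub> f) = r \<odot>\<^bsub>L\<^esub> free_lift R L \<phi> f"
    by (simp add: free_lift_def A_def)
qed

lemma free_lift_gen:
  assumes "x \<in> X"
  shows "free_lift R L \<phi> (free_gen R x) = \<phi> x"
proof -
  have "free_lift R L \<phi> (free_gen R x) = (\<Oplus>\<^bsub>L\<^esub>z \<in> {x}. free_gen R x z \<odot>\<^bsub>L\<^esub> \<phi> z)"
    by (rule free_lift_superset[OF free_gen_closed]) (use assms in \<open>auto simp: free_gen_def\<close>)
  thus ?thesis using phi_closed[OF assms] by (simp add: free_gen_def L.finsum_insert)
qed

end

end

section \<open>Tensor products\<close>

lemma (in abelian_group) minus_eq_zero_iff:
  "\<lbrakk>x \<in> carrier G; y \<in> carrier G\<rbrakk> \<Longrightarrow> x \<ominus> y = \<zero> \<longleftrightarrow> x = y"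
  using add.inv_solve_right[of \<zero> x y] by (auto simp: minus_eq)

definition bilinear_maps :: "('r, 's) ring_scheme \<Rightarrow> ('r, 'a, 'l) module_scheme \<Rightarrow> ('r, 'b, 'm) module_scheme
    \<Rightarrow> ('r, 'c, 'n) module_scheme \<Rightarrow> ('a \<Rightarrow> 'b \<Rightarrow> 'c) set" where
  "bilinear_maps R M N L = {f. (\<forall>x \<in> carrier M. f x \<in> module_maps R N L) \<and>
     (\<forall>y \<in> carrier N. (\<lambda>x. f x y) \<in> module_maps R M L)}"

lemma image_eq_singletonI: "\<lbrakk>\<And>x. x \<in> A \<Longrightarrow> f x = c; a \<in> A\<rbrakk> \<Longrightarrow> f ` A = {c}"
  by auto

lemma bilinear_mapsI:
  assumes "\<And>x. x \<in> carrier M \<Longrightarrow> f x \<in> module_maps R N L"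
    and "\<And>y. y \<in> carrier N \<Longrightarrow> (\<lambda>x. f x y) \<in> module_maps R M L"
  shows "f \<in> bilinear_maps R M N L"
  using assms by (auto simp: bilinear_maps_def)

lemma
  assumes "f \<in> bilinear_maps R M N L"
  shows bilinear_maps_right: "x \<in> carrier M \<Longrightarrow> f x \<in> module_maps R N L"
    and bilinear_maps_left: "y \<in> carrier N \<Longrightarrow> (\<lambda>x. f x y) \<in> module_maps R M L"
  using assms by (auto simp: bilinear_maps_def)

lemma bilinear_maps_closed:
  "\<lbrakk>f \<in> bilinear_maps R M N L; x \<in> carrier M; y \<in> carrier N\<rbrakk> \<Longrightarrow> f x y \<in> carrier L"
  by (auto simp: bilinear_maps_def dest: module_maps_closed)

lemma bilinear_maps_comp:
  assumes h: "h \<in> bilinear_maps R M' N' L" and f: "f \<in> module_maps R M M'" and g: "g \<in> module_maps R N N'"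
  shows "(\<lambda>x y. h (f x) (g y)) \<in> bilinear_maps R M N L"
proof (rule bilinear_mapsI)
  fix x assume "x \<in> carrier M"
  thus "(\<lambda>y. h (f x) (g y)) \<in> module_maps R N L"
    using module_maps_comp[OF g bilinear_maps_right[OF h]] module_maps_closed[OF f] by auto
next
  fix y assume "y \<in> carrier N"
  thus "(\<lambda>x. h (f x) (g y)) \<in> module_maps R M L"
    using module_maps_comp[OF f bilinear_maps_left[OF h]] module_maps_closed[OF g] by auto
qed

lemma bilinear_maps_swap:
  assumes h: "h \<in> bilinear_maps R M N L"
  shows "(\<lambda>y x. h x y) \<in> bilinear_maps R N M L"
  using h by (auto simp: bilinear_maps_def)

context
  fixes R :: "('r, 's) ring_scheme" and M :: "('r, 'a) module" and N :: "('r, 'b) module"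
  assumes M: "Module.module R M" and N: "Module.module R N"
begin

interpretation M: Module.module R M by (fact M)
interpretation N: Module.module R N by (fact N)

abbreviation (input) "FF \<equiv> free_module R (carrier M \<times> carrier N)"

lemma FF_module: "Module.module R FF"
  by (rule free_module_module[OF M.is_cring])

interpretation F: Module.module R FF by (rule FF_module)

definition bilinearity_relators :: "('a \<times> 'b \<Rightarrow> 'r) set" where
  "bilinearity_relators = (let F = free_module R (carrier M \<times> carrier N); e = free_gen R in
       {e (x \<oplus>\<^bsub>M\<^esub> x', y) \<ominus>\<^bsub>F\<^esub> (e (x, y) \<oplus>\<^bsub>F\<^esub> e (x', y)) | x x' y.
          x \<in> carrier M \<and> x' \<in> carrier M \<and> y \<in> carrier N} \<union>
       {e (x, y \<oplus>\<^bsub>N\<^esub> y') \<ominus>\<^bsub>F\<^esub> (e (x, y) \<oplus>\<^bsub>F\<^esub> e (x, y')) | x y y'.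
          x \<in> carrier M \<and> y \<in> carrier N \<and> y' \<in> carrier N} \<union>
       {e (r \<odot>\<^bsub>M\<^esub> x, y) \<ominus>\<^bsub>F\<^esub> r \<odot>\<^bsub>F\<^esub> e (x, y) | r x y.
          r \<in> carrier R \<and> x \<in> carrier M \<and> y \<in> carrier N} \<union>
       {e (x, r \<odot>\<^bsub>N\<^esub> y) \<ominus>\<^bsub>F\<^esub> r \<odot>\<^bsub>F\<^esub> e (x, y) | r x y.
          r \<in> carrier R \<and> x \<in> carrier M \<and> y \<in> carrier N})"

lemma tensor_rels_eq: "tensor_rels R M N = submodule_span R FF bilinearity_relators"
  by (simp add: tensor_rels_def bilinearity_relators_def Let_def)

lemma gen_closed: "\<lbrakk>x \<in> carrier M; y \<in> carrier N\<rbrakk> \<Longrightarrow> free_gen R (x, y) \<in> carrier FF"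
  by (rule free_gen_closed[OF M.is_cring]) auto

lemma relators_closed: "bilinearity_relators \<subseteq> carrier FF"
  by (auto simp: bilinearity_relators_def Let_def gen_closed intro!: F.minus_closed F.a_closed F.smult_closed)

lemma tensor_rels_submodule: "submodule (tensor_rels R M N) R FF"
  unfolding tensor_rels_eq by (rule submodule_submodule_span[OF FF_module relators_closed])

lemma tensor_module: "Module.module R (tensor R M N)"
  unfolding tensor_def by (rule quot_module_module[OF FF_module tensor_rels_submodule])

interpretation T: Module.module R "tensor R M N" by (rule tensor_module)

lemma tensor_coset_maps: "(\<lambda>g. tensor_rels R M N +>\<^bsub>FF\<^esub> g) \<in> module_maps R FF (tensor R M N)"
  unfolding tensor_def by (rule coset_module_maps[OF FF_module tensor_rels_submodule])

lemma tensor_pure_closed: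
  "\<lbrakk>x \<in> carrier M; y \<in> carrier N\<rbrakk> \<Longrightarrow> tensor_pure R M N x y \<in> carrier (tensor R M N)"
  unfolding tensor_pure_def by (rule module_maps_closed[OF tensor_coset_maps gen_closed])

lemma tensor_coset_eqI:
  assumes "f \<ominus>\<^bsub>FF\<^esub> g \<in> bilinearity_relators" "f \<in> carrier FF" "g \<in> carrier FF"
  shows "tensor_rels R M N +>\<^bsub>FF\<^esub> f = tensor_rels R M N +>\<^bsub>FF\<^esub> g"
proof -
  have "f \<ominus>\<^bsub>FF\<^esub> g \<in> tensor_rels R M N"
    unfolding tensor_rels_eq by (rule subsetD[OF submodule_span_superset assms(1)])
  thus ?thesis using coset_eq_iff[OF FF_module tensor_rels_submodule assms(2,3)] by simp
qed

lemma tensor_pure_bilinear: "tensor_pure R M N \<in> bilinear_maps R M N (tensor R M N)"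
proof -
  note q = module_maps_add[OF tensor_coset_maps] module_maps_smult[OF tensor_coset_maps]
  note cl = gen_closed F.a_closed F.smult_closed M.a_closed N.a_closed M.smult_closed N.smult_closed
  let ?e = "free_gen R"
  have 1: "tensor_pure R M N (x \<oplus>\<^bsub>M\<^esub> x') y = tensor_pure R M N x y \<oplus>\<^bsub>tensor R M N\<^esub> tensor_pure R M N x' y"
    if c: "x \<in> carrier M" "x' \<in> carrier M" "y \<in> carrier N" for x x' y
  proof -
    have "?e (x \<oplus>\<^bsub>M\<^esub> x', y) \<ominus>\<^bsub>FF\<^esub> (?e (x, y) \<oplus>\<^bsub>FF\<^esub> ?e (x', y)) \<in> bilinearity_relators"
      unfolding bilinearity_relators_def Let_def using c by blast
    from tensor_coset_eqI[OF this] show ?thesis unfolding tensor_pure_def by (simp only: q cl c)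
  qed
  have 2: "tensor_pure R M N x (y \<oplus>\<^bsub>N\<^esub> y') = tensor_pure R M N x y \<oplus>\<^bsub>tensor R M N\<^esub> tensor_pure R M N x y'"
    if c: "x \<in> carrier M" "y' \<in> carrier N" "y \<in> carrier N" for x y y'
  proof -
    have "?e (x, y \<oplus>\<^bsub>N\<^esub> y') \<ominus>\<^bsub>FF\<^esub> (?e (x, y) \<oplus>\<^bsub>FF\<^esub> ?e (x, y')) \<in> bilinearity_relators"
      unfolding bilinearity_relators_def Let_def using c by blast
    from tensor_coset_eqI[OF this] show ?thesis unfolding tensor_pure_def by (simp only: q cl c)
  qed
  have 3: "tensor_pure R M N (r \<odot>\<^bsub>M\<^esub> x) y = r \<odot>\<^bsub>tensor R M N\<^esub> tensor_pure R M N x y"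
    if c: "x \<in> carrier M" "r \<in> carrier R" "y \<in> carrier N" for x y r
  proof -
    have "?e (r \<odot>\<^bsub>M\<^esub> x, y) \<ominus>\<^bsub>FF\<^esub> r \<odot>\<^bsub>FF\<^esub> ?e (x, y) \<in> bilinearity_relators"
      unfolding bilinearity_relators_def Let_def using c by blast
    from tensor_coset_eqI[OF this] show ?thesis unfolding tensor_pure_def by (simp only: q cl c)
  qed
  have 4: "tensor_pure R M N x (r \<odot>\<^bsub>N\<^esub> y) = r \<odot>\<^bsub>tensor R M N\<^esub> tensor_pure R M N x y"
    if c: "x \<in> carrier M" "r \<in> carrier R" "y \<in> carrier N" for x y r
  proof -
    have "?e (x, r \<odot>\<^bsub>N\<^esub> y) \<ominus>\<^bsub>FF\<^esub> r \<odot>\<^bsub>FF\<^esub> ?e (x, y) \<in> bilinearity_relators"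
      unfolding bilinearity_relators_def Let_def using c by blast
    from tensor_coset_eqI[OF this] show ?thesis unfolding tensor_pure_def by (simp only: q cl c)
  qed
  show ?thesis
    by (intro bilinear_mapsI module_mapsI) (simp_all add: 1 2 3 4 tensor_pure_closed)
qed

text \<open>
  Every tensor is a sum of pure tensors.  No scalars are needed in the induction, since they can be
  moved into the first factor.
\<close>

lemma tensor_induct [consumes 1, case_names zero pure add]:
  assumes "t \<in> carrier (tensor R M N)"
    and zero: "P \<zero>\<^bsub>tensor R M N\<^esub>"
    and pure: "\<And>x y. \<lbrakk>x \<in> carrier M; y \<in> carrier N\<rbrakk> \<Longrightarrow> P (tensor_pure R M N x y)"
    and add: "\<And>s t. \<lbrakk>s \<in> carrier (tensor R M N); t \<in> carrier (tensor R M N); P s; P t\<rbrakk>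
      \<Longrightarrow> P (s \<oplus>\<^bsub>tensor R M N\<^esub> t)"
  shows "P t"
proof -
  have "carrier (tensor R M N) = (\<lambda>g. tensor_rels R M N +>\<^bsub>FF\<^esub> g) ` carrier FF"
    unfolding tensor_def by (rule carrier_quot_module[OF FF_module tensor_rels_submodule])
  with assms(1) obtain g where g: "g \<in> carrier FF" and t: "t = tensor_rels R M N +>\<^bsub>FF\<^esub> g" by auto
  note q = tensor_coset_maps
  have "P (tensor_rels R M N +>\<^bsub>FF\<^esub> g)" using g
  proof (induction rule: free_module_induct[OF M.is_cring, consumes 1, case_names zero add])
    case zero
    thus ?case using assms(2) module_maps_zero[OF FF_module tensor_module q] by simp
  next
    case (add g r z)
    obtain x y where z: "z = (x, y)" "x \<in> carrier M" "y \<in> carrier N" using add.hyps(3) by auto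
    have "tensor_rels R M N +>\<^bsub>FF\<^esub> (g \<oplus>\<^bsub>FF\<^esub> r \<odot>\<^bsub>FF\<^esub> free_gen R z)
        = (tensor_rels R M N +>\<^bsub>FF\<^esub> g) \<oplus>\<^bsub>tensor R M N\<^esub> r \<odot>\<^bsub>tensor R M N\<^esub> tensor_pure R M N x y"
      using add.hyps z by (simp add: module_maps_add[OF q] module_maps_smult[OF q] gen_closed tensor_pure_def)
    also have "r \<odot>\<^bsub>tensor R M N\<^esub> tensor_pure R M N x y = tensor_pure R M N (r \<odot>\<^bsub>M\<^esub> x) y"
      using module_maps_smult[OF bilinear_maps_left[OF tensor_pure_bilinear]] z add.hyps(2) by simp
    finally show ?case
      using assms(4)[OF module_maps_closed[OF q add.hyps(1)] _ add.IH pure] z add.hyps(2) tensor_pure_closed by simp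
  qed
  thus ?thesis by (simp add: t)
qed

lemma tensor_ext:
  assumes L: "Module.module R L" and f: "f \<in> module_maps R (tensor R M N) L"
    and g: "g \<in> module_maps R (tensor R M N) L"
    and eq: "\<And>x y. \<lbrakk>x \<in> carrier M; y \<in> carrier N\<rbrakk> \<Longrightarrow> f (tensor_pure R M N x y) = g (tensor_pure R M N x y)"
    and t: "t \<in> carrier (tensor R M N)"
  shows "f t = g t"
  using t
proof (induction rule: tensor_induct)
  case zero
  thus ?case using module_maps_zero[OF tensor_module L] f g by metis
qed (simp_all add: eq module_maps_add[OF f] module_maps_add[OF g])

context
  fixes L :: "('r, 'c) module" and f :: "'a \<Rightarrow> 'b \<Rightarrow> 'c"
  assumes L: "Module.module R L" and f: "f \<in> bilinear_maps R M N L"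
begin

interpretation L: Module.module R L by (fact L)

lemma free_lift_f: "free_lift R L (\<lambda>z. f (fst z) (snd z)) \<in> module_maps R FF L"
  by (rule free_lift_module_maps[OF M.is_cring L]) (auto intro: bilinear_maps_closed[OF f])

lemma free_lift_f_gen:
  "\<lbrakk>x \<in> carrier M; y \<in> carrier N\<rbrakk> \<Longrightarrow> free_lift R L (\<lambda>z. f (fst z) (snd z)) (free_gen R (x, y)) = f x y"
  by (subst free_lift_gen[OF M.is_cring L, where X="carrier M \<times> carrier N"]) (auto intro: bilinear_maps_closed[OF f])

lemma free_lift_f_relators:
  "bilinearity_relators \<subseteq> {g \<in> carrier FF. free_lift R L (\<lambda>z. f (fst z) (snd z)) g = \<zero>\<^bsub>L\<^esub>}"
proof -
  note fl = free_lift_f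
  note [simp] = module_maps_add[OF fl] module_maps_smult[OF fl] module_maps_minus[OF FF_module L fl]
    gen_closed free_lift_f_gen bilinear_maps_closed[OF f]
    module_maps_add[OF bilinear_maps_right[OF f]] module_maps_smult[OF bilinear_maps_right[OF f]]
    module_maps_add[OF bilinear_maps_left[OF f]] module_maps_smult[OF bilinear_maps_left[OF f]]
  have [simp]: "x \<in> carrier L \<Longrightarrow> x \<ominus>\<^bsub>L\<^esub> x = \<zero>\<^bsub>L\<^esub>" for x by (simp add: L.minus_eq L.r_neg)
  have "g \<in> bilinearity_relators \<Longrightarrow> free_lift R L (\<lambda>z. f (fst z) (snd z)) g = \<zero>\<^bsub>L\<^esub>" for g
    unfolding bilinearity_relators_def Let_def by (elim UnE CollectE exE conjE) simp_all
  thus ?thesis using relators_closed by auto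
qed

text \<open>
  The kernel of the linear extension of \<open>f\<close> is a submodule that contains the relators, hence all
  relations.  So all representatives of a tensor have the same value, which is what the definition
  of \<open>tensor_lift\<close> presupposes.
\<close>

lemma tensor_lift_coset:
  assumes g: "g \<in> carrier FF"
  shows "tensor_lift R L f (tensor_rels R M N +>\<^bsub>FF\<^esub> g) = free_lift R L (\<lambda>z. f (fst z) (snd z)) g"
proof -
  let ?\<Phi> = "free_lift R L (\<lambda>z. f (fst z) (snd z))"
  interpret H: abelian_subgroup "tensor_rels R M N" FF
    by (rule submodule_abelian_subgroup[OF FF_module tensor_rels_submodule])
  have rels: "tensor_rels R M N \<subseteq> {g \<in> carrier FF. ?\<Phi> g = \<zero>\<^bsub>L\<^esub>}"
    unfolding tensor_rels_eq
    by (rule submodule_span_minimal[OF submodule_kernel[OF FF_module L free_lift_f] free_lift_f_relators])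
  have "?\<Phi> g' = ?\<Phi> g" if g': "g' \<in> tensor_rels R M N +>\<^bsub>FF\<^esub> g" for g'
  proof -
    have c: "g' \<in> carrier FF" by (rule H.a_elemrcos_carrier[OF g g'])
    have "g' \<ominus>\<^bsub>FF\<^esub> g \<in> tensor_rels R M N"
      using coset_eq_iff[OF FF_module tensor_rels_submodule c g] H.a_repr_independence'[OF g' g] by simp
    hence "?\<Phi> g' \<ominus>\<^bsub>L\<^esub> ?\<Phi> g = \<zero>\<^bsub>L\<^esub>"
      using rels module_maps_minus[OF FF_module L free_lift_f c g] by auto
    thus ?thesis using module_maps_closed[OF free_lift_f] c g by (simp add: L.minus_eq_zero_iff)
  qed
  hence "?\<Phi> ` (tensor_rels R M N +>\<^bsub>FF\<^esub> g) = {?\<Phi> g}"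
    by (rule image_eq_singletonI[OF _ H.a_rcos_self[OF g]])
  moreover have "tensor_lift R L f X = the_elem (?\<Phi> ` X)" for X
    unfolding tensor_lift_def free_lift_def ..
  ultimately show ?thesis by simp
qed

lemma tensor_lift_module_maps: "tensor_lift R L f \<in> module_maps R (tensor R M N) L"
proof -
  have carr: "carrier (tensor R M N) = (\<lambda>g. tensor_rels R M N +>\<^bsub>FF\<^esub> g) ` carrier FF"
    unfolding tensor_def by (rule carrier_quot_module[OF FF_module tensor_rels_submodule])
  note q = tensor_coset_maps
  note [simp] = module_maps_add[OF q, symmetric] module_maps_smult[OF q, symmetric] tensor_lift_coset
    module_maps_add[OF free_lift_f] module_maps_smult[OF free_lift_f] module_maps_closed[OF free_lift_f]
  show ?thesis by (rule module_mapsI; unfold carr; elim imageE) simp_all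
qed

lemma tensor_lift_pure:
  "\<lbrakk>x \<in> carrier M; y \<in> carrier N\<rbrakk> \<Longrightarrow> tensor_lift R L f (tensor_pure R M N x y) = f x y"
  by (simp add: tensor_pure_def tensor_lift_coset gen_closed free_lift_f_gen)

end

end

context
  fixes R :: "('r, 's) ring_scheme" and M :: "('r, 'a) module" and N :: "('r, 'b) module"
    and C :: "('r, 'c) module" and D :: "('r, 'd) module"
  assumes M: "Module.module R M" and N: "Module.module R N"
    and C: "Module.module R C" and D: "Module.module R D"
begin

lemma tensor_map_bilinear:
  assumes "f \<in> module_maps R M C" and "g \<in> module_maps R N D"
  shows "(\<lambda>x y. tensor_pure R C D (f x) (g y)) \<in> bilinear_maps R M N (tensor R C D)"
  by (rule bilinear_maps_comp[OF tensor_pure_bilinear[OF C D] assms])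

lemma tensor_map_module_maps:
  assumes "f \<in> module_maps R M C" and "g \<in> module_maps R N D"
  shows "tensor_map R C D f g \<in> module_maps R (tensor R M N) (tensor R C D)"
  unfolding tensor_map_def
  by (rule tensor_lift_module_maps[OF M N tensor_module[OF C D] tensor_map_bilinear[OF assms]])

lemma tensor_map_pure:
  assumes "f \<in> module_maps R M C" and "g \<in> module_maps R N D" "x \<in> carrier M" "y \<in> carrier N"
  shows "tensor_map R C D f g (tensor_pure R M N x y) = tensor_pure R C D (f x) (g y)"
  unfolding tensor_map_def
  by (rule tensor_lift_pure[OF M N tensor_module[OF C D] tensor_map_bilinear]) (rule assms)+

lemma tensor_map_unique:
  assumes "f \<in> module_maps R M C" "g \<in> module_maps R N D"
    and h: "h \<in> module_maps R (tensor R M N) (tensor R C D)"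
    and "\<And>x y. \<lbrakk>x \<in> carrier M; y \<in> carrier N\<rbrakk> \<Longrightarrow> h (tensor_pure R M N x y) = tensor_pure R C D (f x) (g y)"
    and "t \<in> carrier (tensor R M N)"
  shows "tensor_map R C D f g t = h t"
  by (rule tensor_ext[OF M N tensor_module[OF C D] tensor_map_module_maps[OF assms(1,2)] h _ assms(5)])
    (simp add: tensor_map_pure assms)

lemma tensor_map_diff_left:
  assumes f: "f \<in> module_maps R M C" and f': "f' \<in> module_maps R M C" and g: "g \<in> module_maps R N D"
    and t: "t \<in> carrier (tensor R M N)"
  shows "tensor_map R C D (\<lambda>x. f x \<ominus>\<^bsub>C\<^esub> f' x) g t
    = tensor_map R C D f g t \<ominus>\<^bsub>tensor R C D\<^esub> tensor_map R C D f' g t"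
  by (rule tensor_map_unique[OF module_maps_diff[OF C M f f'] g module_maps_diff[OF tensor_module[OF C D]
        tensor_module[OF M N] tensor_map_module_maps[OF f g] tensor_map_module_maps[OF f' g]] _ t])
    (simp add: tensor_map_pure f f' g module_maps_closed[OF f] module_maps_closed[OF f'] module_maps_closed[OF g]
      module_maps_minus[OF C tensor_module[OF C D] bilinear_maps_left[OF tensor_pure_bilinear[OF C D]]])

lemma tensor_map_diff_right:
  assumes f: "f \<in> module_maps R M C" and g: "g \<in> module_maps R N D" and g': "g' \<in> module_maps R N D"
    and t: "t \<in> carrier (tensor R M N)"
  shows "tensor_map R C D f (\<lambda>x. g x \<ominus>\<^bsub>D\<^esub> g' x) t
    = tensor_map R C D f g t \<ominus>\<^bsub>tensor R C D\<^esub> tensor_map R C D f g' t"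
  by (rule tensor_map_unique[OF f module_maps_diff[OF D N g g'] module_maps_diff[OF tensor_module[OF C D]
        tensor_module[OF M N] tensor_map_module_maps[OF f g] tensor_map_module_maps[OF f g']] _ t])
    (simp add: tensor_map_pure f g g' module_maps_closed[OF f] module_maps_closed[OF g] module_maps_closed[OF g']
      module_maps_minus[OF D tensor_module[OF C D] bilinear_maps_right[OF tensor_pure_bilinear[OF C D]]])

end

lemma tensor_flip:
  assumes M: "Module.module R M"
  shows tensor_flip_module_maps: "tensor_flip R M \<in> module_maps R (tensor R M M) (tensor R M M)"
    and tensor_flip_pure: "\<lbrakk>x \<in> carrier M; y \<in> carrier M\<rbrakk>
      \<Longrightarrow> tensor_flip R M (tensor_pure R M M x y) = tensor_pure R M M y x"
proof -
  note b = bilinear_maps_swap[OF tensor_pure_bilinear[OF M M]]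
  show "tensor_flip R M \<in> module_maps R (tensor R M M) (tensor R M M)"
    unfolding tensor_flip_def by (rule tensor_lift_module_maps[OF M M tensor_module[OF M M] b])
  show "\<lbrakk>x \<in> carrier M; y \<in> carrier M\<rbrakk> \<Longrightarrow> tensor_flip R M (tensor_pure R M M x y) = tensor_pure R M M y x"
    unfolding tensor_flip_def by (rule tensor_lift_pure[OF M M tensor_module[OF M M] b])
qed

lemma tensor_flip_flip:
  assumes M: "Module.module R M" and t: "t \<in> carrier (tensor R M M)"
  shows "tensor_flip R M (tensor_flip R M t) = t"
  by (rule tensor_ext[OF M M tensor_module[OF M M] module_maps_comp[OF tensor_flip_module_maps[OF M]
        tensor_flip_module_maps[OF M]] module_maps_id(1) _ t]) (simp add: tensor_flip_pure[OF M])

lemma tensor_flip_tensor_map: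
  assumes M: "Module.module R M" and C: "Module.module R C"
    and f: "f \<in> module_maps R M C" and g: "g \<in> module_maps R M C" and t: "t \<in> carrier (tensor R M M)"
  shows "tensor_flip R C (tensor_map R C C f g t) = tensor_map R C C g f (tensor_flip R M t)"
  by (rule tensor_ext[OF M M tensor_module[OF C C] module_maps_comp[OF tensor_map_module_maps[OF M M C C f g]
      tensor_flip_module_maps[OF C]] module_maps_comp[OF tensor_flip_module_maps[OF M]
      tensor_map_module_maps[OF M M C C g f]] _ t])
    (simp add: tensor_flip_pure[OF M] tensor_flip_pure[OF C] tensor_map_pure[OF M M C C] f g
      module_maps_closed[OF f] module_maps_closed[OF g])

text \<open>
  The associator is a lift of lifts.  The inner one, \<open>y \<otimes> z \<mapsto> (x \<otimes> y) \<otimes> z\<close>, is linear in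
  \<open>y \<otimes> z\<close> by construction; that it is also linear in \<open>x\<close> for a fixed tensor follows by induction over
  this tensor.
\<close>

lemma tensor_assoc:
  assumes M: "Module.module R M"
  shows tensor_assoc_module_maps: "tensor_assoc R M \<in>
      module_maps R (tensor R M (tensor R M M)) (tensor R (tensor R M M) M)"
    and tensor_assoc_pure: "\<lbrakk>x \<in> carrier M; y \<in> carrier M; z \<in> carrier M\<rbrakk>
      \<Longrightarrow> tensor_assoc R M (tensor_pure R M (tensor R M M) x (tensor_pure R M M y z))
        = tensor_pure R (tensor R M M) M (tensor_pure R M M x y) z"
proof -
  note T = tensor_module[OF M M]
  note T3 = tensor_module[OF T M]
  interpret M: Module.module R M by (rule M)
  interpret T3: Module.module R "tensor R (tensor R M M) M" by (rule T3)
  let ?g = "\<lambda>x y z. tensor_pure R (tensor R M M) M (tensor_pure R M M x y) z"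
  let ?h = "\<lambda>x. tensor_lift R (tensor R (tensor R M M) M) (?g x)"
  note p2 = tensor_pure_bilinear[OF M M] and p3 = tensor_pure_bilinear[OF T M]
  have g: "?g x \<in> bilinear_maps R M M (tensor R (tensor R M M) M)" if "x \<in> carrier M" for x
    using bilinear_maps_comp[OF p3 bilinear_maps_right[OF p2 that] module_maps_id(1)] .
  note hr = tensor_lift_module_maps[OF M M T3 g]
  note hp = tensor_lift_pure[OF M M T3 g]
  have gl: "(\<lambda>x. ?g x y z) \<in> module_maps R M (tensor R (tensor R M M) M)"
    if "y \<in> carrier M" "z \<in> carrier M" for y z
    using module_maps_comp[OF bilinear_maps_left[OF p2 that(1)] bilinear_maps_left[OF p3 that(2)]] .
  have hl: "(\<lambda>x. ?h x t) \<in> module_maps R M (tensor R (tensor R M M) M)"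
    if "t \<in> carrier (tensor R M M)" for t
    using that
  proof (induction rule: tensor_induct[OF M M, consumes 1, case_names zero pure add])
    case zero
    show ?case
    proof (rule module_mapsI)
    qed (simp_all add: module_maps_zero[OF T T3 hr])
  next
    case (pure y z)
    show ?case
      by (rule module_mapsI)
        (simp_all add: hp pure module_maps_closed[OF gl] module_maps_add[OF gl] module_maps_smult[OF gl])
  next
    case (add s t)
    show ?case
      by (rule module_mapsI)
        (simp_all add: add(1,2) module_maps_add[OF hr] module_maps_closed[OF add(3)] module_maps_closed[OF add(4)]
          module_maps_add[OF add(3)] module_maps_add[OF add(4)] module_maps_smult[OF add(3)]
          module_maps_smult[OF add(4)] T3.a_ac T3.smult_r_distr)
  qed
  have h: "?h \<in> bilinear_maps R M (tensor R M M) (tensor R (tensor R M M) M)"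
    by (rule bilinear_mapsI) (use hr hl in auto)
  show "tensor_assoc R M \<in> module_maps R (tensor R M (tensor R M M)) (tensor R (tensor R M M) M)"
    unfolding tensor_assoc_def Let_def by (rule tensor_lift_module_maps[OF M T T3 h])
  show "tensor_assoc R M (tensor_pure R M (tensor R M M) x (tensor_pure R M M y z))
      = tensor_pure R (tensor R M M) M (tensor_pure R M M x y) z"
    if "x \<in> carrier M" "y \<in> carrier M" "z \<in> carrier M"
    unfolding tensor_assoc_def Let_def using that
    by (simp add: tensor_lift_pure[OF M T T3 h] tensor_pure_closed[OF M M] hp)
qed

lemma tensor_D_module_maps:
  assumes M: "Module.module R M" and D: "D \<in> module_maps R M M"
  shows "tensor_D R M D \<in> module_maps R (tensor R M M) (tensor R M M)"
proof -
  have "tensor_D R M D = (\<lambda>x. tensor_map R M M D id x \<oplus>\<^bsub>tensor R M M\<^esub> tensor_map R M M id D x)"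
    by (simp add: tensor_D_def fun_eq_iff)
  thus ?thesis
    using module_maps_plus[OF tensor_module[OF M M] tensor_module[OF M M]
        tensor_map_module_maps[OF M M M M D module_maps_id(2)]
        tensor_map_module_maps[OF M M M M module_maps_id(2) D]] by simp
qed

lemma tensor_flip_tensor_D:
  assumes M: "Module.module R M" and D: "D \<in> module_maps R M M" and t: "t \<in> carrier (tensor R M M)"
  shows "tensor_flip R M (tensor_D R M D t) = tensor_D R M D (tensor_flip R M t)"
proof -
  interpret T: Module.module R "tensor R M M" by (rule tensor_module[OF M M])
  note F = tensor_flip_module_maps[OF M]
  note DD = tensor_map_module_maps[OF M M M M D module_maps_id(2)]
    tensor_map_module_maps[OF M M M M module_maps_id(2) D]
  show ?thesis
    using t module_maps_closed[OF F t]
    by (simp add: tensor_D_def module_maps_add[OF F] module_maps_closed[OF DD(1)] module_maps_closed[OF DD(2)]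
      tensor_flip_tensor_map[OF M M D module_maps_id(2)] tensor_flip_tensor_map[OF M M module_maps_id(2) D]
      module_maps_closed T.a_comm)
qed

section \<open>Evaluation of polynomials at operators\<close>

lemma (in abelian_group) a_inv_zero [simp]: "\<ominus> \<zero> = \<zero>"
  by (rule minus_equality) auto

text \<open>
  Additivity is all that polynomials and substitutions in them need of a coefficient map.  The weaker
  notion matters because the embedding of a \<open>k\<close>-module into a \<open>k[[h]]\<close>-module is linear over
  different rings on the two sides.
\<close>

definition additive_maps :: "('a, 'm) ring_scheme \<Rightarrow> ('b, 'n) ring_scheme \<Rightarrow> ('a \<Rightarrow> 'b) set" where
  "additive_maps M N = {f \<in> carrier M \<rightarrow> carrier N.
     \<forall>x \<in> carrier M. \<forall>y \<in> carrier M. f (x \<oplus>\<^bsub>M\<^esub> y) = f x \<oplus>\<^bsub>N\<^esub> f y}"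

lemma module_maps_additive: "f \<in> module_maps R M N \<Longrightarrow> f \<in> additive_maps M N"
  by (auto simp: module_maps_def additive_maps_def)

lemma
  assumes "f \<in> additive_maps M N"
  shows additive_maps_closed: "x \<in> carrier M \<Longrightarrow> f x \<in> carrier N"
    and additive_maps_add: "\<lbrakk>x \<in> carrier M; y \<in> carrier M\<rbrakk> \<Longrightarrow> f (x \<oplus>\<^bsub>M\<^esub> y) = f x \<oplus>\<^bsub>N\<^esub> f y"
  using assms by (auto simp: additive_maps_def)

lemma additive_maps_hom:
  assumes "abelian_group M" "abelian_group N" "f \<in> additive_maps M N"
  shows "abelian_group_hom M N f"
  using assms by (intro abelian_group_homI group_hom.intro group_hom_axioms.intro abelian_group.a_group)
    (auto simp: additive_maps_def hom_def)

lemma additive_maps_comp: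
  "\<lbrakk>f \<in> additive_maps L M; g \<in> additive_maps M N\<rbrakk> \<Longrightarrow> (\<lambda>x. g (f x)) \<in> additive_maps L N"
  by (auto simp: additive_maps_def Pi_def)

text \<open>
  The polynomial \<open>a + \<lambda> p(\<lambda>)\<close>.  Together with \<open>0\<close> it generates all polynomials, which gives an
  induction principle that avoids finite sums.
\<close>

definition horner_cons :: "'a \<Rightarrow> (nat \<Rightarrow> 'a) \<Rightarrow> nat \<Rightarrow> 'a" where
  "horner_cons a p n = (case n of 0 \<Rightarrow> a | Suc m \<Rightarrow> p m)"

lemma horner_cons_simps [simp]: "horner_cons a p 0 = a" "horner_cons a p (Suc n) = p n"
  by (simp_all add: horner_cons_def)

lemma times_lambda_eq: "times_lambda M p = horner_cons \<zero>\<^bsub>M\<^esub> p"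
  by (auto simp: times_lambda_def horner_cons_def fun_eq_iff)

lemma const_coeff_eq: "const_coeff M a = horner_cons a (\<lambda>n. \<zero>\<^bsub>M\<^esub>)"
  by (auto simp: const_coeff_def horner_cons_def fun_eq_iff split: nat.splits)

lemma horner_cons_map: "(\<lambda>n. f (horner_cons a p n)) = horner_cons (f a) (\<lambda>n. f (p n))"
  by (auto simp: horner_cons_def fun_eq_iff split: nat.splits)

lemma up_iff: "p \<in> up M \<longleftrightarrow> (\<forall>n. p n \<in> carrier M) \<and> (\<exists>N. \<forall>n\<ge>N. p n = \<zero>\<^bsub>M\<^esub>)"
proof -
  have "(\<exists>n. bound \<zero>\<^bsub>M\<^esub> n p) \<longleftrightarrow> (\<exists>N. \<forall>n\<ge>N. p n = \<zero>\<^bsub>M\<^esub>)"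
    unfolding bound_def by (metis less_le_not_le Suc_le_eq lessI)
  thus ?thesis by (auto simp: up_def)
qed

lemma upD: "p \<in> up M \<Longrightarrow> p n \<in> carrier M"
  by (simp add: up_iff)

text \<open>
  The value \<open>\<Sum> E^k (p k)\<close> of a polynomial with coefficients in a module when an operator \<open>E\<close> is
  substituted for \<open>\<lambda>\<close>.  A scalar \<open>r\<close> is substituted as the operator \<open>pt M r\<close>.
\<close>

definition op_eval :: "('a, 'm) ring_scheme \<Rightarrow> ('a \<Rightarrow> 'a) \<Rightarrow> (nat \<Rightarrow> 'a) \<Rightarrow> 'a" where
  "op_eval M E p = (\<Oplus>\<^bsub>M\<^esub>k \<in> {k. p k \<noteq> \<zero>\<^bsub>M\<^esub>}. (E ^^ k) (p k))"

lemma funpow_module_maps: "E \<in> module_maps R M M \<Longrightarrow> (E ^^ k) \<in> module_maps R M M"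
proof (induction k)
  case 0
  thus ?case by (simp add: module_maps_id)
next
  case (Suc k)
  thus ?case using module_maps_comp[OF Suc.IH] by (auto simp: comp_def)
qed

context
  fixes R :: "('r, 's) ring_scheme" and M :: "('r, 'a) module"
  assumes M: "Module.module R M"
begin

interpretation M: Module.module R M by (fact M)

lemma up_zero: "(\<lambda>n. \<zero>\<^bsub>M\<^esub>) \<in> up M"
  by (auto simp: up_iff)

lemma up_horner_cons: "a \<in> carrier M \<Longrightarrow> p \<in> up M \<Longrightarrow> horner_cons a p \<in> up M"
proof -
  assume a: "a \<in> carrier M" and p: "p \<in> up M"
  then obtain N where N: "\<forall>n\<ge>N. p n = \<zero>\<^bsub>M\<^esub>" by (auto simp: up_iff)
  hence "\<forall>n\<ge>Suc N. horner_cons a p n = \<zero>\<^bsub>M\<^esub>" by (auto simp: horner_cons_def split: nat.splits)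
  thus ?thesis using a p unfolding up_iff by (auto simp: horner_cons_def split: nat.splits)
qed

lemma up_add: "p \<in> up M \<Longrightarrow> q \<in> up M \<Longrightarrow> (\<lambda>n. p n \<oplus>\<^bsub>M\<^esub> q n) \<in> up M"
proof -
  assume p: "p \<in> up M" and q: "q \<in> up M"
  then obtain N N' where "\<forall>n\<ge>N. p n = \<zero>\<^bsub>M\<^esub>" "\<forall>n\<ge>N'. q n = \<zero>\<^bsub>M\<^esub>" by (auto simp: up_iff)
  hence "\<forall>n\<ge>max N N'. p n \<oplus>\<^bsub>M\<^esub> q n = \<zero>\<^bsub>M\<^esub>" by auto
  thus ?thesis using p q unfolding up_iff by blast
qed

lemma up_map:
  assumes N: "Module.module S N" and G: "G \<in> additive_maps M N" and p: "p \<in> up M"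
  shows "(\<lambda>n. G (p n)) \<in> up N"
proof -
  interpret N: Module.module S N by (fact N)
  interpret G: abelian_group_hom M N G by (rule additive_maps_hom) (fact G M.abelian_group_axioms N.abelian_group_axioms)+
  obtain n0 where "\<forall>n\<ge>n0. p n = \<zero>\<^bsub>M\<^esub>" using p by (auto simp: up_iff)
  hence "\<forall>n\<ge>n0. G (p n) = \<zero>\<^bsub>N\<^esub>" by auto
  moreover have "\<forall>n. G (p n) \<in> carrier N" using upD[OF p] by simp
  ultimately show ?thesis unfolding up_iff by blast
qed

lemma up_times_lambda: "p \<in> up M \<Longrightarrow> times_lambda M p \<in> up M"
  by (simp add: times_lambda_eq up_horner_cons)

lemma up_const_coeff: "a \<in> carrier M \<Longrightarrow> const_coeff M a \<in> up M"
  by (simp add: const_coeff_eq up_horner_cons up_zero)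

lemma up_uminus: "p \<in> up M \<Longrightarrow> (\<lambda>n. \<ominus>\<^bsub>M\<^esub> p n) \<in> up M"
  using up_map[OF M, of "\<lambda>x. \<ominus>\<^bsub>M\<^esub> x"] module_maps_additive[OF module_maps_uminus[OF M M module_maps_id(1)]]
  by simp

lemma up_diff: "p \<in> up M \<Longrightarrow> q \<in> up M \<Longrightarrow> (\<lambda>n. p n \<ominus>\<^bsub>M\<^esub> q n) \<in> up M"
  using up_add[OF _ up_uminus] by (simp add: M.minus_eq)

lemma up_induct [consumes 1, case_names zero cons]:
  assumes "p \<in> up M" and zero: "P (\<lambda>n. \<zero>\<^bsub>M\<^esub>)"
    and cons: "\<And>a q. \<lbrakk>a \<in> carrier M; q \<in> up M; P q\<rbrakk> \<Longrightarrow> P (horner_cons a q)"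
  shows "P p"
proof -
  have "P p" if "\<forall>n\<ge>N. p n = \<zero>\<^bsub>M\<^esub>" "p \<in> up M" for N p
    using that
  proof (induction N arbitrary: p)
    case 0
    hence "p = (\<lambda>n. \<zero>\<^bsub>M\<^esub>)" by auto
    thus ?case using zero by simp
  next
    case (Suc N)
    have q: "\<forall>n\<ge>N. p (Suc n) = \<zero>\<^bsub>M\<^esub>" using Suc.prems by auto
    hence q': "(\<lambda>n. p (Suc n)) \<in> up M" using Suc.prems unfolding up_iff by blast
    have "horner_cons (p 0) (\<lambda>n. p (Suc n)) = p"
      by (auto simp: horner_cons_def fun_eq_iff split: nat.splits)
    thus ?case using cons[OF upD[OF Suc.prems(2)] q' Suc.IH[OF q q']] by metis
  qed
  thus ?thesis using assms(1) by (auto simp: up_iff)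
qed

lemma op_eval_bound:
  assumes E: "E \<in> module_maps R M M" and p: "p \<in> up M" and N: "\<forall>n>N. p n = \<zero>\<^bsub>M\<^esub>"
  shows "op_eval M E p = (\<Oplus>\<^bsub>M\<^esub>k \<in> {..N}. (E ^^ k) (p k))"
proof -
  note Ek = funpow_module_maps[OF E]
  have "{k. p k \<noteq> \<zero>\<^bsub>M\<^esub>} \<subseteq> {..N}" using N by (auto simp: not_less[symmetric])
  thus ?thesis
    unfolding op_eval_def
    by (intro M.add.finprod_mono_neutral_cong_left)
      (auto simp: module_maps_zero[OF M M Ek] intro!: module_maps_closed[OF Ek] upD[OF p])
qed

lemma up_boundE:
  assumes "p \<in> up M"
  obtains N where "\<forall>n>N. p n = \<zero>\<^bsub>M\<^esub>"
  using assms unfolding up_iff by (meson less_imp_le_nat)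

lemma op_eval_closed:
  assumes E: "E \<in> module_maps R M M" and p: "p \<in> up M"
  shows "op_eval M E p \<in> carrier M"
  unfolding op_eval_def
  by (rule M.finsum_closed) (auto intro!: module_maps_closed[OF funpow_module_maps[OF E]] upD[OF p])

lemma op_eval_zero: "op_eval M E (\<lambda>n. \<zero>\<^bsub>M\<^esub>) = \<zero>\<^bsub>M\<^esub>"
  by (simp add: op_eval_def)

lemma op_eval_cons:
  assumes E: "E \<in> module_maps R M M" and a: "a \<in> carrier M" and p: "p \<in> up M"
  shows "op_eval M E (horner_cons a p) = a \<oplus>\<^bsub>M\<^esub> E (op_eval M E p)"
proof -
  obtain N where N: "\<forall>n>N. p n = \<zero>\<^bsub>M\<^esub>" by (rule up_boundE[OF p])
  hence N': "\<forall>n>Suc N. horner_cons a p n = \<zero>\<^bsub>M\<^esub>" by (auto simp: horner_cons_def split: nat.splits)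
  note Ek = funpow_module_maps[OF E]
  have c: "horner_cons a p k \<in> carrier M" for k using upD[OF up_horner_cons[OF a p]] .
  have "op_eval M E (horner_cons a p) = (\<Oplus>\<^bsub>M\<^esub>k \<in> {..Suc N}. (E ^^ k) (horner_cons a p k))"
    by (rule op_eval_bound[OF E up_horner_cons[OF a p] N'])
  also have "\<dots> = (\<Oplus>\<^bsub>M\<^esub>k \<in> {..N}. (E ^^ Suc k) (horner_cons a p (Suc k))) \<oplus>\<^bsub>M\<^esub> (E ^^ 0) (horner_cons a p 0)"
    by (rule M.finsum_Suc2) (use c module_maps_closed[OF Ek] in blast)
  also have "\<dots> = (\<Oplus>\<^bsub>M\<^esub>k \<in> {..N}. E ((E ^^ k) (p k))) \<oplus>\<^bsub>M\<^esub> a" by simp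
  also have "(\<Oplus>\<^bsub>M\<^esub>k \<in> {..N}. E ((E ^^ k) (p k))) = E (op_eval M E p)"
    unfolding op_eval_bound[OF E p N]
    by (rule module_maps_finsum[OF M M E, symmetric]) (auto intro!: module_maps_closed[OF Ek] upD[OF p])
  finally show ?thesis using a op_eval_closed[OF E p] module_maps_closed[OF E] M.a_comm by simp
qed

lemma op_eval_times_lambda:
  assumes E: "E \<in> module_maps R M M" and p: "p \<in> up M"
  shows "op_eval M E (times_lambda M p) = E (op_eval M E p)"
  using op_eval_cons[OF E M.zero_closed p] module_maps_closed[OF E op_eval_closed[OF E p]]
  by (simp add: times_lambda_eq)

lemma op_eval_const:
  assumes E: "E \<in> module_maps R M M" and a: "a \<in> carrier M"
  shows "op_eval M E (const_coeff M a) = a"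
  using op_eval_cons[OF E a up_zero] a by (simp add: const_coeff_eq op_eval_zero module_maps_zero[OF M M E])

lemma op_eval_add:
  assumes E: "E \<in> module_maps R M M" and p: "p \<in> up M" and q: "q \<in> up M"
  shows "op_eval M E (\<lambda>n. p n \<oplus>\<^bsub>M\<^esub> q n) = op_eval M E p \<oplus>\<^bsub>M\<^esub> op_eval M E q"
proof -
  obtain N where N: "\<forall>n>N. p n = \<zero>\<^bsub>M\<^esub>" by (rule up_boundE[OF p])
  obtain N' where N': "\<forall>n>N'. q n = \<zero>\<^bsub>M\<^esub>" by (rule up_boundE[OF q])
  define K where "K = max N N'"
  have K: "\<forall>n>K. p n = \<zero>\<^bsub>M\<^esub>" "\<forall>n>K. q n = \<zero>\<^bsub>M\<^esub>" "\<forall>n>K. p n \<oplus>\<^bsub>M\<^esub> q n = \<zero>\<^bsub>M\<^esub>"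
    using N N' by (auto simp: K_def)
  note Ek = funpow_module_maps[OF E]
  show ?thesis
    unfolding op_eval_bound[OF E p K(1)] op_eval_bound[OF E q K(2)] op_eval_bound[OF E up_add[OF p q] K(3)]
    by (subst M.finsum_addf[symmetric])
      (auto simp: module_maps_add[OF Ek] upD[OF p] upD[OF q] intro!: module_maps_closed[OF Ek])
qed

end

lemma op_eval_map:
  fixes M :: "('r, 'a) module" and N :: "('q, 'b) module"
  assumes M: "Module.module R M" and N: "Module.module S N" and G: "G \<in> additive_maps M N"
    and E: "E \<in> module_maps R M M" and E': "E' \<in> module_maps S N N"
    and comm: "\<And>x. x \<in> carrier M \<Longrightarrow> G (E x) = E' (G x)" and p: "p \<in> up M"
  shows "op_eval N E' (\<lambda>n. G (p n)) = G (op_eval M E p)"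
proof -
  interpret M: Module.module R M by (fact M)
  interpret N: Module.module S N by (fact N)
  interpret G: abelian_group_hom M N G
    by (rule additive_maps_hom) (fact G M.abelian_group_axioms N.abelian_group_axioms)+
  show ?thesis
    using p
  proof (induction rule: up_induct[OF M, consumes 1, case_names zero cons])
    case zero
    thus ?case by (simp add: op_eval_def)
  next
    case (cons a q)
    show ?case
      using cons op_eval_closed[OF M E cons(2)] module_maps_closed[OF E]
      by (simp add: op_eval_cons[OF M E] op_eval_cons[OF N E'] horner_cons_map comm up_map[OF M N G])
  qed
qed

lemma op_eval_cong:
  fixes M :: "('r, 'a) module"
  assumes M: "Module.module R M" and E: "E \<in> module_maps R M M" and E': "E' \<in> module_maps R M M"
    and eq: "\<And>x. x \<in> carrier M \<Longrightarrow> E x = E' x" and p: "p \<in> up M"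
  shows "op_eval M E p = op_eval M E' p"
  using op_eval_map[OF M M _ E' E _ p, of "\<lambda>x. x"] eq module_maps_additive[OF module_maps_id(1)] by auto

abbreviation (input) pt :: "('r, 'a) module \<Rightarrow> 'r \<Rightarrow> 'a \<Rightarrow> 'a" where
  "pt M r \<equiv> smult M r"

text \<open>
  The ring is an algebra over the rational numbers.
\<close>

definition rational_scalars :: "('r, 's) ring_scheme \<Rightarrow> bool" where
  "rational_scalars R \<longleftrightarrow> (\<forall>n>0. add_pow R (n::nat) \<one>\<^bsub>R\<^esub> \<in> Units R)"

context
  fixes R :: "('r, 's) ring_scheme" and M :: "('r, 'a) module"
  assumes M: "Module.module R M"
begin

interpretation M: Module.module R M by (fact M)

abbreviation (input) nn :: "nat \<Rightarrow> 'r" where "nn n \<equiv> add_pow R n \<one>\<^bsub>R\<^esub>"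

lemma pt_module_maps: "r \<in> carrier R \<Longrightarrow> pt M r \<in> module_maps R M M"
  by (rule module_maps_smult_const[OF M])

lemma op_eval_smult:
  assumes E: "E \<in> module_maps R M M" and r: "r \<in> carrier R" and p: "p \<in> up M"
  shows "op_eval M E (\<lambda>n. r \<odot>\<^bsub>M\<^esub> p n) = r \<odot>\<^bsub>M\<^esub> op_eval M E p"
  by (rule op_eval_map[OF M M module_maps_additive[OF module_maps_smult_const[OF M r]] E E _ p])
    (simp add: module_maps_smult[OF E r])

lemma op_eval_uminus:
  assumes E: "E \<in> module_maps R M M" and p: "p \<in> up M"
  shows "op_eval M E (\<lambda>n. \<ominus>\<^bsub>M\<^esub> p n) = \<ominus>\<^bsub>M\<^esub> op_eval M E p"
  by (rule op_eval_map[OF M M module_maps_additive[OF module_maps_uminus[OF M M module_maps_id(1)]] E E _ p])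
    (simp add: module_maps_neg[OF M M E])

lemma op_eval_diff:
  assumes E: "E \<in> module_maps R M M" and p: "p \<in> up M" and q: "q \<in> up M"
  shows "op_eval M E (\<lambda>n. p n \<ominus>\<^bsub>M\<^esub> q n) = op_eval M E p \<ominus>\<^bsub>M\<^esub> op_eval M E q"
  using op_eval_add[OF M E p up_uminus[OF M q]] by (simp add: M.minus_eq op_eval_uminus[OF E q])

lemma up_smult: "r \<in> carrier R \<Longrightarrow> p \<in> up M \<Longrightarrow> (\<lambda>n. r \<odot>\<^bsub>M\<^esub> p n) \<in> up M"
  by (rule up_map[OF M M module_maps_additive[OF module_maps_smult_const[OF M]]])

text \<open>
  The coefficients of \<open>p(r + \<lambda>)\<close> are chosen before the operator, so the same polynomial serves
  scalars and operators.
\<close>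

lemma taylor_shift:
  assumes r: "r \<in> carrier R" and p: "p \<in> up M"
  shows "\<exists>w \<in> up M. \<forall>E \<in> module_maps R M M.
    op_eval M (\<lambda>x. r \<odot>\<^bsub>M\<^esub> x \<oplus>\<^bsub>M\<^esub> E x) p = op_eval M E w"
  using p
proof (induction rule: up_induct[OF M, consumes 1, case_names zero cons])
  case zero
  show ?case by (rule bexI[OF _ up_zero[OF M]]) (simp add: op_eval_zero[OF M])
next
  case (cons a q)
  then obtain w where w: "w \<in> up M"
    and eq: "\<And>E. E \<in> module_maps R M M \<Longrightarrow>
      op_eval M (\<lambda>x. r \<odot>\<^bsub>M\<^esub> x \<oplus>\<^bsub>M\<^esub> E x) q = op_eval M E w" by blast
  note u = up_horner_cons[OF M cons(1) w] up_smult[OF r w]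
  show ?case
  proof (intro bexI ballI)
    show "(\<lambda>n. horner_cons a w n \<oplus>\<^bsub>M\<^esub> r \<odot>\<^bsub>M\<^esub> w n) \<in> up M" by (rule up_add[OF M u])
    fix E assume E: "E \<in> module_maps R M M"
    have E': "(\<lambda>x. r \<odot>\<^bsub>M\<^esub> x \<oplus>\<^bsub>M\<^esub> E x) \<in> module_maps R M M"
      by (rule module_maps_plus[OF M M module_maps_smult_const[OF M r] E])
    show "op_eval M (\<lambda>x. r \<odot>\<^bsub>M\<^esub> x \<oplus>\<^bsub>M\<^esub> E x) (horner_cons a q)
        = op_eval M E (\<lambda>n. horner_cons a w n \<oplus>\<^bsub>M\<^esub> r \<odot>\<^bsub>M\<^esub> w n)"
      using op_eval_closed[OF M E w] module_maps_closed[OF E] r cons(1)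
      by (simp add: op_eval_cons[OF M E' cons(1,2)] eq[OF E] op_eval_add[OF M E u] op_eval_smult[OF E r w]
          op_eval_cons[OF M E cons(1) w] M.a_ac)
  qed
qed

text \<open>
  Synthetic division by \<open>\<lambda> - r\<close>, which makes sense for coefficients in a module because the divisor is
  monic.  The bound on the degree of the quotient drives the induction in \<open>polynomial_zeroI\<close>.
\<close>

lemma synthetic_division:
  assumes r: "r \<in> carrier R" and p: "p \<in> up M" and "\<forall>k\<ge>Suc N. p k = \<zero>\<^bsub>M\<^esub>"
  shows "\<exists>q \<in> up M. \<exists>c \<in> carrier M. (\<forall>k\<ge>N. q k = \<zero>\<^bsub>M\<^esub>) \<and>
    p = (\<lambda>n. horner_cons c q n \<ominus>\<^bsub>M\<^esub> r \<odot>\<^bsub>M\<^esub> q n)"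
  using p assms(3)
proof (induction N arbitrary: p)
  case 0
  have "p = horner_cons (p 0) (\<lambda>n. \<zero>\<^bsub>M\<^esub>)"
    using 0(2) by (auto simp: horner_cons_def fun_eq_iff split: nat.splits)
  moreover have "horner_cons (p 0) (\<lambda>n. \<zero>\<^bsub>M\<^esub>) n \<in> carrier M" for n
    using upD[OF 0(1)] by (auto simp: horner_cons_def split: nat.splits)
  ultimately show ?case
    using r upD[OF 0(1)] by (intro bexI[OF _ up_zero[OF M]] bexI[of _ "p 0"]) (auto simp: M.minus_eq)
next
  case (Suc N)
  define q0 where "q0 = (\<lambda>n. p (Suc n))"
  have q0: "q0 \<in> up M" using Suc.prems unfolding up_iff q0_def by blast
  have "\<forall>k\<ge>Suc N. q0 k = \<zero>\<^bsub>M\<^esub>" using Suc.prems(2) by (simp add: q0_def)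
  from Suc.IH[OF q0 this] obtain q1 c0 where q1: "q1 \<in> up M" and c0: "c0 \<in> carrier M"
    and b: "\<forall>k\<ge>N. q1 k = \<zero>\<^bsub>M\<^esub>" and eq: "q0 = (\<lambda>n. horner_cons c0 q1 n \<ominus>\<^bsub>M\<^esub> r \<odot>\<^bsub>M\<^esub> q1 n)"
    by blast
  note q1c [simp] = upD[OF q1]
  note q0c [simp] = upD[OF q0]
  note p0 [simp] = upD[OF Suc.prems(1)]
  have eq0: "q0 0 \<oplus>\<^bsub>M\<^esub> r \<odot>\<^bsub>M\<^esub> q1 0 = c0" using r c0 by (simp add: eq M.minus_eq M.a_assoc M.l_neg)
  have eqS: "q0 (Suc n) \<oplus>\<^bsub>M\<^esub> r \<odot>\<^bsub>M\<^esub> q1 (Suc n) = q1 n" for n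
    using r c0 by (simp add: eq M.minus_eq M.a_assoc M.l_neg)
  let ?q = "\<lambda>n. q0 n \<oplus>\<^bsub>M\<^esub> r \<odot>\<^bsub>M\<^esub> q1 n"
  show ?case
  proof (intro bexI conjI)
    show "?q \<in> up M" by (rule up_add[OF M q0 up_smult[OF r q1]])
    show "p 0 \<oplus>\<^bsub>M\<^esub> r \<odot>\<^bsub>M\<^esub> c0 \<in> carrier M" using r c0 by simp
    show "\<forall>k\<ge>Suc N. ?q k = \<zero>\<^bsub>M\<^esub>" using Suc.prems(2) b r by (auto simp: q0_def)
    show "p = (\<lambda>n. horner_cons (p 0 \<oplus>\<^bsub>M\<^esub> r \<odot>\<^bsub>M\<^esub> c0) ?q n \<ominus>\<^bsub>M\<^esub> r \<odot>\<^bsub>M\<^esub> ?q n)"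
    proof
      fix n
      show "p n = horner_cons (p 0 \<oplus>\<^bsub>M\<^esub> r \<odot>\<^bsub>M\<^esub> c0) ?q n \<ominus>\<^bsub>M\<^esub> r \<odot>\<^bsub>M\<^esub> ?q n"
      proof (cases n)
        case 0
        thus ?thesis using r c0 by (simp add: eq0 M.minus_eq M.a_assoc M.r_neg)
      next
        case (Suc m)
        have "p n = q0 m" by (simp add: q0_def Suc)
        thus ?thesis using r c0 by (simp add: Suc eqS M.minus_eq M.a_assoc M.r_neg)
      qed
    qed
  qed
qed

lemma op_eval_synthetic:
  assumes E: "E \<in> module_maps R M M" and r: "r \<in> carrier R" and q: "q \<in> up M" and c: "c \<in> carrier M"
  shows "op_eval M E (\<lambda>n. horner_cons c q n \<ominus>\<^bsub>M\<^esub> r \<odot>\<^bsub>M\<^esub> q n)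
    = c \<oplus>\<^bsub>M\<^esub> (E (op_eval M E q) \<ominus>\<^bsub>M\<^esub> r \<odot>\<^bsub>M\<^esub> op_eval M E q)"
  using r c op_eval_closed[OF M E q] module_maps_closed[OF E]
  by (subst op_eval_diff[OF E up_horner_cons[OF M c q] up_smult[OF r q]])
    (simp add: op_eval_cons[OF M E c q] op_eval_smult[OF E r q] M.minus_eq M.a_assoc)

text \<open>
  Let \<open>p\<close> vanish at all integers \<open>n \<ge> m\<close> and divide: \<open>p = c + (\<lambda> - m) q\<close>.  The remainder \<open>c\<close> is the
  value at \<open>m\<close>, hence zero, and then \<open>(n - m) q(n) = 0\<close> for \<open>n > m\<close>.  As \<open>n - m\<close> is invertible, \<open>q\<close>
  vanishes at all integers \<open>n \<ge> m + 1\<close>; it has fewer coefficients than \<open>p\<close>.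
\<close>

lemma polynomial_zeroI:
  assumes Q: "rational_scalars R" and p: "p \<in> up M"
    and "\<And>n. op_eval M (pt M (nn n)) p = \<zero>\<^bsub>M\<^esub>"
  shows "p = (\<lambda>n. \<zero>\<^bsub>M\<^esub>)"
proof -
  have "p = (\<lambda>n. \<zero>\<^bsub>M\<^esub>)"
    if "\<forall>k\<ge>N. p k = \<zero>\<^bsub>M\<^esub>" "p \<in> up M" "\<forall>n\<ge>m. op_eval M (pt M (nn n)) p = \<zero>\<^bsub>M\<^esub>" for p m N
    using that
  proof (induction N arbitrary: p m)
    case 0
    thus ?case by auto
  next
    case (Suc N)
    have nn: "nn n \<in> carrier R" for n by simp
    obtain q c where q: "q \<in> up M" and c: "c \<in> carrier M" and b: "\<forall>k\<ge>N. q k = \<zero>\<^bsub>M\<^esub>"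
      and eq: "p = (\<lambda>n. horner_cons c q n \<ominus>\<^bsub>M\<^esub> nn m \<odot>\<^bsub>M\<^esub> q n)"
      using synthetic_division[OF nn Suc.prems(2,1)] by blast
    have ev: "c \<oplus>\<^bsub>M\<^esub> (nn n \<odot>\<^bsub>M\<^esub> op_eval M (pt M (nn n)) q \<ominus>\<^bsub>M\<^esub> nn m \<odot>\<^bsub>M\<^esub> op_eval M (pt M (nn n)) q) = \<zero>\<^bsub>M\<^esub>"
      if "n \<ge> m" for n
      using Suc.prems(3) that op_eval_synthetic[OF pt_module_maps[OF nn] nn q c] by (simp add: eq)
    note cl [simp] = op_eval_closed[OF M pt_module_maps[OF nn] q]
    have c0: "c = \<zero>\<^bsub>M\<^esub>" using ev[of m] c by (simp add: M.minus_eq M.r_neg)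
    have "op_eval M (pt M (nn n)) q = \<zero>\<^bsub>M\<^esub>" if n: "n \<ge> Suc m" for n
    proof -
      obtain d where d: "n = m + d" "d > 0" using n by (metis less_eq_Suc_le less_imp_add_positive)
      let ?x = "op_eval M (pt M (nn n)) q"
      have "nn n = nn d \<oplus>\<^bsub>R\<^esub> nn m" by (simp add: d M.R.add.nat_pow_mult add.commute)
      hence "nn d \<odot>\<^bsub>M\<^esub> x = nn n \<odot>\<^bsub>M\<^esub> x \<ominus>\<^bsub>M\<^esub> nn m \<odot>\<^bsub>M\<^esub> x" if "x \<in> carrier M" for x
        using that by (simp add: M.smult_l_distr M.minus_eq M.a_assoc M.r_neg)
      hence "nn d \<odot>\<^bsub>M\<^esub> ?x = \<zero>\<^bsub>M\<^esub>"
        using ev[of n] n by (simp add: c0)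
      hence "inv\<^bsub>R\<^esub> nn d \<odot>\<^bsub>M\<^esub> (nn d \<odot>\<^bsub>M\<^esub> ?x) = \<zero>\<^bsub>M\<^esub>"
        using Q d(2) by (simp add: rational_scalars_def)
      thus ?thesis using Q d(2) by (simp add: rational_scalars_def M.smult_assoc1[symmetric])
    qed
    hence "q = (\<lambda>n. \<zero>\<^bsub>M\<^esub>)" by (intro Suc.IH[OF b q]) auto
    thus ?case
      by (auto simp: eq c0 horner_cons_def fun_eq_iff M.minus_eq split: nat.splits)
  qed
  moreover obtain N where "\<forall>k\<ge>N. p k = \<zero>\<^bsub>M\<^esub>" using p by (auto simp: up_iff)
  ultimately show ?thesis using assms by blast
qed

lemma polynomial_eqI:
  assumes Q: "rational_scalars R" and p: "p \<in> up M" and q: "q \<in> up M"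
    and eq: "\<And>r. r \<in> carrier R \<Longrightarrow> op_eval M (pt M r) p = op_eval M (pt M r) q"
  shows "p = q"
proof -
  have "(\<lambda>n. p n \<ominus>\<^bsub>M\<^esub> q n) = (\<lambda>n. \<zero>\<^bsub>M\<^esub>)"
  proof (rule polynomial_zeroI[OF Q up_diff[OF M p q]])
    fix n
    have r: "nn n \<in> carrier R" by simp
    show "op_eval M (pt M (nn n)) (\<lambda>n. p n \<ominus>\<^bsub>M\<^esub> q n) = \<zero>\<^bsub>M\<^esub>"
      using op_eval_closed[OF M pt_module_maps[OF r] q]
      by (simp add: op_eval_diff[OF pt_module_maps[OF r] p q] eq[OF r] M.minus_eq_zero_iff)
  qed
  thus ?thesis using upD[OF p] upD[OF q] by (auto simp: fun_eq_iff M.minus_eq_zero_iff)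
qed

text \<open>
  An identity \<open>p(r + u) = w(u)\<close> that holds for all scalars \<open>u\<close> is an identity of polynomials, so
  that an operator may be substituted for \<open>u\<close>.
\<close>

lemma op_eval_shift:
  assumes Q: "rational_scalars R" and r: "r \<in> carrier R" and p: "p \<in> up M" and w: "w \<in> up M"
    and eq: "\<And>u. u \<in> carrier R \<Longrightarrow> op_eval M (pt M (r \<oplus>\<^bsub>R\<^esub> u)) p = op_eval M (pt M u) w"
    and E: "E \<in> module_maps R M M" and E': "E' \<in> module_maps R M M"
    and EE': "\<And>x. x \<in> carrier M \<Longrightarrow> E' x = r \<odot>\<^bsub>M\<^esub> x \<oplus>\<^bsub>M\<^esub> E x"
  shows "op_eval M E' p = op_eval M E w"
proof -
  obtain w' where w': "w' \<in> up M" and s: "\<And>E. E \<in> module_maps R M M \<Longrightarrow>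
      op_eval M (\<lambda>x. r \<odot>\<^bsub>M\<^esub> x \<oplus>\<^bsub>M\<^esub> E x) p = op_eval M E w'"
    using taylor_shift[OF r p] by blast
  have rE: "(\<lambda>x. r \<odot>\<^bsub>M\<^esub> x \<oplus>\<^bsub>M\<^esub> E x) \<in> module_maps R M M" if "E \<in> module_maps R M M" for E
    by (rule module_maps_plus[OF M M module_maps_smult_const[OF M r] that])
  have "w = w'"
  proof (rule polynomial_eqI[OF Q w w'])
    fix u assume u: "u \<in> carrier R"
    have "op_eval M (pt M (r \<oplus>\<^bsub>R\<^esub> u)) p = op_eval M (\<lambda>x. r \<odot>\<^bsub>M\<^esub> x \<oplus>\<^bsub>M\<^esub> pt M u x) p"
      by (rule op_eval_cong[OF M pt_module_maps rE[OF pt_module_maps] _ p])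
        (use r u in \<open>auto simp: M.smult_l_distr\<close>)
    thus "op_eval M (pt M u) w = op_eval M (pt M u) w'"
      using eq[OF u] s[OF pt_module_maps[OF u]] by simp
  qed
  thus ?thesis using s[OF E] op_eval_cong[OF M E' rE[OF E] EE' p] by simp
qed

end

section \<open>The substitution of \<open>-\<lambda>-\<partial>\<close>\<close>

context
  fixes R :: "('r, 's) ring_scheme" and M :: "('r, 'a) module" and D :: "'a \<Rightarrow> 'a"
  assumes M: "Module.module R M" and D: "D \<in> module_maps R M M"
begin

interpretation M: Module.module R M by (fact M)

lemma neg_lambda_D_up: "p \<in> up M \<Longrightarrow> neg_lambda_D M D p \<in> up M"
  using up_diff[OF M up_uminus[OF M up_times_lambda[OF M]] up_map[OF M M module_maps_additive[OF D]], of p p]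
  by (simp add: neg_lambda_D_def[abs_def])

lemma neg_lambda_D_pow_up: "p \<in> up M \<Longrightarrow> (neg_lambda_D M D ^^ k) p \<in> up M"
  by (induction k) (auto intro: neg_lambda_D_up)

lemma neg_lambda_D_zero: "neg_lambda_D M D (\<lambda>n. \<zero>\<^bsub>M\<^esub>) = (\<lambda>n. \<zero>\<^bsub>M\<^esub>)"
  by (auto simp: neg_lambda_D_def times_lambda_eq horner_cons_def fun_eq_iff M.minus_eq
      module_maps_zero[OF M M D] split: nat.splits)

lemma neg_lambda_D_pow_zero: "(neg_lambda_D M D ^^ k) (\<lambda>n. \<zero>\<^bsub>M\<^esub>) = (\<lambda>n. \<zero>\<^bsub>M\<^esub>)"
  by (induction k) (auto simp: neg_lambda_D_zero)

lemma const_coeff_zero: "const_coeff M \<zero>\<^bsub>M\<^esub> = (\<lambda>n. \<zero>\<^bsub>M\<^esub>)"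
  by (auto simp: const_coeff_def)

lemma subst_neg_bound:
  assumes p: "p \<in> up M" and N: "\<forall>n>N. p n = \<zero>\<^bsub>M\<^esub>"
  shows "subst_neg M D p n = (\<Oplus>\<^bsub>M\<^esub>k \<in> {..N}. (neg_lambda_D M D ^^ k) (const_coeff M (p k)) n)"
proof -
  have "{k. p k \<noteq> \<zero>\<^bsub>M\<^esub>} \<subseteq> {..N}" using N by (auto simp: not_less[symmetric])
  thus ?thesis
    unfolding subst_neg_def
    by (intro M.add.finprod_mono_neutral_cong_left)
      (auto simp: const_coeff_zero neg_lambda_D_pow_zero intro!: upD[OF neg_lambda_D_pow_up] up_const_coeff[OF M] upD[OF p])
qed

lemma neg_lambda_D_finsum:
  assumes "finite A" and F: "\<And>k. k \<in> A \<Longrightarrow> F k \<in> up M"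
  shows "neg_lambda_D M D (\<lambda>n. \<Oplus>\<^bsub>M\<^esub>k\<in>A. F k n) n = (\<Oplus>\<^bsub>M\<^esub>k\<in>A. neg_lambda_D M D (F k) n)"
proof -
  have c: "(\<lambda>k. F k m) \<in> A \<rightarrow> carrier M" for m using upD[OF F] by auto
  have t: "times_lambda M (\<lambda>n. \<Oplus>\<^bsub>M\<^esub>k\<in>A. F k n) n = (\<Oplus>\<^bsub>M\<^esub>k\<in>A. times_lambda M (F k) n)"
    by (simp add: times_lambda_def split: nat.splits)
  have tc: "(\<lambda>k. times_lambda M (F k) n) \<in> A \<rightarrow> carrier M"
    using upD[OF up_times_lambda[OF M F]] by auto
  have ntc: "(\<lambda>k. \<ominus>\<^bsub>M\<^esub> times_lambda M (F k) n) \<in> A \<rightarrow> carrier M"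
    "(\<lambda>k. \<ominus>\<^bsub>M\<^esub> D (F k n)) \<in> A \<rightarrow> carrier M" "(\<lambda>k. D (F k n)) \<in> A \<rightarrow> carrier M"
    using upD[OF up_times_lambda[OF M F]] module_maps_closed[OF D upD[OF F]] by auto
  have neg: "\<ominus>\<^bsub>M\<^esub> (\<Oplus>\<^bsub>M\<^esub>k\<in>A. g k) = (\<Oplus>\<^bsub>M\<^esub>k\<in>A. \<ominus>\<^bsub>M\<^esub> g k)" if "g \<in> A \<rightarrow> carrier M" for g
    by (rule module_maps_finsum[OF M M module_maps_uminus[OF M M module_maps_id(1)] that])
  show ?thesis
    unfolding neg_lambda_D_def M.minus_eq
    by (simp add: t neg[OF tc] module_maps_finsum[OF M M D c] neg[OF ntc(3)] M.finsum_addf[OF ntc(1,2)])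
qed

lemma subst_neg_zero: "subst_neg M D (\<lambda>n. \<zero>\<^bsub>M\<^esub>) n = \<zero>\<^bsub>M\<^esub>"
  by (simp add: subst_neg_def)

lemma up_finsum:
  assumes "finite A" and F: "\<And>k. k \<in> A \<Longrightarrow> F k \<in> up M"
  shows "(\<lambda>n. \<Oplus>\<^bsub>M\<^esub>k\<in>A. F k n) \<in> up M"
  using assms
proof (induction A)
  case empty
  thus ?case by (simp add: up_zero[OF M])
next
  case (insert x A)
  have "(\<lambda>k. F k n) \<in> A \<rightarrow> carrier M" "F x n \<in> carrier M" for n using insert.prems upD by blast+
  thus ?case using insert by (simp add: M.finsum_insert up_add[OF M])
qed

lemma subst_neg_up:
  assumes p: "p \<in> up M"
  shows "subst_neg M D p \<in> up M"
proof -
  obtain N where N: "\<forall>n>N. p n = \<zero>\<^bsub>M\<^esub>" by (rule up_boundE[OF M p])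
  have "subst_neg M D p = (\<lambda>n. \<Oplus>\<^bsub>M\<^esub>k\<in>{..N}. (neg_lambda_D M D ^^ k) (const_coeff M (p k)) n)"
    by (auto simp: subst_neg_bound[OF p N])
  thus ?thesis
    using up_finsum[OF finite_atMost neg_lambda_D_pow_up[OF up_const_coeff[OF M upD[OF p]]]] by simp
qed

lemma subst_neg_cons:
  assumes a: "a \<in> carrier M" and p: "p \<in> up M"
  shows "subst_neg M D (horner_cons a p) n = const_coeff M a n \<oplus>\<^bsub>M\<^esub> neg_lambda_D M D (subst_neg M D p) n"
proof -
  obtain N where N: "\<forall>n>N. p n = \<zero>\<^bsub>M\<^esub>" by (rule up_boundE[OF M p])
  hence N': "\<forall>n>Suc N. horner_cons a p n = \<zero>\<^bsub>M\<^esub>" by (auto simp: horner_cons_def split: nat.splits)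
  let ?F = "\<lambda>k. (neg_lambda_D M D ^^ k) (const_coeff M (p k))"
  have c: "horner_cons a p k \<in> carrier M" for k using upD[OF up_horner_cons[OF M a p]] .
  have F: "?F k \<in> up M" for k by (rule neg_lambda_D_pow_up[OF up_const_coeff[OF M upD[OF p]]])
  have "subst_neg M D (horner_cons a p) n
      = (\<Oplus>\<^bsub>M\<^esub>k \<in> {..Suc N}. (neg_lambda_D M D ^^ k) (const_coeff M (horner_cons a p k)) n)"
    by (rule subst_neg_bound[OF up_horner_cons[OF M a p] N'])
  also have "\<dots> = (\<Oplus>\<^bsub>M\<^esub>k \<in> {..N}. (neg_lambda_D M D ^^ Suc k) (const_coeff M (horner_cons a p (Suc k))) n)
      \<oplus>\<^bsub>M\<^esub> (neg_lambda_D M D ^^ 0) (const_coeff M (horner_cons a p 0)) n"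
    by (rule M.finsum_Suc2) (use upD[OF neg_lambda_D_pow_up[OF up_const_coeff[OF M c]]] in blast)
  also have "\<dots> = (\<Oplus>\<^bsub>M\<^esub>k \<in> {..N}. neg_lambda_D M D (?F k) n) \<oplus>\<^bsub>M\<^esub> const_coeff M a n" by simp
  also have "(\<Oplus>\<^bsub>M\<^esub>k \<in> {..N}. neg_lambda_D M D (?F k) n) = neg_lambda_D M D (\<lambda>n. \<Oplus>\<^bsub>M\<^esub>k\<in>{..N}. ?F k n) n"
    by (rule neg_lambda_D_finsum[symmetric]) (auto intro: F)
  also have "(\<lambda>n. \<Oplus>\<^bsub>M\<^esub>k\<in>{..N}. ?F k n) = subst_neg M D p"
    by (auto simp: subst_neg_bound[OF p N])
  finally show ?thesis
    using M.a_comm[OF upD[OF neg_lambda_D_up[OF subst_neg_up[OF p]]] upD[OF up_const_coeff[OF M a]]]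
    by simp
qed

lemma commuting_neg:
  assumes E: "E \<in> module_maps R M M"
  shows "(\<lambda>x. \<ominus>\<^bsub>M\<^esub> E x \<ominus>\<^bsub>M\<^esub> D x) \<in> module_maps R M M"
  by (rule module_maps_diff[OF M M module_maps_uminus[OF M M E] D])

lemma op_eval_neg_lambda_D:
  assumes E: "E \<in> module_maps R M M" and comm: "\<And>x. x \<in> carrier M \<Longrightarrow> E (D x) = D (E x)"
    and p: "p \<in> up M"
  shows "op_eval M E (neg_lambda_D M D p) = \<ominus>\<^bsub>M\<^esub> E (op_eval M E p) \<ominus>\<^bsub>M\<^esub> D (op_eval M E p)"
proof -
  have Dp: "(\<lambda>n. D (p n)) \<in> up M" by (rule up_map[OF M M module_maps_additive[OF D] p])
  have D': "op_eval M E (\<lambda>n. D (p n)) = D (op_eval M E p)"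
    by (rule op_eval_map[OF M M module_maps_additive[OF D] E E _ p]) (simp add: comm)
  show ?thesis
    unfolding neg_lambda_D_def[abs_def]
    by (simp add: op_eval_diff[OF M E up_uminus[OF M up_times_lambda[OF M p]] Dp] D'
        op_eval_uminus[OF M E up_times_lambda[OF M p]] op_eval_times_lambda[OF M E p])
qed

text \<open>
  The operator \<open>-\<lambda>-\<partial>\<close> on polynomials becomes \<open>-E-\<partial>\<close> when an operator \<open>E\<close> that commutes with
  \<open>\<partial>\<close> is substituted for \<open>\<lambda>\<close>.
\<close>

lemma op_eval_subst_neg:
  assumes E: "E \<in> module_maps R M M" and comm: "\<And>x. x \<in> carrier M \<Longrightarrow> E (D x) = D (E x)"
    and p: "p \<in> up M"
  shows "op_eval M E (subst_neg M D p) = op_eval M (\<lambda>x. \<ominus>\<^bsub>M\<^esub> E x \<ominus>\<^bsub>M\<^esub> D x) p"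
  using p
proof (induction rule: up_induct[OF M, consumes 1, case_names zero cons])
  case zero
  show ?case by (simp add: op_eval_zero[OF M] subst_neg_zero[abs_def])
next
  case (cons a q)
  have 1: "subst_neg M D (horner_cons a q) = (\<lambda>n. const_coeff M a n \<oplus>\<^bsub>M\<^esub> neg_lambda_D M D (subst_neg M D q) n)"
    by (auto simp: subst_neg_cons[OF cons(1,2)])
  note S = subst_neg_up[OF cons(2)]
  show ?case
    unfolding 1
    by (simp add: op_eval_add[OF M E up_const_coeff[OF M cons(1)] neg_lambda_D_up[OF S]]
        op_eval_const[OF M E cons(1)] op_eval_neg_lambda_D[OF E comm S] cons(3)
        op_eval_cons[OF M commuting_neg[OF E] cons(1,2)])
qed

lemma op_eval_pt_subst_neg:
  assumes r: "r \<in> carrier R" and p: "p \<in> up M"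
  shows "op_eval M (pt M r) (subst_neg M D p) = op_eval M (\<lambda>x. \<ominus>\<^bsub>M\<^esub> pt M r x \<ominus>\<^bsub>M\<^esub> D x) p"
  by (rule op_eval_subst_neg[OF pt_module_maps[OF M r] _ p]) (simp add: r module_maps_smult[OF D])

text \<open>
  At a scalar \<open>r\<close> the left side is the value of \<open>p\<close> at \<open>-(-r-\<partial>)-\<partial> = r\<close>.
\<close>

lemma subst_neg_subst_neg:
  assumes Q: "rational_scalars R" and p: "p \<in> up M"
  shows "subst_neg M D (subst_neg M D p) = p"
proof (rule polynomial_eqI[OF M Q subst_neg_up[OF subst_neg_up[OF p]] p])
  fix r assume r: "r \<in> carrier R"
  note E = pt_module_maps[OF M r]
  note E' = commuting_neg[OF E]
  have "op_eval M (pt M r) (subst_neg M D (subst_neg M D p))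
      = op_eval M (\<lambda>x. \<ominus>\<^bsub>M\<^esub> (\<ominus>\<^bsub>M\<^esub> pt M r x \<ominus>\<^bsub>M\<^esub> D x) \<ominus>\<^bsub>M\<^esub> D x) p"
    by (subst op_eval_pt_subst_neg[OF r subst_neg_up[OF p]], rule op_eval_subst_neg[OF E' _ p])
      (simp add: r module_maps_smult[OF D] module_maps_closed[OF D] module_maps_neg[OF M M D]
        module_maps_minus[OF M M D])
  also have "\<dots> = op_eval M (pt M r) p"
    by (rule op_eval_cong[OF M commuting_neg[OF E'] E _ p])
      (simp add: r module_maps_closed[OF D] M.minus_eq M.minus_add M.a_assoc M.l_neg M.r_neg)
  finally show "op_eval M (pt M r) (subst_neg M D (subst_neg M D p)) = op_eval M (pt M r) p" .
qed

end

lemma subst_neg_map: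
  fixes M :: "('r, 'a) module" and N :: "('q, 'b) module"
  assumes M: "Module.module R M" and D: "D \<in> module_maps R M M"
    and N: "Module.module S N" and D': "D' \<in> module_maps S N N"
    and G: "G \<in> additive_maps M N" and comm: "\<And>x. x \<in> carrier M \<Longrightarrow> G (D x) = D' (G x)"
    and p: "p \<in> up M"
  shows "subst_neg N D' (\<lambda>n. G (p n)) n = G (subst_neg M D p n)"
  using p
proof (induction arbitrary: n rule: up_induct[OF M, consumes 1, case_names zero cons])
  interpret M: Module.module R M by (fact M)
  interpret N: Module.module S N by (fact N)
  interpret G: abelian_group_hom M N G
    by (rule additive_maps_hom) (fact G M.abelian_group_axioms N.abelian_group_axioms)+
  case zero
  thus ?case by (simp add: subst_neg_zero[OF M D] subst_neg_zero[OF N D'])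
next
  interpret M: Module.module R M by (fact M)
  interpret N: Module.module S N by (fact N)
  interpret G: abelian_group_hom M N G
    by (rule additive_maps_hom) (fact G M.abelian_group_axioms N.abelian_group_axioms)+
  case (cons a q)
  note Gq = up_map[OF M N G cons(2)]
  note S = upD[OF subst_neg_up[OF M D cons(2)]]
  have IH: "subst_neg N D' (\<lambda>n. G (q n)) = (\<lambda>n. G (subst_neg M D q n))" using cons(3) by auto
  have 1: "const_coeff N (G a) n = G (const_coeff M a n)" by (simp add: const_coeff_def)
  have 2: "neg_lambda_D N D' (\<lambda>n. G (subst_neg M D q n)) n = G (neg_lambda_D M D (subst_neg M D q) n)"
    using S module_maps_closed[OF D] module_maps_closed[OF D'] upD[OF up_times_lambda[OF M subst_neg_up[OF M D cons(2)]]]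
    by (cases n) (auto simp: neg_lambda_D_def times_lambda_eq comm M.minus_eq N.minus_eq)
  show ?case
    using upD[OF up_const_coeff[OF M cons(1)]] upD[OF neg_lambda_D_up[OF M D subst_neg_up[OF M D cons(2)]]]
    by (simp add: horner_cons_map subst_neg_cons[OF N D' G.hom_closed[OF cons(1)] Gq] IH 1 2
        subst_neg_cons[OF M D cons(1,2)])
qed

context
  fixes R :: "('r, 's) ring_scheme" and M :: "('r, 'a) module" and D :: "'a \<Rightarrow> 'a"
  assumes M: "Module.module R M" and D: "D \<in> module_maps R M M"
begin

interpretation M: Module.module R M by (fact M)

lemma neg_lambda_D_add:
  assumes "p \<in> up M" "q \<in> up M"
  shows "neg_lambda_D M D (\<lambda>n. p n \<oplus>\<^bsub>M\<^esub> q n) n = neg_lambda_D M D p n \<oplus>\<^bsub>M\<^esub> neg_lambda_D M D q n"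
proof -
  note c = upD[OF assms(1)] upD[OF assms(2)] upD[OF up_times_lambda[OF M assms(1)]]
    upD[OF up_times_lambda[OF M assms(2)]]
  have "times_lambda M (\<lambda>n. p n \<oplus>\<^bsub>M\<^esub> q n) n = times_lambda M p n \<oplus>\<^bsub>M\<^esub> times_lambda M q n"
    by (cases n) (auto simp: times_lambda_eq)
  thus ?thesis using c module_maps_closed[OF D]
    by (simp add: neg_lambda_D_def module_maps_add[OF D] M.minus_eq M.minus_add M.a_ac)
qed

lemma subst_neg_add:
  assumes p: "p \<in> up M" and q: "q \<in> up M"
  shows "subst_neg M D (\<lambda>n. p n \<oplus>\<^bsub>M\<^esub> q n) n = subst_neg M D p n \<oplus>\<^bsub>M\<^esub> subst_neg M D q n"
proof -
  obtain N1 where N1: "\<forall>n>N1. p n = \<zero>\<^bsub>M\<^esub>" by (rule up_boundE[OF M p])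
  obtain N2 where N2: "\<forall>n>N2. q n = \<zero>\<^bsub>M\<^esub>" by (rule up_boundE[OF M q])
  define N where "N = max N1 N2"
  have N: "\<forall>n>N. p n = \<zero>\<^bsub>M\<^esub>" "\<forall>n>N. q n = \<zero>\<^bsub>M\<^esub>" "\<forall>n>N. p n \<oplus>\<^bsub>M\<^esub> q n = \<zero>\<^bsub>M\<^esub>"
    using N1 N2 by (auto simp: N_def)
  have a: "(neg_lambda_D M D ^^ k) (\<lambda>n. f n \<oplus>\<^bsub>M\<^esub> g n)
      = (\<lambda>n. (neg_lambda_D M D ^^ k) f n \<oplus>\<^bsub>M\<^esub> (neg_lambda_D M D ^^ k) g n)"
    if "f \<in> up M" "g \<in> up M" for k f g
    by (induction k) (auto simp: neg_lambda_D_add neg_lambda_D_pow_up[OF M D] that)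
  have c: "const_coeff M (p k \<oplus>\<^bsub>M\<^esub> q k) = (\<lambda>n. const_coeff M (p k) n \<oplus>\<^bsub>M\<^esub> const_coeff M (q k) n)" for k
    by (auto simp: const_coeff_def)
  note u = up_const_coeff[OF M upD[OF p]] up_const_coeff[OF M upD[OF q]]
  show ?thesis
    unfolding subst_neg_bound[OF M D p N(1)] subst_neg_bound[OF M D q N(2)] subst_neg_bound[OF M D up_add[OF M p q] N(3)]
    by (subst M.finsum_addf[symmetric])
      (auto simp: c a[OF u] intro!: upD[OF neg_lambda_D_pow_up[OF M D u(1)]] upD[OF neg_lambda_D_pow_up[OF M D u(2)]])
qed

lemma subst_neg_uminus:
  assumes p: "p \<in> up M"
  shows "subst_neg M D (\<lambda>n. \<ominus>\<^bsub>M\<^esub> p n) n = \<ominus>\<^bsub>M\<^esub> subst_neg M D p n"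
  by (rule subst_neg_map[OF M D M D module_maps_additive[OF module_maps_uminus[OF M M module_maps_id(1)]] _ p])
    (simp add: module_maps_neg[OF M M D])

lemma subst_neg_smult:
  assumes p: "p \<in> up M" and r: "r \<in> carrier R"
  shows "subst_neg M D (\<lambda>n. r \<odot>\<^bsub>M\<^esub> p n) n = r \<odot>\<^bsub>M\<^esub> subst_neg M D p n"
  by (rule subst_neg_map[OF M D M D module_maps_additive[OF module_maps_smult_const[OF M r]] _ p])
    (simp add: module_maps_smult[OF D r])

lemma subst_neg_diff:
  assumes p: "p \<in> up M" and q: "q \<in> up M"
  shows "subst_neg M D (\<lambda>n. p n \<ominus>\<^bsub>M\<^esub> q n) n = subst_neg M D p n \<ominus>\<^bsub>M\<^esub> subst_neg M D q n"
  using subst_neg_add[OF p up_uminus[OF M q]] by (simp add: M.minus_eq subst_neg_uminus[OF q])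

lemma subst_neg_D:
  assumes p: "p \<in> up M"
  shows "subst_neg M D (\<lambda>n. D (p n)) n = D (subst_neg M D p n)"
  by (rule subst_neg_map[OF M D M D module_maps_additive[OF D] _ p]) simp

lemma subst_neg_times_lambda:
  assumes p: "p \<in> up M"
  shows "subst_neg M D (times_lambda M p) n = neg_lambda_D M D (subst_neg M D p) n"
  using subst_neg_cons[OF M D M.zero_closed p] upD[OF neg_lambda_D_up[OF M D subst_neg_up[OF M D p]]]
  by (simp add: times_lambda_eq const_coeff_zero[OF M D])

end

section \<open>Deciding identities in abelian groups\<close>

text \<open>
  Reflected sums and differences in an abelian group: an identity holds if every variable has the
  same integer coefficient on both sides.  The identities below have up to sixteen different terms,
  and comparing coefficients is much cheaper than rewriting with associativity and commutativity.
\<close>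

datatype group_expr = GZ | GV nat | GA group_expr group_expr | GM group_expr group_expr | GN group_expr

primrec group_eval :: "('a, 'm) ring_scheme \<Rightarrow> 'a list \<Rightarrow> group_expr \<Rightarrow> 'a" where
  "group_eval G xs GZ = \<zero>\<^bsub>G\<^esub>"
| "group_eval G xs (GV i) = xs ! i"
| "group_eval G xs (GA s t) = group_eval G xs s \<oplus>\<^bsub>G\<^esub> group_eval G xs t"
| "group_eval G xs (GM s t) = group_eval G xs s \<ominus>\<^bsub>G\<^esub> group_eval G xs t"
| "group_eval G xs (GN t) = \<ominus>\<^bsub>G\<^esub> group_eval G xs t"

primrec group_coeff :: "nat \<Rightarrow> group_expr \<Rightarrow> int" where
  "group_coeff i GZ = 0"
| "group_coeff i (GV j) = (if i = j then 1 else 0)"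
| "group_coeff i (GA s t) = group_coeff i s + group_coeff i t"
| "group_coeff i (GM s t) = group_coeff i s - group_coeff i t"
| "group_coeff i (GN t) = - group_coeff i t"

primrec group_vars :: "nat \<Rightarrow> group_expr \<Rightarrow> bool" where
  "group_vars n GZ = True"
| "group_vars n (GV j) = (j < n)"
| "group_vars n (GA s t) = (group_vars n s \<and> group_vars n t)"
| "group_vars n (GM s t) = (group_vars n s \<and> group_vars n t)"
| "group_vars n (GN t) = group_vars n t"

context abelian_group
begin

lemma group_eval_normal_form:
  assumes xs: "set xs \<subseteq> carrier G" and "group_vars (length xs) e"
  shows "group_eval G xs e \<in> carrier G \<and>
    group_eval G xs e = (\<Oplus>i\<in>{..<length xs}. add_pow G (group_coeff i e) (xs ! i))"
  using assms(2)
proof (induction e)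
  have x [simp]: "xs ! i \<in> carrier G" if "i < length xs" for i using xs that by auto
  have p: "(\<lambda>i. add_pow G (g i) (xs ! i)) \<in> {..<length xs} \<rightarrow> carrier G" for g :: "nat \<Rightarrow> int"
    by auto
  have add: "(\<Oplus>i\<in>{..<length xs}. add_pow G (g i + g' i) (xs ! i)) =
      (\<Oplus>i\<in>{..<length xs}. add_pow G (g i) (xs ! i)) \<oplus> (\<Oplus>i\<in>{..<length xs}. add_pow G (g' i) (xs ! i))"
    for g g' :: "nat \<Rightarrow> int"
    unfolding finsum_addf[OF p p, symmetric]
    by (rule finsum_cong') (auto simp: add.int_pow_mult)
  have zero: "(\<Oplus>i\<in>{..<length xs}. add_pow G (0 :: int) (xs ! i)) = \<zero>"
    by (rule add.finprod_one_eqI) (simp add: add_pow_int_ge)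
  have neg: "(\<Oplus>i\<in>{..<length xs}. add_pow G (- g i) (xs ! i)) = \<ominus> (\<Oplus>i\<in>{..<length xs}. add_pow G (g i) (xs ! i))"
    for g :: "nat \<Rightarrow> int"
  proof (rule minus_equality[symmetric])
    show "(\<Oplus>i\<in>{..<length xs}. add_pow G (- g i) (xs ! i)) \<oplus> (\<Oplus>i\<in>{..<length xs}. add_pow G (g i) (xs ! i)) = \<zero>"
      unfolding add[symmetric] using zero by simp
  qed (intro finsum_closed p)+
  {
    case GZ
    show ?case using zero by simp
  next
    case (GV j)
    hence "(\<Oplus>i\<in>{..<length xs}. add_pow G (if i = j then 1 else 0 :: int) (xs ! i))
        = (\<Oplus>i\<in>{..<length xs}. if j = i then xs ! i else \<zero>)"
      by (intro finsum_cong') (auto simp: add_pow_int_ge)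
    also have "\<dots> = xs ! j" using GV by (intro add.finprod_singleton) auto
    finally show ?case using GV by simp
  next
    case (GA s t)
    thus ?case using add[of "\<lambda>i. group_coeff i s" "\<lambda>i. group_coeff i t"] by simp
  next
    case (GM s t)
    thus ?case using add[of "\<lambda>i. group_coeff i s" "\<lambda>i. - group_coeff i t"] neg
      by (simp add: minus_eq)
  next
    case (GN t)
    thus ?case using neg by simp
  }
qed

lemma group_identity:
  assumes "set xs \<subseteq> carrier G" "group_vars (length xs) s" "group_vars (length xs) t"
    "list_all (\<lambda>i. group_coeff i s = group_coeff i t) [0..<length xs]"
  shows "group_eval G xs s = group_eval G xs t"
proof -
  have c: "xs ! i \<in> carrier G" if "i < length xs" for i using assms(1) that by auto
  have "(\<Oplus>i\<in>{..<length xs}. add_pow G (group_coeff i s) (xs ! i))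
      = (\<Oplus>i\<in>{..<length xs}. add_pow G (group_coeff i t) (xs ! i))"
    by (rule finsum_cong') (use assms(4) c in \<open>auto simp: list_all_iff\<close>)
  thus ?thesis
    using group_eval_normal_form[OF assms(1,2)] group_eval_normal_form[OF assms(1,3)] by simp
qed

end

section \<open>Polynomials in two variables\<close>

text \<open>
  Polynomials in \<open>\<lambda>, \<mu>\<close> as families of coefficients that vanish outside a square, and their values
  at pairs of scalars.
\<close>

definition up2 :: "('r, 'a) module \<Rightarrow> (nat \<Rightarrow> nat \<Rightarrow> 'a) set" where
  "up2 M = {F. (\<forall>m n. F m n \<in> carrier M) \<and> (\<exists>N. \<forall>m n. N \<le> m \<or> N \<le> n \<longrightarrow> F m n = \<zero>\<^bsub>M\<^esub>)}"

definition op_eval2 :: "('r, 'a) module \<Rightarrow> 'r \<Rightarrow> 'r \<Rightarrow> (nat \<Rightarrow> nat \<Rightarrow> 'a) \<Rightarrow> 'a" where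
  "op_eval2 M r s F = op_eval M (pt M r) (\<lambda>m. op_eval M (pt M s) (F m))"

context
  fixes R :: "('r, 's) ring_scheme" and M :: "('r, 'a) module"
  assumes M: "Module.module R M"
begin

interpretation M: Module.module R M by (fact M)

lemma up2D: "F \<in> up2 M \<Longrightarrow> F m n \<in> carrier M"
  by (simp add: up2_def)

lemma up2_inner: "F \<in> up2 M \<Longrightarrow> F m \<in> up M"
  unfolding up2_def up_iff by blast

lemma up2_outer:
  assumes s: "s \<in> carrier R" and F: "F \<in> up2 M"
  shows "(\<lambda>m. op_eval M (pt M s) (F m)) \<in> up M"
proof -
  obtain N where "\<forall>m n. N \<le> m \<or> N \<le> n \<longrightarrow> F m n = \<zero>\<^bsub>M\<^esub>" using F by (auto simp: up2_def)
  hence "F m = (\<lambda>n. \<zero>\<^bsub>M\<^esub>)" if "m \<ge> N" for m using that by auto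
  hence "\<forall>m\<ge>N. op_eval M (pt M s) (F m) = \<zero>\<^bsub>M\<^esub>" by (simp add: op_eval_zero[OF M])
  thus ?thesis
    unfolding up_iff using op_eval_closed[OF M pt_module_maps[OF M s] up2_inner[OF F]] by blast
qed

lemma polynomial2_eqI:
  assumes Q: "rational_scalars R" and F: "F \<in> up2 M" and G: "G \<in> up2 M"
    and eq: "\<And>r s. \<lbrakk>r \<in> carrier R; s \<in> carrier R\<rbrakk> \<Longrightarrow> op_eval2 M r s F = op_eval2 M r s G"
  shows "F m n = G m n"
proof -
  have "F m = G m"
  proof (rule polynomial_eqI[OF M Q up2_inner[OF F] up2_inner[OF G]])
    fix s assume s: "s \<in> carrier R"
    have "(\<lambda>m. op_eval M (pt M s) (F m)) = (\<lambda>m. op_eval M (pt M s) (G m))"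
      by (rule polynomial_eqI[OF M Q up2_outer[OF s F] up2_outer[OF s G]])
        (use eq s in \<open>auto simp: op_eval2_def\<close>)
    thus "op_eval M (pt M s) (F m) = op_eval M (pt M s) (G m)" by (rule fun_cong)
  qed
  thus ?thesis by simp
qed

lemma up2_add:
  assumes F: "F \<in> up2 M" and G: "G \<in> up2 M"
  shows "(\<lambda>m n. F m n \<oplus>\<^bsub>M\<^esub> G m n) \<in> up2 M"
proof -
  obtain N1 where N1: "\<forall>m n. N1 \<le> m \<or> N1 \<le> n \<longrightarrow> F m n = \<zero>\<^bsub>M\<^esub>" using F by (auto simp: up2_def)
  obtain N2 where N2: "\<forall>m n. N2 \<le> m \<or> N2 \<le> n \<longrightarrow> G m n = \<zero>\<^bsub>M\<^esub>" using G by (auto simp: up2_def)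
  have "\<forall>m n. max N1 N2 \<le> m \<or> max N1 N2 \<le> n \<longrightarrow> F m n \<oplus>\<^bsub>M\<^esub> G m n = \<zero>\<^bsub>M\<^esub>"
    using N1 N2 by auto
  thus ?thesis unfolding up2_def using up2D[OF F] up2D[OF G] by blast
qed

lemma op_eval2_add:
  assumes r: "r \<in> carrier R" and s: "s \<in> carrier R" and F: "F \<in> up2 M" and G: "G \<in> up2 M"
  shows "op_eval2 M r s (\<lambda>m n. F m n \<oplus>\<^bsub>M\<^esub> G m n) = op_eval2 M r s F \<oplus>\<^bsub>M\<^esub> op_eval2 M r s G"
  unfolding op_eval2_def
  by (simp add: op_eval_add[OF M pt_module_maps[OF M s] up2_inner[OF F] up2_inner[OF G]]
      op_eval_add[OF M pt_module_maps[OF M r] up2_outer[OF s F] up2_outer[OF s G]])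

lemma up2_shift1:
  assumes F: "F \<in> up2 M"
  shows "horner_cons (\<lambda>n. \<zero>\<^bsub>M\<^esub>) F \<in> up2 M"
proof -
  obtain N where "\<forall>m n. N \<le> m \<or> N \<le> n \<longrightarrow> F m n = \<zero>\<^bsub>M\<^esub>" using F by (auto simp: up2_def)
  hence "\<forall>m n. Suc N \<le> m \<or> Suc N \<le> n \<longrightarrow> horner_cons (\<lambda>n. \<zero>\<^bsub>M\<^esub>) F m n = \<zero>\<^bsub>M\<^esub>"
    by (auto simp: horner_cons_def split: nat.splits)
  moreover have "horner_cons (\<lambda>n. \<zero>\<^bsub>M\<^esub>) F m n \<in> carrier M" for m n
    using up2D[OF F] by (auto simp: horner_cons_def split: nat.splits)
  ultimately show ?thesis unfolding up2_def by blast
qed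

lemma op_eval2_shift1:
  assumes r: "r \<in> carrier R" and s: "s \<in> carrier R" and F: "F \<in> up2 M"
  shows "op_eval2 M r s (horner_cons (\<lambda>n. \<zero>\<^bsub>M\<^esub>) F) = r \<odot>\<^bsub>M\<^esub> op_eval2 M r s F"
proof -
  have "(\<lambda>m. op_eval M (pt M s) (horner_cons (\<lambda>n. \<zero>\<^bsub>M\<^esub>) F m))
      = times_lambda M (\<lambda>m. op_eval M (pt M s) (F m))"
    by (simp add: horner_cons_map times_lambda_eq op_eval_zero[OF M])
  thus ?thesis
    unfolding op_eval2_def by (simp add: op_eval_times_lambda[OF M pt_module_maps[OF M r] up2_outer[OF s F]])
qed

lemma up2_shift2:
  assumes F: "F \<in> up2 M"
  shows "(\<lambda>m. times_lambda M (F m)) \<in> up2 M"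
proof -
  obtain N where "\<forall>m n. N \<le> m \<or> N \<le> n \<longrightarrow> F m n = \<zero>\<^bsub>M\<^esub>" using F by (auto simp: up2_def)
  hence "\<forall>m n. Suc N \<le> m \<or> Suc N \<le> n \<longrightarrow> times_lambda M (F m) n = \<zero>\<^bsub>M\<^esub>"
    by (auto simp: times_lambda_def split: nat.splits)
  moreover have "times_lambda M (F m) n \<in> carrier M" for m n
    using up2D[OF F] by (auto simp: times_lambda_def split: nat.splits)
  ultimately show ?thesis unfolding up2_def by blast
qed

lemma op_eval2_shift2:
  assumes r: "r \<in> carrier R" and s: "s \<in> carrier R" and F: "F \<in> up2 M"
  shows "op_eval2 M r s (\<lambda>m. times_lambda M (F m)) = s \<odot>\<^bsub>M\<^esub> op_eval2 M r s F"
  unfolding op_eval2_def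
  by (simp add: op_eval_times_lambda[OF M pt_module_maps[OF M s] up2_inner[OF F]]
      op_eval_smult[OF M pt_module_maps[OF M r] s up2_outer[OF s F]])

lemma up2_const:
  assumes a: "a \<in> carrier M"
  shows "horner_cons (const_coeff M a) (\<lambda>m n. \<zero>\<^bsub>M\<^esub>) \<in> up2 M"
proof -
  have "\<forall>m n. Suc 0 \<le> m \<or> Suc 0 \<le> n \<longrightarrow> horner_cons (const_coeff M a) (\<lambda>m n. \<zero>\<^bsub>M\<^esub>) m n = \<zero>\<^bsub>M\<^esub>"
    by (auto simp: horner_cons_def const_coeff_def split: nat.splits)
  moreover have "horner_cons (const_coeff M a) (\<lambda>m n. \<zero>\<^bsub>M\<^esub>) m n \<in> carrier M" for m n
    using a by (auto simp: horner_cons_def const_coeff_def split: nat.splits)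
  ultimately show ?thesis unfolding up2_def by blast
qed

lemma op_eval2_const:
  assumes r: "r \<in> carrier R" and s: "s \<in> carrier R" and a: "a \<in> carrier M"
  shows "op_eval2 M r s (horner_cons (const_coeff M a) (\<lambda>m n. \<zero>\<^bsub>M\<^esub>)) = a"
proof -
  have "(\<lambda>m. op_eval M (pt M s) (horner_cons (const_coeff M a) (\<lambda>m n. \<zero>\<^bsub>M\<^esub>) m)) = const_coeff M a"
    by (simp add: horner_cons_map const_coeff_eq[of M a, symmetric] op_eval_zero[OF M]
        op_eval_const[OF M pt_module_maps[OF M s] a])
  thus ?thesis unfolding op_eval2_def by (simp add: op_eval_const[OF M pt_module_maps[OF M r] a])
qed

text \<open>
  Pascal's rule in the form \<open>(a + \<nu> q(\<nu>))\<close> at \<open>\<nu> = \<lambda> + \<mu>\<close>; it is the only fact on binomial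
  coefficients that is needed.
\<close>

lemma subst_sum_cons:
  assumes a: "a \<in> carrier M" and q: "q \<in> up M"
  shows "subst_sum M (horner_cons a q) m n =
    horner_cons (const_coeff M a) (\<lambda>m n. \<zero>\<^bsub>M\<^esub>) m n \<oplus>\<^bsub>M\<^esub>
      (horner_cons (\<lambda>n. \<zero>\<^bsub>M\<^esub>) (subst_sum M q) m n \<oplus>\<^bsub>M\<^esub> times_lambda M (subst_sum M q m) n)"
proof -
  note [simp] = a upD[OF q] subst_sum_def times_lambda_eq const_coeff_def
  show ?thesis
    by (cases m; cases n) (auto simp: M.add.nat_pow_mult[symmetric] add.commute)
qed

lemma subst_sum_up2_eval:
  assumes q: "q \<in> up M"
  shows "subst_sum M q \<in> up2 M \<and> (\<forall>r\<in>carrier R. \<forall>s\<in>carrier R.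
    op_eval2 M r s (subst_sum M q) = op_eval M (pt M (r \<oplus>\<^bsub>R\<^esub> s)) q)"
  using q
proof (induction rule: up_induct[OF M, consumes 1, case_names zero cons])
  case zero
  have 1: "subst_sum M (\<lambda>n. \<zero>\<^bsub>M\<^esub>) = (\<lambda>m n. \<zero>\<^bsub>M\<^esub>)" by (auto simp: subst_sum_def fun_eq_iff)
  have "(\<lambda>m n. \<zero>\<^bsub>M\<^esub>) \<in> up2 M" by (auto simp: up2_def)
  thus ?case by (simp add: 1 op_eval2_def op_eval_zero[OF M])
next
  case (cons a q)
  hence F: "subst_sum M q \<in> up2 M" by simp
  have eq: "subst_sum M (horner_cons a q) = (\<lambda>m n. horner_cons (const_coeff M a) (\<lambda>m n. \<zero>\<^bsub>M\<^esub>) m n \<oplus>\<^bsub>M\<^esub>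
      (horner_cons (\<lambda>n. \<zero>\<^bsub>M\<^esub>) (subst_sum M q) m n \<oplus>\<^bsub>M\<^esub> times_lambda M (subst_sum M q m) n))"
    by (auto simp: subst_sum_cons[OF cons(1,2)] fun_eq_iff)
  note u = up2_const[OF cons(1)] up2_add[OF up2_shift1[OF F] up2_shift2[OF F]]
  show ?case
  proof (intro conjI ballI)
    show "subst_sum M (horner_cons a q) \<in> up2 M" unfolding eq by (rule up2_add[OF u])
    fix r s assume r: "r \<in> carrier R" and s: "s \<in> carrier R"
    hence rs: "r \<oplus>\<^bsub>R\<^esub> s \<in> carrier R" by simp
    show "op_eval2 M r s (subst_sum M (horner_cons a q)) = op_eval M (pt M (r \<oplus>\<^bsub>R\<^esub> s)) (horner_cons a q)"
      unfolding eq using r s cons(3)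
      by (simp add: op_eval2_add[OF r s u] op_eval2_const[OF r s cons(1)] op_eval2_add[OF r s up2_shift1[OF F] up2_shift2[OF F]]
          op_eval2_shift1[OF r s F] op_eval2_shift2[OF r s F] op_eval_cons[OF M pt_module_maps[OF M rs] cons(1,2)]
          M.smult_l_distr op_eval_closed[OF M pt_module_maps[OF M rs] cons(2)])
  qed
qed

end

section \<open>Evaluation of \<open>\<lambda>\<close>-products\<close>

text \<open>
  The product \<open>a\<^sub>\<lambda> b\<close> at \<open>\<lambda> = r\<close>, an ordinary bilinear map.
\<close>

definition prod_at :: "('r, 'a) module \<Rightarrow> ('a \<Rightarrow> 'a \<Rightarrow> nat \<Rightarrow> 'a) \<Rightarrow> 'r \<Rightarrow> 'a \<Rightarrow> 'a \<Rightarrow> 'a" where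
  "prod_at M f r a b = op_eval M (pt M r) (f a b)"

context lambda_product
begin

lemmas M_module = module_axioms

lemma f_left: "b \<in> carrier M \<Longrightarrow> (\<lambda>a. f a b n) \<in> module_maps R M M"
  and f_right: "a \<in> carrier M \<Longrightarrow> (\<lambda>b. f a b n) \<in> module_maps R M M"
  using bilinear by (auto simp: lambda_bilinear_def)

lemma f_closed: "a \<in> carrier M \<Longrightarrow> b \<in> carrier M \<Longrightarrow> f a b n \<in> carrier M"
  by (rule upD[OF polynomial])

lemma prod_at_closed: "\<lbrakk>r \<in> carrier R; a \<in> carrier M; b \<in> carrier M\<rbrakk> \<Longrightarrow> prod_at M f r a b \<in> carrier M"
  unfolding prod_at_def by (rule op_eval_closed[OF M_module pt_module_maps[OF M_module] polynomial])

lemma prod_at_left: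
  assumes r: "r \<in> carrier R" and b: "b \<in> carrier M"
  shows "(\<lambda>a. prod_at M f r a b) \<in> module_maps R M M"
proof -
  note E = pt_module_maps[OF M_module r]
  show ?thesis
  proof (rule module_mapsI)
    fix x y assume xy: "x \<in> carrier M" "y \<in> carrier M"
    have "f (x \<oplus>\<^bsub>M\<^esub> y) b = (\<lambda>n. f x b n \<oplus>\<^bsub>M\<^esub> f y b n)"
      using module_maps_add[OF f_left[OF b] xy] by auto
    thus "prod_at M f r (x \<oplus>\<^bsub>M\<^esub> y) b = prod_at M f r x b \<oplus>\<^bsub>M\<^esub> prod_at M f r y b"
      using xy b by (simp add: prod_at_def op_eval_add[OF M_module E] polynomial)
  next
    fix c x assume cx: "c \<in> carrier R" "x \<in> carrier M"
    have "f (c \<odot>\<^bsub>M\<^esub> x) b = (\<lambda>n. c \<odot>\<^bsub>M\<^esub> f x b n)"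
      using module_maps_smult[OF f_left[OF b] cx] by auto
    thus "prod_at M f r (c \<odot>\<^bsub>M\<^esub> x) b = c \<odot>\<^bsub>M\<^esub> prod_at M f r x b"
      using cx b by (simp add: prod_at_def op_eval_smult[OF M_module E] polynomial)
  qed (rule prod_at_closed[OF r _ b])
qed

lemma prod_at_right:
  assumes r: "r \<in> carrier R" and a: "a \<in> carrier M"
  shows "prod_at M f r a \<in> module_maps R M M"
proof -
  note E = pt_module_maps[OF M_module r]
  show ?thesis
  proof (rule module_mapsI)
    fix x y assume xy: "x \<in> carrier M" "y \<in> carrier M"
    have "f a (x \<oplus>\<^bsub>M\<^esub> y) = (\<lambda>n. f a x n \<oplus>\<^bsub>M\<^esub> f a y n)"
      using module_maps_add[OF f_right[OF a] xy] by auto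
    thus "prod_at M f r a (x \<oplus>\<^bsub>M\<^esub> y) = prod_at M f r a x \<oplus>\<^bsub>M\<^esub> prod_at M f r a y"
      using xy a by (simp add: prod_at_def op_eval_add[OF M_module E] polynomial)
  next
    fix c x assume cx: "c \<in> carrier R" "x \<in> carrier M"
    have "f a (c \<odot>\<^bsub>M\<^esub> x) = (\<lambda>n. c \<odot>\<^bsub>M\<^esub> f a x n)"
      using module_maps_smult[OF f_right[OF a] cx] by auto
    thus "prod_at M f r a (c \<odot>\<^bsub>M\<^esub> x) = c \<odot>\<^bsub>M\<^esub> prod_at M f r a x"
      using cx a by (simp add: prod_at_def op_eval_smult[OF M_module E] polynomial)
  qed (rule prod_at_closed[OF r a])
qed

lemma prod_at_D_left:
  assumes r: "r \<in> carrier R" and a: "a \<in> carrier M" and b: "b \<in> carrier M"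
  shows "prod_at M f r (D a) b = \<ominus>\<^bsub>M\<^esub> (r \<odot>\<^bsub>M\<^esub> prod_at M f r a b)"
proof -
  note E = pt_module_maps[OF M_module r] and p = polynomial[OF a b]
  have "f (D a) b = (\<lambda>n. \<ominus>\<^bsub>M\<^esub> times_lambda M (f a b) n)" using sesqui_left[OF a b] by auto
  thus ?thesis
    by (simp add: prod_at_def op_eval_uminus[OF M_module E up_times_lambda[OF M_module p]]
        op_eval_times_lambda[OF M_module E p])
qed

lemma prod_at_D_right:
  assumes r: "r \<in> carrier R" and a: "a \<in> carrier M" and b: "b \<in> carrier M"
  shows "prod_at M f r a (D b) = D (prod_at M f r a b) \<oplus>\<^bsub>M\<^esub> r \<odot>\<^bsub>M\<^esub> prod_at M f r a b"
proof -
  note E = pt_module_maps[OF M_module r] and p = polynomial[OF a b]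
  note Da = module_maps_additive[OF D_linear]
  have "f a (D b) = (\<lambda>n. D (f a b n) \<oplus>\<^bsub>M\<^esub> times_lambda M (f a b) n)" using sesqui_right[OF a b] by auto
  moreover have "op_eval M (pt M r) (\<lambda>n. D (f a b n)) = D (op_eval M (pt M r) (f a b))"
    by (rule op_eval_map[OF M_module M_module Da E E _ p]) (simp add: module_maps_smult[OF D_linear r])
  ultimately show ?thesis
    by (simp add: prod_at_def op_eval_add[OF M_module E up_map[OF M_module M_module Da p] up_times_lambda[OF M_module p]]
        op_eval_times_lambda[OF M_module E p])
qed

text \<open>
  The degree of \<open>a\<^sub>\<lambda> b\<close> may depend on \<open>b\<close>, but only finitely many \<open>b = p n\<close> are nonzero.
\<close>

lemma up2_left_outer:
  assumes a: "a \<in> carrier M" and p: "p \<in> up M"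
  shows "(\<lambda>m n. f a (p n) m) \<in> up2 M"
proof -
  obtain N where N: "\<forall>n\<ge>N. p n = \<zero>\<^bsub>M\<^esub>" using p by (auto simp: up_iff)
  have "\<forall>n. \<exists>K. \<forall>m\<ge>K. f a (p n) m = \<zero>\<^bsub>M\<^esub>"
    using polynomial[OF a upD[OF p]] by (auto simp: up_iff)
  then obtain K where K: "\<And>n m. m \<ge> K n \<Longrightarrow> f a (p n) m = \<zero>\<^bsub>M\<^esub>" by metis
  define L where "L = Max (insert N (K ` {..<N}))"
  have L: "L \<ge> N" "\<And>n. n < N \<Longrightarrow> L \<ge> K n" by (auto simp: L_def)
  have z: "f a (p n) m = \<zero>\<^bsub>M\<^esub>" if "n \<ge> N" for m n
    using N that module_maps_zero[OF M_module M_module f_right[OF a]] by simp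
  have "\<forall>m n. L \<le> m \<or> L \<le> n \<longrightarrow> f a (p n) m = \<zero>\<^bsub>M\<^esub>"
    using z K L by (metis le_trans not_le)
  thus ?thesis using f_closed[OF a upD[OF p]] unfolding up2_def by blast
qed

lemma up2_left_inner:
  assumes a: "a \<in> carrier M" and p: "p \<in> up M"
  shows "(\<lambda>m n. f a (p m) n) \<in> up2 M"
  using up2_left_outer[OF assms] unfolding up2_def by fast

lemma op_eval2_left_outer:
  assumes r: "r \<in> carrier R" and s: "s \<in> carrier R" and a: "a \<in> carrier M" and p: "p \<in> up M"
  shows "op_eval2 M r s (\<lambda>m n. f a (p n) m) = prod_at M f r a (op_eval M (pt M s) p)"
proof -
  note E = pt_module_maps[OF M_module s]
  have "op_eval M (pt M s) (\<lambda>n. f a (p n) m) = f a (op_eval M (pt M s) p) m" for m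
    by (rule op_eval_map[OF M_module M_module module_maps_additive[OF f_right[OF a]] E E _ p])
      (rule module_maps_smult[OF f_right[OF a] s])
  thus ?thesis by (simp add: op_eval2_def prod_at_def)
qed

lemma op_eval2_left_inner:
  assumes r: "r \<in> carrier R" and s: "s \<in> carrier R" and a: "a \<in> carrier M" and p: "p \<in> up M"
  shows "op_eval2 M r s (\<lambda>m n. f a (p m) n) = prod_at M f s a (op_eval M (pt M r) p)"
proof -
  note E = pt_module_maps[OF M_module r]
  have "op_eval M (pt M r) (\<lambda>m. prod_at M f s a (p m)) = prod_at M f s a (op_eval M (pt M r) p)"
    by (rule op_eval_map[OF M_module M_module module_maps_additive[OF prod_at_right[OF s a]] E E _ p])
      (rule module_maps_smult[OF prod_at_right[OF s a] r])
  thus ?thesis by (simp add: op_eval2_def prod_at_def)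
qed

lemma lambda_mu_prod_cons:
  assumes a: "a \<in> carrier M" and q: "q \<in> up M" and c: "c \<in> carrier M"
  shows "lambda_mu_prod M f (horner_cons a q) c m n =
    subst_sum M (f a c) m n \<oplus>\<^bsub>M\<^esub> horner_cons (\<lambda>n. \<zero>\<^bsub>M\<^esub>) (lambda_mu_prod M f q c) m n"
proof -
  have s: "subst_sum M (f x c) i j \<in> carrier M" if "x \<in> carrier M" for x i j
    using f_closed[OF that c] by (simp add: subst_sum_def)
  have x: "horner_cons a q i \<in> carrier M" for i using upD[OF up_horner_cons[OF M_module a q]] .
  show ?thesis
  proof (cases m)
    case 0
    thus ?thesis using s[OF a] by (simp add: lambda_mu_prod_def)
  next
    case (Suc k)
    have "lambda_mu_prod M f (horner_cons a q) c m n =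
      (\<Oplus>\<^bsub>M\<^esub>i \<in> {..k}. subst_sum M (f (horner_cons a q (Suc i)) c) (Suc k - Suc i) n)
        \<oplus>\<^bsub>M\<^esub> subst_sum M (f (horner_cons a q 0) c) (Suc k - 0) n"
      unfolding lambda_mu_prod_def Suc by (rule finsum_Suc2) (use s[OF x] in auto)
    also have "\<dots> = lambda_mu_prod M f q c k n \<oplus>\<^bsub>M\<^esub> subst_sum M (f a c) m n"
      by (simp add: lambda_mu_prod_def Suc)
    also have "\<dots> = subst_sum M (f a c) m n \<oplus>\<^bsub>M\<^esub> lambda_mu_prod M f q c k n"
      unfolding lambda_mu_prod_def by (rule M.a_comm[OF finsum_closed s[OF a]]) (use s[OF upD[OF q]] in auto)
    finally show ?thesis by (simp add: Suc)
  qed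
qed

text \<open>
  The polynomial \<open>p(\<lambda>)\<^sub>\<lambda>\<^sub>+\<^sub>\<mu> c\<close> at \<open>\<lambda> = r\<close>, \<open>\<mu> = s\<close> is the product of \<open>p(r)\<close> and \<open>c\<close> at \<open>r + s\<close>.
\<close>

lemma lambda_mu_prod_up2_eval:
  assumes p: "p \<in> up M" and c: "c \<in> carrier M"
  shows "lambda_mu_prod M f p c \<in> up2 M \<and> (\<forall>r\<in>carrier R. \<forall>s\<in>carrier R.
    op_eval2 M r s (lambda_mu_prod M f p c) = prod_at M f (r \<oplus> s) (op_eval M (pt M r) p) c)"
  using p
proof (induction rule: up_induct[OF M_module, consumes 1, case_names zero cons])
  case zero
  have z: "f \<zero>\<^bsub>M\<^esub> c = (\<lambda>n. \<zero>\<^bsub>M\<^esub>)"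
    using module_maps_zero[OF M_module M_module f_left[OF c]] by auto
  have 1: "lambda_mu_prod M f (\<lambda>n. \<zero>\<^bsub>M\<^esub>) c = (\<lambda>m n. \<zero>\<^bsub>M\<^esub>)"
    by (auto simp: lambda_mu_prod_def subst_sum_def fun_eq_iff z)
  have "(\<lambda>m n. \<zero>\<^bsub>M\<^esub>) \<in> up2 M" by (auto simp: up2_def)
  thus ?case by (simp add: 1 op_eval2_def op_eval_zero[OF M_module] prod_at_def z)
next
  case (cons a q)
  hence F: "lambda_mu_prod M f q c \<in> up2 M" by simp
  have eq: "lambda_mu_prod M f (horner_cons a q) c = (\<lambda>m n. subst_sum M (f a c) m n
      \<oplus>\<^bsub>M\<^esub> horner_cons (\<lambda>n. \<zero>\<^bsub>M\<^esub>) (lambda_mu_prod M f q c) m n)"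
    by (auto simp: lambda_mu_prod_cons[OF cons(1,2) c] fun_eq_iff)
  have S: "subst_sum M (f a c) \<in> up2 M" and Se: "\<And>r s. \<lbrakk>r \<in> carrier R; s \<in> carrier R\<rbrakk> \<Longrightarrow>
      op_eval2 M r s (subst_sum M (f a c)) = prod_at M f (r \<oplus> s) a c"
    using subst_sum_up2_eval[OF M_module polynomial[OF cons(1) c]] by (auto simp: prod_at_def)
  note u = S up2_shift1[OF M_module F]
  show ?case
  proof (intro conjI ballI)
    show "lambda_mu_prod M f (horner_cons a q) c \<in> up2 M" unfolding eq by (rule up2_add[OF M_module u])
    fix r s assume r: "r \<in> carrier R" and s: "s \<in> carrier R"
    hence rs: "r \<oplus> s \<in> carrier R" by simp
    note L = prod_at_left[OF rs c]
    note q' = op_eval_closed[OF M_module pt_module_maps[OF M_module r] cons(2)]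
    show "op_eval2 M r s (lambda_mu_prod M f (horner_cons a q) c)
        = prod_at M f (r \<oplus> s) (op_eval M (pt M r) (horner_cons a q)) c"
      unfolding eq using r s cons(1,3) q'
      by (simp add: op_eval2_add[OF M_module r s u] Se op_eval2_shift1[OF M_module r s F]
          op_eval_cons[OF M_module pt_module_maps[OF M_module r] cons(1,2)] module_maps_add[OF L] module_maps_smult[OF L])
  qed
qed

end

section \<open>The opposite product\<close>

lemma lambda_bilinear_right_mult:
  assumes M: "Module.module R M" and D: "D \<in> module_maps R M M" and f: "lambda_bilinear R M f"
    and p: "\<And>a b. \<lbrakk>a \<in> carrier M; b \<in> carrier M\<rbrakk> \<Longrightarrow> f a b \<in> up M"
  shows "lambda_bilinear R M (right_mult M D f)"
  unfolding lambda_bilinear_def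
proof (intro conjI ballI allI)
  fix a n assume a: "a \<in> carrier M"
  note S = upD[OF subst_neg_up[OF M D p]]
  have l: "(\<lambda>x. f x a n) \<in> module_maps R M M" and r: "(\<lambda>x. f a x n) \<in> module_maps R M M" for n
    using f a by (auto simp: lambda_bilinear_def)
  show "(\<lambda>b. right_mult M D f a b n) \<in> module_maps R M M"
  proof (rule module_mapsI)
    fix x y assume xy: "x \<in> carrier M" "y \<in> carrier M"
    have "f (x \<oplus>\<^bsub>M\<^esub> y) a = (\<lambda>n. f x a n \<oplus>\<^bsub>M\<^esub> f y a n)" using module_maps_add[OF l xy] by auto
    thus "right_mult M D f a (x \<oplus>\<^bsub>M\<^esub> y) n = right_mult M D f a x n \<oplus>\<^bsub>M\<^esub> right_mult M D f a y n"
      using xy a by (simp add: right_mult_def subst_neg_add[OF M D] p)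
  next
    fix c x assume cx: "c \<in> carrier R" "x \<in> carrier M"
    have "f (c \<odot>\<^bsub>M\<^esub> x) a = (\<lambda>n. c \<odot>\<^bsub>M\<^esub> f x a n)" using module_maps_smult[OF l cx] by auto
    thus "right_mult M D f a (c \<odot>\<^bsub>M\<^esub> x) n = c \<odot>\<^bsub>M\<^esub> right_mult M D f a x n"
      using cx a by (simp add: right_mult_def subst_neg_smult[OF M D] p)
  qed (simp add: right_mult_def S a)
  show "(\<lambda>b. right_mult M D f b a n) \<in> module_maps R M M"
  proof (rule module_mapsI)
    fix x y assume xy: "x \<in> carrier M" "y \<in> carrier M"
    have "f a (x \<oplus>\<^bsub>M\<^esub> y) = (\<lambda>n. f a x n \<oplus>\<^bsub>M\<^esub> f a y n)" using module_maps_add[OF r xy] by auto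
    thus "right_mult M D f (x \<oplus>\<^bsub>M\<^esub> y) a n = right_mult M D f x a n \<oplus>\<^bsub>M\<^esub> right_mult M D f y a n"
      using xy a by (simp add: right_mult_def subst_neg_add[OF M D] p)
  next
    fix c x assume cx: "c \<in> carrier R" "x \<in> carrier M"
    have "f a (c \<odot>\<^bsub>M\<^esub> x) = (\<lambda>n. c \<odot>\<^bsub>M\<^esub> f a x n)" using module_maps_smult[OF r cx] by auto
    thus "right_mult M D f (c \<odot>\<^bsub>M\<^esub> x) a n = c \<odot>\<^bsub>M\<^esub> right_mult M D f x a n"
      using cx a by (simp add: right_mult_def subst_neg_smult[OF M D] p)
  qed (simp add: right_mult_def S a)
qed

lemma lambda_bilinear_diff:
  assumes M: "Module.module R M" and f: "lambda_bilinear R M f" and g: "lambda_bilinear R M g"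
  shows "lambda_bilinear R M (\<lambda>a b n. f a b n \<ominus>\<^bsub>M\<^esub> g a b n)"
  using f g module_maps_diff[OF M M] by (simp add: lambda_bilinear_def)

text \<open>
  The substitution of \<open>-\<lambda>-\<partial>\<close> exchanges the two sesquilinearity conditions: multiplication of
  \<open>b\<^sub>\<lambda> a\<close> by \<open>\<lambda>\<close> turns into \<open>-\<lambda>-\<partial>\<close>.
\<close>

lemma lambda_product_right_mult:
  assumes "lambda_product R M D f"
  shows "lambda_product R M D (right_mult M D f)"
proof -
  interpret lambda_product R M D f by fact
  note M = M_module and S = subst_neg_up[OF M_module D_linear]
  note Sc = upD[OF S[OF polynomial]]
  show ?thesis
  proof unfold_locales
    show "lambda_bilinear R M (right_mult M D f)"
      by (rule lambda_bilinear_right_mult[OF M D_linear bilinear polynomial])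
  next
    fix a b assume a: "a \<in> carrier M" and b: "b \<in> carrier M"
    note p = polynomial[OF b a]
    note Sp = Sc[OF b a]
    show "right_mult M D f a b \<in> up M" using a b by (simp add: right_mult_def S polynomial)
    fix n
    have "f b (D a) = (\<lambda>n. D (f b a n) \<oplus>\<^bsub>M\<^esub> times_lambda M (f b a) n)" using sesqui_right[OF b a] by auto
    hence "right_mult M D f (D a) b n = D (subst_neg M D (f b a) n) \<oplus>\<^bsub>M\<^esub> neg_lambda_D M D (subst_neg M D (f b a)) n"
      by (simp add: right_mult_def subst_neg_add[OF M D_linear up_map[OF M M module_maps_additive[OF D_linear] p]
            up_times_lambda[OF M p]] subst_neg_D[OF M D_linear p] subst_neg_times_lambda[OF M D_linear p])
    also have "\<dots> = \<ominus>\<^bsub>M\<^esub> times_lambda M (subst_neg M D (f b a)) n"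
      using Sp module_maps_closed[OF D_linear] upD[OF up_times_lambda[OF M S[OF p]]]
      by (simp add: neg_lambda_D_def M.minus_eq M.a_ac M.r_neg1 M.r_neg2 M.r_neg M.l_neg)
    finally show "right_mult M D f (D a) b n = \<ominus>\<^bsub>M\<^esub> times_lambda M (right_mult M D f a b) n"
      by (simp add: right_mult_def)
    have "f (D b) a = (\<lambda>n. \<ominus>\<^bsub>M\<^esub> times_lambda M (f b a) n)" using sesqui_left[OF b a] by auto
    hence "right_mult M D f a (D b) n = \<ominus>\<^bsub>M\<^esub> neg_lambda_D M D (subst_neg M D (f b a)) n"
      by (simp add: right_mult_def subst_neg_uminus[OF M D_linear up_times_lambda[OF M p]]
          subst_neg_times_lambda[OF M D_linear p])
    also have "\<dots> = D (subst_neg M D (f b a) n) \<oplus>\<^bsub>M\<^esub> times_lambda M (subst_neg M D (f b a)) n"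
      using Sp module_maps_closed[OF D_linear] upD[OF up_times_lambda[OF M S[OF p]]]
      by (simp add: neg_lambda_D_def M.minus_eq M.minus_add M.a_comm)
    finally show "right_mult M D f a (D b) n = D (right_mult M D f a b n) \<oplus>\<^bsub>M\<^esub> times_lambda M (right_mult M D f a b) n"
      by (simp add: right_mult_def)
  qed
qed

lemma lambda_product_diff:
  assumes f: "lambda_product R M D f" and g: "lambda_product R M D g"
  shows "lambda_product R M D (\<lambda>a b n. f a b n \<ominus>\<^bsub>M\<^esub> g a b n)"
proof -
  interpret f: lambda_product R M D f by fact
  interpret g: lambda_product R M D g by fact
  note M = f.M_module
  note c = f.f_closed g.f_closed
  have t: "times_lambda M (\<lambda>n. p n \<ominus>\<^bsub>M\<^esub> q n) n = times_lambda M p n \<ominus>\<^bsub>M\<^esub> times_lambda M q n" for p q n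
    by (cases n) (auto simp: times_lambda_def f.M.minus_eq)
  show ?thesis
  proof unfold_locales
    show "lambda_bilinear R M (\<lambda>a b n. f a b n \<ominus>\<^bsub>M\<^esub> g a b n)"
      by (rule lambda_bilinear_diff[OF M f.bilinear g.bilinear])
  next
    fix a b assume a: "a \<in> carrier M" and b: "b \<in> carrier M"
    show "(\<lambda>n. f a b n \<ominus>\<^bsub>M\<^esub> g a b n) \<in> up M"
      by (rule up_diff[OF M f.polynomial[OF a b] g.polynomial[OF a b]])
    fix n
    note tc = upD[OF up_times_lambda[OF M f.polynomial[OF a b]]] upD[OF up_times_lambda[OF M g.polynomial[OF a b]]]
      c[OF a b] module_maps_closed[OF f.D_linear]
    show "f (D a) b n \<ominus>\<^bsub>M\<^esub> g (D a) b n = \<ominus>\<^bsub>M\<^esub> times_lambda M (\<lambda>n. f a b n \<ominus>\<^bsub>M\<^esub> g a b n) n"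
      using tc by (simp add: t[unfolded f.M.minus_eq] f.sesqui_left[OF a b] g.sesqui_left[OF a b] f.M.minus_eq f.M.minus_add)
    show "f a (D b) n \<ominus>\<^bsub>M\<^esub> g a (D b) n =
        D (f a b n \<ominus>\<^bsub>M\<^esub> g a b n) \<oplus>\<^bsub>M\<^esub> times_lambda M (\<lambda>n. f a b n \<ominus>\<^bsub>M\<^esub> g a b n) n"
      using tc by (simp add: t[unfolded f.M.minus_eq] f.sesqui_right[OF a b] g.sesqui_right[OF a b] f.M.minus_eq f.M.minus_add
          module_maps_add[OF f.D_linear] module_maps_neg[OF M M f.D_linear] f.M.a_ac)
  qed
qed

section \<open>The commutator of an associative conformal algebra\<close>

definition commutator :: "('r, 'a) module \<Rightarrow> ('a \<Rightarrow> 'a) \<Rightarrow> ('a \<Rightarrow> 'a \<Rightarrow> nat \<Rightarrow> 'a) \<Rightarrow> 'a \<Rightarrow> 'a \<Rightarrow> nat \<Rightarrow> 'a" where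
  "commutator M D f a b n = f a b n \<ominus>\<^bsub>M\<^esub> right_mult M D f a b n"

lemma lambda_product_commutator:
  "lambda_product R M D f \<Longrightarrow> lambda_product R M D (commutator M D f)"
  using lambda_product_diff[OF _ lambda_product_right_mult] by (simp add: commutator_def[abs_def])

lemma commutator_skew:
  assumes f: "lambda_product R M D f" and Q: "rational_scalars R" and a: "a \<in> carrier M" and b: "b \<in> carrier M"
  shows "commutator M D f a b n = \<ominus>\<^bsub>M\<^esub> subst_neg M D (commutator M D f b a) n"
proof -
  interpret f: lambda_product R M D f by fact
  interpret g: lambda_product R M D "right_mult M D f" by (rule lambda_product_right_mult[OF f])
  have "subst_neg M D (commutator M D f b a) n
      = right_mult M D f a b n \<ominus>\<^bsub>M\<^esub> f a b n"
    using subst_neg_diff[OF f.M_module f.D_linear f.polynomial[OF b a] g.polynomial[OF b a], of n]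
      subst_neg_subst_neg[OF f.M_module f.D_linear Q f.polynomial[OF a b]]
    by (simp add: commutator_def[abs_def] right_mult_def)
  thus ?thesis using f.f_closed[OF a b] g.f_closed[OF a b]
    by (simp add: commutator_def f.M.minus_eq f.M.minus_add f.M.a_comm)
qed

text \<open>
  The operator \<open>-r-\<partial>\<close>, at which \<open>b\<^sub>\<lambda> a\<close> has to be evaluated to get the opposite product at \<open>r\<close>.
\<close>

definition neg_op :: "('r, 'a) module \<Rightarrow> ('a \<Rightarrow> 'a) \<Rightarrow> 'r \<Rightarrow> 'a \<Rightarrow> 'a" where
  "neg_op M D r x = \<ominus>\<^bsub>M\<^esub> (r \<odot>\<^bsub>M\<^esub> x) \<ominus>\<^bsub>M\<^esub> D x"

context lambda_product
begin

lemma neg_op_module_maps: "r \<in> carrier R \<Longrightarrow> neg_op M D r \<in> module_maps R M M"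
  unfolding neg_op_def[abs_def] by (rule commuting_neg[OF M_module D_linear pt_module_maps[OF M_module]])

lemma neg_op_shift:
  assumes "r \<in> carrier R" "s \<in> carrier R" "x \<in> carrier M"
  shows "neg_op M D s x = r \<odot>\<^bsub>M\<^esub> x \<oplus>\<^bsub>M\<^esub> neg_op M D (r \<oplus> s) x"
  using assms module_maps_closed[OF D_linear]
    M.group_identity[of "[r \<odot>\<^bsub>M\<^esub> x, s \<odot>\<^bsub>M\<^esub> x, D x]" "GM (GN (GV 1)) (GV 2)"
      "GA (GV 0) (GM (GN (GA (GV 0) (GV 1))) (GV 2))"]
  by (simp add: neg_op_def smult_l_distr eval_nat_numeral)

lemma prod_at_right_mult:
  assumes "r \<in> carrier R" "a \<in> carrier M" "b \<in> carrier M"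
  shows "prod_at M (right_mult M D f) r a b = op_eval M (neg_op M D r) (f b a)"
  unfolding prod_at_def right_mult_def neg_op_def[abs_def]
  by (rule op_eval_pt_subst_neg[OF M_module D_linear assms(1) polynomial[OF assms(3,2)]])

text \<open>
  In the left factor of a product at \<open>r + s\<close>, the derivation acts as \<open>-(r + s)\<close>, so that \<open>-r-\<partial>\<close>
  acts as the scalar \<open>s\<close>.
\<close>

lemma prod_at_neg_op_left:
  assumes r: "r \<in> carrier R" and s: "s \<in> carrier R" and c: "c \<in> carrier M" and p: "p \<in> up M"
  shows "prod_at M f (r \<oplus> s) (op_eval M (neg_op M D r) p) c = prod_at M f (r \<oplus> s) (op_eval M (pt M s) p) c"
proof -
  have rs: "r \<oplus> s \<in> carrier R" using r s by simp
  note G = prod_at_left[OF rs c]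
  have 1: "prod_at M f (r \<oplus> s) (neg_op M D r x) c = s \<odot>\<^bsub>M\<^esub> prod_at M f (r \<oplus> s) x c" if x: "x \<in> carrier M" for x
    using r s x module_maps_closed[OF D_linear x] prod_at_closed[OF rs x c]
      M.group_identity[of "[r \<odot>\<^bsub>M\<^esub> prod_at M f (r \<oplus> s) x c, s \<odot>\<^bsub>M\<^esub> prod_at M f (r \<oplus> s) x c]"
        "GM (GN (GV 0)) (GN (GA (GV 0) (GV 1)))" "GV 1"]
    by (simp add: neg_op_def module_maps_minus[OF M_module M_module G] module_maps_neg[OF M_module M_module G]
        module_maps_smult[OF G] prod_at_D_left[OF rs x c] smult_l_distr)
  show ?thesis
    using op_eval_map[OF M_module M_module module_maps_additive[OF G] neg_op_module_maps[OF r]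
        pt_module_maps[OF M_module s] 1 p]
      op_eval_map[OF M_module M_module module_maps_additive[OF G] pt_module_maps[OF M_module s]
        pt_module_maps[OF M_module s] module_maps_smult[OF G s] p] by simp
qed

end

context assoc_conformal_algebra
begin

text \<open>
  Write \<open>L\<^sub>r(a,b)\<close> for the product at \<open>r\<close>.  Associativity says
  \<open>L\<^sub>r\<^sub>+\<^sub>s(L\<^sub>r(a,b),c) = L\<^sub>r(a,L\<^sub>s(b,c))\<close>; the following lemmas are its analogues in which some of the
  products are replaced by the opposite product.
\<close>

lemma prod_at_assoc:
  assumes r: "r \<in> carrier R" and s: "s \<in> carrier R" and a: "a \<in> carrier M" and b: "b \<in> carrier M" and c: "c \<in> carrier M"
  shows "prod_at M f (r \<oplus> s) (prod_at M f r a b) c = prod_at M f r a (prod_at M f s b c)"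
proof -
  have "lambda_mu_prod M f (f a b) c = (\<lambda>m n. f a (f b c n) m)"
    using assoc[OF a b c] by (auto simp: fun_eq_iff)
  thus ?thesis
    using lambda_mu_prod_up2_eval[OF polynomial[OF a b] c] r s
      op_eval2_left_outer[OF r s a polynomial[OF b c]]
    by (simp add: prod_at_def)
qed

abbreviation (input) g where "g \<equiv> right_mult M D f"

lemma opp_lambda_product: "lambda_product R M D g"
  by (rule lambda_product_right_mult[OF lambda_product_axioms])

lemma prod_at_opp_left:
  assumes r: "r \<in> carrier R" and s: "s \<in> carrier R" and a: "a \<in> carrier M" and b: "b \<in> carrier M" and c: "c \<in> carrier M"
  shows "prod_at M f (r \<oplus> s) (prod_at M g r a b) c = prod_at M f (r \<oplus> s) (prod_at M f s b a) c"
    and "prod_at M g (r \<oplus> s) (prod_at M g r a b) c = prod_at M g (r \<oplus> s) (prod_at M f s b a) c"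
  using prod_at_neg_op_left[OF r s c polynomial[OF b a]]
    lambda_product.prod_at_neg_op_left[OF opp_lambda_product r s c polynomial[OF b a]]
  by (simp_all add: prod_at_right_mult[OF r a b] prod_at_def[of _ f s b a])

text \<open>
  Left and right multiplications commute.  The right multiplication is an evaluation at the operator
  \<open>-r-\<partial>\<close>, where associativity cannot be applied directly.  But associativity gives, for all scalars
  \<open>u\<close>, the value at \<open>s + u\<close> of \<open>(b\<^sub>s c)\<^sub>\<lambda> a\<close>, and by \<open>op_eval_shift\<close> it may then be used for an
  operator in place of \<open>u\<close>.
\<close>

lemma prod_at_opp_commute:
  assumes Q: "rational_scalars R"
    and r: "r \<in> carrier R" and s: "s \<in> carrier R" and a: "a \<in> carrier M" and b: "b \<in> carrier M" and c: "c \<in> carrier M"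
  shows "prod_at M f s b (prod_at M g r a c) = prod_at M g r a (prod_at M f s b c)"
proof -
  note G = prod_at_right[OF s b]
  have sr: "s \<oplus> r \<in> carrier R" using r s by simp
  have G_neg: "prod_at M f s b (neg_op M D r x) = neg_op M D (s \<oplus> r) (prod_at M f s b x)" if x: "x \<in> carrier M" for x
    using r s x module_maps_closed[OF D_linear x] prod_at_closed[OF s b x]
      module_maps_closed[OF D_linear prod_at_closed[OF s b x]]
      M.group_identity[of "[r \<odot>\<^bsub>M\<^esub> prod_at M f s b x, s \<odot>\<^bsub>M\<^esub> prod_at M f s b x, D (prod_at M f s b x)]"
        "GM (GN (GV 0)) (GA (GV 2) (GV 1))" "GM (GN (GA (GV 1) (GV 0))) (GV 2)"]
    by (simp add: neg_op_def module_maps_minus[OF M_module M_module G] module_maps_neg[OF M_module M_module G]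
        module_maps_smult[OF G] prod_at_D_right[OF s b x] smult_l_distr eval_nat_numeral)
  have w: "(\<lambda>n. prod_at M f s b (f c a n)) \<in> up M"
    by (rule up_map[OF M_module M_module module_maps_additive[OF G] polynomial[OF c a]])
  have "op_eval M (neg_op M D r) (f (prod_at M f s b c) a) = op_eval M (neg_op M D (s \<oplus> r)) (\<lambda>n. prod_at M f s b (f c a n))"
  proof (rule op_eval_shift[OF M_module Q s polynomial[OF prod_at_closed[OF s b c] a] w _ neg_op_module_maps[OF sr] neg_op_module_maps[OF r]])
    fix u assume u: "u \<in> carrier R"
    have "op_eval M (pt M (s \<oplus> u)) (f (prod_at M f s b c) a) = prod_at M f s b (prod_at M f u c a)"
      using prod_at_assoc[OF s u b c a] by (simp add: prod_at_def)
    also have "\<dots> = op_eval M (pt M u) (\<lambda>n. prod_at M f s b (f c a n))"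
      unfolding prod_at_def[of _ _ u]
      by (rule op_eval_map[OF M_module M_module module_maps_additive[OF G] pt_module_maps[OF M_module u]
        pt_module_maps[OF M_module u] module_maps_smult[OF G u] polynomial[OF c a], symmetric])
    finally show "op_eval M (pt M (s \<oplus> u)) (f (prod_at M f s b c) a) = op_eval M (pt M u) (\<lambda>n. prod_at M f s b (f c a n))" .
  qed (rule neg_op_shift[OF s r])
  also have "\<dots> = prod_at M f s b (op_eval M (neg_op M D r) (f c a))"
    by (rule op_eval_map[OF M_module M_module module_maps_additive[OF G] neg_op_module_maps[OF r]
        neg_op_module_maps[OF sr] G_neg polynomial[OF c a]])
  finally show ?thesis by (simp add: prod_at_right_mult r a c prod_at_closed s b)
qed

text \<open>
  The same argument with the roles of the factors changed; here the scalar identity combines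
  associativity with \<open>prod_at_opp_left\<close>.
\<close>

lemma prod_at_opp_assoc':
  assumes Q: "rational_scalars R"
    and r: "r \<in> carrier R" and s: "s \<in> carrier R" and a: "a \<in> carrier M" and b: "b \<in> carrier M" and c: "c \<in> carrier M"
  shows "prod_at M g (r \<oplus> s) (prod_at M f r a b) c = prod_at M g s b (prod_at M g r a c)"
proof -
  have rs: "r \<oplus> s \<in> carrier R" using r s by simp
  note ab = prod_at_closed[OF r a b]
  have ac: "prod_at M g r a c \<in> carrier M"
    by (rule lambda_product.prod_at_closed[OF opp_lambda_product r a c])
  have "op_eval M (neg_op M D s) (f (prod_at M g r a c) b) = op_eval M (neg_op M D (r \<oplus> s)) (f c (prod_at M f r a b))"
  proof (rule op_eval_shift[OF M_module Q r polynomial[OF ac b] polynomial[OF c ab] _ neg_op_module_maps[OF rs] neg_op_module_maps[OF s]])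
    fix u assume u: "u \<in> carrier R"
    have "op_eval M (pt M (r \<oplus> u)) (f (prod_at M g r a c) b) = prod_at M f (u \<oplus> r) (prod_at M f u c a) b"
      using prod_at_opp_left(1)[OF r u a c b] r u by (simp add: prod_at_def R.a_comm)
    also have "\<dots> = op_eval M (pt M u) (f c (prod_at M f r a b))"
      using prod_at_assoc[OF u r c a b] by (simp add: prod_at_def)
    finally show "op_eval M (pt M (r \<oplus> u)) (f (prod_at M g r a c) b) = op_eval M (pt M u) (f c (prod_at M f r a b))" .
  qed (rule neg_op_shift[OF r s])
  thus ?thesis by (simp add: prod_at_right_mult ac b c ab r s)
qed

lemma prod_at_opp_assoc:
  assumes Q: "rational_scalars R"
    and r: "r \<in> carrier R" and s: "s \<in> carrier R" and a: "a \<in> carrier M" and b: "b \<in> carrier M" and c: "c \<in> carrier M"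
  shows "prod_at M g (r \<oplus> s) (prod_at M g r a b) c = prod_at M g r a (prod_at M g s b c)"
  using prod_at_opp_left(2)[OF r s a b c] prod_at_opp_assoc'[OF Q s r b a c] r s by (simp add: R.a_comm)

lemma prod_at_commutator:
  assumes r: "r \<in> carrier R" and a: "a \<in> carrier M" and b: "b \<in> carrier M"
  shows "prod_at M (commutator M D f) r a b = prod_at M f r a b \<ominus>\<^bsub>M\<^esub> prod_at M g r a b"
  unfolding prod_at_def commutator_def[abs_def]
  by (rule op_eval_diff[OF M_module pt_module_maps[OF M_module r] polynomial[OF a b]
        lambda_product.polynomial[OF opp_lambda_product a b]])

text \<open>
  Both sides are polynomials in \<open>\<lambda>, \<mu>\<close>, so they may be compared at scalars \<open>r, s\<close>.  There the
  commutator is \<open>f - g\<close>, with the product \<open>f\<close> and the opposite product \<open>g\<close>, and the associativity rules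
  reduce all terms to iterated products applied to \<open>c\<close>, as in the classical proof that the
  commutator of an associative algebra is a Lie bracket and acts by derivations.
\<close>

lemma commutator_identities:
  assumes Q: "rational_scalars R" and a: "a \<in> carrier M" and b: "b \<in> carrier M" and c: "c \<in> carrier M"
  shows commutator_leibniz: "commutator M D f a (f b c n) m =
      lambda_mu_prod M f (commutator M D f a b) c m n \<oplus>\<^bsub>M\<^esub> f b (commutator M D f a c m) n"
    and commutator_jacobi: "commutator M D f a (commutator M D f b c n) m =
      lambda_mu_prod M (commutator M D f) (commutator M D f a b) c m n
        \<oplus>\<^bsub>M\<^esub> commutator M D f b (commutator M D f a c m) n"
proof -
  let ?B = "commutator M D f"
  interpret B: lambda_product R M D ?B by (rule lambda_product_commutator[OF lambda_product_axioms])
  interpret g: lambda_product R M D g by (rule opp_lambda_product)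
  note Bp = B.polynomial
  note u1 = lambda_mu_prod_up2_eval[OF Bp[OF a b] c, THEN conjunct1] up2_left_inner[OF b Bp[OF a c]]
  note u2 = B.lambda_mu_prod_up2_eval[OF Bp[OF a b] c, THEN conjunct1] B.up2_left_inner[OF b Bp[OF a c]]
  show "?B a (f b c n) m = lambda_mu_prod M f (?B a b) c m n \<oplus>\<^bsub>M\<^esub> f b (?B a c m) n"
  proof (rule polynomial2_eqI[OF M_module Q B.up2_left_outer[OF a polynomial[OF b c]] up2_add[OF M_module u1]])
    fix r s assume r: "r \<in> carrier R" and s: "s \<in> carrier R"
    hence rs: "r \<oplus> s \<in> carrier R" by simp
    let ?f = "prod_at M f" and ?g = "prod_at M g"
    have L: "op_eval2 M r s (\<lambda>m n. ?B a (f b c n) m) = ?f r a (?f s b c) \<ominus>\<^bsub>M\<^esub> ?g r a (?f s b c)"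
      using B.op_eval2_left_outer[OF r s a polynomial[OF b c]] prod_at_commutator[OF r a prod_at_closed[OF s b c]]
      by (simp add: prod_at_def[of _ f s])
    have R1: "op_eval2 M r s (lambda_mu_prod M f (?B a b) c) = ?f (r \<oplus> s) (?f r a b) c \<ominus>\<^bsub>M\<^esub> ?f (r \<oplus> s) (?g r a b) c"
      using lambda_mu_prod_up2_eval[OF Bp[OF a b] c] r s prod_at_commutator[OF r a b]
        module_maps_minus[OF M_module M_module prod_at_left[OF rs c] prod_at_closed[OF r a b] g.prod_at_closed[OF r a b]]
      by (simp add: prod_at_def[of _ ?B])
    have R2: "op_eval2 M r s (\<lambda>m n. f b (?B a c m) n) = ?f s b (?f r a c) \<ominus>\<^bsub>M\<^esub> ?f s b (?g r a c)"
      using op_eval2_left_inner[OF r s b Bp[OF a c]] prod_at_commutator[OF r a c]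
        module_maps_minus[OF M_module M_module prod_at_right[OF s b] prod_at_closed[OF r a c] g.prod_at_closed[OF r a c]]
      by (simp add: prod_at_def[of _ ?B])
    have 3: "?f (r \<oplus> s) (?g r a b) c = ?f s b (?f r a c)"
      using prod_at_opp_left(1)[OF r s a b c] prod_at_assoc[OF s r b a c] r s by (simp add: R.a_comm)
    show "op_eval2 M r s (\<lambda>m n. ?B a (f b c n) m) =
        op_eval2 M r s (\<lambda>m n. lambda_mu_prod M f (?B a b) c m n \<oplus>\<^bsub>M\<^esub> f b (?B a c m) n)"
      unfolding op_eval2_add[OF M_module r s u1] L R1 R2 3 prod_at_assoc[OF r s a b c] prod_at_opp_commute[OF Q r s a b c]
      using M.group_identity[of "[?f r a (?f s b c), ?f s b (?f r a c), ?g r a (?f s b c)]"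
          "GM (GV 0) (GV 2)" "GA (GM (GV 0) (GV 1)) (GM (GV 1) (GV 2))"]
      by (simp add: prod_at_closed g.prod_at_closed a b c r s numeral_2_eq_2)
  qed
  show "?B a (?B b c n) m = lambda_mu_prod M ?B (?B a b) c m n \<oplus>\<^bsub>M\<^esub> ?B b (?B a c m) n"
  proof (rule polynomial2_eqI[OF M_module Q B.up2_left_outer[OF a Bp[OF b c]] up2_add[OF M_module u2]])
    fix r s assume r: "r \<in> carrier R" and s: "s \<in> carrier R"
    hence rs: "r \<oplus> s \<in> carrier R" by simp
    let ?f = "prod_at M f" and ?g = "prod_at M g"
    note cl = prod_at_closed g.prod_at_closed a b c r s rs
    note fm = module_maps_minus[OF M_module M_module prod_at_right] module_maps_minus[OF M_module M_module g.prod_at_right]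
    note lm = module_maps_minus[OF M_module M_module prod_at_left[OF rs c]] module_maps_minus[OF M_module M_module g.prod_at_left[OF rs c]]
    have L: "op_eval2 M r s (\<lambda>m n. ?B a (?B b c n) m) =
        (?f r a (?f s b c) \<ominus>\<^bsub>M\<^esub> ?f r a (?g s b c)) \<ominus>\<^bsub>M\<^esub> (?g r a (?f s b c) \<ominus>\<^bsub>M\<^esub> ?g r a (?g s b c))"
      unfolding B.op_eval2_left_outer[OF r s a Bp[OF b c]] prod_at_def[of M ?B s b c, symmetric]
      by (simp add: prod_at_commutator fm cl)
    have R1: "op_eval2 M r s (lambda_mu_prod M ?B (?B a b) c) =
        (?f (r \<oplus> s) (?f r a b) c \<ominus>\<^bsub>M\<^esub> ?f (r \<oplus> s) (?g r a b) c) \<ominus>\<^bsub>M\<^esub>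
        (?g (r \<oplus> s) (?f r a b) c \<ominus>\<^bsub>M\<^esub> ?g (r \<oplus> s) (?g r a b) c)"
    proof -
      have "op_eval2 M r s (lambda_mu_prod M ?B (?B a b) c) = prod_at M ?B (r \<oplus> s) (prod_at M ?B r a b) c"
        using B.lambda_mu_prod_up2_eval[OF Bp[OF a b] c] r s by (simp add: prod_at_def[of M ?B r a b])
      thus ?thesis by (simp add: prod_at_commutator lm cl)
    qed
    have R2: "op_eval2 M r s (\<lambda>m n. ?B b (?B a c m) n) =
        (?f s b (?f r a c) \<ominus>\<^bsub>M\<^esub> ?f s b (?g r a c)) \<ominus>\<^bsub>M\<^esub> (?g s b (?f r a c) \<ominus>\<^bsub>M\<^esub> ?g s b (?g r a c))"
      unfolding B.op_eval2_left_inner[OF r s b Bp[OF a c]] prod_at_def[of M ?B r a c, symmetric]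
      by (simp add: prod_at_commutator fm cl)
    have 3: "?f (r \<oplus> s) (?g r a b) c = ?f s b (?f r a c)"
      using prod_at_opp_left(1)[OF r s a b c] prod_at_assoc[OF s r b a c] r s by (simp add: R.a_comm)
    show "op_eval2 M r s (\<lambda>m n. ?B a (?B b c n) m) =
        op_eval2 M r s (\<lambda>m n. lambda_mu_prod M ?B (?B a b) c m n \<oplus>\<^bsub>M\<^esub> ?B b (?B a c m) n)"
      unfolding op_eval2_add[OF M_module r s u2] L R1 R2 3 prod_at_assoc[OF r s a b c]
        prod_at_opp_assoc[OF Q r s a b c] prod_at_opp_assoc'[OF Q r s a b c]
        prod_at_opp_commute[OF Q r s a b c] prod_at_opp_commute[OF Q s r b a c]
      using M.group_identity[of "[?f r a (?f s b c), ?g s b (?f r a c), ?g r a (?f s b c), ?g r a (?g s b c),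
            ?f s b (?f r a c), ?g s b (?g r a c)]"
          "GM (GM (GV 0) (GV 1)) (GM (GV 2) (GV 3))"
          "GA (GM (GM (GV 0) (GV 4)) (GM (GV 5) (GV 3))) (GM (GM (GV 4) (GV 2)) (GM (GV 1) (GV 5)))"]
      by (simp add: cl eval_nat_numeral)
  qed
qed

end

section \<open>The cocommutator of an associative conformal coalgebra\<close>

definition cocommutator :: "('r, 's) ring_scheme \<Rightarrow> ('r, 'a) module \<Rightarrow> ('a \<Rightarrow> ('a \<times> 'a \<Rightarrow> 'r) set)
    \<Rightarrow> 'a \<Rightarrow> ('a \<times> 'a \<Rightarrow> 'r) set" where
  "cocommutator R M \<Delta> a = \<Delta> a \<ominus>\<^bsub>tensor R M M\<^esub> tensor_flip R M (\<Delta> a)"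

text \<open>
  The cyclic permutation \<open>x \<otimes> y \<otimes> z \<mapsto> z \<otimes> x \<otimes> y\<close>.
\<close>

definition tensor_cycle :: "('r, 's) ring_scheme \<Rightarrow> ('r, 'a) module
    \<Rightarrow> (('a \<times> 'a \<Rightarrow> 'r) set \<times> 'a \<Rightarrow> 'r) set \<Rightarrow> (('a \<times> 'a \<Rightarrow> 'r) set \<times> 'a \<Rightarrow> 'r) set" where
  "tensor_cycle R M t = tensor_assoc R M (tensor_lift R (tensor R M (tensor R M M))
     (\<lambda>x y. tensor_pure R M (tensor R M M) y x) t)"

text \<open>
  \<open>\<Delta> \<otimes> I\<close> and \<open>I \<otimes> \<Delta>\<close> as maps on tensors, whereas \<open>coprod_left\<close> and \<open>coprod_right\<close> are
  composites with a second coproduct.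
\<close>

definition coprod_on_left :: "('r, 's) ring_scheme \<Rightarrow> ('r, 'a) module \<Rightarrow> ('a \<Rightarrow> ('a \<times> 'a \<Rightarrow> 'r) set)
    \<Rightarrow> ('a \<times> 'a \<Rightarrow> 'r) set \<Rightarrow> (('a \<times> 'a \<Rightarrow> 'r) set \<times> 'a \<Rightarrow> 'r) set" where
  "coprod_on_left R M \<Delta> t = tensor_map R (tensor R M M) M \<Delta> id t"

definition coprod_on_right :: "('r, 's) ring_scheme \<Rightarrow> ('r, 'a) module \<Rightarrow> ('a \<Rightarrow> ('a \<times> 'a \<Rightarrow> 'r) set)
    \<Rightarrow> ('a \<times> 'a \<Rightarrow> 'r) set \<Rightarrow> (('a \<times> 'a \<Rightarrow> 'r) set \<times> 'a \<Rightarrow> 'r) set" where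
  "coprod_on_right R M \<Delta> t = tensor_assoc R M (tensor_map R M (tensor R M M) id \<Delta> t)"

definition flip_left :: "('r, 's) ring_scheme \<Rightarrow> ('r, 'a) module
    \<Rightarrow> (('a \<times> 'a \<Rightarrow> 'r) set \<times> 'a \<Rightarrow> 'r) set \<Rightarrow> (('a \<times> 'a \<Rightarrow> 'r) set \<times> 'a \<Rightarrow> 'r) set" where
  "flip_left R M t = tensor_map R (tensor R M M) M (tensor_flip R M) id t"

lemma coprod_on:
  "coprod_left R M \<Delta> \<Gamma> a = coprod_on_left R M \<Delta> (\<Gamma> a)"
  "coprod_right R M \<Delta> \<Gamma> a = coprod_on_right R M \<Delta> (\<Gamma> a)"
  "coprod_right_flip R M \<Delta> \<Gamma> a = flip_left R M (coprod_on_right R M \<Delta> (\<Gamma> a))"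
  by (simp_all add: coprod_left_def coprod_right_def coprod_right_flip_def coprod_on_left_def
      coprod_on_right_def flip_left_def)

context
  fixes R :: "('r, 's) ring_scheme" and M :: "('r, 'a) module"
  assumes M: "Module.module R M"
begin

abbreviation (input) TT where "TT \<equiv> tensor R M M"
abbreviation (input) T3 where "T3 \<equiv> tensor R TT M"

interpretation M: Module.module R M by (fact M)
lemma TT_module: "Module.module R TT" by (rule tensor_module[OF M M])
interpretation T: Module.module R TT by (rule TT_module)
lemma T3_module: "Module.module R T3" by (rule tensor_module[OF TT_module M])
interpretation T3: Module.module R T3 by (rule T3_module)
lemma MT_module: "Module.module R (tensor R M TT)" by (rule tensor_module[OF M TT_module])

lemma tensor_cycle_module_maps: "tensor_cycle R M \<in> module_maps R T3 T3"
  unfolding tensor_cycle_def[abs_def]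
  by (rule module_maps_comp[OF tensor_lift_module_maps[OF TT_module M MT_module
        bilinear_maps_swap[OF tensor_pure_bilinear[OF M TT_module]]] tensor_assoc_module_maps[OF M]])

lemma tensor_cycle_swap:
  "\<lbrakk>x \<in> carrier TT; y \<in> carrier M\<rbrakk>
    \<Longrightarrow> tensor_cycle R M (tensor_pure R TT M x y) = tensor_assoc R M (tensor_pure R M TT y x)"
  unfolding tensor_cycle_def
  by (simp add: tensor_lift_pure[OF TT_module M MT_module bilinear_maps_swap[OF tensor_pure_bilinear[OF M TT_module]]])

lemma tensor_cycle_pure:
  "\<lbrakk>x \<in> carrier M; y \<in> carrier M; z \<in> carrier M\<rbrakk>
    \<Longrightarrow> tensor_cycle R M (tensor_pure R TT M (tensor_pure R M M x y) z)
      = tensor_pure R TT M (tensor_pure R M M z x) y"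
  by (simp add: tensor_cycle_swap tensor_pure_closed[OF M M] tensor_assoc_pure[OF M])

lemma flip_left_module_maps: "flip_left R M \<in> module_maps R T3 T3"
  unfolding flip_left_def[abs_def]
  by (rule tensor_map_module_maps[OF TT_module M TT_module M tensor_flip_module_maps[OF M] module_maps_id(2)])

lemma flip_left_pure:
  "\<lbrakk>x \<in> carrier TT; y \<in> carrier M\<rbrakk>
    \<Longrightarrow> flip_left R M (tensor_pure R TT M x y) = tensor_pure R TT M (tensor_flip R M x) y"
  unfolding flip_left_def
  by (simp add: tensor_map_pure[OF TT_module M TT_module M tensor_flip_module_maps[OF M] module_maps_id(2)])

lemma flip_left_flip_left:
  assumes t: "t \<in> carrier T3"
  shows "flip_left R M (flip_left R M t) = t"
  by (rule tensor_ext[OF TT_module M T3_module module_maps_comp[OF flip_left_module_maps flip_left_module_maps]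
        module_maps_id(1) _ t])
    (simp add: flip_left_pure module_maps_closed[OF tensor_flip_module_maps[OF M]] tensor_flip_flip[OF M])

lemma assoc_flip:
  assumes x: "x \<in> carrier M" and y: "y \<in> carrier TT"
  shows "tensor_assoc R M (tensor_pure R M TT x (tensor_flip R M y))
    = flip_left R M (tensor_cycle R M (tensor_assoc R M (tensor_pure R M TT x y)))"
proof -
  note 1 = module_maps_comp[OF bilinear_maps_right[OF tensor_pure_bilinear[OF M TT_module] x] tensor_assoc_module_maps[OF M]]
  show ?thesis
    by (rule tensor_ext[OF M M T3_module module_maps_comp[OF tensor_flip_module_maps[OF M] 1]
        module_maps_comp[OF module_maps_comp[OF 1 tensor_cycle_module_maps] flip_left_module_maps] _ y])
      (simp add: x tensor_flip_pure[OF M] tensor_assoc_pure[OF M] tensor_cycle_pure flip_left_pure tensor_pure_closed[OF M M])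
qed

lemma cycle_cycle_assoc:
  assumes x: "x \<in> carrier M" and y: "y \<in> carrier TT"
  shows "tensor_cycle R M (tensor_cycle R M (tensor_assoc R M (tensor_pure R M TT x y))) = tensor_pure R TT M y x"
proof -
  note 1 = module_maps_comp[OF bilinear_maps_right[OF tensor_pure_bilinear[OF M TT_module] x] tensor_assoc_module_maps[OF M]]
  show ?thesis
    by (rule tensor_ext[OF M M T3_module module_maps_comp[OF module_maps_comp[OF 1 tensor_cycle_module_maps] tensor_cycle_module_maps]
        bilinear_maps_left[OF tensor_pure_bilinear[OF TT_module M] x] _ y])
      (simp add: x tensor_assoc_pure[OF M] tensor_cycle_pure tensor_pure_closed[OF M M])
qed

context
  fixes \<Delta> :: "'a \<Rightarrow> ('a \<times> 'a \<Rightarrow> 'r) set"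
  assumes \<Delta>: "\<Delta> \<in> module_maps R M TT"
begin

lemma coprod_on_left_module_maps: "coprod_on_left R M \<Delta> \<in> module_maps R TT T3"
  unfolding coprod_on_left_def[abs_def]
  by (rule tensor_map_module_maps[OF M M TT_module M \<Delta> module_maps_id(2)])

lemma coprod_on_right_module_maps: "coprod_on_right R M \<Delta> \<in> module_maps R TT T3"
  unfolding coprod_on_right_def[abs_def]
  by (rule module_maps_comp[OF tensor_map_module_maps[OF M M M TT_module module_maps_id(2) \<Delta>] tensor_assoc_module_maps[OF M]])

lemma coprod_on_left_pure:
  "\<lbrakk>x \<in> carrier M; y \<in> carrier M\<rbrakk> \<Longrightarrow> coprod_on_left R M \<Delta> (tensor_pure R M M x y) = tensor_pure R TT M (\<Delta> x) y"
  unfolding coprod_on_left_def by (simp add: tensor_map_pure[OF M M TT_module M \<Delta> module_maps_id(2)])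

lemma coprod_on_right_pure:
  "\<lbrakk>x \<in> carrier M; y \<in> carrier M\<rbrakk>
    \<Longrightarrow> coprod_on_right R M \<Delta> (tensor_pure R M M x y) = tensor_assoc R M (tensor_pure R M TT x (\<Delta> y))"
  unfolding coprod_on_right_def by (simp add: tensor_map_pure[OF M M M TT_module module_maps_id(2) \<Delta>])

lemma flip_coproduct: "(\<lambda>x. tensor_flip R M (\<Delta> x)) \<in> module_maps R M TT"
  by (rule module_maps_comp[OF \<Delta> tensor_flip_module_maps[OF M]])

lemma cocommutator_module_maps: "cocommutator R M \<Delta> \<in> module_maps R M TT"
  unfolding cocommutator_def[abs_def] by (rule module_maps_diff[OF TT_module M \<Delta> flip_coproduct])

end

context
  fixes \<Delta> :: "'a \<Rightarrow> ('a \<times> 'a \<Rightarrow> 'r) set"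
  assumes \<Delta>: "\<Delta> \<in> module_maps R M TT"
begin

lemma coprod_on_left_flip:
  assumes t: "t \<in> carrier TT"
  shows "coprod_on_left R M (\<lambda>x. tensor_flip R M (\<Delta> x)) t = flip_left R M (coprod_on_left R M \<Delta> t)"
  by (rule tensor_ext[OF M M T3_module coprod_on_left_module_maps[OF flip_coproduct[OF \<Delta>]]
        module_maps_comp[OF coprod_on_left_module_maps[OF \<Delta>] flip_left_module_maps] _ t])
    (simp add: coprod_on_left_pure[OF \<Delta>] coprod_on_left_pure[OF flip_coproduct[OF \<Delta>]] flip_left_pure
      module_maps_closed[OF \<Delta>])

lemma coprod_on_right_flip:
  assumes t: "t \<in> carrier TT"
  shows "coprod_on_right R M (\<lambda>x. tensor_flip R M (\<Delta> x)) t
    = flip_left R M (tensor_cycle R M (coprod_on_right R M \<Delta> t))"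
  by (rule tensor_ext[OF M M T3_module coprod_on_right_module_maps[OF flip_coproduct[OF \<Delta>]]
        module_maps_comp[OF module_maps_comp[OF coprod_on_right_module_maps[OF \<Delta>] tensor_cycle_module_maps]
          flip_left_module_maps] _ t])
    (simp add: coprod_on_right_pure[OF \<Delta>] coprod_on_right_pure[OF flip_coproduct[OF \<Delta>]] assoc_flip
      module_maps_closed[OF \<Delta>])

lemma coprod_on_right_of_flip:
  assumes t: "t \<in> carrier TT"
  shows "coprod_on_right R M \<Delta> (tensor_flip R M t) = tensor_cycle R M (coprod_on_left R M \<Delta> t)"
  by (rule tensor_ext[OF M M T3_module module_maps_comp[OF tensor_flip_module_maps[OF M] coprod_on_right_module_maps[OF \<Delta>]]
        module_maps_comp[OF coprod_on_left_module_maps[OF \<Delta>] tensor_cycle_module_maps] _ t])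
    (simp add: coprod_on_right_pure[OF \<Delta>] coprod_on_left_pure[OF \<Delta>] tensor_flip_pure[OF M] tensor_cycle_swap
      module_maps_closed[OF \<Delta>])

lemma coprod_on_left_of_flip:
  assumes t: "t \<in> carrier TT"
  shows "coprod_on_left R M \<Delta> (tensor_flip R M t)
    = tensor_cycle R M (tensor_cycle R M (coprod_on_right R M \<Delta> t))"
  by (rule tensor_ext[OF M M T3_module module_maps_comp[OF tensor_flip_module_maps[OF M] coprod_on_left_module_maps[OF \<Delta>]]
        module_maps_comp[OF module_maps_comp[OF coprod_on_right_module_maps[OF \<Delta>] tensor_cycle_module_maps]
          tensor_cycle_module_maps] _ t])
    (simp add: coprod_on_right_pure[OF \<Delta>] coprod_on_left_pure[OF \<Delta>] tensor_flip_pure[OF M] cycle_cycle_assoc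
      module_maps_closed[OF \<Delta>])

lemma coprod_on_left_cocommutator:
  assumes t: "t \<in> carrier TT"
  shows "coprod_on_left R M (cocommutator R M \<Delta>) t
    = coprod_on_left R M \<Delta> t \<ominus>\<^bsub>T3\<^esub> flip_left R M (coprod_on_left R M \<Delta> t)"
proof -
  have "coprod_on_left R M (cocommutator R M \<Delta>) t
      = coprod_on_left R M \<Delta> t \<ominus>\<^bsub>T3\<^esub> coprod_on_left R M (\<lambda>x. tensor_flip R M (\<Delta> x)) t"
    unfolding cocommutator_def[abs_def] coprod_on_left_def
    by (rule tensor_map_diff_left[OF M M TT_module M \<Delta> flip_coproduct[OF \<Delta>] module_maps_id(2) t])
  thus ?thesis by (simp only: coprod_on_left_flip[OF t])
qed

lemma coprod_on_right_cocommutator: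
  assumes t: "t \<in> carrier TT"
  shows "coprod_on_right R M (cocommutator R M \<Delta>) t
    = coprod_on_right R M \<Delta> t \<ominus>\<^bsub>T3\<^esub> flip_left R M (tensor_cycle R M (coprod_on_right R M \<Delta> t))"
proof -
  have "coprod_on_right R M (cocommutator R M \<Delta>) t
      = coprod_on_right R M \<Delta> t \<ominus>\<^bsub>T3\<^esub> coprod_on_right R M (\<lambda>x. tensor_flip R M (\<Delta> x)) t"
    unfolding cocommutator_def[abs_def] coprod_on_right_def
    by (simp add: tensor_map_diff_right[OF M M M TT_module module_maps_id(2) \<Delta> flip_coproduct[OF \<Delta>] t]
      module_maps_minus[OF MT_module T3_module tensor_assoc_module_maps[OF M]]
      module_maps_closed[OF tensor_map_module_maps[OF M M M TT_module module_maps_id(2) \<Delta>] t]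
      module_maps_closed[OF tensor_map_module_maps[OF M M M TT_module module_maps_id(2) flip_coproduct[OF \<Delta>]] t])
  thus ?thesis by (simp only: coprod_on_right_flip[OF t])
qed

text \<open>
  By coassociativity there is a single iterated coproduct \<open>X\<close> of \<open>a\<close>.  A flip after the first or the
  second coproduct only permutes the three factors, so that every term of the two identities is a
  permutation of \<open>X\<close>.  What remains are identities in the group ring of the symmetric group on three
  letters, generated by the exchange \<open>s\<close> of the first two factors and the cycle \<open>c\<close>.
\<close>

lemma cocommutator_identities:
  assumes coassoc: "coprod_right R M \<Delta> \<Delta> a = coprod_left R M \<Delta> \<Delta> a" and a: "a \<in> carrier M"
  defines "\<delta> \<equiv> cocommutator R M \<Delta>"
  shows cocommutator_cojacobi: "coprod_right R M \<delta> \<delta> a \<ominus>\<^bsub>T3\<^esub> coprod_right_flip R M \<delta> \<delta> a = coprod_left R M \<delta> \<delta> a"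
    and cocommutator_coleibniz: "coprod_right R M \<Delta> \<delta> a =
      coprod_left R M \<delta> \<Delta> a \<oplus>\<^bsub>T3\<^esub> coprod_right_flip R M \<delta> \<Delta> a"
proof -
  let ?x = "\<Delta> a" and ?s = "flip_left R M" and ?c = "tensor_cycle R M"
  have x: "?x \<in> carrier TT" and tx: "tensor_flip R M ?x \<in> carrier TT"
    using module_maps_closed[OF \<Delta> a] module_maps_closed[OF flip_coproduct[OF \<Delta>] a] by auto
  define X where "X = coprod_on_left R M \<Delta> ?x"
  have XR: "coprod_on_right R M \<Delta> ?x = X" using coassoc by (simp add: X_def coprod_on)
  note L = coprod_on_left_module_maps[OF \<Delta>] and Rr = coprod_on_right_module_maps[OF \<Delta>]
  have X: "X \<in> carrier T3" unfolding X_def by (rule module_maps_closed[OF L x])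
  note cl = X module_maps_closed[OF flip_left_module_maps] module_maps_closed[OF tensor_cycle_module_maps]
  note md = module_maps_minus[OF T3_module T3_module flip_left_module_maps]
    module_maps_minus[OF T3_module T3_module tensor_cycle_module_maps]
  have \<delta>: "\<delta> a = ?x \<ominus>\<^bsub>TT\<^esub> tensor_flip R M ?x" by (simp add: \<delta>_def cocommutator_def)
  have \<delta>c: "\<delta> a \<in> carrier TT" using x tx by (simp add: \<delta>)
  have L\<delta>: "coprod_on_left R M \<Delta> (\<delta> a) = X \<ominus>\<^bsub>T3\<^esub> ?c (?c X)"
    by (simp add: \<delta> module_maps_minus[OF TT_module T3_module L x tx] coprod_on_left_of_flip[OF x] XR X_def)
  have R\<delta>: "coprod_on_right R M \<Delta> (\<delta> a) = X \<ominus>\<^bsub>T3\<^esub> ?c X"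
    by (simp add: \<delta> module_maps_minus[OF TT_module T3_module Rr x tx] coprod_on_right_of_flip[OF x] XR X_def[symmetric])
  show "coprod_right R M \<delta> \<delta> a \<ominus>\<^bsub>T3\<^esub> coprod_right_flip R M \<delta> \<delta> a = coprod_left R M \<delta> \<delta> a"
    using T3.group_identity[of "[X, ?s X, ?c X, ?c (?c X), ?s (?c X), ?s (?c (?c X))]"
        "GM (GM (GM (GV 0) (GV 2)) (GM (GV 4) (GV 5))) (GM (GM (GV 1) (GV 4)) (GM (GV 2) (GV 3)))"
        "GM (GM (GV 0) (GV 3)) (GM (GV 1) (GV 5))"]
    by (simp add: coprod_on \<delta>_def[symmetric] coprod_on_right_cocommutator[OF \<delta>c, folded \<delta>_def]
        coprod_on_left_cocommutator[OF \<delta>c, folded \<delta>_def] L\<delta> R\<delta> md cl flip_left_flip_left eval_nat_numeral)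
  show "coprod_right R M \<Delta> \<delta> a = coprod_left R M \<delta> \<Delta> a \<oplus>\<^bsub>T3\<^esub> coprod_right_flip R M \<delta> \<Delta> a"
    using T3.group_identity[of "[X, ?s X, ?c X]" "GM (GV 0) (GV 2)" "GA (GM (GV 0) (GV 1)) (GM (GV 1) (GV 2))"]
    by (simp add: coprod_on coprod_on_right_cocommutator[OF x, folded \<delta>_def]
        coprod_on_left_cocommutator[OF x, folded \<delta>_def] R\<delta> XR X_def[symmetric] md cl flip_left_flip_left eval_nat_numeral)
qed

end

end

lemma coproduct_cocommutator:
  assumes "coproduct R M D \<Delta>"
  shows "coproduct R M D (cocommutator R M \<Delta>)"
proof -
  interpret coproduct R M D \<Delta> by fact
  note M = module_axioms
  note T = tensor_module[OF M M]
  show ?thesis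
  proof unfold_locales
    show "cocommutator R M \<Delta> \<in> module_maps R M (tensor R M M)"
      by (rule cocommutator_module_maps[OF M coprod_linear])
    fix a assume a: "a \<in> carrier M"
    show "cocommutator R M \<Delta> (D a) = tensor_D R M D (cocommutator R M \<Delta> a)"
      using module_maps_closed[OF coprod_linear a] module_maps_closed[OF flip_coproduct[OF M coprod_linear] a]
      by (simp add: cocommutator_def coprod_D[OF a] tensor_flip_tensor_D[OF M D_linear]
          module_maps_minus[OF T T tensor_D_module_maps[OF M D_linear]])
  qed
qed

lemma cocommutator_coskew:
  assumes "coproduct R M D \<Delta>" and a: "a \<in> carrier M"
  shows "cocommutator R M \<Delta> a = \<ominus>\<^bsub>tensor R M M\<^esub> tensor_flip R M (cocommutator R M \<Delta> a)"
proof -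
  interpret coproduct R M D \<Delta> by fact
  note M = module_axioms
  note T = tensor_module[OF M M]
  interpret T: Module.module R "tensor R M M" by (rule T)
  note c = module_maps_closed[OF coprod_linear a] module_maps_closed[OF flip_coproduct[OF M coprod_linear] a]
  show ?thesis
    using c T.group_identity[of "[\<Delta> a, tensor_flip R M (\<Delta> a)]" "GM (GV 0) (GV 1)" "GN (GM (GV 1) (GV 0))"]
    by (simp only: cocommutator_def module_maps_minus[OF T T tensor_flip_module_maps[OF M]]
        tensor_flip_flip[OF M]) simp
qed

section \<open>Antisymmetric infinitesimal bialgebras\<close>

text \<open>
  Families \<open>F\<^sub>\<lambda>\<close> of linear maps that depend polynomially on \<open>\<lambda>\<close>, such as the multiplication by an
  element and the adjoint action.  The degree may depend on the argument, so that polynomiality of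
  \<open>F\<^sub>\<lambda> \<otimes> I\<close> on a tensor needs an induction over the tensor.
\<close>

definition conformal_maps :: "('r, 's) ring_scheme \<Rightarrow> ('r, 'a) module \<Rightarrow> ('a \<Rightarrow> nat \<Rightarrow> 'a) set" where
  "conformal_maps R M = {F. (\<forall>n. (\<lambda>u. F u n) \<in> module_maps R M M) \<and> (\<forall>u \<in> carrier M. F u \<in> up M)}"

context
  fixes R :: "('r, 's) ring_scheme" and M :: "('r, 'a) module" and D
  assumes M: "Module.module R M" and D: "D \<in> module_maps R M M"
begin

interpretation M: Module.module R M by (fact M)
interpretation T: Module.module R "tensor R M M" by (rule tensor_module[OF M M])

lemma conformal_mapsD:
  assumes "F \<in> conformal_maps R M"
  shows "(\<lambda>u. F u n) \<in> module_maps R M M" "u \<in> carrier M \<Longrightarrow> F u \<in> up M"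
  using assms by (auto simp: conformal_maps_def)

context
  fixes F assumes F: "F \<in> conformal_maps R M"
begin

lemmas conformal_linear = conformal_mapsD(1)[OF F] and conformal_up = conformal_mapsD(2)[OF F]

lemma act_left_module_maps: "(\<lambda>x. act_left R M F x n) \<in> module_maps R (tensor R M M) (tensor R M M)"
  unfolding act_left_def by (rule tensor_map_module_maps[OF M M M M conformal_linear module_maps_id(2)])

lemma act_right_module_maps: "(\<lambda>x. act_right R M F x n) \<in> module_maps R (tensor R M M) (tensor R M M)"
  unfolding act_right_def by (rule tensor_map_module_maps[OF M M M M module_maps_id(2) conformal_linear])

lemma flip_act_left:
  "x \<in> carrier (tensor R M M) \<Longrightarrow> tensor_flip R M (act_left R M F x n) = act_right R M F (tensor_flip R M x) n"
  unfolding act_left_def act_right_def by (rule tensor_flip_tensor_map[OF M M conformal_linear module_maps_id(2)])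

lemma flip_act_right:
  "x \<in> carrier (tensor R M M) \<Longrightarrow> tensor_flip R M (act_right R M F x n) = act_left R M F (tensor_flip R M x) n"
  unfolding act_left_def act_right_def by (rule tensor_flip_tensor_map[OF M M module_maps_id(2) conformal_linear])

lemma act_left_up:
  assumes "x \<in> carrier (tensor R M M)"
  shows "act_left R M F x \<in> up (tensor R M M)"
  using assms
proof (induction rule: tensor_induct[OF M M, consumes 1, case_names zero pure add])
  case zero
  have "act_left R M F \<zero>\<^bsub>tensor R M M\<^esub> = (\<lambda>n. \<zero>\<^bsub>tensor R M M\<^esub>)"
    using module_maps_zero[OF tensor_module[OF M M] tensor_module[OF M M] act_left_module_maps] by auto
  thus ?case by (simp add: up_zero[OF tensor_module[OF M M]])
next
  case (pure x y)
  have "act_left R M F (tensor_pure R M M x y) = (\<lambda>n. tensor_pure R M M (F x n) y)"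
    using pure by (auto simp: act_left_def tensor_map_pure[OF M M M M conformal_linear module_maps_id(2)])
  thus ?case
    using up_map[OF M tensor_module[OF M M] module_maps_additive[OF bilinear_maps_left[OF tensor_pure_bilinear[OF M M] pure(2)]] conformal_up[OF pure(1)]]
    by simp
next
  case (add s t)
  have "act_left R M F (s \<oplus>\<^bsub>tensor R M M\<^esub> t) = (\<lambda>n. act_left R M F s n \<oplus>\<^bsub>tensor R M M\<^esub> act_left R M F t n)"
    using module_maps_add[OF act_left_module_maps add(1,2)] by auto
  thus ?case using up_add[OF tensor_module[OF M M] add(3,4)] by simp
qed

lemma act_right_up:
  assumes x: "x \<in> carrier (tensor R M M)"
  shows "act_right R M F x \<in> up (tensor R M M)"
proof -
  have tx: "tensor_flip R M x \<in> carrier (tensor R M M)" by (rule module_maps_closed[OF tensor_flip_module_maps[OF M] x])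
  have "act_right R M F x = (\<lambda>n. tensor_flip R M (act_left R M F (tensor_flip R M x) n))"
    by (simp add: flip_act_left[OF tx] tensor_flip_flip[OF M x])
  thus ?thesis
    using up_map[OF tensor_module[OF M M] tensor_module[OF M M] module_maps_additive[OF tensor_flip_module_maps[OF M]] act_left_up[OF tx]]
    by simp
qed

lemma act_left_neg_up: "x \<in> carrier (tensor R M M) \<Longrightarrow> act_left_neg R M D F x \<in> up (tensor R M M)"
  unfolding act_left_neg_def by (rule subst_neg_up[OF tensor_module[OF M M] tensor_D_module_maps[OF M D] act_left_up])

lemma act_right_neg_up: "x \<in> carrier (tensor R M M) \<Longrightarrow> act_right_neg R M D F x \<in> up (tensor R M M)"
  unfolding act_right_neg_def by (rule subst_neg_up[OF tensor_module[OF M M] tensor_D_module_maps[OF M D] act_right_up])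

lemma flip_act_left_neg:
  assumes x: "x \<in> carrier (tensor R M M)"
  shows "tensor_flip R M (act_left_neg R M D F x n) = act_right_neg R M D F (tensor_flip R M x) n"
proof -
  have "act_right R M F (tensor_flip R M x) = (\<lambda>n. tensor_flip R M (act_left R M F x n))"
    by (simp add: flip_act_left[OF x])
  thus ?thesis unfolding act_left_neg_def act_right_neg_def
    by (simp add: subst_neg_map[OF tensor_module[OF M M] tensor_D_module_maps[OF M D] tensor_module[OF M M]
      tensor_D_module_maps[OF M D] module_maps_additive[OF tensor_flip_module_maps[OF M]] tensor_flip_tensor_D[OF M D] act_left_up[OF x]])
qed

lemma flip_act_right_neg:
  assumes x: "x \<in> carrier (tensor R M M)"
  shows "tensor_flip R M (act_right_neg R M D F x n) = act_left_neg R M D F (tensor_flip R M x) n"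
proof -
  have "act_left R M F (tensor_flip R M x) = (\<lambda>n. tensor_flip R M (act_right R M F x n))"
    by (simp add: flip_act_right[OF x])
  thus ?thesis unfolding act_left_neg_def act_right_neg_def
    by (simp add: subst_neg_map[OF tensor_module[OF M M] tensor_D_module_maps[OF M D] tensor_module[OF M M]
      tensor_D_module_maps[OF M D] module_maps_additive[OF tensor_flip_module_maps[OF M]] tensor_flip_tensor_D[OF M D] act_right_up[OF x]])
qed

lemma act_minus:
  assumes x: "x \<in> carrier (tensor R M M)" and y: "y \<in> carrier (tensor R M M)"
  shows act_left_minus: "act_left R M F (x \<ominus>\<^bsub>tensor R M M\<^esub> y) n = act_left R M F x n \<ominus>\<^bsub>tensor R M M\<^esub> act_left R M F y n"
    and act_right_minus: "act_right R M F (x \<ominus>\<^bsub>tensor R M M\<^esub> y) n = act_right R M F x n \<ominus>\<^bsub>tensor R M M\<^esub> act_right R M F y n"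
    and act_left_neg_minus: "act_left_neg R M D F (x \<ominus>\<^bsub>tensor R M M\<^esub> y) n
      = act_left_neg R M D F x n \<ominus>\<^bsub>tensor R M M\<^esub> act_left_neg R M D F y n"
    and act_right_neg_minus: "act_right_neg R M D F (x \<ominus>\<^bsub>tensor R M M\<^esub> y) n
      = act_right_neg R M D F x n \<ominus>\<^bsub>tensor R M M\<^esub> act_right_neg R M D F y n"
proof -
  note T = tensor_module[OF M M]
  show l: "act_left R M F (x \<ominus>\<^bsub>tensor R M M\<^esub> y) n = act_left R M F x n \<ominus>\<^bsub>tensor R M M\<^esub> act_left R M F y n" for n
    by (rule module_maps_minus[OF T T act_left_module_maps x y])
  show r: "act_right R M F (x \<ominus>\<^bsub>tensor R M M\<^esub> y) n = act_right R M F x n \<ominus>\<^bsub>tensor R M M\<^esub> act_right R M F y n" for n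
    by (rule module_maps_minus[OF T T act_right_module_maps x y])
  have l': "act_left R M F (x \<ominus>\<^bsub>tensor R M M\<^esub> y) = (\<lambda>n. act_left R M F x n \<ominus>\<^bsub>tensor R M M\<^esub> act_left R M F y n)"
    and r': "act_right R M F (x \<ominus>\<^bsub>tensor R M M\<^esub> y) = (\<lambda>n. act_right R M F x n \<ominus>\<^bsub>tensor R M M\<^esub> act_right R M F y n)"
    using l r by auto
  show "act_left_neg R M D F (x \<ominus>\<^bsub>tensor R M M\<^esub> y) n
      = act_left_neg R M D F x n \<ominus>\<^bsub>tensor R M M\<^esub> act_left_neg R M D F y n"
    unfolding act_left_neg_def l' by (rule subst_neg_diff[OF T tensor_D_module_maps[OF M D] act_left_up[OF x] act_left_up[OF y]])
  show "act_right_neg R M D F (x \<ominus>\<^bsub>tensor R M M\<^esub> y) n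
      = act_right_neg R M D F x n \<ominus>\<^bsub>tensor R M M\<^esub> act_right_neg R M D F y n"
    unfolding act_right_neg_def r' by (rule subst_neg_diff[OF T tensor_D_module_maps[OF M D] act_right_up[OF x] act_right_up[OF y]])
qed

end

lemma act_diff:
  assumes F: "F \<in> conformal_maps R M" and G: "G \<in> conformal_maps R M" and x: "x \<in> carrier (tensor R M M)"
  shows act_left_diff: "act_left R M (\<lambda>u n. F u n \<ominus>\<^bsub>M\<^esub> G u n) x n = act_left R M F x n \<ominus>\<^bsub>tensor R M M\<^esub> act_left R M G x n"
    and act_right_diff: "act_right R M (\<lambda>u n. F u n \<ominus>\<^bsub>M\<^esub> G u n) x n = act_right R M F x n \<ominus>\<^bsub>tensor R M M\<^esub> act_right R M G x n"
    and act_left_neg_diff: "act_left_neg R M D (\<lambda>u n. F u n \<ominus>\<^bsub>M\<^esub> G u n) x n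
      = act_left_neg R M D F x n \<ominus>\<^bsub>tensor R M M\<^esub> act_left_neg R M D G x n"
    and act_right_neg_diff: "act_right_neg R M D (\<lambda>u n. F u n \<ominus>\<^bsub>M\<^esub> G u n) x n
      = act_right_neg R M D F x n \<ominus>\<^bsub>tensor R M M\<^esub> act_right_neg R M D G x n"
proof -
  note T = tensor_module[OF M M] and c = conformal_mapsD(1)
  show l: "act_left R M (\<lambda>u n. F u n \<ominus>\<^bsub>M\<^esub> G u n) x n = act_left R M F x n \<ominus>\<^bsub>tensor R M M\<^esub> act_left R M G x n" for n
    unfolding act_left_def by (rule tensor_map_diff_left[OF M M M M c[OF F] c[OF G] module_maps_id(2) x])
  show r: "act_right R M (\<lambda>u n. F u n \<ominus>\<^bsub>M\<^esub> G u n) x n = act_right R M F x n \<ominus>\<^bsub>tensor R M M\<^esub> act_right R M G x n" for n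
    unfolding act_right_def by (rule tensor_map_diff_right[OF M M M M module_maps_id(2) c[OF F] c[OF G] x])
  have l': "act_left R M (\<lambda>u n. F u n \<ominus>\<^bsub>M\<^esub> G u n) x = (\<lambda>n. act_left R M F x n \<ominus>\<^bsub>tensor R M M\<^esub> act_left R M G x n)"
    and r': "act_right R M (\<lambda>u n. F u n \<ominus>\<^bsub>M\<^esub> G u n) x = (\<lambda>n. act_right R M F x n \<ominus>\<^bsub>tensor R M M\<^esub> act_right R M G x n)"
    using l r by auto
  show "act_left_neg R M D (\<lambda>u n. F u n \<ominus>\<^bsub>M\<^esub> G u n) x n
      = act_left_neg R M D F x n \<ominus>\<^bsub>tensor R M M\<^esub> act_left_neg R M D G x n"
    unfolding act_left_neg_def l' by (rule subst_neg_diff[OF T tensor_D_module_maps[OF M D] act_left_up[OF F x] act_left_up[OF G x]])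
  show "act_right_neg R M D (\<lambda>u n. F u n \<ominus>\<^bsub>M\<^esub> G u n) x n
      = act_right_neg R M D F x n \<ominus>\<^bsub>tensor R M M\<^esub> act_right_neg R M D G x n"
    unfolding act_right_neg_def r' by (rule subst_neg_diff[OF T tensor_D_module_maps[OF M D] act_right_up[OF F x] act_right_up[OF G x]])
qed

end

lemma conformal_maps_lambda_product:
  assumes f: "lambda_product R M D f" and a: "a \<in> carrier M"
  shows "f a \<in> conformal_maps R M"
proof -
  interpret lambda_product R M D f by fact
  show ?thesis using f_right[OF a] polynomial[OF a] by (auto simp: conformal_maps_def)
qed

context ASI_conformal_bialgebra
begin

text \<open>
  Expand everything in the left and right multiplications by \<open>a\<close> on either factor of \<open>\<Delta> b\<close>, those by
  \<open>b\<close> on either factor of \<open>\<Delta> a\<close>, and the flips of these eight terms.  The formula for \<open>\<Delta> (a\<^sub>\<lambda> b)\<close>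
  and its image under \<open>-\<lambda>-\<partial>\<close>, which gives \<open>\<Delta>\<close> of the opposite product, express the left sides.  The
  antisymmetry condition and its flip relate the sixteen terms.  Without the last subtracted terms,
  which contain both the commutator and the cocommutator, the second and third identity have the form
  of the compatibility conditions of a Poisson bialgebra.
\<close>

lemma ASI_commutator_identities:
  assumes Q: "rational_scalars R" and a: "a \<in> carrier M" and b: "b \<in> carrier M"
  defines "Br \<equiv> commutator M D mul" and "\<delta> \<equiv> cocommutator R M \<Delta>"
  shows ASI_cobracket_bracket: "\<delta> (Br a b n) =
      (act_left R M (Br a) (\<delta> b) n \<oplus>\<^bsub>tensor R M M\<^esub> act_right R M (Br a) (\<delta> b) n)
      \<ominus>\<^bsub>tensor R M M\<^esub>
      (act_left_neg R M D (Br b) (\<delta> a) n \<oplus>\<^bsub>tensor R M M\<^esub> act_right_neg R M D (Br b) (\<delta> a) n)"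
    and ASI_cobracket_mult: "\<delta> (mul a b n) =
      (act_left R M (mul a) (\<delta> b) n
        \<oplus>\<^bsub>tensor R M M\<^esub> act_left_neg R M D (mul b) (\<delta> a) n
        \<oplus>\<^bsub>tensor R M M\<^esub> act_right R M (Br a) (\<Delta> b) n
        \<oplus>\<^bsub>tensor R M M\<^esub> act_right_neg R M D (Br b) (\<Delta> a) n)
      \<ominus>\<^bsub>tensor R M M\<^esub> (act_left_neg R M D (Br b) (\<delta> a) n \<oplus>\<^bsub>tensor R M M\<^esub> act_right_neg R M D (Br b) (\<delta> a) n)"
    and ASI_coproduct_bracket: "\<Delta> (Br a b n) =
      ((act_left R M (Br a) (\<Delta> b) n \<oplus>\<^bsub>tensor R M M\<^esub> act_right R M (Br a) (\<Delta> b) n)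
          \<ominus>\<^bsub>tensor R M M\<^esub> act_right_neg R M D (mul b) (\<delta> a) n)
        \<oplus>\<^bsub>tensor R M M\<^esub> act_left_neg R M D (mul b) (\<delta> a) n
        \<ominus>\<^bsub>tensor R M M\<^esub> act_left_neg R M D (Br b) (\<delta> a) n"
proof -
  let ?T = "tensor R M M" and ?DT = "tensor_D R M D" and ?g = "right_mult M D mul"
  let ?\<tau> = "tensor_flip R M"
  note M = M_module and D = D_linear
  note T = tensor_module[OF M M] and DT = tensor_D_module_maps[OF M D]
  interpret T: Module.module R ?T by (rule T)
  note F = tensor_flip_module_maps[OF M]
  note lg = opp_lambda_product
  interpret g: lambda_product R M D ?g by (rule lg)
  interpret B: lambda_product R M D Br unfolding Br_def by (rule lambda_product_commutator[OF lambda_product_axioms])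
  note cf = conformal_maps_lambda_product[OF lambda_product_axioms] conformal_maps_lambda_product[OF lg]
  note cl = module_maps_closed[OF coprod_linear]
  have x: "\<Delta> a \<in> carrier ?T" and y: "\<Delta> b \<in> carrier ?T" using cl a b by auto
  have tx: "?\<tau> (\<Delta> a) \<in> carrier ?T" and ty: "?\<tau> (\<Delta> b) \<in> carrier ?T"
    using module_maps_closed[OF F] x y by auto
  define A1 where "A1 = act_left R M (mul a) (\<Delta> b) n"
  define A2 where "A2 = act_right R M (mul a) (\<Delta> b) n"
  define A3 where "A3 = act_left R M (?g a) (\<Delta> b) n"
  define A4 where "A4 = act_right R M (?g a) (\<Delta> b) n"
  define B1 where "B1 = act_left_neg R M D (mul b) (\<Delta> a) n"
  define B2 where "B2 = act_right_neg R M D (mul b) (\<Delta> a) n"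
  define B3 where "B3 = act_left_neg R M D (?g b) (\<Delta> a) n"
  define B4 where "B4 = act_right_neg R M D (?g b) (\<Delta> a) n"
  note defs = A1_def A2_def A3_def A4_def B1_def B2_def B3_def B4_def
  have c: "A1 \<in> carrier ?T" "A2 \<in> carrier ?T" "A3 \<in> carrier ?T" "A4 \<in> carrier ?T"
    "B1 \<in> carrier ?T" "B2 \<in> carrier ?T" "B3 \<in> carrier ?T" "B4 \<in> carrier ?T"
    unfolding defs
    using upD[OF act_left_up[OF M D cf(1)[OF a] y]] upD[OF act_right_up[OF M D cf(1)[OF a] y]]
      upD[OF act_left_up[OF M D cf(2)[OF a] y]] upD[OF act_right_up[OF M D cf(2)[OF a] y]]
      upD[OF act_left_neg_up[OF M D cf(1)[OF b] x]] upD[OF act_right_neg_up[OF M D cf(1)[OF b] x]]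
      upD[OF act_left_neg_up[OF M D cf(2)[OF b] x]] upD[OF act_right_neg_up[OF M D cf(2)[OF b] x]] by auto
  note tc = module_maps_closed[OF F]
  note td = module_maps_minus[OF T T F] module_maps_add[OF F]
  have t: "act_right R M (mul a) (?\<tau> (\<Delta> b)) n = ?\<tau> A1" "act_left R M (mul a) (?\<tau> (\<Delta> b)) n = ?\<tau> A2"
    "act_right R M (?g a) (?\<tau> (\<Delta> b)) n = ?\<tau> A3" "act_left R M (?g a) (?\<tau> (\<Delta> b)) n = ?\<tau> A4"
    "act_right_neg R M D (mul b) (?\<tau> (\<Delta> a)) n = ?\<tau> B1" "act_left_neg R M D (mul b) (?\<tau> (\<Delta> a)) n = ?\<tau> B2"
    "act_right_neg R M D (?g b) (?\<tau> (\<Delta> a)) n = ?\<tau> B3" "act_left_neg R M D (?g b) (?\<tau> (\<Delta> a)) n = ?\<tau> B4"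
    unfolding defs using cf a b x y
    by (simp_all add: flip_act_left[OF M D] flip_act_right[OF M D] flip_act_left_neg[OF M D] flip_act_right_neg[OF M D])
  have anti: "(A1 \<ominus>\<^bsub>?T\<^esub> A4) \<oplus>\<^bsub>?T\<^esub> (?\<tau> B1 \<ominus>\<^bsub>?T\<^esub> ?\<tau> B4) = \<zero>\<^bsub>?T\<^esub>"
  proof -
    have "(B1 \<ominus>\<^bsub>?T\<^esub> B4) \<oplus>\<^bsub>?T\<^esub> ?\<tau> (A1 \<ominus>\<^bsub>?T\<^esub> A4) = \<zero>\<^bsub>?T\<^esub>"
      unfolding defs by (rule ASI_anti[OF a b])
    from arg_cong[OF this, of ?\<tau>] show ?thesis
      using c tc by (simp add: td tensor_flip_flip[OF M] module_maps_zero[OF T T F] T.a_comm)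
  qed
  have \<Delta>mul: "\<Delta> (mul a b n) = A2 \<oplus>\<^bsub>?T\<^esub> B3"
    unfolding defs by (rule ASI_mult[OF a b])
  have \<Delta>g: "\<Delta> (?g a b n) = B2 \<oplus>\<^bsub>?T\<^esub> A3"
  proof -
    have "(\<lambda>n. \<Delta> (mul b a n)) = (\<lambda>n. act_right R M (mul b) (\<Delta> a) n \<oplus>\<^bsub>?T\<^esub> act_left_neg R M D (?g a) (\<Delta> b) n)"
      using ASI_mult[OF b a] by auto
    hence "\<Delta> (?g a b n) = subst_neg ?T ?DT (\<lambda>n. act_right R M (mul b) (\<Delta> a) n \<oplus>\<^bsub>?T\<^esub> act_left_neg R M D (?g a) (\<Delta> b) n) n"
      using subst_neg_map[OF M D T DT module_maps_additive[OF coprod_linear] coprod_D polynomial[OF b a], of n]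
      by (simp add: right_mult_def)
    also have "\<dots> = B2 \<oplus>\<^bsub>?T\<^esub> A3"
      using subst_neg_add[OF T DT act_right_up[OF M D cf(1)[OF b] x] act_left_neg_up[OF M D cf(2)[OF a] y], of n]
        subst_neg_subst_neg[OF T DT Q act_left_up[OF M D cf(2)[OF a] y]]
      by (simp add: B2_def A3_def act_right_neg_def act_left_neg_def)
    finally show ?thesis .
  qed
  have \<Delta>Br: "\<Delta> (Br a b n) = (A2 \<oplus>\<^bsub>?T\<^esub> B3) \<ominus>\<^bsub>?T\<^esub> (B2 \<oplus>\<^bsub>?T\<^esub> A3)"
    unfolding Br_def commutator_def
    by (simp add: module_maps_minus[OF M T coprod_linear f_closed[OF a b] g.f_closed[OF a b]] \<Delta>mul \<Delta>g)
  have Bra: "Br a = (\<lambda>u n. mul a u n \<ominus>\<^bsub>M\<^esub> ?g a u n)" and Brb: "Br b = (\<lambda>u n. mul b u n \<ominus>\<^bsub>M\<^esub> ?g b u n)"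
    by (auto simp: Br_def commutator_def fun_eq_iff)
  have \<delta>: "\<delta> u = \<Delta> u \<ominus>\<^bsub>?T\<^esub> ?\<tau> (\<Delta> u)" for u by (simp add: \<delta>_def cocommutator_def)
  note am = act_minus[OF M D cf(1)[OF a] y ty] act_minus[OF M D cf(1)[OF b] x tx]
    act_minus[OF M D cf(2)[OF a] y ty] act_minus[OF M D cf(2)[OF b] x tx]
  have dc: "\<delta> a \<in> carrier ?T" "\<delta> b \<in> carrier ?T" using x y tx ty by (auto simp: \<delta>)
  note ad = act_diff[OF M D cf(1)[OF a] cf(2)[OF a] dc(2), folded Bra] act_diff[OF M D cf(1)[OF b] cf(2)[OF b] dc(1), folded Brb]
    act_diff[OF M D cf(1)[OF a] cf(2)[OF a] y, folded Bra] act_diff[OF M D cf(1)[OF b] cf(2)[OF b] x, folded Brb]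
  have atoms: "act_left R M (mul a) (\<delta> b) n = A1 \<ominus>\<^bsub>?T\<^esub> ?\<tau> A2"
    "act_left_neg R M D (mul b) (\<delta> a) n = B1 \<ominus>\<^bsub>?T\<^esub> ?\<tau> B2"
    "act_right_neg R M D (mul b) (\<delta> a) n = B2 \<ominus>\<^bsub>?T\<^esub> ?\<tau> B1"
    "act_left R M (Br a) (\<Delta> b) n = A1 \<ominus>\<^bsub>?T\<^esub> A3"
    "act_right R M (Br a) (\<Delta> b) n = A2 \<ominus>\<^bsub>?T\<^esub> A4"
    "act_right_neg R M D (Br b) (\<Delta> a) n = B2 \<ominus>\<^bsub>?T\<^esub> B4"
    "act_left R M (Br a) (\<delta> b) n = (A1 \<ominus>\<^bsub>?T\<^esub> ?\<tau> A2) \<ominus>\<^bsub>?T\<^esub> (A3 \<ominus>\<^bsub>?T\<^esub> ?\<tau> A4)"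
    "act_right R M (Br a) (\<delta> b) n = (A2 \<ominus>\<^bsub>?T\<^esub> ?\<tau> A1) \<ominus>\<^bsub>?T\<^esub> (A4 \<ominus>\<^bsub>?T\<^esub> ?\<tau> A3)"
    "act_left_neg R M D (Br b) (\<delta> a) n = (B1 \<ominus>\<^bsub>?T\<^esub> ?\<tau> B2) \<ominus>\<^bsub>?T\<^esub> (B3 \<ominus>\<^bsub>?T\<^esub> ?\<tau> B4)"
    "act_right_neg R M D (Br b) (\<delta> a) n = (B2 \<ominus>\<^bsub>?T\<^esub> ?\<tau> B1) \<ominus>\<^bsub>?T\<^esub> (B4 \<ominus>\<^bsub>?T\<^esub> ?\<tau> B3)"
    unfolding ad unfolding \<delta> am t defs[symmetric] by (rule refl)+
  let ?xs = "[A1, A2, A3, A4, B1, B2, B3, B4, ?\<tau> A1, ?\<tau> A2, ?\<tau> A3, ?\<tau> A4, ?\<tau> B1, ?\<tau> B2, ?\<tau> B3, ?\<tau> B4]"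
  have xs: "set ?xs \<subseteq> carrier ?T" using c tc by simp
  have antit: "(?\<tau> A1 \<ominus>\<^bsub>?T\<^esub> ?\<tau> A4) \<oplus>\<^bsub>?T\<^esub> (B1 \<ominus>\<^bsub>?T\<^esub> B4) = \<zero>\<^bsub>?T\<^esub>"
    using arg_cong[OF anti, of ?\<tau>] c tc
    by (simp add: td tensor_flip_flip[OF M] module_maps_zero[OF T T F])
  have \<delta>mul: "\<delta> (mul a b n) = (A2 \<oplus>\<^bsub>?T\<^esub> B3) \<ominus>\<^bsub>?T\<^esub> (?\<tau> A2 \<oplus>\<^bsub>?T\<^esub> ?\<tau> B3)"
    using c by (simp add: \<delta> \<Delta>mul td)
  have \<delta>Br: "\<delta> (Br a b n) = ((A2 \<oplus>\<^bsub>?T\<^esub> B3) \<ominus>\<^bsub>?T\<^esub> (B2 \<oplus>\<^bsub>?T\<^esub> A3)) \<ominus>\<^bsub>?T\<^esub> ((?\<tau> A2 \<oplus>\<^bsub>?T\<^esub> ?\<tau> B3) \<ominus>\<^bsub>?T\<^esub> (?\<tau> B2 \<oplus>\<^bsub>?T\<^esub> ?\<tau> A3))"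
    using c by (simp add: \<delta> \<Delta>Br td)
  have minus_zero: "z \<ominus>\<^bsub>?T\<^esub> \<zero>\<^bsub>?T\<^esub> = z" if "z \<in> carrier ?T" for z
    using that by (simp add: T.minus_eq)
  show "\<delta> (Br a b n) =
      (act_left R M (Br a) (\<delta> b) n \<oplus>\<^bsub>tensor R M M\<^esub> act_right R M (Br a) (\<delta> b) n)
      \<ominus>\<^bsub>tensor R M M\<^esub>
      (act_left_neg R M D (Br b) (\<delta> a) n \<oplus>\<^bsub>tensor R M M\<^esub> act_right_neg R M D (Br b) (\<delta> a) n)"
    \<comment> \<open>The coefficients agree only after the antisymmetry relation and its flip, which are both
      zero, are taken into account; they appear at the end of the reflected right side.\<close>
    unfolding atoms \<delta>Br
    using T.group_identity[OF xs, of "GM (GM (GA (GV 1) (GV 6)) (GA (GV 5) (GV 2))) (GM (GA (GV 9) (GV 14)) (GA (GV 13) (GV 10)))"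
        "GM (GM (GA (GM (GM (GV 0) (GV 9)) (GM (GV 2) (GV 11))) (GM (GM (GV 1) (GV 8)) (GM (GV 3) (GV 10)))) (GA (GM (GM (GV 4) (GV 13)) (GM (GV 6) (GV 15))) (GM (GM (GV 5) (GV 12)) (GM (GV 7) (GV 14))))) (GM (GA (GM (GV 0) (GV 3)) (GM (GV 12) (GV 15))) (GA (GM (GV 8) (GV 11)) (GM (GV 4) (GV 7))))"] c tc
    by (simp add: eval_nat_numeral anti antit minus_zero)
  show "\<delta> (mul a b n) =
      (act_left R M (mul a) (\<delta> b) n
        \<oplus>\<^bsub>tensor R M M\<^esub> act_left_neg R M D (mul b) (\<delta> a) n
        \<oplus>\<^bsub>tensor R M M\<^esub> act_right R M (Br a) (\<Delta> b) n
        \<oplus>\<^bsub>tensor R M M\<^esub> act_right_neg R M D (Br b) (\<Delta> a) n)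
      \<ominus>\<^bsub>tensor R M M\<^esub> (act_left_neg R M D (Br b) (\<delta> a) n \<oplus>\<^bsub>tensor R M M\<^esub> act_right_neg R M D (Br b) (\<delta> a) n)"
    unfolding atoms \<delta>mul
    using T.group_identity[OF xs, of "GM (GA (GV 1) (GV 6)) (GA (GV 9) (GV 14))"
        "GM (GM (GA (GA (GA (GM (GV 0) (GV 9)) (GM (GV 4) (GV 13))) (GM (GV 1) (GV 3))) (GM (GV 5) (GV 7))) (GA (GM (GM (GV 4) (GV 13)) (GM (GV 6) (GV 15))) (GM (GM (GV 5) (GV 12)) (GM (GV 7) (GV 14))))) (GA (GM (GV 0) (GV 3)) (GM (GV 12) (GV 15)))"] c tc
    by (simp add: eval_nat_numeral anti antit minus_zero)
  show "\<Delta> (Br a b n) =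
      ((act_left R M (Br a) (\<Delta> b) n \<oplus>\<^bsub>tensor R M M\<^esub> act_right R M (Br a) (\<Delta> b) n)
          \<ominus>\<^bsub>tensor R M M\<^esub> act_right_neg R M D (mul b) (\<delta> a) n)
        \<oplus>\<^bsub>tensor R M M\<^esub> act_left_neg R M D (mul b) (\<delta> a) n
        \<ominus>\<^bsub>tensor R M M\<^esub> act_left_neg R M D (Br b) (\<delta> a) n"
    unfolding atoms \<Delta>Br
    using T.group_identity[OF xs, of "GM (GA (GV 1) (GV 6)) (GA (GV 5) (GV 2))"
        "GM (GM (GA (GM (GA (GM (GV 0) (GV 2)) (GM (GV 1) (GV 3))) (GM (GV 5) (GV 12))) (GM (GV 4) (GV 13))) (GM (GM (GV 4) (GV 13)) (GM (GV 6) (GV 15)))) (GA (GM (GV 0) (GV 3)) (GM (GV 12) (GV 15)))"] c tc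
    by (simp add: eval_nat_numeral anti antit minus_zero)
qed

end

section \<open>Quotients modulo \<open>h^n\<close>\<close>

text \<open>
  The bilinear map induced on quotients modulo \<open>h^n\<close>.  It serves both for the products on the quotients
  and, in \<open>h_lift_tensor\<close>, for the multiplication of truncated power series.
\<close>

definition quot_bilinear :: "('r, 's) ring_scheme \<Rightarrow> 'r \<Rightarrow> ('r, 'c) module \<Rightarrow> nat \<Rightarrow> ('a \<Rightarrow> 'b \<Rightarrow> 'c)
    \<Rightarrow> 'a set \<Rightarrow> 'b set \<Rightarrow> 'c set" where
  "quot_bilinear R h L n B X Y = (\<Union>a\<in>X. \<Union>b\<in>Y. hadic_coset R h L n (B a b))"

lemma quot_prod_eq: "quot_prod R h M n mul A B k = quot_bilinear R h M n (\<lambda>a b. mul a b k) A B"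
  by (simp add: quot_prod_def quot_bilinear_def)

context
  fixes R :: "('r, 's) ring_scheme" and h :: 'r and M :: "('r, 'a) module" and n :: nat
  assumes M: "Module.module R M" and h: "h \<in> carrier R"
begin

interpretation M: Module.module R M by (fact M)

lemma h_pow_closed: "h [^]\<^bsub>R\<^esub> (i::nat) \<in> carrier R"
  by (rule M.R.nat_pow_closed[OF h])

lemma hadic_sub_submodule: "submodule (hadic_sub R h M n) R M"
  unfolding hadic_sub_def by (rule submodule_range[OF M M module_maps_smult_const[OF M h_pow_closed]])

lemma hadic_quot_module: "Module.module R (hadic_quot R h M n)"
  unfolding hadic_quot_def by (rule quot_module_module[OF M hadic_sub_submodule])

lemma hadic_coset_module_maps: "hadic_coset R h M n \<in> module_maps R M (hadic_quot R h M n)"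
  unfolding hadic_quot_def hadic_coset_def[abs_def] by (rule coset_module_maps[OF M hadic_sub_submodule])

lemma carrier_hadic_quot: "carrier (hadic_quot R h M n) = hadic_coset R h M n ` carrier M"
  unfolding hadic_quot_def hadic_coset_def[abs_def] by (rule carrier_quot_module[OF M hadic_sub_submodule])

lemma hadic_coset_eq_iff:
  "\<lbrakk>x \<in> carrier M; y \<in> carrier M\<rbrakk>
    \<Longrightarrow> hadic_coset R h M n x = hadic_coset R h M n y \<longleftrightarrow> x \<ominus>\<^bsub>M\<^esub> y \<in> hadic_sub R h M n"
  unfolding hadic_coset_def by (rule coset_eq_iff[OF M hadic_sub_submodule])

lemma UN_hadic_coset:
  assumes "x \<in> carrier M"
    and "\<And>x'. \<lbrakk>x' \<in> carrier M; hadic_coset R h M n x' = hadic_coset R h M n x\<rbrakk> \<Longrightarrow> F x' = F x"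
  shows "(\<Union>x'\<in>hadic_coset R h M n x. F x') = F x"
  using UN_coset_const[OF M hadic_sub_submodule assms(1)] assms(2) unfolding hadic_coset_def by blast

lemma hadic_coset_h_pow:
  assumes "x \<in> carrier M"
  shows "hadic_coset R h M n (h [^]\<^bsub>R\<^esub> n \<odot>\<^bsub>M\<^esub> x) = \<zero>\<^bsub>hadic_quot R h M n\<^esub>"
proof -
  have "hadic_coset R h M n (h [^]\<^bsub>R\<^esub> n \<odot>\<^bsub>M\<^esub> x) = hadic_coset R h M n \<zero>\<^bsub>M\<^esub>"
    using assms h_pow_closed by (subst hadic_coset_eq_iff) (auto simp: hadic_sub_def M.minus_eq)
  thus ?thesis by (simp add: module_maps_zero[OF M hadic_quot_module hadic_coset_module_maps])
qed

end

lemma hadic_coset_cong_linear: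
  assumes M: "Module.module R M" and N: "Module.module R N" and h: "h \<in> carrier R"
    and f: "f \<in> module_maps R M N" and x: "x \<in> carrier M" "y \<in> carrier M"
    and eq: "hadic_coset R h M n x = hadic_coset R h M n y"
  shows "hadic_coset R h N n (f x) = hadic_coset R h N n (f y)"
proof -
  interpret M: Module.module R M by fact
  obtain z where z: "z \<in> carrier M" "x \<ominus>\<^bsub>M\<^esub> y = h [^]\<^bsub>R\<^esub> n \<odot>\<^bsub>M\<^esub> z"
    using eq hadic_coset_eq_iff[OF M h x] by (auto simp: hadic_sub_def)
  have "f x \<ominus>\<^bsub>N\<^esub> f y = h [^]\<^bsub>R\<^esub> n \<odot>\<^bsub>N\<^esub> f z"
    using module_maps_minus[OF M N f x] module_maps_smult[OF f h_pow_closed[OF M h] z(1)] z(2) by metis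
  thus ?thesis
    using hadic_coset_eq_iff[OF N h module_maps_closed[OF f x(1)] module_maps_closed[OF f x(2)]]
      module_maps_closed[OF f z(1)] by (auto simp: hadic_sub_def)
qed

lemma quot_map_coset:
  assumes M: "Module.module R M" and N: "Module.module R N" and h: "h \<in> carrier R"
    and f: "f \<in> module_maps R M N" and x: "x \<in> carrier M"
  shows "quot_map R h N n f (hadic_coset R h M n x) = hadic_coset R h N n (f x)"
  unfolding quot_map_def
  by (rule UN_hadic_coset[OF M h x]) (rule hadic_coset_cong_linear[OF M N h f _ x])

lemma quot_bilinear_coset:
  assumes M: "Module.module R M" and N: "Module.module R N" and L: "Module.module R L"
    and h: "h \<in> carrier R" and B: "B \<in> bilinear_maps R M N L" and x: "x \<in> carrier M" and y: "y \<in> carrier N"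
  shows "quot_bilinear R h L n B (hadic_coset R h M n x) (hadic_coset R h N n y) = hadic_coset R h L n (B x y)"
proof -
  have 1: "(\<Union>b\<in>hadic_coset R h N n y. hadic_coset R h L n (B x' b)) = hadic_coset R h L n (B x' y)"
    if x': "x' \<in> carrier M" for x'
    by (rule UN_hadic_coset[OF N h y]) (rule hadic_coset_cong_linear[OF N L h bilinear_maps_right[OF B x'] _ y])
  have "quot_bilinear R h L n B (hadic_coset R h M n x) (hadic_coset R h N n y)
      = (\<Union>b\<in>hadic_coset R h N n y. hadic_coset R h L n (B x b))"
    unfolding quot_bilinear_def
  proof (rule UN_hadic_coset[OF M h x])
    fix x' assume x': "x' \<in> carrier M" "hadic_coset R h M n x' = hadic_coset R h M n x"
    show "(\<Union>b\<in>hadic_coset R h N n y. hadic_coset R h L n (B x' b))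
        = (\<Union>b\<in>hadic_coset R h N n y. hadic_coset R h L n (B x b))"
      unfolding 1[OF x'(1)] 1[OF x]
      by (rule hadic_coset_cong_linear[OF M L h bilinear_maps_left[OF B y] x'(1) x x'(2)])
  qed
  thus ?thesis using 1[OF x] by simp
qed

lemma quot_bilinear_maps:
  assumes M: "Module.module R M" and N: "Module.module R N" and L: "Module.module R L"
    and h: "h \<in> carrier R" and B: "B \<in> bilinear_maps R M N L"
  shows "quot_bilinear R h L n B \<in> bilinear_maps R (hadic_quot R h M n) (hadic_quot R h N n) (hadic_quot R h L n)"
proof -
  note qM = hadic_coset_module_maps[OF M h] and qN = hadic_coset_module_maps[OF N h]
    and qL = hadic_coset_module_maps[OF L h]
  interpret M: Module.module R M by fact
  interpret N: Module.module R N by fact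
  note [simp] = module_maps_add[OF qM, symmetric] module_maps_smult[OF qM, symmetric]
    module_maps_add[OF qN, symmetric] module_maps_smult[OF qN, symmetric]
    quot_bilinear_coset[OF M N L h B] bilinear_maps_closed[OF B]
    module_maps_add[OF qL] module_maps_smult[OF qL] module_maps_closed[OF qL]
  show ?thesis
  proof (intro bilinear_mapsI module_mapsI; unfold carrier_hadic_quot[OF M h] carrier_hadic_quot[OF N h]; elim imageE)
  qed (simp_all add: module_maps_add[OF bilinear_maps_right[OF B]] module_maps_add[OF bilinear_maps_left[OF B]]
      module_maps_smult[OF bilinear_maps_right[OF B]] module_maps_smult[OF bilinear_maps_left[OF B]])
qed

section \<open>Power series\<close>

text \<open>
  Both sides are the sum of \<open>F i j l\<close> over all \<open>i + j + l = n\<close>, grouped in two ways.  This is the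
  associativity of convolutions.
\<close>

lemma (in abelian_monoid) finsum_triple:
  assumes "\<And>i j l. F i j l \<in> carrier G"
  shows "(\<Oplus>i\<in>{..n::nat}. \<Oplus>j\<in>{..i}. F j (i - j) (n - i)) = (\<Oplus>j\<in>{..n}. \<Oplus>i\<in>{..n - j}. F j i (n - j - i))"
  using assms
proof (induction n arbitrary: F)
  case 0
  thus ?case by simp
next
  case (Suc n)
  note c = Suc.prems
  have "(\<Oplus>i\<in>{..Suc n}. \<Oplus>j\<in>{..i}. F j (i - j) (Suc n - i))
      = (\<Oplus>i\<in>{..n}. \<Oplus>j\<in>{..Suc i}. F j (Suc i - j) (n - i)) \<oplus> F 0 0 (Suc n)"
    by (subst finsum_Suc2) (auto simp: c intro!: finsum_closed)
  also have "(\<Oplus>i\<in>{..n}. \<Oplus>j\<in>{..Suc i}. F j (Suc i - j) (n - i))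
      = (\<Oplus>i\<in>{..n}. (\<Oplus>j\<in>{..i}. F (Suc j) (i - j) (n - i)) \<oplus> F 0 (Suc i) (n - i))"
    by (rule finsum_cong') (auto simp: c finsum_Suc2 simp del: finsum_Suc intro!: finsum_closed)
  also have "\<dots> = (\<Oplus>i\<in>{..n}. \<Oplus>j\<in>{..i}. F (Suc j) (i - j) (n - i)) \<oplus> (\<Oplus>i\<in>{..n}. F 0 (Suc i) (n - i))"
    by (rule finsum_addf) (auto simp: c intro!: finsum_closed)
  also have "(\<Oplus>i\<in>{..n}. \<Oplus>j\<in>{..i}. F (Suc j) (i - j) (n - i)) = (\<Oplus>j\<in>{..n}. \<Oplus>i\<in>{..n - j}. F (Suc j) i (n - j - i))"
    using Suc.IH[of "\<lambda>j. F (Suc j)"] c by simp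
  also have "(\<Oplus>j\<in>{..n}. \<Oplus>i\<in>{..n - j}. F (Suc j) i (n - j - i)) \<oplus> (\<Oplus>i\<in>{..n}. F 0 (Suc i) (n - i)) \<oplus> F 0 0 (Suc n)
      = (\<Oplus>j\<in>{..n}. \<Oplus>i\<in>{..n - j}. F (Suc j) i (n - j - i)) \<oplus> (\<Oplus>i\<in>{..Suc n}. F 0 i (Suc n - i))"
    by (subst finsum_Suc2[of _ n]) (auto simp: c a_assoc simp del: finsum_Suc intro!: finsum_closed)
  also have "\<dots> = (\<Oplus>j\<in>{..Suc n}. \<Oplus>i\<in>{..Suc n - j}. F j i (Suc n - j - i))"
    by (subst (2) finsum_Suc2) (auto simp: c simp del: finsum_Suc intro!: finsum_closed)
  finally show ?case .
qed

lemma (in abelian_monoid) finsum_reverse: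
  assumes f: "\<And>i. f i \<in> carrier G"
  shows "(\<Oplus>i\<in>{..n::nat}. f i) = (\<Oplus>i\<in>{..n}. f (n - i))"
proof -
  have "(\<lambda>i. n - i) ` {..n} = {..n}"
  proof -
    have "x \<in> (\<lambda>i. n - i) ` {..n}" if "x \<le> n" for x
      by (rule image_eqI[of _ _ "n - x"]) (use that in auto)
    thus ?thesis by auto
  qed
  moreover have "(\<Oplus>i\<in>(\<lambda>i. n - i) ` {..n}. f i) = (\<Oplus>i\<in>{..n}. f (n - i))"
    by (rule finsum_reindex) (auto simp: f inj_on_def)
  ultimately show ?thesis by simp
qed

lemma finsum_smult_right:
  assumes M: "Module.module R M" and x: "x \<in> carrier M" and f: "\<And>i. i \<in> A \<Longrightarrow> f i \<in> carrier R" and A: "finite A"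
  shows "(\<Oplus>\<^bsub>R\<^esub>i\<in>A. f i) \<odot>\<^bsub>M\<^esub> x = (\<Oplus>\<^bsub>M\<^esub>i\<in>A. f i \<odot>\<^bsub>M\<^esub> x)"
proof -
  interpret M: Module.module R M by fact
  show ?thesis using A f
  proof (induction A)
    case (insert a A)
    hence "f \<in> A \<rightarrow> carrier R" "f a \<in> carrier R" "(\<lambda>i. f i \<odot>\<^bsub>M\<^esub> x) \<in> A \<rightarrow> carrier M" using x by auto
    thus ?case using insert x
      by (simp add: M.R.finsum_insert M.finsum_insert M.smult_l_distr M.R.finsum_closed)
  qed (simp add: x)
qed

context
  fixes k :: "('k, 's) ring_scheme" and Q :: "('k, 'q) module"
  assumes Q: "Module.module k Q"
begin

interpretation Q: Module.module k Q by (fact Q)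

lemma power_series_module_simps:
  "v \<in> carrier (power_series_module Q) \<longleftrightarrow> (\<forall>n. v n \<in> carrier Q)"
  "\<zero>\<^bsub>power_series_module Q\<^esub> = (\<lambda>n. \<zero>\<^bsub>Q\<^esub>)"
  "v \<oplus>\<^bsub>power_series_module Q\<^esub> w = (\<lambda>n. v n \<oplus>\<^bsub>Q\<^esub> w n)"
  "c \<odot>\<^bsub>power_series_module Q\<^esub> v = (\<lambda>n. \<Oplus>\<^bsub>Q\<^esub>i \<in> {..n}. c i \<odot>\<^bsub>Q\<^esub> v (n - i))"
  by (auto simp: power_series_module_def)

lemma power_series_ring_simps:
  "c \<in> carrier (power_series_ring k) \<longleftrightarrow> (\<forall>n. c n \<in> carrier k)"
  "\<zero>\<^bsub>power_series_ring k\<^esub> = (\<lambda>n. \<zero>\<^bsub>k\<^esub>)"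
  "\<one>\<^bsub>power_series_ring k\<^esub> = const_coeff k \<one>\<^bsub>k\<^esub>"
  "c \<oplus>\<^bsub>power_series_ring k\<^esub> d = (\<lambda>n. c n \<oplus>\<^bsub>k\<^esub> d n)"
  "c \<otimes>\<^bsub>power_series_ring k\<^esub> d = (\<lambda>n. \<Oplus>\<^bsub>k\<^esub>i \<in> {..n}. c i \<otimes>\<^bsub>k\<^esub> d (n - i))"
  by (auto simp: power_series_ring_def)

lemma const_coeff_closed: "q \<in> carrier Q \<Longrightarrow> const_coeff Q q \<in> carrier (power_series_module Q)"
  by (auto simp: power_series_module_simps const_coeff_def)

lemma const_coeff_ring_closed: "c \<in> carrier k \<Longrightarrow> const_coeff k c \<in> carrier (power_series_ring k)"
  by (auto simp: power_series_ring_simps const_coeff_def)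

lemma const_coeff_mult:
  assumes "c \<in> carrier k" "d \<in> carrier k"
  shows "const_coeff k c \<otimes>\<^bsub>power_series_ring k\<^esub> const_coeff k d = const_coeff k (c \<otimes>\<^bsub>k\<^esub> d)"
proof
  fix n
  have "(\<Oplus>\<^bsub>k\<^esub>i \<in> {..n}. const_coeff k c i \<otimes>\<^bsub>k\<^esub> const_coeff k d (n - i))
      = (\<Oplus>\<^bsub>k\<^esub>i\<in>{..n}. if 0 = i then const_coeff k (c \<otimes>\<^bsub>k\<^esub> d) n else \<zero>\<^bsub>k\<^esub>)"
    by (rule Q.R.finsum_cong') (auto simp: const_coeff_def assms)
  also have "\<dots> = const_coeff k (c \<otimes>\<^bsub>k\<^esub> d) n"
    using Q.R.finsum_singleton[of 0 "{..n}" "\<lambda>_. const_coeff k (c \<otimes>\<^bsub>k\<^esub> d) n"] assms by (simp add: const_coeff_def)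
  finally show "(const_coeff k c \<otimes>\<^bsub>power_series_ring k\<^esub> const_coeff k d) n = const_coeff k (c \<otimes>\<^bsub>k\<^esub> d) n"
    by (simp add: power_series_ring_simps)
qed

lemma const_smult:
  assumes c: "c \<in> carrier k" and v: "\<And>n. v n \<in> carrier Q"
  shows "const_coeff k c \<odot>\<^bsub>power_series_module Q\<^esub> v = (\<lambda>n. c \<odot>\<^bsub>Q\<^esub> v n)"
proof
  fix n
  have "(\<Oplus>\<^bsub>Q\<^esub>i \<in> {..n}. const_coeff k c i \<odot>\<^bsub>Q\<^esub> v (n - i)) = (\<Oplus>\<^bsub>Q\<^esub>i \<in> {..n}. if 0 = i then c \<odot>\<^bsub>Q\<^esub> v (n - i) else \<zero>\<^bsub>Q\<^esub>)"
    by (rule Q.finsum_cong') (auto simp: const_coeff_def c v)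
  also have "\<dots> = c \<odot>\<^bsub>Q\<^esub> v n"
    using c v Q.finsum_singleton[of 0 "{..n}" "\<lambda>i. c \<odot>\<^bsub>Q\<^esub> v (n - i)"] by auto
  finally show "(const_coeff k c \<odot>\<^bsub>power_series_module Q\<^esub> v) n = c \<odot>\<^bsub>Q\<^esub> v n"
    by (simp add: power_series_module_simps)
qed

lemma power_series_module_module:
  assumes K: "cring (power_series_ring k)"
  shows "Module.module (power_series_ring k) (power_series_module Q)"
proof (rule moduleI[OF K])
  let ?K = "power_series_ring k" and ?P = "power_series_module Q"
  show "abelian_group ?P"
  proof (rule abelian_groupI)
    fix v assume "v \<in> carrier ?P"
    thus "\<exists>w\<in>carrier ?P. w \<oplus>\<^bsub>?P\<^esub> v = \<zero>\<^bsub>?P\<^esub>"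
      by (intro bexI[of _ "\<lambda>n. \<ominus>\<^bsub>Q\<^esub> v n"]) (auto simp: power_series_module_simps Q.l_neg)
  qed (auto simp: power_series_module_simps Q.a_ac)
  fix c v assume c: "c \<in> carrier ?K" and v: "v \<in> carrier ?P"
  have cn: "c n \<in> carrier k" for n using c by (simp add: power_series_ring_simps)
  have vn: "v n \<in> carrier Q" for n using v by (simp add: power_series_module_simps)
  show "c \<odot>\<^bsub>?P\<^esub> v \<in> carrier ?P"
    by (auto simp: power_series_module_simps cn vn intro!: Q.finsum_closed)
  {
    fix d assume d: "d \<in> carrier ?K"
    have dn: "d n \<in> carrier k" for n using d by (simp add: power_series_ring_simps)
    show "(c \<oplus>\<^bsub>?K\<^esub> d) \<odot>\<^bsub>?P\<^esub> v = c \<odot>\<^bsub>?P\<^esub> v \<oplus>\<^bsub>?P\<^esub> d \<odot>\<^bsub>?P\<^esub> v"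
      by (auto simp: power_series_module_simps power_series_ring_simps cn dn vn Q.smult_l_distr Q.finsum_addf)
    show "(c \<otimes>\<^bsub>?K\<^esub> d) \<odot>\<^bsub>?P\<^esub> v = c \<odot>\<^bsub>?P\<^esub> (d \<odot>\<^bsub>?P\<^esub> v)"
    proof
      fix n
      have "((c \<otimes>\<^bsub>?K\<^esub> d) \<odot>\<^bsub>?P\<^esub> v) n = (\<Oplus>\<^bsub>Q\<^esub>i\<in>{..n}. \<Oplus>\<^bsub>Q\<^esub>j\<in>{..i}. (c j \<otimes>\<^bsub>k\<^esub> d (i - j)) \<odot>\<^bsub>Q\<^esub> v (n - i))"
        unfolding power_series_module_simps power_series_ring_simps
        by (rule Q.finsum_cong') (auto simp: cn dn vn finsum_smult_right[OF Q] intro!: Q.finsum_closed)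
      also have "\<dots> = (\<Oplus>\<^bsub>Q\<^esub>j\<in>{..n}. \<Oplus>\<^bsub>Q\<^esub>i\<in>{..n - j}. (c j \<otimes>\<^bsub>k\<^esub> d i) \<odot>\<^bsub>Q\<^esub> v (n - j - i))"
        by (rule Q.finsum_triple[of "\<lambda>j i l. (c j \<otimes>\<^bsub>k\<^esub> d i) \<odot>\<^bsub>Q\<^esub> v l"]) (simp add: cn dn vn)
      also have "\<dots> = (c \<odot>\<^bsub>?P\<^esub> (d \<odot>\<^bsub>?P\<^esub> v)) n"
        unfolding power_series_module_simps
        by (rule Q.finsum_cong')
          (auto simp: cn dn vn Q.smult_assoc1 Q.finsum_smult_ldistr intro!: Q.finsum_closed)
      finally show "((c \<otimes>\<^bsub>?K\<^esub> d) \<odot>\<^bsub>?P\<^esub> v) n = (c \<odot>\<^bsub>?P\<^esub> (d \<odot>\<^bsub>?P\<^esub> v)) n" .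
    qed
  }
  {
    fix w assume w: "w \<in> carrier ?P"
    have wn: "w n \<in> carrier Q" for n using w by (simp add: power_series_module_simps)
    show "c \<odot>\<^bsub>?P\<^esub> (v \<oplus>\<^bsub>?P\<^esub> w) = c \<odot>\<^bsub>?P\<^esub> v \<oplus>\<^bsub>?P\<^esub> c \<odot>\<^bsub>?P\<^esub> w"
      by (auto simp: power_series_module_simps cn wn vn Q.smult_r_distr Q.finsum_addf)
  }
next
  fix v assume "v \<in> carrier (power_series_module Q)"
  thus "\<one>\<^bsub>power_series_ring k\<^esub> \<odot>\<^bsub>power_series_module Q\<^esub> v = v"
    using const_smult[of "\<one>\<^bsub>k\<^esub>" v] by (auto simp: power_series_ring_simps power_series_module_simps(1))
qed

lemma hvar_closed: "hvar k \<in> carrier (power_series_ring k)"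
  by (simp add: power_series_ring_simps hvar_def)

text \<open>
  Multiplication by \<open>h\<close> shifts the coefficients, just as multiplication by \<open>\<lambda>\<close> does.
\<close>

lemma hvar_smult:
  assumes v: "v \<in> carrier (power_series_module Q)"
  shows "hvar k \<odot>\<^bsub>power_series_module Q\<^esub> v = horner_cons \<zero>\<^bsub>Q\<^esub> v"
proof
  fix n
  have vn: "v n \<in> carrier Q" for n using v by (simp add: power_series_module_simps)
  show "(hvar k \<odot>\<^bsub>power_series_module Q\<^esub> v) n = horner_cons \<zero>\<^bsub>Q\<^esub> v n"
  proof (cases n)
    case 0
    thus ?thesis by (simp add: power_series_module_simps hvar_def vn)
  next
    case (Suc m)
    have "(\<Oplus>\<^bsub>Q\<^esub>i \<in> {..n}. hvar k i \<odot>\<^bsub>Q\<^esub> v (n - i)) = (\<Oplus>\<^bsub>Q\<^esub>i \<in> {..n}. if 1 = i then v (n - i) else \<zero>\<^bsub>Q\<^esub>)"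
      by (rule Q.finsum_cong') (auto simp: hvar_def vn)
    also have "\<dots> = v m" using vn Suc Q.finsum_singleton[of 1 "{..n}" "\<lambda>i. v (n - i)"] by auto
    finally show ?thesis by (simp add: power_series_module_simps Suc)
  qed
qed

lemma hvar_pow_smult:
  assumes K: "cring (power_series_ring k)" and v: "v \<in> carrier (power_series_module Q)"
  shows "(hvar k [^]\<^bsub>power_series_ring k\<^esub> (n::nat)) \<odot>\<^bsub>power_series_module Q\<^esub> v
    = (\<lambda>i. if i < n then \<zero>\<^bsub>Q\<^esub> else v (i - n))"
  using v
proof (induction n arbitrary: v)
  interpret P: Module.module "power_series_ring k" "power_series_module Q"
    by (rule power_series_module_module[OF K])
  {
    case 0
    thus ?case by (simp add: fun_eq_iff)
  next
    case (Suc n)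
    have s: "horner_cons \<zero>\<^bsub>Q\<^esub> v \<in> carrier (power_series_module Q)"
      using P.smult_closed[OF hvar_closed Suc.prems] by (simp add: hvar_smult[OF Suc.prems])
    have "(hvar k [^]\<^bsub>power_series_ring k\<^esub> Suc n) \<odot>\<^bsub>power_series_module Q\<^esub> v
        = (hvar k [^]\<^bsub>power_series_ring k\<^esub> n) \<odot>\<^bsub>power_series_module Q\<^esub> horner_cons \<zero>\<^bsub>Q\<^esub> v"
      by (simp add: P.smult_assoc1 hvar_closed Suc.prems hvar_smult)
    also have "\<dots> = (\<lambda>i. if i < n then \<zero>\<^bsub>Q\<^esub> else horner_cons \<zero>\<^bsub>Q\<^esub> v (i - n))" by (rule Suc.IH[OF s])
    also have "\<dots> = (\<lambda>i. if i < Suc n then \<zero>\<^bsub>Q\<^esub> else v (i - Suc n))"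
      by (auto simp: horner_cons_def fun_eq_iff not_less Suc_diff_le split: nat.splits)
        (metis Suc_diff_Suc Suc_le_eq diff_Suc_Suc le_neq_implies_less old.nat.inject zero_less_diff less_irrefl)+
    finally show ?case .
  }
qed

end

section \<open>Convolution\<close>

text \<open>
  The Cauchy product \<open>\<Sum> h^n \<Sum> B (u i) (v (n - i))\<close> of two power series.
\<close>

definition conv :: "('c, 'm) ring_scheme \<Rightarrow> ('a \<Rightarrow> 'b \<Rightarrow> 'c) \<Rightarrow> (nat \<Rightarrow> 'a) \<Rightarrow> (nat \<Rightarrow> 'b) \<Rightarrow> nat \<Rightarrow> 'c" where
  "conv L B u v n = (\<Oplus>\<^bsub>L\<^esub>i\<in>{..n}. B (u i) (v (n - i)))"

lemma conv_left:
  fixes Q1 :: "('k, 'a) module" and Q2 :: "('k, 'b) module" and L :: "('k, 'c) module"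
  assumes K: "cring (power_series_ring k)" and Q1: "Module.module k Q1" and Q2: "Module.module k Q2"
    and L: "Module.module k L" and B: "B \<in> bilinear_maps k Q1 Q2 L" and v: "v \<in> carrier (power_series_module Q2)"
  shows "(\<lambda>u. conv L B u v) \<in> module_maps (power_series_ring k) (power_series_module Q1) (power_series_module L)"
proof -
  interpret L: Module.module k L by fact
  interpret Q1: Module.module k Q1 by fact
  have vn: "v n \<in> carrier Q2" for n using v by (simp add: power_series_module_simps[OF Q2])
  note Bc = bilinear_maps_closed[OF B _ vn] and Bl = bilinear_maps_left[OF B vn]
  show ?thesis
  proof (rule module_mapsI)
    fix u assume "u \<in> carrier (power_series_module Q1)"
    hence un: "u n \<in> carrier Q1" for n by (simp add: power_series_module_simps[OF Q1])
    show "conv L B u v \<in> carrier (power_series_module L)"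
      by (auto simp: power_series_module_simps[OF L] conv_def intro!: L.finsum_closed Bc un)
    {
      fix u' assume "u' \<in> carrier (power_series_module Q1)"
      hence u'n: "u' n \<in> carrier Q1" for n by (simp add: power_series_module_simps[OF Q1])
      show "conv L B (u \<oplus>\<^bsub>power_series_module Q1\<^esub> u') v = conv L B u v \<oplus>\<^bsub>power_series_module L\<^esub> conv L B u' v"
        by (auto simp: power_series_module_simps[OF L] power_series_module_simps[OF Q1] conv_def
            module_maps_add[OF Bl] un u'n Bc L.finsum_addf)
    }
  next
    fix c u assume "c \<in> carrier (power_series_ring k)" and "u \<in> carrier (power_series_module Q1)"
    hence un: "u n \<in> carrier Q1" and cn: "c n \<in> carrier k" for n
      by (simp_all add: power_series_module_simps[OF Q1] power_series_ring_simps[OF Q1])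
    show "conv L B (c \<odot>\<^bsub>power_series_module Q1\<^esub> u) v = c \<odot>\<^bsub>power_series_module L\<^esub> conv L B u v"
    proof
      fix n
      have "conv L B (c \<odot>\<^bsub>power_series_module Q1\<^esub> u) v n
          = (\<Oplus>\<^bsub>L\<^esub>i\<in>{..n}. \<Oplus>\<^bsub>L\<^esub>j\<in>{..i}. c j \<odot>\<^bsub>L\<^esub> B (u (i - j)) (v (n - i)))"
        unfolding conv_def power_series_module_simps[OF Q1]
      proof (rule L.finsum_cong')
        fix i
        have "(\<lambda>j. c j \<odot>\<^bsub>Q1\<^esub> u (i - j)) \<in> {..i} \<rightarrow> carrier Q1" using un cn by auto
        from module_maps_finsum[OF Q1 L Bl this]
        show "B (\<Oplus>\<^bsub>Q1\<^esub>j\<in>{..i}. c j \<odot>\<^bsub>Q1\<^esub> u (i - j)) (v (n - i))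
            = (\<Oplus>\<^bsub>L\<^esub>j\<in>{..i}. c j \<odot>\<^bsub>L\<^esub> B (u (i - j)) (v (n - i)))"
          by (simp add: module_maps_smult[OF Bl] un cn)
      qed (auto simp: un cn Bc intro!: L.finsum_closed)
      also have "\<dots> = (\<Oplus>\<^bsub>L\<^esub>j\<in>{..n}. \<Oplus>\<^bsub>L\<^esub>i\<in>{..n - j}. c j \<odot>\<^bsub>L\<^esub> B (u i) (v (n - j - i)))"
        by (rule L.finsum_triple[of "\<lambda>j i l. c j \<odot>\<^bsub>L\<^esub> B (u i) (v l)"]) (simp add: cn un Bc)
      also have "\<dots> = (c \<odot>\<^bsub>power_series_module L\<^esub> conv L B u v) n"
        unfolding power_series_module_simps[OF L] conv_def
        by (rule L.finsum_cong') (auto simp: un cn Bc L.finsum_smult_ldistr intro!: L.finsum_closed)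
      finally show "conv L B (c \<odot>\<^bsub>power_series_module Q1\<^esub> u) v n = (c \<odot>\<^bsub>power_series_module L\<^esub> conv L B u v) n" .
    qed
  qed
qed

lemma conv_swap:
  assumes L: "Module.module k L" and "\<And>i j. B (u i) (v j) \<in> carrier L"
  shows "conv L B u v = conv L (\<lambda>y x. B x y) v u"
proof
  fix n
  interpret L: Module.module k L by fact
  have "conv L B u v n = (\<Oplus>\<^bsub>L\<^esub>i\<in>{..n}. B (u (n - i)) (v (n - (n - i))))"
    unfolding conv_def by (rule L.finsum_reverse) (rule assms)
  also have "\<dots> = conv L (\<lambda>y x. B x y) v u n"
    unfolding conv_def by (rule L.finsum_cong') (auto simp: assms)
  finally show "conv L B u v n = conv L (\<lambda>y x. B x y) v u n" .
qed

lemma conv_bilinear: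
  fixes Q1 :: "('k, 'a) module" and Q2 :: "('k, 'b) module" and L :: "('k, 'c) module"
  assumes K: "cring (power_series_ring k)" and Q1: "Module.module k Q1" and Q2: "Module.module k Q2"
    and L: "Module.module k L" and B: "B \<in> bilinear_maps k Q1 Q2 L"
  shows "conv L B \<in> bilinear_maps (power_series_ring k) (power_series_module Q1) (power_series_module Q2) (power_series_module L)"
proof (rule bilinear_mapsI)
  fix u assume u: "u \<in> carrier (power_series_module Q1)"
  note P2 = power_series_module_module[OF Q2 K]
  note m = conv_left[OF K Q2 Q1 L bilinear_maps_swap[OF B] u]
  have eq: "conv L B u v = conv L (\<lambda>y x. B x y) v u" if v: "v \<in> carrier (power_series_module Q2)" for v
    using conv_swap[OF L] bilinear_maps_closed[OF B] u v
    by (metis power_series_module_simps(1)[OF Q1] power_series_module_simps(1)[OF Q2])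
  interpret P2: Module.module "power_series_ring k" "power_series_module Q2" by (rule P2)
  show "conv L B u \<in> module_maps (power_series_ring k) (power_series_module Q2) (power_series_module L)"
    by (rule module_mapsI)
      (simp_all add: eq module_maps_closed[OF m] module_maps_add[OF m] module_maps_smult[OF m])
qed (rule conv_left[OF assms])

lemma conv_const:
  assumes L: "Module.module k L" and Q1: "Module.module k Q1" and Q2: "Module.module k Q2"
    and B: "B \<in> bilinear_maps k Q1 Q2 L" and u: "u \<in> carrier Q1" and v: "v \<in> carrier Q2"
  shows "conv L B (const_coeff Q1 u) (const_coeff Q2 v) = const_coeff L (B u v)"
proof
  fix n
  interpret L: Module.module k L by fact
  interpret Q1: Module.module k Q1 by fact
  interpret Q2: Module.module k Q2 by fact
  have z: "B u \<zero>\<^bsub>Q2\<^esub> = \<zero>\<^bsub>L\<^esub>" "B \<zero>\<^bsub>Q1\<^esub> v = \<zero>\<^bsub>L\<^esub>" "B \<zero>\<^bsub>Q1\<^esub> \<zero>\<^bsub>Q2\<^esub> = \<zero>\<^bsub>L\<^esub>"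
    using module_maps_zero[OF Q2 L bilinear_maps_right[OF B]] module_maps_zero[OF Q1 L bilinear_maps_left[OF B]] u v
    by auto
  have "conv L B (const_coeff Q1 u) (const_coeff Q2 v) n
      = (\<Oplus>\<^bsub>L\<^esub>i\<in>{..n}. if 0 = i then const_coeff L (B u v) n else \<zero>\<^bsub>L\<^esub>)"
    unfolding conv_def
    by (rule L.finsum_cong') (auto simp: const_coeff_def z bilinear_maps_closed[OF B u v])
  also have "\<dots> = const_coeff L (B u v) n"
    using L.finsum_singleton[of 0 "{..n}" "\<lambda>_. const_coeff L (B u v) n"] bilinear_maps_closed[OF B u v]
    by (simp add: const_coeff_def)
  finally show "conv L B (const_coeff Q1 u) (const_coeff Q2 v) n = const_coeff L (B u v) n" .
qed

section \<open>Lifts to power series and leading coefficients\<close>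

definition h_mult :: "('k, 's) ring_scheme \<Rightarrow> (nat \<Rightarrow> 'k, 'n) module \<Rightarrow> nat \<Rightarrow> 'n \<Rightarrow> 'n" where
  "h_mult k N i x = (hvar k [^]\<^bsub>power_series_ring k\<^esub> i) \<odot>\<^bsub>N\<^esub> x"

context
  fixes k :: "('k, 's) ring_scheme" and N :: "(nat \<Rightarrow> 'k, 'n) module"
  assumes N: "Module.module (power_series_ring k) N" and hv: "hvar k \<in> carrier (power_series_ring k)"
begin

interpretation N: Module.module "power_series_ring k" N by (fact N)

lemma h_mult_module_maps: "h_mult k N i \<in> module_maps (power_series_ring k) N N"
  unfolding h_mult_def[abs_def] by (rule module_maps_smult_const[OF N h_pow_closed[OF N hv]])

lemma h_mult_0: "x \<in> carrier N \<Longrightarrow> h_mult k N 0 x = x"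
  by (simp add: h_mult_def)

lemma h_mult_Suc_0: "x \<in> carrier N \<Longrightarrow> h_mult k N (Suc 0) x = hvar k \<odot>\<^bsub>N\<^esub> x"
  by (simp add: h_mult_def hv)

lemma h_mult_h_mult: "x \<in> carrier N \<Longrightarrow> h_mult k N i (h_mult k N j x) = h_mult k N (i + j) x"
  by (simp add: h_mult_def N.smult_assoc1[symmetric] h_pow_closed[OF N hv] N.R.nat_pow_mult hv)

lemma h_mult_linear:
  assumes "F \<in> module_maps (power_series_ring k) N N'" and "x \<in> carrier N"
  shows "F (h_mult k N i x) = h_mult k N' i (F x)"
  unfolding h_mult_def by (rule module_maps_smult[OF assms(1) h_pow_closed[OF N hv] assms(2)])

end

definition base_lift :: "('k, 's) ring_scheme \<Rightarrow> nat \<Rightarrow> ('k, 'q) module \<Rightarrow> 'q \<Rightarrow> (nat \<Rightarrow> 'q) set" where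
  "base_lift k n Q q = hadic_coset (power_series_ring k) (hvar k) (power_series_module Q) n (const_coeff Q q)"

text \<open>
  \<open>z = h^i q + O(h^(i+1))\<close>.  Nothing is said about minimality of \<open>i\<close>: an element of higher order has the
  symbol \<open>0\<close> in degree \<open>i\<close>.
\<close>

definition has_symbol :: "('k, 's) ring_scheme \<Rightarrow> (nat \<Rightarrow> 'k, 'n) module \<Rightarrow> ('q \<Rightarrow> 'n) \<Rightarrow> nat \<Rightarrow> 'n \<Rightarrow> 'q \<Rightarrow> bool" where
  "has_symbol k N \<iota> i z q \<longleftrightarrow> (\<exists>w \<in> carrier N. z = h_mult k N i (\<iota> q) \<oplus>\<^bsub>N\<^esub> h_mult k N (Suc i) w)"

text \<open>
  A \<open>k[[h]]\<close>-module \<open>N\<close> that contains the constants \<open>Q\<close> and is generated by them modulo \<open>h\<close>.  The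
  retraction to \<open>Q[[h]] / h^n\<close> excludes that \<open>h\<close> kills too much: it makes leading coefficients unique
  below degree \<open>n\<close>.  The examples are \<open>Q[[h]]\<close>, its quotient modulo \<open>h^n\<close>, and tensor products of
  lifts.
\<close>

locale h_lift =
  fixes k :: "('k, 's) ring_scheme" and n :: nat and Q :: "('k, 'q) module"
    and N :: "(nat \<Rightarrow> 'k, 'n) module" and \<iota> :: "'q \<Rightarrow> 'n"
  assumes Q_module: "Module.module k Q"
    and N_module: "Module.module (power_series_ring k) N"
    and iota_additive: "\<iota> \<in> additive_maps Q N"
    and iota_smult: "\<lbrakk>c \<in> carrier k; q \<in> carrier Q\<rbrakk> \<Longrightarrow> \<iota> (c \<odot>\<^bsub>Q\<^esub> q) = const_coeff k c \<odot>\<^bsub>N\<^esub> \<iota> q"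
    and generated: "z \<in> carrier N \<Longrightarrow> \<exists>q \<in> carrier Q. \<exists>w \<in> carrier N. z = \<iota> q \<oplus>\<^bsub>N\<^esub> h_mult k N (Suc 0) w"
    and retraction: "\<exists>\<theta> \<in> module_maps (power_series_ring k) N
        (hadic_quot (power_series_ring k) (hvar k) (power_series_module Q) n).
      \<forall>q \<in> carrier Q. \<theta> (\<iota> q) = base_lift k n Q q"
begin

interpretation Q: Module.module k Q by (rule Q_module)
interpretation N: Module.module "power_series_ring k" N by (rule N_module)
interpretation \<iota>: abelian_group_hom Q N \<iota>
  by (rule additive_maps_hom) (fact iota_additive Q.abelian_group_axioms N.abelian_group_axioms)+

lemma K_cring: "cring (power_series_ring k)" by (rule N.is_cring)
lemmas hv = hvar_closed[OF Q_module]
lemmas hm = h_mult_module_maps[OF N_module hv]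
lemmas hm_closed = module_maps_closed[OF hm] and hm_add = module_maps_add[OF hm]
lemma iota_closed: "q \<in> carrier Q \<Longrightarrow> \<iota> q \<in> carrier N" by simp

lemma symbol_closed: "\<lbrakk>has_symbol k N \<iota> i z q; q \<in> carrier Q\<rbrakk> \<Longrightarrow> z \<in> carrier N"
  by (auto simp: has_symbol_def hm_closed)

lemma symbolI: "w \<in> carrier N \<Longrightarrow> z = h_mult k N i (\<iota> q) \<oplus>\<^bsub>N\<^esub> h_mult k N (Suc i) w \<Longrightarrow> has_symbol k N \<iota> i z q"
  by (auto simp: has_symbol_def)

lemma symbol_h_mult_iota: "q \<in> carrier Q \<Longrightarrow> has_symbol k N \<iota> i (h_mult k N i (\<iota> q)) q"
  by (rule symbolI[OF N.zero_closed]) (simp add: hm_closed module_maps_zero[OF N_module N_module hm])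

lemma symbol_iota: "q \<in> carrier Q \<Longrightarrow> has_symbol k N \<iota> 0 (\<iota> q) q"
  using symbol_h_mult_iota[of q 0] by (simp add: h_mult_0[OF N_module hv])

lemma symbol_h_mult_Suc: "w \<in> carrier N \<Longrightarrow> has_symbol k N \<iota> i (h_mult k N (Suc i) w) \<zero>\<^bsub>Q\<^esub>"
  by (rule symbolI[of w]) (simp_all add: hm_closed module_maps_zero[OF N_module N_module hm])

lemma symbol_zero: "has_symbol k N \<iota> i \<zero>\<^bsub>N\<^esub> \<zero>\<^bsub>Q\<^esub>"
  using symbol_h_mult_iota[OF Q.zero_closed, of i] by (simp add: module_maps_zero[OF N_module N_module hm])

lemma symbol_add:
  assumes "has_symbol k N \<iota> i z q" "has_symbol k N \<iota> i z' q'" "q \<in> carrier Q" "q' \<in> carrier Q"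
  shows "has_symbol k N \<iota> i (z \<oplus>\<^bsub>N\<^esub> z') (q \<oplus>\<^bsub>Q\<^esub> q')"
proof -
  obtain w w' where w: "w \<in> carrier N" "w' \<in> carrier N"
    "z = h_mult k N i (\<iota> q) \<oplus>\<^bsub>N\<^esub> h_mult k N (Suc i) w" "z' = h_mult k N i (\<iota> q') \<oplus>\<^bsub>N\<^esub> h_mult k N (Suc i) w'"
    using assms by (auto simp: has_symbol_def)
  show ?thesis
    by (rule symbolI[of "w \<oplus>\<^bsub>N\<^esub> w'"]) (use w assms(3,4) in \<open>simp_all add: hm_add hm_closed N.a_ac\<close>)
qed

lemma symbol_neg:
  assumes "has_symbol k N \<iota> i z q" "q \<in> carrier Q"
  shows "has_symbol k N \<iota> i (\<ominus>\<^bsub>N\<^esub> z) (\<ominus>\<^bsub>Q\<^esub> q)"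
proof -
  obtain w where w: "w \<in> carrier N" "z = h_mult k N i (\<iota> q) \<oplus>\<^bsub>N\<^esub> h_mult k N (Suc i) w"
    using assms by (auto simp: has_symbol_def)
  show ?thesis
    by (rule symbolI[of "\<ominus>\<^bsub>N\<^esub> w"])
      (use w assms(2) in \<open>simp_all add: module_maps_neg[OF N_module N_module hm] hm_closed N.minus_add\<close>)
qed

lemma symbol_minus:
  assumes "has_symbol k N \<iota> i z q" "has_symbol k N \<iota> i z' q'" "q \<in> carrier Q" "q' \<in> carrier Q"
  shows "has_symbol k N \<iota> i (z \<ominus>\<^bsub>N\<^esub> z') (q \<ominus>\<^bsub>Q\<^esub> q')"
  unfolding N.minus_eq Q.minus_eq using symbol_add[OF assms(1) symbol_neg[OF assms(2,4)]] assms by simp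

lemma symbol_finsum:
  assumes "finite A" "\<And>j. j \<in> A \<Longrightarrow> has_symbol k N \<iota> i (f j) (g j)" "\<And>j. j \<in> A \<Longrightarrow> g j \<in> carrier Q"
  shows "has_symbol k N \<iota> i (\<Oplus>\<^bsub>N\<^esub>j\<in>A. f j) (\<Oplus>\<^bsub>Q\<^esub>j\<in>A. g j)"
  using assms
proof (induction A)
  case empty
  show ?case by (simp add: symbol_zero)
next
  case (insert a A)
  have c: "f \<in> A \<rightarrow> carrier N" "g \<in> A \<rightarrow> carrier Q" "f a \<in> carrier N" "g a \<in> carrier Q"
    using symbol_closed[OF insert.prems(1) insert.prems(2)] insert.prems(2) by auto
  show ?case using insert c by (simp add: N.finsum_insert Q.finsum_insert symbol_add Q.finsum_closed)
qed

lemma symbol_add_pow: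
  assumes "has_symbol k N \<iota> i z q" "q \<in> carrier Q"
  shows "has_symbol k N \<iota> i (add_pow N (m::nat) z) (add_pow Q m q)"
proof (induction m)
  case 0
  show ?case by (simp add: symbol_zero)
next
  case (Suc m)
  show ?case using symbol_add[OF Suc assms(1) _ assms(2)] assms(2) by simp
qed

lemma symbol_Suc:
  assumes "has_symbol k N \<iota> (Suc i) z q" "q \<in> carrier Q"
  shows "has_symbol k N \<iota> i z \<zero>\<^bsub>Q\<^esub>"
proof -
  obtain w where w: "w \<in> carrier N" "z = h_mult k N (Suc i) (\<iota> q) \<oplus>\<^bsub>N\<^esub> h_mult k N (Suc (Suc i)) w"
    using assms by (auto simp: has_symbol_def)
  have "z = h_mult k N (Suc i) (\<iota> q \<oplus>\<^bsub>N\<^esub> h_mult k N (Suc 0) w)"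
    using w assms(2) by (simp add: hm_add hm_closed h_mult_h_mult[OF N_module hv])
  thus ?thesis using symbol_h_mult_Suc[of "\<iota> q \<oplus>\<^bsub>N\<^esub> h_mult k N (Suc 0) w" i] w assms(2) by (simp add: hm_closed)
qed

lemma symbol_times_lambda:
  assumes "\<And>m. has_symbol k N \<iota> i (f m) (g m)"
  shows "has_symbol k N \<iota> i (times_lambda N f m) (times_lambda Q g m)"
  using assms symbol_zero by (cases m) (auto simp: times_lambda_eq)

text \<open>
  If \<open>q\<close> and \<open>q'\<close> are leading coefficients of \<open>z\<close> in degree \<open>i\<close>, then \<open>h^i (q - q')\<close> is divisible by
  \<open>h^(i+1)\<close>.  The retraction transports this to power series modulo \<open>h^n\<close>, where the coefficient of
  \<open>h^i\<close> can be read off.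
\<close>

lemma symbol_unique:
  assumes "has_symbol k N \<iota> i z q" "has_symbol k N \<iota> i z q'" "q \<in> carrier Q" "q' \<in> carrier Q" "i < n"
  shows "q = q'"
proof -
  let ?K = "power_series_ring k" and ?P = "power_series_module Q"
  let ?q = "q \<ominus>\<^bsub>Q\<^esub> q'"
  note P = power_series_module_module[OF Q_module K_cring]
  interpret P: Module.module ?K ?P by (rule P)
  have qc: "?q \<in> carrier Q" using assms by simp
  have zc: "z \<in> carrier N" by (rule symbol_closed[OF assms(1,3)])
  have "has_symbol k N \<iota> i (z \<ominus>\<^bsub>N\<^esub> z) ?q" by (rule symbol_minus[OF assms(1-4)])
  then obtain w where w: "w \<in> carrier N" "\<zero>\<^bsub>N\<^esub> = h_mult k N i (\<iota> ?q) \<oplus>\<^bsub>N\<^esub> h_mult k N (Suc i) w"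
    using zc by (auto simp: has_symbol_def N.minus_eq N.r_neg)
  obtain \<theta> where th: "\<theta> \<in> module_maps ?K N (hadic_quot ?K (hvar k) ?P n)"
    and thi: "\<And>q. q \<in> carrier Q \<Longrightarrow> \<theta> (\<iota> q) = base_lift k n Q q"
    using retraction by blast
  note HQ = hadic_quot_module[OF P hv] and hc = hadic_coset_module_maps[OF P hv]
  obtain v where v: "v \<in> carrier ?P" "\<theta> w = hadic_coset ?K (hvar k) ?P n v"
    using module_maps_closed[OF th w(1)] by (auto simp: carrier_hadic_quot[OF P hv])
  note cq = const_coeff_closed[OF Q_module qc]
  let ?x = "h_mult k ?P i (const_coeff Q ?q) \<oplus>\<^bsub>?P\<^esub> h_mult k ?P (Suc i) v"
  note hmP = module_maps_closed[OF h_mult_module_maps[OF P hv]]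
  have "\<zero>\<^bsub>hadic_quot ?K (hvar k) ?P n\<^esub> = \<theta> (h_mult k N i (\<iota> ?q) \<oplus>\<^bsub>N\<^esub> h_mult k N (Suc i) w)"
    using module_maps_zero[OF N_module HQ th] w(2) by simp
  also have "\<dots> = hadic_coset ?K (hvar k) ?P n ?x"
    using qc w(1) v cq hmP
    by (simp add: module_maps_add[OF th] hm_closed h_mult_linear[OF N_module hv th] thi base_lift_def
        h_mult_linear[OF P hv hc] module_maps_add[OF hc])
  finally have "hadic_coset ?K (hvar k) ?P n ?x = hadic_coset ?K (hvar k) ?P n \<zero>\<^bsub>?P\<^esub>"
    by (simp add: module_maps_zero[OF P HQ hc])
  hence "?x \<in> hadic_sub ?K (hvar k) ?P n"
    using cq v hmP by (simp add: hadic_coset_eq_iff[OF P hv] P.minus_eq)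
  then obtain y where y: "y \<in> carrier ?P" "?x = (hvar k [^]\<^bsub>?K\<^esub> n) \<odot>\<^bsub>?P\<^esub> y" by (auto simp: hadic_sub_def)
  have "?x i = \<zero>\<^bsub>Q\<^esub>" using assms(5) by (simp add: y hvar_pow_smult[OF Q_module K_cring])
  moreover have "h_mult k ?P i (const_coeff Q ?q) i = ?q" "h_mult k ?P (Suc i) v i = \<zero>\<^bsub>Q\<^esub>"
    unfolding h_mult_def hvar_pow_smult[OF Q_module K_cring cq] hvar_pow_smult[OF Q_module K_cring v(1)]
    by (simp_all add: const_coeff_def)
  hence "?x i = ?q" using qc by (simp add: power_series_module_simps(3)[OF Q_module])
  ultimately show ?thesis using assms(3,4) by (simp add: Q.minus_eq_zero_iff)
qed

end

text \<open>
  If a linear map raises the order of all constants by \<open>e\<close>, it raises the order of every element by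
  \<open>e\<close>, since constants generate the module modulo \<open>h\<close>.  Hence \<open>h^i q + O(h^(i+1))\<close> has the image
  \<open>h^i F(q) + O(h^(i+1+e))\<close>, and only the leading coefficients of the \<open>F(q)\<close> matter.
\<close>

lemma symbol_map:
  assumes l1: "h_lift k n Q N \<iota>" and l2: "h_lift k n Q' N' \<iota>'"
    and F: "F \<in> module_maps (power_series_ring k) N N'"
    and G: "\<And>q. q \<in> carrier Q \<Longrightarrow> G q \<in> carrier Q'"
    and FG: "\<And>q. q \<in> carrier Q \<Longrightarrow> has_symbol k N' \<iota>' e (F (\<iota> q)) (G q)"
    and z: "has_symbol k N \<iota> i z q" and q: "q \<in> carrier Q"
  shows "has_symbol k N' \<iota>' (i + e) (F z) (G q)"
proof -
  interpret L: h_lift k n Q N \<iota> by fact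
  interpret L': h_lift k n Q' N' \<iota>' by fact
  interpret N: Module.module "power_series_ring k" N by (rule L.N_module)
  interpret N': Module.module "power_series_ring k" N' by (rule L'.N_module)
  note hh = h_mult_h_mult[OF L.N_module L.hv] h_mult_h_mult[OF L'.N_module L.hv]
  note Fh = h_mult_linear[OF L.N_module L.hv F]
  note Fc = module_maps_closed[OF F]
  \<comment> \<open>The image of \<open>F\<close> is divisible by \<open>h^j\<close> for all \<open>j \<le> e\<close>: write \<open>w\<close> as a constant plus
    \<open>h w1\<close> and apply the hypothesis for \<open>j - 1\<close> to \<open>w1\<close>.\<close>
  have div: "\<exists>w'\<in>carrier N'. F w = h_mult k N' j w'" if "j \<le> e" "w \<in> carrier N" for j w
    using that
  proof (induction j arbitrary: w)
    case 0
    thus ?case using h_mult_0[OF L'.N_module L.hv] Fc by metis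
  next
    case (Suc j)
    obtain p w1 where p: "p \<in> carrier Q" and w1: "w1 \<in> carrier N" and w: "w = \<iota> p \<oplus>\<^bsub>N\<^esub> h_mult k N (Suc 0) w1"
      using L.generated[OF Suc.prems(2)] by blast
    obtain w2 where w2: "w2 \<in> carrier N'" "F (\<iota> p) = h_mult k N' e (\<iota>' (G p)) \<oplus>\<^bsub>N'\<^esub> h_mult k N' (Suc e) w2"
      using FG[OF p] by (auto simp: has_symbol_def)
    obtain w3 where w3: "w3 \<in> carrier N'" "F w1 = h_mult k N' j w3" using Suc.IH[OF _ w1] Suc.prems by auto
    define y where "y = h_mult k N' (e - Suc j) (\<iota>' (G p)) \<oplus>\<^bsub>N'\<^esub> h_mult k N' (e - j) w2 \<oplus>\<^bsub>N'\<^esub> w3"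
    have y: "y \<in> carrier N'" using w2 w3 p G by (simp add: y_def L'.hm_closed L'.iota_closed)
    have e: "Suc (j + (e - Suc j)) = e" "Suc (j + (e - j)) = Suc e" using Suc.prems by auto
    have "F w = h_mult k N' (Suc j) y"
      using p w1 w2 w3 G
      by (simp add: w y_def module_maps_add[OF F] L.iota_closed L.hm_closed Fh L'.hm_closed L'.hm_add L'.iota_closed hh e)
    thus ?case using y by blast
  qed
  obtain w where w: "w \<in> carrier N" "z = h_mult k N i (\<iota> q) \<oplus>\<^bsub>N\<^esub> h_mult k N (Suc i) w"
    using z by (auto simp: has_symbol_def)
  obtain w1 where w1: "w1 \<in> carrier N'" "F w = h_mult k N' e w1" using div[OF order_refl w(1)] by blast
  obtain w2 where w2: "w2 \<in> carrier N'" "F (\<iota> q) = h_mult k N' e (\<iota>' (G q)) \<oplus>\<^bsub>N'\<^esub> h_mult k N' (Suc e) w2"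
    using FG[OF q] by (auto simp: has_symbol_def)
  show ?thesis
  proof (rule L'.symbolI[of "w2 \<oplus>\<^bsub>N'\<^esub> w1"])
    show "F z = h_mult k N' (i + e) (\<iota>' (G q)) \<oplus>\<^bsub>N'\<^esub> h_mult k N' (Suc (i + e)) (w2 \<oplus>\<^bsub>N'\<^esub> w1)"
      using w w1 w2 q G
      by (simp add: module_maps_add[OF F] L.iota_closed L.hm_closed Fh L'.hm_closed L'.hm_add L'.iota_closed hh N'.a_ac)
  qed (use w1 w2 in auto)
qed

lemma h_lift_power_series:
  assumes Q: "Module.module k Q" and K: "cring (power_series_ring k)"
  shows "h_lift k n Q (power_series_module Q) (const_coeff Q)"
proof -
  let ?K = "power_series_ring k" and ?P = "power_series_module Q"
  let ?c = "hadic_coset ?K (hvar k) ?P n"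
  interpret Q: Module.module k Q by (rule Q)
  note P = power_series_module_module[OF Q K] and hv = hvar_closed[OF Q]
  interpret P: Module.module ?K ?P by (rule P)
  note ps = power_series_module_simps[OF Q]
  note cc = const_coeff_closed[OF Q]
  show ?thesis
  proof (rule h_lift.intro)
    have "const_coeff Q (x \<oplus>\<^bsub>Q\<^esub> y) = const_coeff Q x \<oplus>\<^bsub>?P\<^esub> const_coeff Q y" for x y
      by (auto simp: ps const_coeff_def)
    thus "const_coeff Q \<in> additive_maps Q ?P" using cc by (auto simp: additive_maps_def)
    show "const_coeff Q (c \<odot>\<^bsub>Q\<^esub> q) = const_coeff k c \<odot>\<^bsub>?P\<^esub> const_coeff Q q"
      if c: "c \<in> carrier k" and q: "q \<in> carrier Q" for c q
      using const_smult[OF Q c, of "const_coeff Q q"] cc[OF q] c by (auto simp: ps const_coeff_def)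
    fix v assume v: "v \<in> carrier ?P"
    have v': "(\<lambda>i. v (Suc i)) \<in> carrier ?P" and v0: "v 0 \<in> carrier Q" using v by (auto simp: ps)
    have "v = const_coeff Q (v 0) \<oplus>\<^bsub>?P\<^esub> h_mult k ?P (Suc 0) (\<lambda>i. v (Suc i))"
      unfolding h_mult_Suc_0[OF P hv v']
      using v by (auto simp: hvar_smult[OF Q v'] ps(1,3) const_coeff_def horner_cons_def fun_eq_iff split: nat.splits)
    thus "\<exists>q\<in>carrier Q. \<exists>w\<in>carrier ?P. v = const_coeff Q q \<oplus>\<^bsub>?P\<^esub> h_mult k ?P (Suc 0) w"
      using v0 v' by blast
  next
    show "\<exists>\<theta>\<in>module_maps ?K ?P (hadic_quot ?K (hvar k) ?P n). \<forall>q\<in>carrier Q. \<theta> (const_coeff Q q) = base_lift k n Q q"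
      by (rule bexI[OF _ hadic_coset_module_maps[OF P hv]]) (simp add: base_lift_def)
  qed (rule Q P)+
qed

lemma h_lift_base:
  assumes Q: "Module.module k Q" and K: "cring (power_series_ring k)"
  shows "h_lift k n Q (hadic_quot (power_series_ring k) (hvar k) (power_series_module Q) n) (base_lift k n Q)"
proof -
  let ?K = "power_series_ring k" and ?P = "power_series_module Q"
  let ?c = "hadic_coset ?K (hvar k) ?P n" and ?H = "hadic_quot ?K (hvar k) ?P n"
  interpret L: h_lift k n Q ?P "const_coeff Q" by (rule h_lift_power_series[OF Q K])
  note P = L.N_module and hv = L.hv
  note H = hadic_quot_module[OF P hv] and hc = hadic_coset_module_maps[OF P hv]
  have b: "base_lift k n Q = (\<lambda>q. ?c (const_coeff Q q))" by (simp add: base_lift_def fun_eq_iff)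
  show ?thesis
  proof (rule h_lift.intro)
    show "base_lift k n Q \<in> additive_maps Q ?H"
      unfolding b by (rule additive_maps_comp[OF L.iota_additive module_maps_additive[OF hc]])
    show "base_lift k n Q (c \<odot>\<^bsub>Q\<^esub> q) = const_coeff k c \<odot>\<^bsub>?H\<^esub> base_lift k n Q q"
      if c: "c \<in> carrier k" and q: "q \<in> carrier Q" for c q
      unfolding b L.iota_smult[OF c q]
      by (rule module_maps_smult[OF hc const_coeff_ring_closed[OF Q c] L.iota_closed[OF q]])
    fix z assume "z \<in> carrier ?H"
    then obtain v where v: "v \<in> carrier ?P" "z = ?c v" by (auto simp: carrier_hadic_quot[OF P hv])
    obtain q w where qw: "q \<in> carrier Q" "w \<in> carrier ?P" "v = const_coeff Q q \<oplus>\<^bsub>?P\<^esub> h_mult k ?P (Suc 0) w"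
      using L.generated[OF v(1)] by blast
    have "z = base_lift k n Q q \<oplus>\<^bsub>?H\<^esub> h_mult k ?H (Suc 0) (?c w)"
      using qw by (simp add: v(2) b module_maps_add[OF hc] L.iota_closed L.hm_closed h_mult_linear[OF P hv hc])
    thus "\<exists>q\<in>carrier Q. \<exists>w\<in>carrier ?H. z = base_lift k n Q q \<oplus>\<^bsub>?H\<^esub> h_mult k ?H (Suc 0) w"
      using qw(1) module_maps_closed[OF hc qw(2)] by blast
  next
    show "\<exists>\<theta>\<in>module_maps ?K ?H ?H. \<forall>q\<in>carrier Q. \<theta> (base_lift k n Q q) = base_lift k n Q q"
      by (rule bexI[OF _ module_maps_id(1)]) simp
  qed (rule Q H)+
qed

section \<open>Symbols of tensors\<close>

lemma restrict_scalars_simps: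
  "carrier (restrict_scalars \<phi> N) = carrier N" "\<zero>\<^bsub>restrict_scalars \<phi> N\<^esub> = \<zero>\<^bsub>N\<^esub>"
  "x \<oplus>\<^bsub>restrict_scalars \<phi> N\<^esub> y = x \<oplus>\<^bsub>N\<^esub> y" "c \<odot>\<^bsub>restrict_scalars \<phi> N\<^esub> x = \<phi> c \<odot>\<^bsub>N\<^esub> x"
  by (simp_all add: restrict_scalars_def)

lemma restrict_scalars_module:
  fixes Q :: "('k, 'q) module" and N :: "(nat \<Rightarrow> 'k, 'n) module"
  assumes Q: "Module.module k Q" and N: "Module.module (power_series_ring k) N"
  shows "Module.module k (restrict_scalars (const_coeff k) N)"
proof -
  interpret Q: Module.module k Q by fact
  interpret N: Module.module "power_series_ring k" N by fact
  note ks = power_series_ring_simps[OF Q]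
  note c = const_coeff_ring_closed[OF Q]
  have ca: "const_coeff k (c \<oplus>\<^bsub>k\<^esub> d) = const_coeff k c \<oplus>\<^bsub>power_series_ring k\<^esub> const_coeff k d" for c d
    by (auto simp: ks const_coeff_def)
  note cm = const_coeff_mult[OF Q, symmetric]
  show ?thesis
  proof (rule moduleI[OF Q.is_cring])
    show "abelian_group (restrict_scalars (const_coeff k) N)"
    proof (rule abelian_groupI; unfold restrict_scalars_simps)
      fix x assume "x \<in> carrier N"
      thus "\<exists>y\<in>carrier N. y \<oplus>\<^bsub>N\<^esub> x = \<zero>\<^bsub>N\<^esub>"
        by (intro bexI[of _ "\<ominus>\<^bsub>N\<^esub> x"]) (auto simp: N.l_neg)
    qed (auto simp: N.a_ac)
  qed (auto simp: restrict_scalars_simps c ca cm N.smult_l_distr N.smult_r_distr N.smult_assoc1 ks(3)[symmetric])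
qed

text \<open>
  The embedding of constants \<open>u \<otimes> v \<mapsto> \<iota>1 u \<otimes> \<iota>2 v\<close> into a tensor product over \<open>k[[h]]\<close>.  It is
  lifted along the scalar restriction, as the source is a tensor product over \<open>k\<close>.
\<close>

definition tensor_iota :: "('k, 's) ring_scheme \<Rightarrow> (nat \<Rightarrow> 'k, 'm) module \<Rightarrow> (nat \<Rightarrow> 'k, 'n) module
    \<Rightarrow> ('p \<Rightarrow> 'm) \<Rightarrow> ('q \<Rightarrow> 'n) \<Rightarrow> ('p \<times> 'q \<Rightarrow> 'k) set \<Rightarrow> ('m \<times> 'n \<Rightarrow> (nat \<Rightarrow> 'k)) set" where
  "tensor_iota k N1 N2 \<iota>1 \<iota>2 = tensor_lift k (restrict_scalars (const_coeff k) (tensor (power_series_ring k) N1 N2))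
     (\<lambda>u v. tensor_pure (power_series_ring k) N1 N2 (\<iota>1 u) (\<iota>2 v))"

lemma tensor_embed_eq:
  "tensor_embed k P = tensor_iota k (power_series_module P) (power_series_module P) (const_coeff P) (const_coeff P)"
  by (simp add: tensor_embed_def tensor_iota_def Let_def)

context
  fixes k :: "('k, 's) ring_scheme" and n :: nat
    and Q1 :: "('k, 'a) module" and N1 :: "(nat \<Rightarrow> 'k, 'c) module" and \<iota>1
    and Q2 :: "('k, 'b) module" and N2 :: "(nat \<Rightarrow> 'k, 'd) module" and \<iota>2
  assumes l1: "h_lift k n Q1 N1 \<iota>1" and l2: "h_lift k n Q2 N2 \<iota>2"
begin

interpretation L1: h_lift k n Q1 N1 \<iota>1 by (rule l1)
interpretation L2: h_lift k n Q2 N2 \<iota>2 by (rule l2)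

abbreviation (input) "KK \<equiv> power_series_ring k"
abbreviation (input) "NT \<equiv> tensor KK N1 N2"
abbreviation (input) "QT \<equiv> tensor k Q1 Q2"
abbreviation (input) "\<iota>T \<equiv> tensor_iota k N1 N2 \<iota>1 \<iota>2"

lemmas lift_modules = L1.N_module L2.N_module L1.Q_module L2.Q_module
lemma NT: "Module.module KK NT" by (rule tensor_module[OF lift_modules(1,2)])
lemma QT: "Module.module k QT" by (rule tensor_module[OF lift_modules(3,4)])
lemma RT: "Module.module k (restrict_scalars (const_coeff k) NT)" by (rule restrict_scalars_module[OF lift_modules(3) NT])

interpretation N1: Module.module KK N1 by (rule lift_modules(1))
interpretation N2: Module.module KK N2 by (rule lift_modules(2))
interpretation Q1: Module.module k Q1 by (rule lift_modules(3))
interpretation Q2: Module.module k Q2 by (rule lift_modules(4))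
interpretation NT: Module.module KK NT by (rule NT)
interpretation QT: Module.module k QT by (rule QT)

lemma pure_iota_bilinear:
  "(\<lambda>u v. tensor_pure KK N1 N2 (\<iota>1 u) (\<iota>2 v)) \<in> bilinear_maps k Q1 Q2 (restrict_scalars (const_coeff k) NT)"
proof -
  note p = tensor_pure_bilinear[OF lift_modules(1,2)]
  note c = const_coeff_ring_closed[OF lift_modules(3)]
  show ?thesis
    by (intro bilinear_mapsI module_mapsI)
      (simp_all add: restrict_scalars_simps bilinear_maps_closed[OF p] L1.iota_closed L2.iota_closed
        additive_maps_add[OF L1.iota_additive] additive_maps_add[OF L2.iota_additive] L1.iota_smult L2.iota_smult
        module_maps_add[OF bilinear_maps_right[OF p]] module_maps_add[OF bilinear_maps_left[OF p]]
        module_maps_smult[OF bilinear_maps_right[OF p]] module_maps_smult[OF bilinear_maps_left[OF p]] c)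
qed

lemma tensor_iota_module_maps: "\<iota>T \<in> module_maps k QT (restrict_scalars (const_coeff k) NT)"
  unfolding tensor_iota_def by (rule tensor_lift_module_maps[OF lift_modules(3,4) RT pure_iota_bilinear])

lemma tensor_iota_pure:
  "\<lbrakk>x \<in> carrier Q1; y \<in> carrier Q2\<rbrakk> \<Longrightarrow> \<iota>T (tensor_pure k Q1 Q2 x y) = tensor_pure KK N1 N2 (\<iota>1 x) (\<iota>2 y)"
  unfolding tensor_iota_def by (rule tensor_lift_pure[OF lift_modules(3,4) RT pure_iota_bilinear])

text \<open>
  The retraction of a tensor product is \<open>u \<otimes> v \<mapsto> \<theta>1 u * \<theta>2 v\<close>, where \<open>*\<close> is the Cauchy product with
  respect to the bilinear map \<open>\<otimes>\<close> over \<open>k\<close>, taken modulo \<open>h^n\<close>.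
\<close>

lemma h_lift_tensor: "h_lift k n QT NT \<iota>T"
proof (rule h_lift.intro)
  show "Module.module k QT" "Module.module KK NT" by (rule QT NT)+
  note iT = tensor_iota_module_maps
  show ia: "\<iota>T \<in> additive_maps QT NT"
    using iT by (auto simp: module_maps_def additive_maps_def restrict_scalars_simps)
  show "\<iota>T (c \<odot>\<^bsub>QT\<^esub> q) = const_coeff k c \<odot>\<^bsub>NT\<^esub> \<iota>T q" if "c \<in> carrier k" "q \<in> carrier QT" for c q
    using module_maps_smult[OF iT that] by (simp add: restrict_scalars_simps)
  note hm = h_mult_module_maps[OF NT L1.hv]
  note hmc = module_maps_closed[OF hm]
  note p = tensor_pure_bilinear[OF lift_modules(1,2)]
  show "\<exists>q\<in>carrier QT. \<exists>w\<in>carrier NT. z = \<iota>T q \<oplus>\<^bsub>NT\<^esub> h_mult k NT (Suc 0) w" if "z \<in> carrier NT" for z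
    using that
  proof (induction rule: tensor_induct[OF lift_modules(1,2), consumes 1, case_names zero pure add])
    case zero
    have "\<zero>\<^bsub>NT\<^esub> = \<iota>T \<zero>\<^bsub>QT\<^esub> \<oplus>\<^bsub>NT\<^esub> h_mult k NT (Suc 0) \<zero>\<^bsub>NT\<^esub>"
      using module_maps_zero[OF QT RT iT] by (simp add: restrict_scalars_simps module_maps_zero[OF NT NT hm])
    thus ?case by blast
  next
    case (pure x y)
    obtain q1 w1 where q1: "q1 \<in> carrier Q1" "w1 \<in> carrier N1" "x = \<iota>1 q1 \<oplus>\<^bsub>N1\<^esub> h_mult k N1 (Suc 0) w1"
      using L1.generated[OF pure(1)] by blast
    obtain q2 w2 where q2: "q2 \<in> carrier Q2" "w2 \<in> carrier N2" "y = \<iota>2 q2 \<oplus>\<^bsub>N2\<^esub> h_mult k N2 (Suc 0) w2"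
      using L2.generated[OF pure(2)] by blast
    note c = q1(1,2) q2(1,2) L1.iota_closed L2.iota_closed L1.hm_closed L2.hm_closed bilinear_maps_closed[OF p]
    let ?p = "tensor_pure KK N1 N2"
    let ?w = "?p (\<iota>1 q1) w2 \<oplus>\<^bsub>NT\<^esub> ?p w1 y"
    have y: "y \<in> carrier N2" by (rule pure)
    have "?p x y = ?p (\<iota>1 q1) y \<oplus>\<^bsub>NT\<^esub> ?p (h_mult k N1 (Suc 0) w1) y"
      unfolding q1(3) by (rule module_maps_add[OF bilinear_maps_left[OF p y]]) (simp_all add: c)
    also have "?p (h_mult k N1 (Suc 0) w1) y = h_mult k NT (Suc 0) (?p w1 y)"
      by (rule h_mult_linear[OF lift_modules(1) L1.hv bilinear_maps_left[OF p y] q1(2)])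
    also have "?p (\<iota>1 q1) y = ?p (\<iota>1 q1) (\<iota>2 q2) \<oplus>\<^bsub>NT\<^esub> ?p (\<iota>1 q1) (h_mult k N2 (Suc 0) w2)"
      unfolding q2(3) by (rule module_maps_add[OF bilinear_maps_right[OF p]]) (simp_all add: c)
    also have "?p (\<iota>1 q1) (h_mult k N2 (Suc 0) w2) = h_mult k NT (Suc 0) (?p (\<iota>1 q1) w2)"
      by (rule h_mult_linear[OF lift_modules(2) L1.hv bilinear_maps_right[OF p] q2(2)]) (simp add: c)
    also have "?p (\<iota>1 q1) (\<iota>2 q2) = \<iota>T (tensor_pure k Q1 Q2 q1 q2)"
      by (rule tensor_iota_pure[symmetric]) (rule c)+
    finally have "?p x y = \<iota>T (tensor_pure k Q1 Q2 q1 q2) \<oplus>\<^bsub>NT\<^esub> h_mult k NT (Suc 0) ?w"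
      using c y additive_maps_closed[OF ia tensor_pure_closed[OF lift_modules(3,4) q1(1) q2(1)]]
      by (simp add: module_maps_add[OF hm] hmc NT.a_assoc)
    moreover have "?w \<in> carrier NT" using c y by simp
    moreover have "tensor_pure k Q1 Q2 q1 q2 \<in> carrier QT" by (rule tensor_pure_closed[OF lift_modules(3,4) q1(1) q2(1)])
    ultimately show ?case by blast
  next
    case (add s t)
    obtain q1 w1 where q1: "q1 \<in> carrier QT" "w1 \<in> carrier NT" "s = \<iota>T q1 \<oplus>\<^bsub>NT\<^esub> h_mult k NT (Suc 0) w1"
      using add(3) by blast
    obtain q2 w2 where q2: "q2 \<in> carrier QT" "w2 \<in> carrier NT" "t = \<iota>T q2 \<oplus>\<^bsub>NT\<^esub> h_mult k NT (Suc 0) w2"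
      using add(4) by blast
    have "s \<oplus>\<^bsub>NT\<^esub> t = \<iota>T (q1 \<oplus>\<^bsub>QT\<^esub> q2) \<oplus>\<^bsub>NT\<^esub> h_mult k NT (Suc 0) (w1 \<oplus>\<^bsub>NT\<^esub> w2)"
      using q1 q2 additive_maps_closed[OF ia]
      by (simp add: additive_maps_add[OF ia] module_maps_add[OF hm] hmc NT.a_ac)
    thus ?case using q1 q2 QT.a_closed NT.a_closed by blast
  qed
  let ?Q1 = "power_series_module Q1" and ?Q2 = "power_series_module Q2" and ?QT = "power_series_module QT"
  obtain \<theta>1 where t1: "\<theta>1 \<in> module_maps KK N1 (hadic_quot KK (hvar k) ?Q1 n)"
    "\<And>q. q \<in> carrier Q1 \<Longrightarrow> \<theta>1 (\<iota>1 q) = base_lift k n Q1 q" using L1.retraction by blast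
  obtain \<theta>2 where t2: "\<theta>2 \<in> module_maps KK N2 (hadic_quot KK (hvar k) ?Q2 n)"
    "\<And>q. q \<in> carrier Q2 \<Longrightarrow> \<theta>2 (\<iota>2 q) = base_lift k n Q2 q" using L2.retraction by blast
  note P = power_series_module_module[OF lift_modules(3) L1.K_cring] power_series_module_module[OF lift_modules(4) L1.K_cring]
    power_series_module_module[OF QT L1.K_cring]
  note pb = tensor_pure_bilinear[OF lift_modules(3,4)]
  let ?B = "quot_bilinear KK (hvar k) ?QT n (conv QT (tensor_pure k Q1 Q2))"
  have cv: "conv QT (tensor_pure k Q1 Q2) \<in> bilinear_maps KK ?Q1 ?Q2 ?QT"
    by (rule conv_bilinear[OF L1.K_cring lift_modules(3,4) QT pb])
  have B: "?B \<in> bilinear_maps KK (hadic_quot KK (hvar k) ?Q1 n) (hadic_quot KK (hvar k) ?Q2 n) (hadic_quot KK (hvar k) ?QT n)"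
    by (rule quot_bilinear_maps[OF P L1.hv cv])
  have Bt: "(\<lambda>u v. ?B (\<theta>1 u) (\<theta>2 v)) \<in> bilinear_maps KK N1 N2 (hadic_quot KK (hvar k) ?QT n)"
    by (rule bilinear_maps_comp[OF B t1(1) t2(1)])
  note HQ = hadic_quot_module[OF P(3) L1.hv]
  let ?\<theta> = "tensor_lift KK (hadic_quot KK (hvar k) ?QT n) (\<lambda>u v. ?B (\<theta>1 u) (\<theta>2 v))"
  have th: "?\<theta> \<in> module_maps KK NT (hadic_quot KK (hvar k) ?QT n)"
    by (rule tensor_lift_module_maps[OF lift_modules(1,2) HQ Bt])
  interpret LB: h_lift k n QT "hadic_quot KK (hvar k) ?QT n" "base_lift k n QT"
    by (rule h_lift_base[OF QT L1.K_cring])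
  interpret HQ: Module.module KK "hadic_quot KK (hvar k) ?QT n" by (rule HQ)
  have "?\<theta> (\<iota>T q) = base_lift k n QT q" if "q \<in> carrier QT" for q
    using that
  proof (induction rule: tensor_induct[OF lift_modules(3,4), consumes 1, case_names zero pure add])
    case zero
    interpret \<iota>T: abelian_group_hom QT NT \<iota>T
      by (rule additive_maps_hom) (fact ia QT.abelian_group_axioms NT.abelian_group_axioms)+
    interpret b: abelian_group_hom QT "hadic_quot KK (hvar k) ?QT n" "base_lift k n QT"
      by (rule additive_maps_hom) (fact LB.iota_additive QT.abelian_group_axioms HQ.abelian_group_axioms)+
    show ?case by (simp add: module_maps_zero[OF NT HQ th])
  next
    case (pure x y)
    note cx = const_coeff_closed[OF lift_modules(3) pure(1)] const_coeff_closed[OF lift_modules(4) pure(2)]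
    have "?\<theta> (\<iota>T (tensor_pure k Q1 Q2 x y)) = ?B (base_lift k n Q1 x) (base_lift k n Q2 y)"
      using pure by (simp add: tensor_iota_pure tensor_lift_pure[OF lift_modules(1,2) HQ Bt] L1.iota_closed L2.iota_closed t1(2) t2(2))
    also have "\<dots> = base_lift k n QT (tensor_pure k Q1 Q2 x y)"
      unfolding base_lift_def
      by (simp add: quot_bilinear_coset[OF P L1.hv cv cx] conv_const[OF QT lift_modules(3,4) pb pure])
    finally show ?case .
  next
    case (add s t)
    thus ?case
      by (simp add: additive_maps_add[OF ia] module_maps_add[OF th] additive_maps_closed[OF ia]
          additive_maps_add[OF LB.iota_additive])
  qed
  thus "\<exists>\<theta>\<in>module_maps KK NT (hadic_quot KK (hvar k) ?QT n). \<forall>q\<in>carrier QT. \<theta> (\<iota>T q) = base_lift k n QT q"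
    using th by blast
qed

interpretation LT: h_lift k n QT NT \<iota>T by (rule h_lift_tensor)

lemma symbol_pure:
  assumes z: "has_symbol k N1 \<iota>1 i z p" and y: "has_symbol k N2 \<iota>2 j y q"
    and p: "p \<in> carrier Q1" and q: "q \<in> carrier Q2"
  shows "has_symbol k NT \<iota>T (i + j) (tensor_pure KK N1 N2 z y) (tensor_pure k Q1 Q2 p q)"
proof -
  note b = tensor_pure_bilinear[OF lift_modules(1,2)]
  note c = tensor_pure_closed[OF lift_modules(3,4)]
  have yc: "y \<in> carrier N2" by (rule L2.symbol_closed[OF y q])
  have 1: "has_symbol k NT \<iota>T j (tensor_pure KK N1 N2 (\<iota>1 p) y) (tensor_pure k Q1 Q2 p q)" if p: "p \<in> carrier Q1" for p
    using symbol_map[OF l2 h_lift_tensor bilinear_maps_right[OF b L1.iota_closed[OF p]], of "tensor_pure k Q1 Q2 p" 0 j y q]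
      c p q y LT.symbol_iota by (simp add: tensor_iota_pure[symmetric])
  show ?thesis
    by (rule symbol_map[OF l1 h_lift_tensor bilinear_maps_left[OF b yc] _ 1 z p]) (rule c[OF _ q])
qed

lemma symbol_tensor_mapI:
  assumes l': "h_lift k n Q' N' \<iota>'"
    and F: "F \<in> module_maps KK NT N'" and G: "G \<in> module_maps k QT Q'"
    and FG: "\<And>p q. \<lbrakk>p \<in> carrier Q1; q \<in> carrier Q2\<rbrakk> \<Longrightarrow>
      has_symbol k N' \<iota>' e (F (tensor_pure KK N1 N2 (\<iota>1 p) (\<iota>2 q))) (G (tensor_pure k Q1 Q2 p q))"
    and z: "has_symbol k NT \<iota>T i z x" and x: "x \<in> carrier QT"
  shows "has_symbol k N' \<iota>' (i + e) (F z) (G x)"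
proof (rule symbol_map[OF h_lift_tensor l' F module_maps_closed[OF G] _ z x])
  interpret L': h_lift k n Q' N' \<iota>' by (rule l')
  fix x assume "x \<in> carrier QT"
  thus "has_symbol k N' \<iota>' e (F (\<iota>T x)) (G x)"
  proof (induction rule: tensor_induct[OF lift_modules(3,4), consumes 1, case_names zero pure add])
    case zero
    interpret \<iota>T: abelian_group_hom QT NT \<iota>T
      by (rule additive_maps_hom) (fact LT.iota_additive QT.abelian_group_axioms NT.abelian_group_axioms)+
    show ?case
      by (simp add: module_maps_zero[OF NT L'.N_module F] module_maps_zero[OF QT L'.Q_module G] L'.symbol_zero)
  next
    case (pure p q)
    thus ?case by (simp add: tensor_iota_pure FG)
  next
    case (add s t)
    thus ?case
      by (simp add: additive_maps_add[OF LT.iota_additive] module_maps_add[OF F] module_maps_add[OF G]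
          L'.symbol_add LT.iota_closed module_maps_closed[OF G])
  qed
qed

end

lemma symbol_tensor_map:
  assumes l1: "h_lift k n Q1 N1 \<iota>1" and l2: "h_lift k n Q2 N2 \<iota>2"
    and l1': "h_lift k n Q1' N1' \<iota>1'" and l2': "h_lift k n Q2' N2' \<iota>2'"
    and f: "f \<in> module_maps (power_series_ring k) N1 N1'" and f': "f' \<in> module_maps k Q1 Q1'"
    and ff': "\<And>p. p \<in> carrier Q1 \<Longrightarrow> has_symbol k N1' \<iota>1' e1 (f (\<iota>1 p)) (f' p)"
    and g: "g \<in> module_maps (power_series_ring k) N2 N2'" and g': "g' \<in> module_maps k Q2 Q2'"
    and gg': "\<And>p. p \<in> carrier Q2 \<Longrightarrow> has_symbol k N2' \<iota>2' e2 (g (\<iota>2 p)) (g' p)"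
    and z: "has_symbol k (tensor (power_series_ring k) N1 N2) (tensor_iota k N1 N2 \<iota>1 \<iota>2) i z x"
    and x: "x \<in> carrier (tensor k Q1 Q2)"
  shows "has_symbol k (tensor (power_series_ring k) N1' N2') (tensor_iota k N1' N2' \<iota>1' \<iota>2') (i + (e1 + e2))
    (tensor_map (power_series_ring k) N1' N2' f g z) (tensor_map k Q1' Q2' f' g' x)"
proof (rule symbol_tensor_mapI[OF l1 l2 h_lift_tensor[OF l1' l2'] _ _ _ z x])
  interpret L1: h_lift k n Q1 N1 \<iota>1 by (rule l1)
  interpret L2: h_lift k n Q2 N2 \<iota>2 by (rule l2)
  interpret L1': h_lift k n Q1' N1' \<iota>1' by (rule l1')
  interpret L2': h_lift k n Q2' N2' \<iota>2' by (rule l2')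
  note nm = L1.N_module L2.N_module L1'.N_module L2'.N_module and qm = L1.Q_module L2.Q_module L1'.Q_module L2'.Q_module
  show "tensor_map (power_series_ring k) N1' N2' f g \<in> module_maps (power_series_ring k)
      (tensor (power_series_ring k) N1 N2) (tensor (power_series_ring k) N1' N2')"
    by (rule tensor_map_module_maps[OF nm f g])
  show "tensor_map k Q1' Q2' f' g' \<in> module_maps k (tensor k Q1 Q2) (tensor k Q1' Q2')"
    by (rule tensor_map_module_maps[OF qm f' g'])
  fix p q assume pq: "p \<in> carrier Q1" "q \<in> carrier Q2"
  show "has_symbol k (tensor (power_series_ring k) N1' N2') (tensor_iota k N1' N2' \<iota>1' \<iota>2') (e1 + e2)
     (tensor_map (power_series_ring k) N1' N2' f g (tensor_pure (power_series_ring k) N1 N2 (\<iota>1 p) (\<iota>2 q)))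
     (tensor_map k Q1' Q2' f' g' (tensor_pure k Q1 Q2 p q))"
    unfolding tensor_map_pure[OF nm f g L1.iota_closed[OF pq(1)] L2.iota_closed[OF pq(2)]] tensor_map_pure[OF qm f' g' pq]
    by (rule symbol_pure[OF l1' l2' ff'[OF pq(1)] gg'[OF pq(2)] module_maps_closed[OF f' pq(1)] module_maps_closed[OF g' pq(2)]])
qed

text \<open>
  Induction over the Horner form.  The two polynomials are shortened simultaneously, because the
  coefficients of \<open>q\<close> can vanish where those of \<open>p\<close> do not.
\<close>

lemma symbol_subst_neg:
  assumes l: "h_lift k n Q N \<iota>" and D: "D \<in> module_maps (power_series_ring k) N N" and D': "D' \<in> module_maps k Q Q"
    and DD': "\<And>z q i. \<lbrakk>has_symbol k N \<iota> i z q; q \<in> carrier Q\<rbrakk> \<Longrightarrow> has_symbol k N \<iota> i (D z) (D' q)"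
    and p: "p \<in> up N" and q: "q \<in> up Q" and pq: "\<And>m. has_symbol k N \<iota> i (p m) (q m)"
  shows "has_symbol k N \<iota> i (subst_neg N D p m) (subst_neg Q D' q m)"
proof -
  interpret L: h_lift k n Q N \<iota> by (rule l)
  note N = L.N_module and Q = L.Q_module
  have main: "\<forall>m. has_symbol k N \<iota> i (subst_neg N D p m) (subst_neg Q D' q m)"
    if "p \<in> up N" "q \<in> up Q" "\<forall>m. has_symbol k N \<iota> i (p m) (q m)" "\<forall>j\<ge>b. p j = \<zero>\<^bsub>N\<^esub> \<and> q j = \<zero>\<^bsub>Q\<^esub>" for b p q
    using that
  proof (induction b arbitrary: p q)
    case 0
    hence "p = (\<lambda>n. \<zero>\<^bsub>N\<^esub>)" "q = (\<lambda>n. \<zero>\<^bsub>Q\<^esub>)" by auto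
    thus ?case by (simp add: subst_neg_zero[OF N D] subst_neg_zero[OF Q D'] L.symbol_zero)
  next
    case (Suc b)
    define p' where "p' = (\<lambda>n. p (Suc n))"
    define q' where "q' = (\<lambda>n. q (Suc n))"
    have p': "p' \<in> up N" using Suc.prems(1) unfolding up_iff p'_def by (meson le_SucI)
    have q': "q' \<in> up Q" using Suc.prems(2) unfolding up_iff q'_def by (meson le_SucI)
    have pc: "p = horner_cons (p 0) p'" "q = horner_cons (q 0) q'"
      by (auto simp: p'_def q'_def horner_cons_def fun_eq_iff split: nat.splits)
    have IH: "has_symbol k N \<iota> i (subst_neg N D p' m) (subst_neg Q D' q' m)" for m
      using Suc.IH[OF p' q'] Suc.prems(3,4) by (auto simp: p'_def q'_def)
    note pu = upD[OF subst_neg_up[OF N D p']] and qu = upD[OF subst_neg_up[OF Q D' q']]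
    have t: "has_symbol k N \<iota> i (times_lambda N (subst_neg N D p') m) (times_lambda Q (subst_neg Q D' q') m)" for m
      by (rule L.symbol_times_lambda[OF IH])
    have tq: "times_lambda Q (subst_neg Q D' q') m \<in> carrier Q" for m
      by (rule upD[OF up_times_lambda[OF Q subst_neg_up[OF Q D' q']]])
    interpret QQ: Module.module k Q by (rule Q)
    have nl: "has_symbol k N \<iota> i (neg_lambda_D N D (subst_neg N D p') m) (neg_lambda_D Q D' (subst_neg Q D' q') m)" for m
      unfolding neg_lambda_D_def
      by (intro L.symbol_minus L.symbol_neg t DD' IH qu tq QQ.a_inv_closed module_maps_closed[OF D'])
    have c: "has_symbol k N \<iota> i (const_coeff N (p 0) m) (const_coeff Q (q 0) m)" for m
      using Suc.prems(3) L.symbol_zero by (auto simp: const_coeff_def)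
    have cq: "const_coeff Q (q 0) m \<in> carrier Q" for m using upD[OF Suc.prems(2)] by (auto simp: const_coeff_def)
    have s1: "subst_neg N D p m = const_coeff N (p 0) m \<oplus>\<^bsub>N\<^esub> neg_lambda_D N D (subst_neg N D p') m" for m
      by (subst pc(1)) (rule subst_neg_cons[OF N D upD[OF Suc.prems(1)] p'])
    have s2: "subst_neg Q D' q m = const_coeff Q (q 0) m \<oplus>\<^bsub>Q\<^esub> neg_lambda_D Q D' (subst_neg Q D' q') m" for m
      by (subst pc(2)) (rule subst_neg_cons[OF Q D' upD[OF Suc.prems(2)] q'])
    show ?case
      unfolding s1 s2
      by (intro allI L.symbol_add c nl cq upD[OF neg_lambda_D_up[OF Q D' subst_neg_up[OF Q D' q']]])
  qed
  obtain b1 where b1: "\<forall>j\<ge>b1. p j = \<zero>\<^bsub>N\<^esub>" using p by (auto simp: up_iff)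
  obtain b2 where b2: "\<forall>j\<ge>b2. q j = \<zero>\<^bsub>Q\<^esub>" using q by (auto simp: up_iff)
  have "\<forall>j\<ge>max b1 b2. p j = \<zero>\<^bsub>N\<^esub> \<and> q j = \<zero>\<^bsub>Q\<^esub>" using b1 b2 by simp
  from main[OF p q _ this] pq show ?thesis by blast
qed

lemma tensor_flip_iota:
  assumes l: "h_lift k n P N \<iota>" and x: "x \<in> carrier (tensor k P P)"
  shows "tensor_flip (power_series_ring k) N (tensor_iota k N N \<iota> \<iota> x) = tensor_iota k N N \<iota> \<iota> (tensor_flip k P x)"
  using x
proof (induction rule: tensor_induct[OF h_lift.Q_module[OF l] h_lift.Q_module[OF l], consumes 1, case_names zero pure add])
  interpret L: h_lift k n P N \<iota> by (rule l)
  interpret T: h_lift k n "tensor k P P" "tensor (power_series_ring k) N N" "tensor_iota k N N \<iota> \<iota>"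
    by (rule h_lift_tensor[OF l l])
  interpret QT: Module.module k "tensor k P P" by (rule T.Q_module)
  interpret NT: Module.module "power_series_ring k" "tensor (power_series_ring k) N N" by (rule T.N_module)
  interpret \<iota>T: abelian_group_hom "tensor k P P" "tensor (power_series_ring k) N N" "tensor_iota k N N \<iota> \<iota>"
    by (rule additive_maps_hom) (fact T.iota_additive QT.abelian_group_axioms NT.abelian_group_axioms)+
  note fN = tensor_flip_module_maps[OF L.N_module] and fP = tensor_flip_module_maps[OF L.Q_module]
  {
    case zero
    show ?case by (simp add: module_maps_zero[OF T.N_module T.N_module fN] module_maps_zero[OF T.Q_module T.Q_module fP])
  next
    case (pure p q)
    thus ?case by (simp add: tensor_iota_pure[OF l l] tensor_flip_pure[OF L.Q_module] tensor_flip_pure[OF L.N_module] L.iota_closed)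
  next
    case (add s t)
    thus ?case by (simp add: module_maps_add[OF fN] module_maps_add[OF fP] module_maps_closed[OF fP])
  }
qed

section \<open>Convergent series in the completion\<close>

text \<open>
  The negative in a structure that need not be a group is still determined when the equation for it
  has a unique solution.  This is applied to the completion.
\<close>

lemma a_inv_eqI:
  assumes "y \<in> carrier C" "x \<oplus>\<^bsub>C\<^esub> y = \<zero>\<^bsub>C\<^esub>" "y \<oplus>\<^bsub>C\<^esub> x = \<zero>\<^bsub>C\<^esub>"
    and "\<And>z. \<lbrakk>z \<in> carrier C; x \<oplus>\<^bsub>C\<^esub> z = \<zero>\<^bsub>C\<^esub>\<rbrakk> \<Longrightarrow> z = y"
  shows "\<ominus>\<^bsub>C\<^esub> x = y"
  unfolding a_inv_def m_inv_def
proof (rule the_equality)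
  fix z assume "z \<in> carrier (add_monoid C) \<and> x \<otimes>\<^bsub>add_monoid C\<^esub> z = \<one>\<^bsub>add_monoid C\<^esub>
    \<and> z \<otimes>\<^bsub>add_monoid C\<^esub> x = \<one>\<^bsub>add_monoid C\<^esub>"
  thus "z = y" by (intro assms(4)) simp_all
qed (simp add: assms(1-3))

text \<open>
  The element \<open>\<Sum> h^i x\<^sub>i\<close> of the completion; modulo \<open>h^n\<close> it is given by a partial sum.
\<close>

definition hadic_series :: "('r, 's) ring_scheme \<Rightarrow> 'r \<Rightarrow> ('r, 'a) module \<Rightarrow> (nat \<Rightarrow> 'a) \<Rightarrow> nat \<Rightarrow> 'a set" where
  "hadic_series R h M x n = hadic_coset R h M n (\<Oplus>\<^bsub>M\<^esub>i \<in> {..<n}. (h [^]\<^bsub>R\<^esub> i) \<odot>\<^bsub>M\<^esub> x i)"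

context
  fixes R :: "('r, 's) ring_scheme" and h :: 'r and M :: "('r, 'a) module"
  assumes M: "Module.module R M" and h: "h \<in> carrier R"
begin

interpretation M: Module.module R M by (fact M)

abbreviation (input) CC where "CC \<equiv> hadic_completion R h M"

lemma hpow: "h [^]\<^bsub>R\<^esub> (i::nat) \<in> carrier R" by (rule h_pow_closed[OF M h])

lemma partial_sum_closed:
  "(\<And>i. x i \<in> carrier M) \<Longrightarrow> (\<Oplus>\<^bsub>M\<^esub>i \<in> {..<n::nat}. (h [^]\<^bsub>R\<^esub> i) \<odot>\<^bsub>M\<^esub> x i) \<in> carrier M"
  by (rule M.finsum_closed) (auto simp: hpow)

lemma hadic_series_carrier:
  assumes x: "\<And>i. x i \<in> carrier M"
  shows "hadic_series R h M x \<in> carrier CC"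
proof -
  let ?S = "\<lambda>n::nat. \<Oplus>\<^bsub>M\<^esub>i \<in> {..<n}. (h [^]\<^bsub>R\<^esub> i) \<odot>\<^bsub>M\<^esub> x i"
  have S: "?S n \<in> carrier M" for n by (rule partial_sum_closed[OF x])
  have Suc: "?S (Suc n) = (h [^]\<^bsub>R\<^esub> n) \<odot>\<^bsub>M\<^esub> x n \<oplus>\<^bsub>M\<^esub> ?S n" for n
    by (simp add: lessThan_Suc M.finsum_insert hpow x)
  have "hadic_series R h M x (Suc n) \<subseteq> hadic_series R h M x n" for n
  proof
    fix z assume "z \<in> hadic_series R h M x (Suc n)"
    then obtain y where y: "y \<in> carrier M" "z = (h [^]\<^bsub>R\<^esub> Suc n) \<odot>\<^bsub>M\<^esub> y \<oplus>\<^bsub>M\<^esub> ?S (Suc n)"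
      by (auto simp: hadic_series_def hadic_coset_def hadic_sub_def a_r_coset_def')
    have "z = (h [^]\<^bsub>R\<^esub> n) \<odot>\<^bsub>M\<^esub> (h \<odot>\<^bsub>M\<^esub> y \<oplus>\<^bsub>M\<^esub> x n) \<oplus>\<^bsub>M\<^esub> ?S n"
      using y(1) h x S by (simp add: y(2) Suc M.smult_r_distr M.smult_assoc1 hpow M.a_assoc)
    moreover have "h \<odot>\<^bsub>M\<^esub> y \<oplus>\<^bsub>M\<^esub> x n \<in> carrier M" using y(1) h x by simp
    ultimately show "z \<in> hadic_series R h M x n"
      unfolding hadic_series_def hadic_coset_def hadic_sub_def a_r_coset_def' by blast
  qed
  moreover have "hadic_series R h M x n \<in> carrier (hadic_quot R h M n)" for n
    unfolding hadic_series_def by (rule module_maps_closed[OF hadic_coset_module_maps[OF M h] S])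
  ultimately show ?thesis by (simp add: hadic_completion_def)
qed

lemma hadic_series_map_linear:
  assumes N: "Module.module R N" and F: "F \<in> module_maps R M N" and x: "\<And>i. x i \<in> carrier M"
  shows "F (\<Oplus>\<^bsub>M\<^esub>i \<in> {..<n::nat}. (h [^]\<^bsub>R\<^esub> i) \<odot>\<^bsub>M\<^esub> x i) = (\<Oplus>\<^bsub>N\<^esub>i \<in> {..<n}. (h [^]\<^bsub>R\<^esub> i) \<odot>\<^bsub>N\<^esub> F (x i))"
proof -
  have "(\<lambda>i. (h [^]\<^bsub>R\<^esub> i) \<odot>\<^bsub>M\<^esub> x i) \<in> {..<n} \<rightarrow> carrier M" by (auto simp: hpow x)
  from module_maps_finsum[OF M N F this] show ?thesis by (simp add: module_maps_smult[OF F hpow x])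
qed

lemma hadic_series_add:
  assumes x: "\<And>i. x i \<in> carrier M" and y: "\<And>i. y i \<in> carrier M"
  shows "hadic_series R h M x \<oplus>\<^bsub>CC\<^esub> hadic_series R h M y = hadic_series R h M (\<lambda>i. x i \<oplus>\<^bsub>M\<^esub> y i)"
proof
  fix n
  have "(\<lambda>i. (h [^]\<^bsub>R\<^esub> i) \<odot>\<^bsub>M\<^esub> x i) \<in> {..<n} \<rightarrow> carrier M" "(\<lambda>i. (h [^]\<^bsub>R\<^esub> i) \<odot>\<^bsub>M\<^esub> y i) \<in> {..<n} \<rightarrow> carrier M"
    by (auto simp: hpow x y)
  from M.finsum_addf[OF this]
  show "(hadic_series R h M x \<oplus>\<^bsub>CC\<^esub> hadic_series R h M y) n = hadic_series R h M (\<lambda>i. x i \<oplus>\<^bsub>M\<^esub> y i) n"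
    using partial_sum_closed[OF x, where n=n] partial_sum_closed[OF y, where n=n]
    by (simp add: hadic_completion_def hadic_series_def module_maps_add[OF hadic_coset_module_maps[OF M h], symmetric]
        M.smult_r_distr hpow x y)
qed

lemma hadic_series_zero: "hadic_series R h M (\<lambda>i. \<zero>\<^bsub>M\<^esub>) = \<zero>\<^bsub>CC\<^esub>"
proof
  fix n :: nat
  have "(\<Oplus>\<^bsub>M\<^esub>i \<in> {..<n}. (h [^]\<^bsub>R\<^esub> i) \<odot>\<^bsub>M\<^esub> \<zero>\<^bsub>M\<^esub>) = \<zero>\<^bsub>M\<^esub>"
    by (rule M.add.finprod_one_eqI) (simp add: hpow)
  thus "hadic_series R h M (\<lambda>i. \<zero>\<^bsub>M\<^esub>) n = \<zero>\<^bsub>CC\<^esub> n"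
    by (simp add: hadic_series_def hadic_completion_def
        module_maps_zero[OF M hadic_quot_module[OF M h] hadic_coset_module_maps[OF M h]])
qed

lemma hadic_series_neg:
  assumes x: "\<And>i. x i \<in> carrier M"
  shows "\<ominus>\<^bsub>CC\<^esub> hadic_series R h M x = hadic_series R h M (\<lambda>i. \<ominus>\<^bsub>M\<^esub> x i)"
proof -
  let ?X = "hadic_series R h M x" and ?Y = "hadic_series R h M (\<lambda>i. \<ominus>\<^bsub>M\<^esub> x i)"
  have nx: "\<ominus>\<^bsub>M\<^esub> x i \<in> carrier M" for i by (simp add: x)
  have 1: "?Y \<in> carrier CC" by (rule hadic_series_carrier[OF nx])
  have 2: "?X \<oplus>\<^bsub>CC\<^esub> ?Y = \<zero>\<^bsub>CC\<^esub>" "?Y \<oplus>\<^bsub>CC\<^esub> ?X = \<zero>\<^bsub>CC\<^esub>"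
    by (simp_all add: hadic_series_add x M.r_neg M.l_neg hadic_series_zero)
  have uniq: "Z = ?Y" if Z: "Z \<in> carrier CC" "?X \<oplus>\<^bsub>CC\<^esub> Z = \<zero>\<^bsub>CC\<^esub>" for Z
  proof
    fix n
    interpret Qn: Module.module R "hadic_quot R h M n" by (rule hadic_quot_module[OF M h])
    have c: "?X n \<in> carrier (hadic_quot R h M n)" "?Y n \<in> carrier (hadic_quot R h M n)" "Z n \<in> carrier (hadic_quot R h M n)"
      using hadic_series_carrier[OF x] 1 Z(1) by (auto simp: hadic_completion_def)
    have "?X n \<oplus>\<^bsub>hadic_quot R h M n\<^esub> Z n = \<zero>\<^bsub>hadic_quot R h M n\<^esub>"
      "?X n \<oplus>\<^bsub>hadic_quot R h M n\<^esub> ?Y n = \<zero>\<^bsub>hadic_quot R h M n\<^esub>"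
      using fun_cong[OF Z(2), of n] fun_cong[OF 2(1), of n] by (simp_all add: hadic_completion_def)
    thus "Z n = ?Y n" using c by (metis Qn.a_comm Qn.minus_equality)
  qed
  show ?thesis by (rule a_inv_eqI[OF 1 2 uniq])
qed

text \<open>
  The factor \<open>h\<close> shifts the coefficients.  Modulo \<open>h^n\<close> the shifted partial sum has one more term than
  the definition prescribes, which is divisible by \<open>h^n\<close>.
\<close>

lemma hadic_series_smult:
  assumes x: "\<And>i. x i \<in> carrier M"
  shows "h \<odot>\<^bsub>CC\<^esub> hadic_series R h M x = hadic_series R h M (horner_cons \<zero>\<^bsub>M\<^esub> x)"
proof
  fix n
  note q = hadic_coset_module_maps[OF M h]
  let ?S = "\<Oplus>\<^bsub>M\<^esub>i \<in> {..<n}. (h [^]\<^bsub>R\<^esub> i) \<odot>\<^bsub>M\<^esub> x i"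
  let ?c = "hadic_coset R h M n"
  have hx: "horner_cons \<zero>\<^bsub>M\<^esub> x i \<in> carrier M" for i by (cases i) (auto simp: x)
  have S: "?S \<in> carrier M" by (rule partial_sum_closed[OF x])
  have "(h \<odot>\<^bsub>CC\<^esub> hadic_series R h M x) n = ?c (h \<odot>\<^bsub>M\<^esub> ?S)"
    using S by (simp add: hadic_completion_def hadic_series_def module_maps_smult[OF q h])
  also have "h \<odot>\<^bsub>M\<^esub> ?S = (\<Oplus>\<^bsub>M\<^esub>i \<in> {..<n}. (h [^]\<^bsub>R\<^esub> Suc i) \<odot>\<^bsub>M\<^esub> x i)"
  proof -
    have "(\<lambda>i. (h [^]\<^bsub>R\<^esub> i) \<odot>\<^bsub>M\<^esub> x i) \<in> {..<n} \<rightarrow> carrier M" by (auto simp: hpow x)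
    from module_maps_finsum[OF M M module_maps_smult_const[OF M h] this]
    show ?thesis by (simp add: M.smult_assoc1[symmetric] hpow x h M.R.m_comm)
  qed
  also have "?c \<dots> = ?c (\<Oplus>\<^bsub>M\<^esub>i \<in> {..<n}. (h [^]\<^bsub>R\<^esub> i) \<odot>\<^bsub>M\<^esub> horner_cons \<zero>\<^bsub>M\<^esub> x i)"
  proof (cases n)
    case (Suc m)
    let ?U = "\<Oplus>\<^bsub>M\<^esub>i \<in> {..<m}. (h [^]\<^bsub>R\<^esub> Suc i) \<odot>\<^bsub>M\<^esub> x i"
    have U: "?U \<in> carrier M" by (rule M.finsum_closed) (use hpow x h in \<open>auto simp del: M.R.nat_pow_Suc\<close>)
    have "(\<Oplus>\<^bsub>M\<^esub>i \<in> {..<n}. (h [^]\<^bsub>R\<^esub> Suc i) \<odot>\<^bsub>M\<^esub> x i) = (h [^]\<^bsub>R\<^esub> n) \<odot>\<^bsub>M\<^esub> x m \<oplus>\<^bsub>M\<^esub> ?U"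
      unfolding Suc lessThan_Suc by (rule M.finsum_insert) (use hpow x h in \<open>auto simp del: M.R.nat_pow_Suc\<close>)
    hence "?c (\<Oplus>\<^bsub>M\<^esub>i \<in> {..<n}. (h [^]\<^bsub>R\<^esub> Suc i) \<odot>\<^bsub>M\<^esub> x i) = ?c ?U"
      using U module_maps_closed[OF q U]
      by (simp add: module_maps_add[OF q] hpow x hadic_coset_h_pow[OF M h] Module.module.axioms
          abelian_monoid.l_zero[OF abelian_group.axioms(1)[OF Module.module.axioms(2)[OF hadic_quot_module[OF M h]]]] del: M.R.nat_pow_Suc)
    also have "?U = (\<Oplus>\<^bsub>M\<^esub>i \<in> {..<n}. (h [^]\<^bsub>R\<^esub> i) \<odot>\<^bsub>M\<^esub> horner_cons \<zero>\<^bsub>M\<^esub> x i)"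
    proof -
      have "(\<Oplus>\<^bsub>M\<^esub>i \<in> {..<Suc m}. (h [^]\<^bsub>R\<^esub> i) \<odot>\<^bsub>M\<^esub> horner_cons \<zero>\<^bsub>M\<^esub> x i) = ?U"
      proof (cases m)
        case 0
        show ?thesis by (simp add: 0 lessThan_Suc M.finsum_insert)
      next
        case (Suc l)
        have "(\<Oplus>\<^bsub>M\<^esub>i \<in> {..Suc l}. (h [^]\<^bsub>R\<^esub> i) \<odot>\<^bsub>M\<^esub> horner_cons \<zero>\<^bsub>M\<^esub> x i)
          = (\<Oplus>\<^bsub>M\<^esub>i \<in> {..l}. (h [^]\<^bsub>R\<^esub> Suc i) \<odot>\<^bsub>M\<^esub> horner_cons \<zero>\<^bsub>M\<^esub> x (Suc i)) \<oplus>\<^bsub>M\<^esub> (h [^]\<^bsub>R\<^esub> (0::nat)) \<odot>\<^bsub>M\<^esub> horner_cons \<zero>\<^bsub>M\<^esub> x 0"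
          by (rule M.finsum_Suc2) (auto simp: hpow hx simp del: M.R.nat_pow_Suc)
        thus ?thesis using U by (simp add: Suc lessThan_Suc_atMost del: M.R.nat_pow_Suc)
      qed
      thus ?thesis by (simp add: Suc)
    qed
    finally show ?thesis .
  qed simp
  finally show "(h \<odot>\<^bsub>CC\<^esub> hadic_series R h M x) n = hadic_series R h M (horner_cons \<zero>\<^bsub>M\<^esub> x) n"
    unfolding hadic_series_def[where x="horner_cons \<zero>\<^bsub>M\<^esub> x"] .
qed

lemma completion_map_series:
  assumes F: "F \<in> module_maps R M M" and x: "\<And>i. x i \<in> carrier M"
  shows "completion_map R h M F (hadic_series R h M x) = hadic_series R h M (\<lambda>i. F (x i))"
  by (rule ext) (simp add: completion_map_def hadic_series_def quot_map_coset[OF M M h F partial_sum_closed[OF x]]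
      hadic_series_map_linear[OF M F x])

end

section \<open>The commutators of a formal deformation\<close>

context conformal_formal_deformation
begin

lemmas P_module = module_axioms
lemmas Ph_module = hadic.module_axioms
lemmas K_cring = hadic.is_cring

text \<open>
  By commutativity the constant terms of \<open>a \<circ>\<^sub>\<lambda> b\<close> and \<open>b \<circ>\<^sub>-\<^sub>\<lambda>\<^sub>-\<^sub>\<partial> a\<close> cancel; the quotient by \<open>h\<close> is
  obtained by shifting the remaining coefficients.
\<close>

lemma commutator_divisible:
  assumes br: "\<And>a b n. br a b n = \<mu> 1 a b n \<ominus>\<^bsub>P\<^esub> subst_neg P D (\<mu> 1 b a) n"
    and a: "a \<in> carrier P" and b: "b \<in> carrier P"
  shows "\<exists>y \<in> carrier (power_series_module P).
    hadic_commutator P D mulh (const_coeff P a) (const_coeff P b) n = hvar k \<odot>\<^bsub>power_series_module P\<^esub> y \<and> y 0 = br a b n"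
proof -
  define y where "y = (\<lambda>i. \<mu> (Suc i) a b n \<ominus>\<^bsub>P\<^esub> subst_neg P D (\<mu> (Suc i) b a) n)"
  have mu: "\<mu> (Suc i) a b \<in> up P" "\<mu> (Suc i) b a \<in> up P" for i using mu_polynomial[of "Suc i"] a b by auto
  have y: "y \<in> carrier (power_series_module P)"
    using upD[OF mu(1)] upD[OF subst_neg_up[OF P_module D_linear mu(2)]]
    by (auto simp: power_series_module_simps[OF P_module] y_def)
  have c: "mul a b n \<in> carrier P" by (rule f_closed[OF a b])
  have e: "(\<lambda>m. mulh (const_coeff P b) (const_coeff P a) m i) = (if i = 0 then mul b a else \<mu> i b a)" for i
    by (auto simp: product_expansion[OF b a])
  have "hadic_commutator P D mulh (const_coeff P a) (const_coeff P b) n = hvar k \<odot>\<^bsub>power_series_module P\<^esub> y"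
  proof
    fix i
    show "hadic_commutator P D mulh (const_coeff P a) (const_coeff P b) n i = (hvar k \<odot>\<^bsub>power_series_module P\<^esub> y) i"
      unfolding hvar_smult[OF P_module y]
      by (cases i) (simp_all add: hadic_commutator_def e product_expansion[OF a b] comm[OF a b, symmetric] M.minus_eq M.r_neg c y_def)
  qed
  moreover have "y 0 = br a b n" by (simp add: y_def br)
  ultimately show ?thesis using y by blast
qed

text \<open>
  The flip acts termwise on the series of \<open>\<Delta>h a\<close>, because the embedding of \<open>P \<otimes> P\<close> commutes with flips;
  the constant terms cancel by cocommutativity.
\<close>

lemma cocommutator_divisible:
  assumes \<delta>: "\<And>a. \<delta> a = \<Delta>s 1 a \<ominus>\<^bsub>tensor k P P\<^esub> tensor_flip k P (\<Delta>s 1 a)"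
    and a: "a \<in> carrier P"
  defines "K \<equiv> power_series_ring k" and "Ph \<equiv> power_series_module P"
  defines "T \<equiv> tensor K Ph Ph"
  defines "C \<equiv> hadic_completion K (hvar k) T"
  shows "\<exists>y \<in> carrier C.
    hadic_cocommutator K (hvar k) Ph \<Delta>h (const_coeff P a) = hvar k \<odot>\<^bsub>C\<^esub> y \<and>
    y 1 = hadic_coset K (hvar k) T 1 (tensor_embed k P (\<delta> a))"
proof -
  let ?PP = "tensor k P P" and ?h = "hvar k" and ?\<tau> = "tensor_flip k P" and ?e = "tensor_embed k P"
  have PhM: "Module.module K Ph" unfolding K_def Ph_def by (rule Ph_module)
  have T: "Module.module K T" unfolding T_def by (rule tensor_module[OF PhM PhM])
  interpret T: Module.module K T by (rule T)
  have PP: "Module.module k ?PP" by (rule tensor_module[OF P_module P_module])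
  interpret PP: Module.module k ?PP by (rule PP)
  have h: "?h \<in> carrier K" unfolding K_def by (rule hvar_closed[OF P_module])
  have lP: "h_lift k 0 P Ph (const_coeff P)" unfolding Ph_def by (rule h_lift_power_series[OF P_module K_cring])
  have lT: "h_lift k 0 ?PP T ?e" unfolding tensor_embed_eq T_def K_def Ph_def
    using h_lift_tensor[OF lP lP] by (simp add: Ph_def)
  interpret e: h_lift k 0 ?PP T ?e by (rule lT)
  interpret eh: abelian_group_hom ?PP T ?e
    by (rule additive_maps_hom) (fact e.iota_additive PP.abelian_group_axioms T.abelian_group_axioms)+
  note fP = tensor_flip_module_maps[OF P_module] and fT = tensor_flip_module_maps[OF PhM, folded T_def]
  have ef: "tensor_flip K Ph (?e x) = ?e (?\<tau> x)" if "x \<in> carrier ?PP" for x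
    using tensor_flip_iota[OF lP that] by (simp add: tensor_embed_eq K_def Ph_def)
  define X where "X i = (if i = 0 then \<Delta> a else \<Delta>s i a)" for i
  have X: "X i \<in> carrier ?PP" for i
    using module_maps_closed[OF coprod_linear a] module_maps_closed[OF coproduct.coprod_linear[OF coprods] a]
    by (auto simp: X_def)
  have fX: "?\<tau> (X i) \<in> carrier ?PP" for i by (rule module_maps_closed[OF fP X])
  have eX: "?e (X i) \<in> carrier T" "?e (?\<tau> (X i)) \<in> carrier T" for i by (simp_all add: X fX)
  have "\<Delta>h (const_coeff P a) = hadic_series K ?h T (\<lambda>i. ?e (X i))"
    by (rule ext) (simp add: coproduct_expansion[OF a] Let_def hadic_series_def X_def K_def Ph_def T_def)
  hence "hadic_cocommutator K ?h Ph \<Delta>h (const_coeff P a)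
      = hadic_series K ?h T (\<lambda>i. ?e (X i)) \<ominus>\<^bsub>C\<^esub> hadic_series K ?h T (\<lambda>i. ?e (?\<tau> (X i)))"
    using completion_map_series[OF T h fT eX(1)]
    by (simp add: hadic_cocommutator_def T_def[symmetric] C_def[symmetric] ef X)
  also have "\<dots> = hadic_series K ?h T (\<lambda>i. ?e (X i \<ominus>\<^bsub>?PP\<^esub> ?\<tau> (X i)))"
    using X fX eX by (simp add: a_minus_def C_def hadic_series_neg[OF T h] hadic_series_add[OF T h])
  also have "(\<lambda>i. ?e (X i \<ominus>\<^bsub>?PP\<^esub> ?\<tau> (X i))) = horner_cons \<zero>\<^bsub>T\<^esub> (\<lambda>i. ?e (X (Suc i) \<ominus>\<^bsub>?PP\<^esub> ?\<tau> (X (Suc i))))"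
  proof
    fix i
    have "X 0 \<ominus>\<^bsub>?PP\<^esub> ?\<tau> (X 0) = \<zero>\<^bsub>?PP\<^esub>"
      using cocomm[OF a] X[of 0] by (simp add: X_def PP.minus_eq PP.r_neg)
    thus "?e (X i \<ominus>\<^bsub>?PP\<^esub> ?\<tau> (X i)) = horner_cons \<zero>\<^bsub>T\<^esub> (\<lambda>i. ?e (X (Suc i) \<ominus>\<^bsub>?PP\<^esub> ?\<tau> (X (Suc i)))) i"
      by (cases i) simp_all
  qed
  also have "hadic_series K ?h T \<dots> = ?h \<odot>\<^bsub>C\<^esub> hadic_series K ?h T (\<lambda>i. ?e (X (Suc i) \<ominus>\<^bsub>?PP\<^esub> ?\<tau> (X (Suc i))))"
    unfolding C_def by (rule hadic_series_smult[OF T h, symmetric]) (simp add: X fX)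
  finally have 1: "hadic_cocommutator K ?h Ph \<Delta>h (const_coeff P a)
      = ?h \<odot>\<^bsub>C\<^esub> hadic_series K ?h T (\<lambda>i. ?e (X (Suc i) \<ominus>\<^bsub>?PP\<^esub> ?\<tau> (X (Suc i))))" .
  have 2: "hadic_series K ?h T (\<lambda>i. ?e (X (Suc i) \<ominus>\<^bsub>?PP\<^esub> ?\<tau> (X (Suc i)))) \<in> carrier C"
    unfolding C_def by (rule hadic_series_carrier[OF T h]) (simp add: X fX)
  have "{..<1::nat} = {0}" by auto
  hence 3: "hadic_series K ?h T (\<lambda>i. ?e (X (Suc i) \<ominus>\<^bsub>?PP\<^esub> ?\<tau> (X (Suc i)))) 1 = hadic_coset K ?h T 1 (?e (\<delta> a))"
    using X[of 1] fX[of 1] by (simp add: hadic_series_def T.finsum_insert \<delta> X_def)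
  show ?thesis using 1 2 3 by blast
qed

end

section \<open>Expansions up to second order\<close>

text \<open>
  The truncated expansion \<open>x + h y + h^2 z\<close>, by which elements of \<open>P[[h]] / h^3\<close> and of its tensor powers
  are described.
\<close>

definition h_expand :: "('k, 's) ring_scheme \<Rightarrow> (nat \<Rightarrow> 'k, 'n) module \<Rightarrow> ('q \<Rightarrow> 'n) \<Rightarrow> 'q \<Rightarrow> 'q \<Rightarrow> 'q \<Rightarrow> 'n" where
  "h_expand k N \<iota> x y z = \<iota> x \<oplus>\<^bsub>N\<^esub> h_mult k N (Suc 0) (\<iota> y) \<oplus>\<^bsub>N\<^esub> h_mult k N (Suc (Suc 0)) (\<iota> z)"

context h_lift
begin

interpretation Q: Module.module k Q by (rule Q_module)
interpretation N: Module.module "power_series_ring k" N by (rule N_module)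
interpretation \<iota>: abelian_group_hom Q N \<iota>
  by (rule additive_maps_hom) (fact iota_additive Q.abelian_group_axioms N.abelian_group_axioms)+

lemma h_iota_additive: "(\<lambda>q. h_mult k N i (\<iota> q)) \<in> additive_maps Q N"
  by (rule additive_maps_comp[OF iota_additive module_maps_additive[OF hm]])

lemma h_expand_closed: "\<lbrakk>x \<in> carrier Q; y \<in> carrier Q; z \<in> carrier Q\<rbrakk> \<Longrightarrow> h_expand k N \<iota> x y z \<in> carrier N"
  by (simp add: h_expand_def hm_closed)

lemma h_expand_minus:
  assumes "x \<in> carrier Q" "y \<in> carrier Q" "z \<in> carrier Q" "x' \<in> carrier Q" "y' \<in> carrier Q" "z' \<in> carrier Q"
  shows "h_expand k N \<iota> x y z \<ominus>\<^bsub>N\<^esub> h_expand k N \<iota> x' y' z'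
    = h_expand k N \<iota> (x \<ominus>\<^bsub>Q\<^esub> x') (y \<ominus>\<^bsub>Q\<^esub> y') (z \<ominus>\<^bsub>Q\<^esub> z')"
  using assms
  by (simp add: h_expand_def N.minus_eq Q.minus_eq N.minus_add hm_closed hm_add module_maps_neg[OF N_module N_module hm] N.a_ac)

lemma symbol_h_expand:
  assumes "x \<in> carrier Q" "y \<in> carrier Q" "z \<in> carrier Q"
  shows "has_symbol k N \<iota> 0 (h_expand k N \<iota> x y z) x"
    and "has_symbol k N \<iota> (Suc 0) (h_expand k N \<iota> \<zero>\<^bsub>Q\<^esub> y z) y"
proof -
  have z: "h_mult k N (Suc (Suc 0)) (\<iota> z) = h_mult k N (Suc 0) (h_mult k N (Suc 0) (\<iota> z))"
    using assms by (simp add: h_mult_h_mult[OF N_module hv])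
  show "has_symbol k N \<iota> 0 (h_expand k N \<iota> x y z) x"
    by (rule symbolI[of "\<iota> y \<oplus>\<^bsub>N\<^esub> h_mult k N (Suc 0) (\<iota> z)"])
      (use assms in \<open>simp_all add: h_expand_def z hm_closed hm_add h_mult_0[OF N_module hv] N.a_assoc\<close>)
  show "has_symbol k N \<iota> (Suc 0) (h_expand k N \<iota> \<zero>\<^bsub>Q\<^esub> y z) y"
    by (rule symbolI[of "\<iota> z"]) (use assms in \<open>simp_all add: h_expand_def hm_closed\<close>)
qed

lemma subst_neg_h_expand:
  assumes D: "D \<in> module_maps (power_series_ring k) N N" and D': "D' \<in> module_maps k Q Q"
    and comm: "\<And>q. q \<in> carrier Q \<Longrightarrow> D (\<iota> q) = \<iota> (D' q)"
    and p: "p \<in> up Q" and q: "q \<in> up Q" and r: "r \<in> up Q"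
  shows "subst_neg N D (\<lambda>m. h_expand k N \<iota> (p m) (q m) (r m)) m
    = h_expand k N \<iota> (subst_neg Q D' p m) (subst_neg Q D' q m) (subst_neg Q D' r m)"
proof -
  have u: "(\<lambda>m. h_mult k N i (\<iota> (s m))) \<in> up N" and
    s: "subst_neg N D (\<lambda>m. h_mult k N i (\<iota> (s m))) m = h_mult k N i (\<iota> (subst_neg Q D' s m))" if "s \<in> up Q" for s i
  proof -
    show "(\<lambda>m. h_mult k N i (\<iota> (s m))) \<in> up N" by (rule up_map[OF Q_module N_module h_iota_additive that])
    show "subst_neg N D (\<lambda>m. h_mult k N i (\<iota> (s m))) m = h_mult k N i (\<iota> (subst_neg Q D' s m))"
      by (rule subst_neg_map[OF Q_module D' N_module D h_iota_additive _ that])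
        (simp add: comm[symmetric] h_mult_linear[OF N_module hv D, symmetric])
  qed
  have u0: "(\<lambda>m. \<iota> (p m)) \<in> up N" by (rule up_map[OF Q_module N_module iota_additive p])
  have s0: "subst_neg N D (\<lambda>m. \<iota> (p m)) m = \<iota> (subst_neg Q D' p m)"
    by (rule subst_neg_map[OF Q_module D' N_module D iota_additive _ p]) (simp add: comm)
  show ?thesis
    unfolding h_expand_def
    by (subst subst_neg_add[OF N_module D up_add[OF N_module u0 u[OF q]] u[OF r]])
      (simp add: subst_neg_add[OF N_module D u0 u[OF q]] s0 s[OF q] s[OF r])
qed

end

lemma hadic_coset_expand:
  assumes P: "Module.module k P" and K: "cring (power_series_ring k)" and v: "v \<in> carrier (power_series_module P)"
  shows "hadic_coset (power_series_ring k) (hvar k) (power_series_module P) 3 v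
    = h_expand k (hadic_quot (power_series_ring k) (hvar k) (power_series_module P) 3) (base_lift k 3 P) (v 0) (v 1) (v 2)"
proof -
  let ?K = "power_series_ring k" and ?P = "power_series_module P"
  note Ph = power_series_module_module[OF P K] and hv = hvar_closed[OF P]
  interpret P: Module.module k P by (rule P)
  interpret Ph: Module.module ?K ?P by (rule Ph)
  interpret L: h_lift k 3 P ?P "const_coeff P" by (rule h_lift_power_series[OF P K])
  let ?c = "hadic_coset ?K (hvar k) ?P 3"
  note c = hadic_coset_module_maps[OF Ph hv, of 3]
  interpret Q: Module.module ?K "hadic_quot ?K (hvar k) ?P 3" by (rule hadic_quot_module[OF Ph hv])
  have vi: "v i \<in> carrier P" for i using v by (simp add: power_series_module_simps[OF P])
  define t where "t = (\<lambda>i. v (i + 3))"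
  have t: "t \<in> carrier ?P" using vi by (simp add: power_series_module_simps[OF P] t_def)
  have e: "h_expand k ?P (const_coeff P) (v 0) (v 1) (v 2) \<in> carrier ?P" by (rule L.h_expand_closed[OF vi vi vi])
  have "v = h_expand k ?P (const_coeff P) (v 0) (v 1) (v 2) \<oplus>\<^bsub>?P\<^esub> (hvar k [^]\<^bsub>?K\<^esub> (3::nat)) \<odot>\<^bsub>?P\<^esub> t"
  proof
    fix i :: nat
    have "i = 0 \<or> i = 1 \<or> i = 2 \<or> i \<ge> 3" by arith
    thus "v i = (h_expand k ?P (const_coeff P) (v 0) (v 1) (v 2) \<oplus>\<^bsub>?P\<^esub> (hvar k [^]\<^bsub>?K\<^esub> (3::nat)) \<odot>\<^bsub>?P\<^esub> t) i"
      unfolding h_expand_def h_mult_def power_series_module_simps(3)[OF P]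
        hvar_pow_smult[OF P K t] hvar_pow_smult[OF P K L.iota_closed[OF vi]]
      using vi by (elim disjE) (auto simp: const_coeff_def t_def numeral_2_eq_2)
  qed
  from arg_cong[OF this, of ?c] have "?c v = ?c (h_expand k ?P (const_coeff P) (v 0) (v 1) (v 2))"
    using e t module_maps_closed[OF c e] h_pow_closed[OF Ph hv]
    by (simp add: module_maps_add[OF c] hadic_coset_h_pow[OF Ph hv])
  also have "\<dots> = h_expand k (hadic_quot ?K (hvar k) ?P 3) (base_lift k 3 P) (v 0) (v 1) (v 2)"
    unfolding h_expand_def base_lift_def
    using vi by (simp add: module_maps_add[OF c] L.iota_closed L.hm_closed h_mult_linear[OF Ph hv c])
  finally show ?thesis .
qed

text \<open>
  A nonzero integer is a nonzero constant in \<open>k\<close>, and the inverse of a constant is a constant.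
\<close>

lemma power_series_rational_scalars:
  fixes P :: "('k, 'p) module"
  assumes P: "Module.module k P" and k: "Ring.field k" and K: "cring (power_series_ring k)"
    and char0: "\<And>n::nat. n > 0 \<Longrightarrow> add_pow k n \<one>\<^bsub>k\<^esub> \<noteq> \<zero>\<^bsub>k\<^esub>"
  shows "rational_scalars (power_series_ring k)"
proof -
  interpret k: Ring.field k by (rule k)
  interpret K: cring "power_series_ring k" by (rule K)
  note ks = power_series_ring_simps[OF P]
  have 1: "add_pow (power_series_ring k) n \<one>\<^bsub>power_series_ring k\<^esub> = const_coeff k (add_pow k n \<one>\<^bsub>k\<^esub>)" for n :: nat
  proof (induction n)
    case 0
    show ?case by (auto simp: ks const_coeff_def)
  next
    case (Suc n)
    have "add_pow (power_series_ring k) (Suc n) \<one>\<^bsub>power_series_ring k\<^esub>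
        = const_coeff k (add_pow k n \<one>\<^bsub>k\<^esub>) \<oplus>\<^bsub>power_series_ring k\<^esub> \<one>\<^bsub>power_series_ring k\<^esub>"
      using Suc by simp
    also have "\<dots> = const_coeff k (add_pow k (Suc n) \<one>\<^bsub>k\<^esub>)"
      by (auto simp: ks const_coeff_def)
    finally show ?case .
  qed
  have "add_pow (power_series_ring k) n \<one>\<^bsub>power_series_ring k\<^esub> \<in> Units (power_series_ring k)" if "n > 0" for n :: nat
  proof -
    let ?c = "add_pow k n \<one>\<^bsub>k\<^esub>"
    have c: "?c \<in> carrier k" by simp
    hence u: "?c \<in> Units k" using char0[OF that] by (simp add: k.field_Units)
    hence ic: "inv\<^bsub>k\<^esub> ?c \<in> carrier k" by simp
    have "const_coeff k (inv\<^bsub>k\<^esub> ?c) \<in> carrier (power_series_ring k)" "const_coeff k ?c \<in> carrier (power_series_ring k)"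
      using const_coeff_ring_closed[OF P] c ic by auto
    moreover have "const_coeff k (inv\<^bsub>k\<^esub> ?c) \<otimes>\<^bsub>power_series_ring k\<^esub> const_coeff k ?c = \<one>\<^bsub>power_series_ring k\<^esub>"
      "const_coeff k ?c \<otimes>\<^bsub>power_series_ring k\<^esub> const_coeff k (inv\<^bsub>k\<^esub> ?c) = \<one>\<^bsub>power_series_ring k\<^esub>"
      using u c ic by (simp_all add: const_coeff_mult[OF P] ks(3))
    ultimately show ?thesis unfolding 1 Units_def by blast
  qed
  thus ?thesis by (simp add: rational_scalars_def)
qed

section \<open>The deformed product modulo \<open>h^3\<close>\<close>

context conformal_formal_deformation
begin

\<comment> \<open>The modules \<open>Mq = P[[h]] / h^3\<close>, \<open>TM = Mq \<otimes> Mq\<close> and \<open>TM3\<close> over \<open>Kh = k[[h]]\<close> lift \<open>P\<close>, \<open>TP\<close> and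
  \<open>TP3\<close>, with embeddings \<open>\<iota>q\<close>, \<open>\<iota>2\<close>, \<open>\<iota>3\<close> and leading coefficients \<open>sym1\<close>, \<open>sym2\<close>, \<open>sym3\<close>.\<close>
abbreviation (input) "Kh \<equiv> power_series_ring k"
abbreviation (input) "Ph \<equiv> power_series_module P"
abbreviation (input) "Mq \<equiv> hadic_quot Kh (hvar k) Ph 3"
abbreviation (input) "Dq \<equiv> quot_map Kh (hvar k) Ph 3 (\<lambda>v n. D (v n))"
abbreviation (input) "mq \<equiv> quot_prod Kh (hvar k) Ph 3 mulh"
abbreviation (input) "cq \<equiv> quot_coprod Kh (hvar k) Ph 3 \<Delta>h"
abbreviation (input) "\<iota>q \<equiv> base_lift k 3 P"
abbreviation (input) "TP \<equiv> tensor k P P"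
abbreviation (input) "TM \<equiv> tensor Kh Mq Mq"
abbreviation (input) "\<iota>2 \<equiv> tensor_iota k Mq Mq \<iota>q \<iota>q"
abbreviation (input) "TP3 \<equiv> tensor k TP P"
abbreviation (input) "TM3 \<equiv> tensor Kh TM Mq"
abbreviation (input) "\<iota>3 \<equiv> tensor_iota k TM Mq \<iota>2 \<iota>q"
abbreviation (input) "sym1 \<equiv> has_symbol k Mq \<iota>q"
abbreviation (input) "sym2 \<equiv> has_symbol k TM \<iota>2"
abbreviation (input) "sym3 \<equiv> has_symbol k TM3 \<iota>3"

lemma quotient_ASI: "ASI_conformal_bialgebra Kh Mq Dq mq cq"
  by (rule hadic.hadic_quot_ASI)

lemma lift1: "h_lift k 3 P Mq \<iota>q" by (rule h_lift_base[OF P_module K_cring])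
lemma lift2: "h_lift k 3 TP TM \<iota>2" by (rule h_lift_tensor[OF lift1 lift1])
lemma lift3: "h_lift k 3 TP3 TM3 \<iota>3" by (rule h_lift_tensor[OF lift2 lift1])

interpretation q: ASI_conformal_bialgebra Kh Mq Dq mq cq by (rule quotient_ASI)
interpretation L1: h_lift k 3 P Mq \<iota>q by (rule lift1)
interpretation L2: h_lift k 3 TP TM \<iota>2 by (rule lift2)
interpretation L3: h_lift k 3 TP3 TM3 \<iota>3 by (rule lift3)
interpretation TP: Module.module k TP by (rule L2.Q_module)

lemma Dq_iota:
  assumes p: "p \<in> carrier P"
  shows "Dq (\<iota>q p) = \<iota>q (D p)"
proof -
  note const_coeff_closed[OF P_module p]
  moreover have "(\<lambda>n. D (const_coeff P p n)) = const_coeff P (D p)"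
    by (auto simp: const_coeff_def module_maps_zero[OF P_module P_module D_linear])
  ultimately show ?thesis
    by (simp add: base_lift_def quot_map_coset[OF Ph_module Ph_module L1.hv hadic.D_linear])
qed

lemma symbol_D:
  assumes "sym1 i z p" "p \<in> carrier P"
  shows "sym1 i (Dq z) (D p)"
proof -
  have "sym1 (i + 0) (Dq z) (D p)"
    by (rule symbol_map[OF lift1 lift1 q.D_linear _ _ assms, where G=D])
      (simp_all add: Dq_iota module_maps_closed[OF D_linear] L1.symbol_iota)
  thus ?thesis by simp
qed

lemma mq_iota:
  assumes a: "a \<in> carrier P" and b: "b \<in> carrier P"
  shows "mq (\<iota>q a) (\<iota>q b) m = h_expand k Mq \<iota>q (mul a b m) (\<mu> 1 a b m) (\<mu> 2 a b m)"
proof -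
  have B: "(\<lambda>x y. mulh x y m) \<in> bilinear_maps Kh Ph Ph Ph"
    using hadic.hadic_bilinear by (auto simp: lambda_bilinear_def bilinear_maps_def)
  note c = const_coeff_closed[OF P_module a] const_coeff_closed[OF P_module b]
  have "mq (\<iota>q a) (\<iota>q b) m = hadic_coset Kh (hvar k) Ph 3 (mulh (const_coeff P a) (const_coeff P b) m)"
    unfolding quot_prod_eq base_lift_def
    by (rule quot_bilinear_coset[OF Ph_module Ph_module Ph_module L1.hv B c])
  thus ?thesis
    using hadic_coset_expand[OF P_module K_cring bilinear_maps_closed[OF B c]] by (simp add: product_expansion[OF a b])
qed

lemma mu_closed: "\<lbrakk>i \<ge> 1; a \<in> carrier P; b \<in> carrier P\<rbrakk> \<Longrightarrow> \<mu> i a b m \<in> carrier P"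
  by (rule upD[OF mu_polynomial])

definition bracket :: "'p \<Rightarrow> 'p \<Rightarrow> nat \<Rightarrow> 'p" where
  "bracket = commutator P D (\<mu> 1)"

lemma bracket_eq: "bracket a b n = \<mu> 1 a b n \<ominus>\<^bsub>P\<^esub> subst_neg P D (\<mu> 1 b a) n"
  by (simp add: bracket_def commutator_def right_mult_def)

abbreviation (input) "Bq \<equiv> commutator Mq Dq mq"

lemma Bq_iota:
  assumes a: "a \<in> carrier P" and b: "b \<in> carrier P"
  shows "\<exists>z \<in> carrier P. Bq (\<iota>q a) (\<iota>q b) m = h_expand k Mq \<iota>q \<zero>\<^bsub>P\<^esub> (bracket a b m) z"
proof -
  note u = polynomial[OF b a] mu_polynomial[of 1, OF _ b a] mu_polynomial[of 2, OF _ b a]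
  have "mq (\<iota>q b) (\<iota>q a) = (\<lambda>m. h_expand k Mq \<iota>q (mul b a m) (\<mu> 1 b a m) (\<mu> 2 b a m))"
    using mq_iota[OF b a] by auto
  hence 1: "right_mult Mq Dq mq (\<iota>q a) (\<iota>q b) m
      = h_expand k Mq \<iota>q (mul a b m) (subst_neg P D (\<mu> 1 b a) m) (subst_neg P D (\<mu> 2 b a) m)"
    using L1.subst_neg_h_expand[OF q.D_linear D_linear Dq_iota u(1) u(2) u(3)] comm[OF a b] by (simp add: right_mult_def)
  note S = upD[OF subst_neg_up[OF P_module D_linear u(2)]] upD[OF subst_neg_up[OF P_module D_linear u(3)]]
  have "Bq (\<iota>q a) (\<iota>q b) m = h_expand k Mq \<iota>q (mul a b m \<ominus>\<^bsub>P\<^esub> mul a b m) (bracket a b m) (\<mu> 2 a b m \<ominus>\<^bsub>P\<^esub> subst_neg P D (\<mu> 2 b a) m)"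
    unfolding commutator_def 1 mq_iota[OF a b] bracket_eq
    by (rule L1.h_expand_minus) (use f_closed[OF a b] mu_closed[OF _ a b] S in auto)
  moreover have "\<mu> 2 a b m \<ominus>\<^bsub>P\<^esub> subst_neg P D (\<mu> 2 b a) m \<in> carrier P" using mu_closed[OF _ a b] S by simp
  ultimately show ?thesis using f_closed[OF a b] by (auto simp: M.minus_eq M.r_neg)
qed

lemma bracket_up:
  assumes a: "a \<in> carrier P" and b: "b \<in> carrier P"
  shows "bracket a b \<in> up P"
  unfolding bracket_eq[abs_def]
  by (rule up_diff[OF P_module mu_polynomial[OF _ a b] subst_neg_up[OF P_module D_linear mu_polynomial[OF _ b a]]]) simp_all

lemma bracket_closed: "\<lbrakk>a \<in> carrier P; b \<in> carrier P\<rbrakk> \<Longrightarrow> bracket a b m \<in> carrier P"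
  by (rule upD[OF bracket_up])

lemma Bq_lambda_product: "lambda_product Kh Mq Dq Bq"
  by (rule lambda_product_commutator[OF q.lambda_product_axioms])

text \<open>
  Orders add under a bilinear operation, with a shift \<open>e\<close> that is visible on constants: apply
  \<open>symbol_map\<close> in each argument.
\<close>

lemma symbol_bilinear:
  assumes F: "\<And>x. x \<in> carrier Mq \<Longrightarrow> F x \<in> module_maps Kh Mq Mq" "\<And>y. y \<in> carrier Mq \<Longrightarrow> (\<lambda>x. F x y) \<in> module_maps Kh Mq Mq"
    and G: "\<And>p q. \<lbrakk>p \<in> carrier P; q \<in> carrier P\<rbrakk> \<Longrightarrow> G p q \<in> carrier P"
    and FG: "\<And>p q. \<lbrakk>p \<in> carrier P; q \<in> carrier P\<rbrakk> \<Longrightarrow> sym1 e (F (\<iota>q p) (\<iota>q q)) (G p q)"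
    and x: "sym1 i x p" "p \<in> carrier P" and y: "sym1 j y q" "q \<in> carrier P"
  shows "sym1 (i + j + e) (F x y) (G p q)"
proof -
  have xc: "x \<in> carrier Mq" by (rule L1.symbol_closed[OF x])
  have "sym1 (j + (i + e)) (F x y) (G p q)"
  proof (rule symbol_map[OF lift1 lift1 F(1)[OF xc] _ _ y])
    fix r assume r: "r \<in> carrier P"
    show "sym1 (i + e) (F x (\<iota>q r)) (G p r)"
      by (rule symbol_map[OF lift1 lift1 F(2)[OF L1.iota_closed[OF r]] _ _ x, where G="\<lambda>p. G p r"])
        (simp_all add: G FG r)
  qed (rule G[OF x(2)])
  thus ?thesis by (simp add: ac_simps)
qed

lemma symbol_mul:
  assumes "sym1 i x p" "p \<in> carrier P" "sym1 j y q" "q \<in> carrier P" "l = i + j"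
  shows "sym1 l (mq x y m) (mul p q m)"
  using symbol_bilinear[of "\<lambda>x y. mq x y m" "\<lambda>p q. mul p q m" 0, OF q.f_right q.f_left f_closed _ assms(1-4)]
    L1.symbol_h_expand(1)[OF f_closed mu_closed mu_closed] by (simp add: mq_iota assms(5))

lemma symbol_bracket:
  assumes "sym1 i x p" "p \<in> carrier P" "sym1 j y q" "q \<in> carrier P" "l = Suc (i + j)"
  shows "sym1 l (Bq x y m) (bracket p q m)"
proof -
  interpret B: lambda_product Kh Mq Dq Bq by (rule Bq_lambda_product)
  have "sym1 (Suc 0) (Bq (\<iota>q p) (\<iota>q q) m) (bracket p q m)" if pq: "p \<in> carrier P" "q \<in> carrier P" for p q
    using Bq_iota[OF pq, of m] L1.symbol_h_expand(2)[OF f_closed bracket_closed, OF pq pq] by auto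
  from symbol_bilinear[of "\<lambda>x y. Bq x y m" "\<lambda>p q. bracket p q m" "Suc 0", OF B.f_right B.f_left bracket_closed this assms(1-4)]
  show ?thesis by (simp add: assms(5))
qed

end

section \<open>The Poisson conformal algebra\<close>

context conformal_formal_deformation
begin

interpretation q: ASI_conformal_bialgebra Kh Mq Dq mq cq by (rule quotient_ASI)
interpretation L1: h_lift k 3 P Mq \<iota>q by (rule lift1)
interpretation L2: h_lift k 3 TP TM \<iota>2 by (rule lift2)
interpretation L3: h_lift k 3 TP3 TM3 \<iota>3 by (rule lift3)
interpretation TP: Module.module k TP by (rule L2.Q_module)
interpretation TM: Module.module Kh TM by (rule L2.N_module)
interpretation B: lambda_product Kh Mq Dq Bq by (rule Bq_lambda_product)

text \<open>
  The bracket inherits sesquilinearity from the commutator on \<open>P[[h]] / h^3\<close> by comparing the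
  coefficients of \<open>h\<close>.  Bilinearity and polynomiality come from those of the first-order term of the
  product.
\<close>

lemma bracket_lambda_product: "lambda_product k P D bracket"
proof (rule lambda_product.intro[OF diff_module_axioms], rule lambda_product_axioms.intro)
  have lt: "Suc 0 < 3" by simp
  note sb = symbol_bracket[OF L1.symbol_iota _ L1.symbol_iota, where l="Suc 0"]
  have sbi: "sym1 (Suc 0) (Bq (\<iota>q p) (\<iota>q q) m) (bracket p q m)" if "p \<in> carrier P" "q \<in> carrier P" for p q m
    by (rule sb) (use that in auto)
  show "lambda_bilinear k P bracket"
    unfolding bracket_def commutator_def[abs_def]
    by (rule lambda_bilinear_diff[OF P_module mu_bilinear
          lambda_bilinear_right_mult[OF P_module D_linear mu_bilinear mu_polynomial]]) simp_all
  fix a b assume a: "a \<in> carrier P" and b: "b \<in> carrier P"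
  note Da = module_maps_closed[OF D_linear]
  note ia = L1.iota_closed[OF a] and ib = L1.iota_closed[OF b]
  show "bracket a b \<in> up P" by (rule bracket_up[OF a b])
  fix n
  note t = L1.symbol_times_lambda[OF sbi[OF a b]] and tc = upD[OF up_times_lambda[OF P_module bracket_up[OF a b]]]
  have "sym1 (Suc 0) (Bq (\<iota>q (D a)) (\<iota>q b) n) (\<ominus>\<^bsub>P\<^esub> times_lambda P (bracket a b) n)"
    using L1.symbol_neg[OF t tc] by (simp add: Dq_iota[OF a, symmetric] B.sesqui_left[OF ia ib])
  thus "bracket (D a) b n = \<ominus>\<^bsub>P\<^esub> times_lambda P (bracket a b) n"
    using L1.symbol_unique[OF sbi[OF Da[OF a] b] _ bracket_closed[OF Da[OF a] b] _ lt] tc by simp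
  have "sym1 (Suc 0) (Bq (\<iota>q a) (\<iota>q (D b)) n) (D (bracket a b n) \<oplus>\<^bsub>P\<^esub> times_lambda P (bracket a b) n)"
    using L1.symbol_add[OF symbol_D[OF sbi[OF a b] bracket_closed[OF a b]] t Da[OF bracket_closed[OF a b]] tc]
    by (simp add: Dq_iota[OF b, symmetric] B.sesqui_right[OF ia ib])
  thus "bracket a (D b) n = D (bracket a b n) \<oplus>\<^bsub>P\<^esub> times_lambda P (bracket a b) n"
    using L1.symbol_unique[OF sbi[OF a Da[OF b]] _ bracket_closed[OF a Da[OF b]] _ lt] tc Da[OF bracket_closed[OF a b]] by simp
qed

lemma symbol_lambda_mu_prod:
  assumes G: "lambda_product k P D G"
    and FG: "\<And>x p m. \<lbrakk>sym1 i x p; p \<in> carrier P\<rbrakk> \<Longrightarrow> sym1 l (F x z m) (G p c m)"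
    and xy: "\<And>m. sym1 i (X m) (Y m)" and Y: "\<And>m. Y m \<in> carrier P" and c: "c \<in> carrier P"
  shows "sym1 l (lambda_mu_prod Mq F X z m n) (lambda_mu_prod P G Y c m n)"
proof -
  interpret G: lambda_product k P D G by (rule G)
  show ?thesis
    unfolding lambda_mu_prod_def subst_sum_def
    by (rule L1.symbol_finsum; (intro L1.symbol_add_pow FG xy Y)?) (use G.f_closed[OF Y c] in auto)
qed

text \<open>
  The identities of the commutator on \<open>P[[h]] / h^3\<close> are compared in degree 1 for skew-symmetry and the
  Leibniz rule and in degree 2 for the Jacobi identity, as the number of brackets in each term shows.
\<close>

lemma bracket_identities:
  assumes Q: "rational_scalars Kh" and a: "a \<in> carrier P" and b: "b \<in> carrier P" and c: "c \<in> carrier P"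
  shows bracket_skew: "bracket a b n = \<ominus>\<^bsub>P\<^esub> subst_neg P D (bracket b a) n"
    and bracket_jacobi: "bracket a (bracket b c n) m = lambda_mu_prod P bracket (bracket a b) c m n \<oplus>\<^bsub>P\<^esub> bracket b (bracket a c m) n"
    and bracket_leibniz: "bracket a (mul b c n) m = lambda_mu_prod P mul (bracket a b) c m n \<oplus>\<^bsub>P\<^esub> mul b (bracket a c m) n"
proof -
  interpret b: lambda_product k P D bracket by (rule bracket_lambda_product)
  note i = L1.symbol_iota[OF a] L1.symbol_iota[OF b] L1.symbol_iota[OF c]
  note ic = L1.iota_closed[OF a] L1.iota_closed[OF b] L1.iota_closed[OF c]
  note ab = symbol_bracket[OF i(1) a i(2) b, where l="Suc 0"] and ba = symbol_bracket[OF i(2) b i(1) a, where l="Suc 0"]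
    and ac = symbol_bracket[OF i(1) a i(3) c, where l="Suc 0"] and bc = symbol_bracket[OF i(2) b i(3) c, where l="Suc 0"]
  have lm: "lambda_mu_prod P bracket (bracket a b) c m n \<in> carrier P" "lambda_mu_prod P mul (bracket a b) c m n \<in> carrier P"
    unfolding lambda_mu_prod_def subst_sum_def
    using f_closed[OF bracket_closed[OF a b] c] bracket_closed[OF bracket_closed[OF a b] c] by auto
  show "bracket a b n = \<ominus>\<^bsub>P\<^esub> subst_neg P D (bracket b a) n"
  proof (rule L1.symbol_unique[OF ab])
    have "sym1 (Suc 0) (\<ominus>\<^bsub>Mq\<^esub> subst_neg Mq Dq (Bq (\<iota>q b) (\<iota>q a)) n) (\<ominus>\<^bsub>P\<^esub> subst_neg P D (bracket b a) n)"
      by (intro L1.symbol_neg symbol_subst_neg[OF lift1 q.D_linear D_linear symbol_D B.polynomial[OF ic(2,1)] bracket_up[OF b a] ba]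
        upD[OF subst_neg_up[OF P_module D_linear bracket_up[OF b a]]]) auto
    thus "sym1 (Suc 0) (Bq (\<iota>q a) (\<iota>q b) n) (\<ominus>\<^bsub>P\<^esub> subst_neg P D (bracket b a) n)"
      using commutator_skew[OF q.lambda_product_axioms Q ic(1,2), of n] by simp
  qed (use bracket_closed[OF a b] upD[OF subst_neg_up[OF P_module D_linear bracket_up[OF b a]]] in auto)
  show "bracket a (bracket b c n) m = lambda_mu_prod P bracket (bracket a b) c m n \<oplus>\<^bsub>P\<^esub> bracket b (bracket a c m) n"
  proof (rule L1.symbol_unique[where i=2])
    show "sym1 2 (Bq (\<iota>q a) (Bq (\<iota>q b) (\<iota>q c) n) m) (bracket a (bracket b c n) m)"
      by (rule symbol_bracket[OF i(1) a bc bracket_closed[OF b c]]) simp_all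
    show "sym1 2 (Bq (\<iota>q a) (Bq (\<iota>q b) (\<iota>q c) n) m) (lambda_mu_prod P bracket (bracket a b) c m n \<oplus>\<^bsub>P\<^esub> bracket b (bracket a c m) n)"
      unfolding q.commutator_jacobi[OF Q ic]
    proof (rule L1.symbol_add)
      show "sym1 2 (lambda_mu_prod Mq Bq (Bq (\<iota>q a) (\<iota>q b)) (\<iota>q c) m n) (lambda_mu_prod P bracket (bracket a b) c m n)"
        by (rule symbol_lambda_mu_prod[OF bracket_lambda_product _ ab bracket_closed[OF a b] c], rule symbol_bracket[OF _ _ i(3) c]) simp_all
      show "sym1 2 (Bq (\<iota>q b) (Bq (\<iota>q a) (\<iota>q c) m) n) (bracket b (bracket a c m) n)"
        by (rule symbol_bracket[OF i(2) b ac bracket_closed[OF a c]]) simp_all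
    qed (use lm bracket_closed a b c in auto)
  qed (use lm bracket_closed a b c in auto)
  show "bracket a (mul b c n) m = lambda_mu_prod P mul (bracket a b) c m n \<oplus>\<^bsub>P\<^esub> mul b (bracket a c m) n"
  proof (rule L1.symbol_unique[where i="Suc 0"])
    show "sym1 (Suc 0) (Bq (\<iota>q a) (mq (\<iota>q b) (\<iota>q c) n) m) (bracket a (mul b c n) m)"
      by (rule symbol_bracket[OF i(1) a symbol_mul[OF i(2) b i(3) c, where l=0] f_closed[OF b c]]) simp_all
    show "sym1 (Suc 0) (Bq (\<iota>q a) (mq (\<iota>q b) (\<iota>q c) n) m) (lambda_mu_prod P mul (bracket a b) c m n \<oplus>\<^bsub>P\<^esub> mul b (bracket a c m) n)"
      unfolding q.commutator_leibniz[OF Q ic]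
    proof (rule L1.symbol_add)
      show "sym1 (Suc 0) (lambda_mu_prod Mq mq (Bq (\<iota>q a) (\<iota>q b)) (\<iota>q c) m n) (lambda_mu_prod P mul (bracket a b) c m n)"
        by (rule symbol_lambda_mu_prod[OF lambda_product_axioms _ ab bracket_closed[OF a b] c], rule symbol_mul[OF _ _ i(3) c]) simp_all
      show "sym1 (Suc 0) (mq (\<iota>q b) (Bq (\<iota>q a) (\<iota>q c) m) n) (mul b (bracket a c m) n)"
        by (rule symbol_mul[OF i(2) b ac bracket_closed[OF a c]]) simp_all
    qed (use lm bracket_closed f_closed a b c in auto)
  qed (use lm bracket_closed f_closed a b c in auto)
qed

end

section \<open>The deformed coproduct modulo \<open>h^3\<close>\<close>

context conformal_formal_deformation
begin

interpretation q: ASI_conformal_bialgebra Kh Mq Dq mq cq by (rule quotient_ASI)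
interpretation L1: h_lift k 3 P Mq \<iota>q by (rule lift1)
interpretation L2: h_lift k 3 TP TM \<iota>2 by (rule lift2)
interpretation L3: h_lift k 3 TP3 TM3 \<iota>3 by (rule lift3)
interpretation TP: Module.module k TP by (rule L2.Q_module)
interpretation TM: Module.module Kh TM by (rule L2.N_module)
interpretation TP3: Module.module k TP3 by (rule L3.Q_module)
interpretation TM3: Module.module Kh TM3 by (rule L3.N_module)
interpretation B: lambda_product Kh Mq Dq Bq by (rule Bq_lambda_product)
interpretation br: lambda_product k P D bracket by (rule bracket_lambda_product)

text \<open>
  The tensor product over \<open>k[[h]]\<close> is killed by \<open>h^3\<close> because its factors are; so the map from the
  tensor square of \<open>P[[h]]\<close> factors through the quotient modulo \<open>h^3\<close>, in which the coproduct takes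
  its values.
\<close>

lemma tensor_h_torsion:
  assumes x: "x \<in> carrier TM"
  shows "h_mult k TM 3 x = \<zero>\<^bsub>TM\<^esub>"
proof -
  note pb = tensor_pure_bilinear[OF L1.N_module L1.N_module]
  have z: "h_mult k Mq 3 u = \<zero>\<^bsub>Mq\<^esub>" if u: "u \<in> carrier Mq" for u
  proof -
    obtain v where v: "v \<in> carrier Ph" "u = hadic_coset Kh (hvar k) Ph 3 v"
      using u by (auto simp: carrier_hadic_quot[OF Ph_module L1.hv])
    have "h_mult k Mq 3 u = hadic_coset Kh (hvar k) Ph 3 (h_mult k Ph 3 v)"
      unfolding v(2) by (rule h_mult_linear[OF Ph_module L1.hv hadic_coset_module_maps[OF Ph_module L1.hv] v(1), symmetric])
    thus ?thesis by (simp add: h_mult_def hadic_coset_h_pow[OF Ph_module L1.hv v(1)])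
  qed
  show ?thesis
  proof (rule tensor_ext[OF L1.N_module L1.N_module L2.N_module L2.hm module_maps_null[OF L2.N_module] _ x])
    fix u v assume u: "u \<in> carrier Mq" and v: "v \<in> carrier Mq"
    have "h_mult k TM 3 (tensor_pure Kh Mq Mq u v) = tensor_pure Kh Mq Mq (h_mult k Mq 3 u) v"
      by (rule h_mult_linear[OF L1.N_module L1.hv bilinear_maps_left[OF pb v] u, symmetric])
    thus "h_mult k TM 3 (tensor_pure Kh Mq Mq u v) = \<zero>\<^bsub>TM\<^esub>"
      by (simp add: z[OF u] module_maps_zero[OF L1.N_module L2.N_module bilinear_maps_left[OF pb v]])
  qed
qed

text \<open>
  The induced coproduct is a union over all representatives of the argument and of the value.  Steps 1 and
  2 in the proof say that both choices do not matter, so that it can be computed on a constant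
  and on the partial sum of the series.
\<close>

lemma cq_iota:
  assumes a: "a \<in> carrier P"
  shows "cq (\<iota>q a) = h_expand k TM \<iota>2 (\<Delta> a) (\<Delta>s 1 a) (\<Delta>s 2 a)"
proof -
  let ?c = "hadic_coset Kh (hvar k) Ph 3" and ?T = "tensor Kh Ph Ph" and ?e = "tensor_embed k P"
  let ?cT = "hadic_coset Kh (hvar k) ?T 3"
  let ?tm = "tensor_map Kh Mq Mq ?c ?c"
  note hv = L1.hv
  note c = hadic_coset_module_maps[OF Ph_module hv, of 3]
  have T: "Module.module Kh ?T" by (rule tensor_module[OF Ph_module Ph_module])
  interpret T: Module.module Kh ?T by (rule T)
  interpret QT: Module.module Kh "hadic_quot Kh (hvar k) ?T 3" by (rule hadic_quot_module[OF T hv])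
  note cT = hadic_coset_module_maps[OF T hv, of 3]
  have tm: "?tm \<in> module_maps Kh ?T TM" by (rule tensor_map_module_maps[OF Ph_module Ph_module L1.N_module L1.N_module c c])
  have lP: "h_lift k 3 P Ph (const_coeff P)" by (rule h_lift_power_series[OF P_module K_cring])
  interpret e: h_lift k 3 TP ?T ?e unfolding tensor_embed_eq by (rule h_lift_tensor[OF lP lP])
  interpret eh: abelian_group_hom TP ?T ?e
    by (rule additive_maps_hom) (fact e.iota_additive TP.abelian_group_axioms T.abelian_group_axioms)+
  interpret i2: abelian_group_hom TP TM \<iota>2
    by (rule additive_maps_hom) (fact L2.iota_additive TP.abelian_group_axioms TM.abelian_group_axioms)+
  note cc = const_coeff_closed[OF P_module]
  have tme: "?tm (?e x) = \<iota>2 x" if "x \<in> carrier TP" for x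
    using that
  proof (induction rule: tensor_induct[OF P_module P_module, consumes 1, case_names zero pure add])
    case zero
    show ?case by (simp add: module_maps_zero[OF T L2.N_module tm])
  next
    case (pure u v)
    have b: "?c (const_coeff P u) = \<iota>q u" for u by (simp add: base_lift_def)
    show ?case
      using tensor_map_pure[OF Ph_module Ph_module L1.N_module L1.N_module c c cc[OF pure(1)] cc[OF pure(2)]]
      unfolding b tensor_embed_eq tensor_iota_pure[OF lP lP pure] tensor_iota_pure[OF lift1 lift1 pure] .
  next
    case (add s t)
    thus ?case by (simp add: module_maps_add[OF tm])
  qed
  define X where "X i = (if i = 0 then \<Delta> a else \<Delta>s i a)" for i
  have X: "X i \<in> carrier TP" for i
    using module_maps_closed[OF coprod_linear a] module_maps_closed[OF coproduct.coprod_linear[OF coprods] a]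
    by (auto simp: X_def)
  define S where "S = (\<Oplus>\<^bsub>?T\<^esub>i \<in> {..<3::nat}. (hvar k [^]\<^bsub>Kh\<^esub> i) \<odot>\<^bsub>?T\<^esub> ?e (X i))"
  have S: "S \<in> carrier ?T" unfolding S_def by (rule partial_sum_closed[OF T hv]) (simp add: X)
  have \<Delta>hS: "\<Delta>h (const_coeff P a) 3 = ?cT S"
    by (simp add: coproduct_expansion[OF a] Let_def S_def X_def)
  have \<Delta>3: "(\<lambda>v. \<Delta>h v 3) \<in> module_maps Kh Ph (hadic_quot Kh (hvar k) ?T 3)"
    using hadic.hadic_coprod_linear by (auto simp: module_maps_def hadic_completion_def Pi_def)
  have 1: "\<Delta>h x 3 = \<Delta>h y 3" if xy: "x \<in> carrier Ph" "y \<in> carrier Ph" "?c x = ?c y" for x y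
  proof -
    interpret Ph: Module.module Kh Ph by (rule Ph_module)
    obtain z where z: "z \<in> carrier Ph" "x \<ominus>\<^bsub>Ph\<^esub> y = (hvar k [^]\<^bsub>Kh\<^esub> (3::nat)) \<odot>\<^bsub>Ph\<^esub> z"
      using xy hadic_coset_eq_iff[OF Ph_module hv xy(1,2)] by (auto simp: hadic_sub_def)
    obtain t where t: "t \<in> carrier ?T" "\<Delta>h z 3 = ?cT t"
      using module_maps_closed[OF \<Delta>3 z(1)] by (auto simp: carrier_hadic_quot[OF T hv])
    have "\<Delta>h (x \<ominus>\<^bsub>Ph\<^esub> y) 3 = ?cT ((hvar k [^]\<^bsub>Kh\<^esub> (3::nat)) \<odot>\<^bsub>?T\<^esub> t)"
      unfolding z(2) module_maps_smult[OF \<Delta>3 h_pow_closed[OF Ph_module hv] z(1)] t(2)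
      by (rule module_maps_smult[OF cT h_pow_closed[OF Ph_module hv] t(1), symmetric])
    hence "\<Delta>h x 3 \<ominus>\<^bsub>hadic_quot Kh (hvar k) ?T 3\<^esub> \<Delta>h y 3 = \<zero>\<^bsub>hadic_quot Kh (hvar k) ?T 3\<^esub>"
      unfolding hadic_coset_h_pow[OF T hv t(1)] module_maps_minus[OF Ph_module hadic_quot_module[OF T hv] \<Delta>3 xy(1,2)] .
    thus ?thesis
      using QT.minus_eq_zero_iff[OF module_maps_closed[OF \<Delta>3 xy(1)] module_maps_closed[OF \<Delta>3 xy(2)]] by blast
  qed
  have 2: "?tm t = ?tm S" if t: "t \<in> carrier ?T" "?cT t = ?cT S" for t
  proof -
    obtain z where z: "z \<in> carrier ?T" "t \<ominus>\<^bsub>?T\<^esub> S = h_mult k ?T 3 z"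
      using t S hadic_coset_eq_iff[OF T hv t(1) S] by (auto simp: hadic_sub_def h_mult_def)
    have "?tm t \<ominus>\<^bsub>TM\<^esub> ?tm S = h_mult k TM 3 (?tm z)"
      unfolding module_maps_minus[OF T L2.N_module tm t(1) S, symmetric] z(2)
      by (rule h_mult_linear[OF T hv tm z(1)])
    hence "?tm t \<ominus>\<^bsub>TM\<^esub> ?tm S = \<zero>\<^bsub>TM\<^esub>"
      unfolding tensor_h_torsion[OF module_maps_closed[OF tm z(1)]] .
    thus ?thesis
      using TM.minus_eq_zero_iff[OF module_maps_closed[OF tm t(1)] module_maps_closed[OF tm S]] by blast
  qed
  have three: "{..<3::nat} = {..<Suc (Suc (Suc 0))}" by (simp add: numeral_3_eq_3)
  have "cq (\<iota>q a) = (\<Union>t\<in>\<Delta>h (const_coeff P a) 3. ?tm t)"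
    unfolding quot_coprod_def base_lift_def
  proof (rule UN_hadic_coset[OF Ph_module hv cc[OF a]])
    fix x assume x: "x \<in> carrier Ph" "?c x = ?c (const_coeff P a)"
    show "(\<Union>t\<in>\<Delta>h x 3. ?tm t) = (\<Union>t\<in>\<Delta>h (const_coeff P a) 3. ?tm t)"
      unfolding 1[OF x(1) cc[OF a] x(2)] ..
  qed
  also have "\<dots> = ?tm S" unfolding \<Delta>hS by (rule UN_hadic_coset[OF T hv S], rule 2)
  also have "\<dots> = (\<Oplus>\<^bsub>TM\<^esub>i \<in> {..<3::nat}. (hvar k [^]\<^bsub>Kh\<^esub> i) \<odot>\<^bsub>TM\<^esub> ?tm (?e (X i)))"
    unfolding S_def by (rule hadic_series_map_linear[OF T hv L2.N_module tm]) (simp add: X)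
  also have "\<dots> = (\<Oplus>\<^bsub>TM\<^esub>i \<in> {..<Suc (Suc (Suc 0))}. h_mult k TM i (\<iota>2 (X i)))"
    unfolding three h_mult_def tme[OF X] ..
  also have "\<dots> = h_expand k TM \<iota>2 (\<Delta> a) (\<Delta>s 1 a) (\<Delta>s 2 a)"
    using X[of 0] X[of 1] X[of 2]
    by (simp add: lessThan_Suc TM.finsum_insert L2.hm_closed h_expand_def X_def TM.a_ac h_mult_0[OF L2.N_module hv]
        numeral_2_eq_2)
  finally show ?thesis .
qed

definition cobracket :: "'p \<Rightarrow> ('p \<times> 'p \<Rightarrow> 'k) set" where
  "cobracket = cocommutator k P (\<Delta>s 1)"

abbreviation (input) "dq \<equiv> cocommutator Kh Mq cq"

lemma coprod1: "coproduct k P D (\<Delta>s 1)" by (rule coprods) simp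

lemma cobracket_module_maps: "cobracket \<in> module_maps k P TP"
  unfolding cobracket_def by (rule cocommutator_module_maps[OF P_module coproduct.coprod_linear[OF coprod1]])

lemma dq_module_maps: "dq \<in> module_maps Kh Mq TM"
  by (rule cocommutator_module_maps[OF L1.N_module q.coprod_linear])

lemma dq_iota:
  assumes a: "a \<in> carrier P"
  shows "\<exists>z \<in> carrier TP. dq (\<iota>q a) = h_expand k TM \<iota>2 \<zero>\<^bsub>TP\<^esub> (cobracket a) z"
proof -
  note fM = tensor_flip_module_maps[OF L1.N_module] and fP = tensor_flip_module_maps[OF P_module]
  have c: "\<Delta> a \<in> carrier TP" "\<Delta>s 1 a \<in> carrier TP" "\<Delta>s 2 a \<in> carrier TP"
    using module_maps_closed[OF coprod_linear a] module_maps_closed[OF coproduct.coprod_linear[OF coprods] a] by auto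
  note fc = module_maps_closed[OF fP]
  have "tensor_flip Kh Mq (h_expand k TM \<iota>2 x y z)
      = h_expand k TM \<iota>2 (tensor_flip k P x) (tensor_flip k P y) (tensor_flip k P z)"
    if "x \<in> carrier TP" "y \<in> carrier TP" "z \<in> carrier TP" for x y z
    using that by (simp add: h_expand_def module_maps_add[OF fM] L2.iota_closed L2.hm_closed
        h_mult_linear[OF L2.N_module L1.hv fM] tensor_flip_iota[OF lift1])
  hence "dq (\<iota>q a) = h_expand k TM \<iota>2 (\<Delta> a \<ominus>\<^bsub>TP\<^esub> tensor_flip k P (\<Delta> a)) (cobracket a)
      (\<Delta>s 2 a \<ominus>\<^bsub>TP\<^esub> tensor_flip k P (\<Delta>s 2 a))"
    using c fc by (simp add: cocommutator_def cq_iota[OF a] cobracket_def L2.h_expand_minus)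
  moreover have "\<Delta> a \<ominus>\<^bsub>TP\<^esub> tensor_flip k P (\<Delta> a) = \<zero>\<^bsub>TP\<^esub>"
    using cocomm[OF a] c(1) by (simp add: TP.minus_eq TP.r_neg)
  ultimately show ?thesis using c fc by auto
qed

lemma symbol_coprod:
  assumes "sym1 i z p" "p \<in> carrier P"
  shows "sym2 i (cq z) (\<Delta> p)"
proof -
  note c = module_maps_closed[OF coprod_linear] module_maps_closed[OF coproduct.coprod_linear[OF coprods]]
  have base: "sym2 0 (cq (\<iota>q p)) (\<Delta> p)" if "p \<in> carrier P" for p
    unfolding cq_iota[OF that] by (rule L2.symbol_h_expand(1)) (use c that in auto)
  have "sym2 (i + 0) (cq z) (\<Delta> p)"
    by (rule symbol_map[OF lift1 lift2 q.coprod_linear c(1) base assms])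
  thus ?thesis by simp
qed

lemma symbol_cobracket_iota: "p \<in> carrier P \<Longrightarrow> sym2 (Suc 0) (dq (\<iota>q p)) (cobracket p)"
  using dq_iota[of p] L2.symbol_h_expand(2)[OF TP.zero_closed module_maps_closed[OF cobracket_module_maps]] by auto

lemma symbol_cobracket:
  assumes "sym1 i z p" "p \<in> carrier P" "l = Suc i"
  shows "sym2 l (dq z) (cobracket p)"
  using symbol_map[OF lift1 lift2 dq_module_maps module_maps_closed[OF cobracket_module_maps] symbol_cobracket_iota assms(1,2)]
  by (simp add: assms(3))

lemma symbol_flip:
  assumes "sym2 i z x" "x \<in> carrier TP"
  shows "sym2 i (tensor_flip Kh Mq z) (tensor_flip k P x)"
proof -
  note fM = tensor_flip_module_maps[OF L1.N_module] and fP = tensor_flip_module_maps[OF P_module]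
  have "sym2 (i + 0) (tensor_flip Kh Mq z) (tensor_flip k P x)"
    by (rule symbol_map[OF lift2 lift2 fM module_maps_closed[OF fP] _ assms])
      (simp_all add: tensor_flip_iota[OF lift1] L2.symbol_iota module_maps_closed[OF fP])
  thus ?thesis by simp
qed

context
  fixes F G e
  assumes F: "F \<in> conformal_maps Kh Mq" and G: "G \<in> conformal_maps k P"
    and FG: "\<And>p m. p \<in> carrier P \<Longrightarrow> sym1 e (F (\<iota>q p) m) (G p m)"
begin

lemma symbol_act_left:
  assumes "sym2 i z x" "x \<in> carrier TP" "l = i + e"
  shows "sym2 l (act_left Kh Mq F z m) (act_left k P G x m)"
  using symbol_tensor_map[OF lift1 lift1 lift1 lift1 conformal_mapsD(1)[OF L1.N_module q.D_linear F]
      conformal_mapsD(1)[OF P_module D_linear G] FG module_maps_id(2) module_maps_id(2) _ assms(1,2), of 0]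
    L1.symbol_iota by (simp add: act_left_def assms(3))

lemma symbol_act_right:
  assumes "sym2 i z x" "x \<in> carrier TP" "l = i + e"
  shows "sym2 l (act_right Kh Mq F z m) (act_right k P G x m)"
  using symbol_tensor_map[OF lift1 lift1 lift1 lift1 module_maps_id(2) module_maps_id(2) _
      conformal_mapsD(1)[OF L1.N_module q.D_linear F] conformal_mapsD(1)[OF P_module D_linear G] FG assms(1,2), of 0]
    L1.symbol_iota by (simp add: act_right_def assms(3))

end

lemma symbol_tensor_D:
  assumes z: "sym2 i z x" and x: "x \<in> carrier TP"
  shows "sym2 i (tensor_D Kh Mq Dq z) (tensor_D k P D x)"
proof -
  have D: "sym1 0 (Dq (\<iota>q p)) (D p)" if "p \<in> carrier P" for p by (rule symbol_D[OF L1.symbol_iota that]) (rule that)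
  have "sym2 (i + (0 + 0)) (tensor_map Kh Mq Mq Dq id z) (tensor_map k P P D id x)"
    by (rule symbol_tensor_map[OF lift1 lift1 lift1 lift1 q.D_linear D_linear D module_maps_id(2) module_maps_id(2) _ z x])
      (simp_all add: L1.symbol_iota)
  moreover have "sym2 (i + (0 + 0)) (tensor_map Kh Mq Mq id Dq z) (tensor_map k P P id D x)"
    by (rule symbol_tensor_map[OF lift1 lift1 lift1 lift1 module_maps_id(2) module_maps_id(2) _ q.D_linear D_linear D z x])
      (simp_all add: L1.symbol_iota)
  ultimately show ?thesis
    unfolding tensor_D_def
    using L2.symbol_add module_maps_closed[OF tensor_map_module_maps[OF P_module P_module P_module P_module D_linear module_maps_id(2)] x]
      module_maps_closed[OF tensor_map_module_maps[OF P_module P_module P_module P_module module_maps_id(2) D_linear] x] by simp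
qed

context
  fixes F G e
  assumes F: "F \<in> conformal_maps Kh Mq" and G: "G \<in> conformal_maps k P"
    and FG: "\<And>p m. p \<in> carrier P \<Longrightarrow> sym1 e (F (\<iota>q p) m) (G p m)"
begin

lemma symbol_act_neg:
  assumes z: "sym2 i z x" and x: "x \<in> carrier TP" and l: "l = i + e"
  shows symbol_act_left_neg: "sym2 l (act_left_neg Kh Mq Dq F z m) (act_left_neg k P D G x m)"
    and symbol_act_right_neg: "sym2 l (act_right_neg Kh Mq Dq F z m) (act_right_neg k P D G x m)"
proof -
  have zc: "z \<in> carrier TM" by (rule L2.symbol_closed[OF z x])
  note DD = tensor_D_module_maps[OF L1.N_module q.D_linear] tensor_D_module_maps[OF P_module D_linear]
  show "sym2 l (act_left_neg Kh Mq Dq F z m) (act_left_neg k P D G x m)"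
    unfolding act_left_neg_def
    by (rule symbol_subst_neg[OF lift2 DD symbol_tensor_D act_left_up[OF L1.N_module q.D_linear F zc]
        act_left_up[OF P_module D_linear G x] symbol_act_left[OF F G FG z x l]])
  show "sym2 l (act_right_neg Kh Mq Dq F z m) (act_right_neg k P D G x m)"
    unfolding act_right_neg_def
    by (rule symbol_subst_neg[OF lift2 DD symbol_tensor_D act_right_up[OF L1.N_module q.D_linear F zc]
        act_right_up[OF P_module D_linear G x] symbol_act_right[OF F G FG z x l]])
qed

end

lemma act_closed:
  assumes G: "G \<in> conformal_maps k P" and x: "x \<in> carrier TP"
  shows "act_left k P G x m \<in> carrier TP" "act_right k P G x m \<in> carrier TP"
    "act_left_neg k P D G x m \<in> carrier TP" "act_right_neg k P D G x m \<in> carrier TP"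
  using upD[OF act_left_up[OF P_module D_linear G x]] upD[OF act_right_up[OF P_module D_linear G x]]
    upD[OF act_left_neg_up[OF P_module D_linear G x]] upD[OF act_right_neg_up[OF P_module D_linear G x]] by auto

text \<open>
  The cocycle condition is compared in degree 2 and the other two conditions in degree 1.  In the latter
  the correction terms of \<open>ASI_commutator_identities\<close> contain a commutator and a cocommutator, hence
  have order 2 and contribute the leading coefficient \<open>0\<close>.
\<close>

lemma bialgebra_identities:
  assumes Q: "rational_scalars Kh" and a: "a \<in> carrier P" and b: "b \<in> carrier P"
  shows bialgebra_cobracket_bracket: "cobracket (bracket a b m) =
        (act_left k P (bracket a) (cobracket b) m \<oplus>\<^bsub>TP\<^esub> act_right k P (bracket a) (cobracket b) m)
        \<ominus>\<^bsub>TP\<^esub> (act_left_neg k P D (bracket b) (cobracket a) m \<oplus>\<^bsub>TP\<^esub> act_right_neg k P D (bracket b) (cobracket a) m)"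
    and bialgebra_cobracket_mult: "cobracket (mul a b m) =
        act_left k P (mul a) (cobracket b) m \<oplus>\<^bsub>TP\<^esub> act_left_neg k P D (mul b) (cobracket a) m
        \<oplus>\<^bsub>TP\<^esub> act_right k P (bracket a) (\<Delta> b) m \<oplus>\<^bsub>TP\<^esub> act_right_neg k P D (bracket b) (\<Delta> a) m"
    and bialgebra_coproduct_bracket: "\<Delta> (bracket a b m) =
        ((act_left k P (bracket a) (\<Delta> b) m \<oplus>\<^bsub>TP\<^esub> act_right k P (bracket a) (\<Delta> b) m)
          \<ominus>\<^bsub>TP\<^esub> act_right_neg k P D (mul b) (cobracket a) m)
        \<oplus>\<^bsub>TP\<^esub> act_left_neg k P D (mul b) (cobracket a) m"
proof -
  note i = L1.symbol_iota[OF a] L1.symbol_iota[OF b]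
  note ic = L1.iota_closed[OF a] L1.iota_closed[OF b]
  note cfM = conformal_maps_lambda_product[OF q.lambda_product_axioms] and cfB = conformal_maps_lambda_product[OF Bq_lambda_product]
  note cfm = conformal_maps_lambda_product[OF lambda_product_axioms] and cfb = conformal_maps_lambda_product[OF bracket_lambda_product]
  have smul: "sym1 0 (mq (\<iota>q u) (\<iota>q p) m) (mul u p m)" if "u \<in> carrier P" "p \<in> carrier P" for u p m
    by (rule symbol_mul[OF L1.symbol_iota that(1) L1.symbol_iota that(2)]) (simp_all add: that)
  have sbr: "sym1 (Suc 0) (Bq (\<iota>q u) (\<iota>q p) m) (bracket u p m)" if "u \<in> carrier P" "p \<in> carrier P" for u p m
    by (rule symbol_bracket[OF L1.symbol_iota that(1) L1.symbol_iota that(2)]) (simp_all add: that)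
  note dc = module_maps_closed[OF cobracket_module_maps] and cc = module_maps_closed[OF coprod_linear]
  note da = symbol_cobracket_iota[OF a] and db = symbol_cobracket_iota[OF b]
  note ca = symbol_coprod[OF i(1) a] and cb = symbol_coprod[OF i(2) b]
  note acb = act_closed[OF cfb[OF a]] act_closed[OF cfb[OF b]] act_closed[OF cfm[OF a]] act_closed[OF cfm[OF b]]
  note sBa = cfB[OF ic(1)] cfb[OF a] sbr[OF a] and sBb = cfB[OF ic(2)] cfb[OF b] sbr[OF b]
  note sMa = cfM[OF ic(1)] cfm[OF a] smul[OF a] and sMb = cfM[OF ic(2)] cfm[OF b] smul[OF b]
  note closed = acb dc[OF a] dc[OF b] cc[OF a] cc[OF b]
  have x_minus_0: "x = x \<ominus>\<^bsub>TP\<^esub> \<zero>\<^bsub>TP\<^esub>" if "x \<in> carrier TP" for x using that by (simp add: TP.minus_eq)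
  show "cobracket (bracket a b m) =
        (act_left k P (bracket a) (cobracket b) m \<oplus>\<^bsub>TP\<^esub> act_right k P (bracket a) (cobracket b) m)
        \<ominus>\<^bsub>TP\<^esub> (act_left_neg k P D (bracket b) (cobracket a) m \<oplus>\<^bsub>TP\<^esub> act_right_neg k P D (bracket b) (cobracket a) m)"
  proof (rule L2.symbol_unique[where i=2])
    show "sym2 2 (dq (Bq (\<iota>q a) (\<iota>q b) m)) (cobracket (bracket a b m))"
      by (rule symbol_cobracket[OF sbr[OF a b] bracket_closed[OF a b]]) simp
    show "sym2 2 (dq (Bq (\<iota>q a) (\<iota>q b) m))
       ((act_left k P (bracket a) (cobracket b) m \<oplus>\<^bsub>TP\<^esub> act_right k P (bracket a) (cobracket b) m)
        \<ominus>\<^bsub>TP\<^esub> (act_left_neg k P D (bracket b) (cobracket a) m \<oplus>\<^bsub>TP\<^esub> act_right_neg k P D (bracket b) (cobracket a) m))"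
      unfolding q.ASI_cobracket_bracket[OF Q ic]
      by (intro L2.symbol_minus L2.symbol_add symbol_act_left[OF sBa db] symbol_act_right[OF sBa db]
        symbol_act_left_neg[OF sBb da] symbol_act_right_neg[OF sBb da] TP.a_closed closed) simp_all
  qed (use closed dc bracket_closed[OF a b] in auto)
  show "cobracket (mul a b m) =
        act_left k P (mul a) (cobracket b) m \<oplus>\<^bsub>TP\<^esub> act_left_neg k P D (mul b) (cobracket a) m
        \<oplus>\<^bsub>TP\<^esub> act_right k P (bracket a) (\<Delta> b) m \<oplus>\<^bsub>TP\<^esub> act_right_neg k P D (bracket b) (\<Delta> a) m" (is "_ = ?r")
  proof (rule L2.symbol_unique[where i="Suc 0"])
    show "sym2 (Suc 0) (dq (mq (\<iota>q a) (\<iota>q b) m)) (cobracket (mul a b m))"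
      by (rule symbol_cobracket[OF smul[OF a b] f_closed[OF a b]]) simp
    have "sym2 (Suc 0) (dq (mq (\<iota>q a) (\<iota>q b) m)) (?r \<ominus>\<^bsub>TP\<^esub> \<zero>\<^bsub>TP\<^esub>)"
      unfolding q.ASI_cobracket_mult[OF Q ic]
    proof (rule L2.symbol_minus)
      show "sym2 (Suc 0) (act_left_neg Kh Mq Dq (Bq (\<iota>q b)) (dq (\<iota>q a)) m \<oplus>\<^bsub>TM\<^esub>
          act_right_neg Kh Mq Dq (Bq (\<iota>q b)) (dq (\<iota>q a)) m) \<zero>\<^bsub>TP\<^esub>"
        by (rule L2.symbol_Suc[OF L2.symbol_add[OF symbol_act_left_neg[OF sBb da] symbol_act_right_neg[OF sBb da]]])
          (simp_all add: closed)
      show "sym2 (Suc 0) (act_left Kh Mq (mq (\<iota>q a)) (dq (\<iota>q b)) m \<oplus>\<^bsub>TM\<^esub>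
          act_left_neg Kh Mq Dq (mq (\<iota>q b)) (dq (\<iota>q a)) m \<oplus>\<^bsub>TM\<^esub>
          act_right Kh Mq (Bq (\<iota>q a)) (cq (\<iota>q b)) m \<oplus>\<^bsub>TM\<^esub>
          act_right_neg Kh Mq Dq (Bq (\<iota>q b)) (cq (\<iota>q a)) m) ?r"
        by (intro L2.symbol_add symbol_act_left[OF sMa db] symbol_act_left_neg[OF sMb da] symbol_act_right[OF sBa cb]
          symbol_act_right_neg[OF sBb ca] TP.a_closed closed) simp_all
    qed (use closed in auto)
    thus "sym2 (Suc 0) (dq (mq (\<iota>q a) (\<iota>q b) m)) ?r" using closed by (simp add: x_minus_0[symmetric])
  qed (use closed dc f_closed[OF a b] in auto)
  show "\<Delta> (bracket a b m) =
        ((act_left k P (bracket a) (\<Delta> b) m \<oplus>\<^bsub>TP\<^esub> act_right k P (bracket a) (\<Delta> b) m)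
          \<ominus>\<^bsub>TP\<^esub> act_right_neg k P D (mul b) (cobracket a) m)
        \<oplus>\<^bsub>TP\<^esub> act_left_neg k P D (mul b) (cobracket a) m" (is "_ = ?r")
  proof (rule L2.symbol_unique[where i="Suc 0"])
    show "sym2 (Suc 0) (cq (Bq (\<iota>q a) (\<iota>q b) m)) (\<Delta> (bracket a b m))"
      by (rule symbol_coprod[OF sbr[OF a b] bracket_closed[OF a b]])
    have "sym2 (Suc 0) (cq (Bq (\<iota>q a) (\<iota>q b) m)) (?r \<ominus>\<^bsub>TP\<^esub> \<zero>\<^bsub>TP\<^esub>)"
      unfolding q.ASI_coproduct_bracket[OF Q ic]
    proof (rule L2.symbol_minus)
      show "sym2 (Suc 0) (act_left_neg Kh Mq Dq (Bq (\<iota>q b)) (dq (\<iota>q a)) m) \<zero>\<^bsub>TP\<^esub>"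
        by (rule L2.symbol_Suc[OF symbol_act_left_neg[OF sBb da]]) (simp_all add: closed)
      show "sym2 (Suc 0) (act_left Kh Mq (Bq (\<iota>q a)) (cq (\<iota>q b)) m \<oplus>\<^bsub>TM\<^esub>
          act_right Kh Mq (Bq (\<iota>q a)) (cq (\<iota>q b)) m \<ominus>\<^bsub>TM\<^esub>
          act_right_neg Kh Mq Dq (mq (\<iota>q b)) (dq (\<iota>q a)) m \<oplus>\<^bsub>TM\<^esub>
          act_left_neg Kh Mq Dq (mq (\<iota>q b)) (dq (\<iota>q a)) m) ?r"
        by (intro L2.symbol_add L2.symbol_minus symbol_act_left[OF sBa cb] symbol_act_right[OF sBa cb]
          symbol_act_right_neg[OF sMb da] symbol_act_left_neg[OF sMb da] TP.a_closed TP.minus_closed closed) simp_all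
    qed (use closed in auto)
    thus "sym2 (Suc 0) (cq (Bq (\<iota>q a) (\<iota>q b) m)) ?r" using closed by (simp add: x_minus_0[symmetric])
  qed (use closed cc bracket_closed[OF a b] in auto)
qed

end

section \<open>The Poisson conformal bialgebra\<close>

context conformal_formal_deformation
begin

interpretation q: ASI_conformal_bialgebra Kh Mq Dq mq cq by (rule quotient_ASI)
interpretation L1: h_lift k 3 P Mq \<iota>q by (rule lift1)
interpretation L2: h_lift k 3 TP TM \<iota>2 by (rule lift2)
interpretation L3: h_lift k 3 TP3 TM3 \<iota>3 by (rule lift3)
interpretation TP3: Module.module k TP3 by (rule L3.Q_module)

text \<open>
  The associator preserves leading coefficients; it is enough to check this on \<open>p \<otimes> y\<close> with a constant
  tensor \<open>y\<close>, and then on \<open>y = u \<otimes> v\<close>.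
\<close>

lemma symbol_tensor_assoc:
  assumes z: "has_symbol k (tensor Kh Mq TM) (tensor_iota k Mq TM \<iota>q \<iota>2) i z x" and x: "x \<in> carrier (tensor k P TP)"
  shows "sym3 i (tensor_assoc Kh Mq z) (tensor_assoc k P x)"
proof -
  note aM = tensor_assoc_module_maps[OF L1.N_module] and aP = tensor_assoc_module_maps[OF P_module]
  have pure: "sym3 0 (tensor_assoc Kh Mq (tensor_pure Kh Mq TM (\<iota>q p) (\<iota>2 y))) (tensor_assoc k P (tensor_pure k P TP p y))"
    if p: "p \<in> carrier P" and y: "y \<in> carrier TP" for p y
  proof -
    have "sym3 (0 + 0) (tensor_assoc Kh Mq (tensor_pure Kh Mq TM (\<iota>q p) (\<iota>2 y))) (tensor_assoc k P (tensor_pure k P TP p y))"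
    proof (rule symbol_tensor_mapI[OF lift1 lift1 lift3
        module_maps_comp[OF bilinear_maps_right[OF tensor_pure_bilinear[OF L1.N_module L2.N_module] L1.iota_closed[OF p]] aM]
        module_maps_comp[OF bilinear_maps_right[OF tensor_pure_bilinear[OF P_module L2.Q_module] p] aP] _ L2.symbol_iota[OF y] y])
      fix u v assume uv: "u \<in> carrier P" "v \<in> carrier P"
      show "sym3 0 (tensor_assoc Kh Mq (tensor_pure Kh Mq TM (\<iota>q p) (tensor_pure Kh Mq Mq (\<iota>q u) (\<iota>q v))))
        (tensor_assoc k P (tensor_pure k P TP p (tensor_pure k P P u v)))"
        using L3.symbol_iota[OF tensor_pure_closed[OF L2.Q_module P_module tensor_pure_closed[OF P_module P_module p uv(1)] uv(2)]]
        by (simp add: tensor_assoc_pure[OF L1.N_module] tensor_assoc_pure[OF P_module] p uv L1.iota_closed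
            tensor_iota_pure[OF lift2 lift1] tensor_iota_pure[OF lift1 lift1] tensor_pure_closed[OF P_module P_module])
    qed
    thus ?thesis by simp
  qed
  have "sym3 (i + 0) (tensor_assoc Kh Mq z) (tensor_assoc k P x)"
    by (rule symbol_tensor_mapI[OF lift1 lift2 lift3 aM aP pure z x])
  thus ?thesis by simp
qed

context
  fixes d \<delta> e
  assumes d: "d \<in> module_maps Kh Mq TM" and \<delta>: "\<delta> \<in> module_maps k P TP"
    and d\<delta>: "\<And>p. p \<in> carrier P \<Longrightarrow> sym2 e (d (\<iota>q p)) (\<delta> p)"
begin

lemma symbol_coprod_on_left:
  assumes z: "sym2 i z x" and x: "x \<in> carrier TP" and l: "l = i + e"
  shows "sym3 l (coprod_on_left Kh Mq d z) (coprod_on_left k P \<delta> x)"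
  using symbol_tensor_map[OF lift1 lift1 lift2 lift1 d \<delta> d\<delta> module_maps_id(2) module_maps_id(2) _ z x, of 0] L1.symbol_iota
  by (simp add: coprod_on_left_def l)

lemma symbol_coprod_on_right:
  assumes z: "sym2 i z x" and x: "x \<in> carrier TP" and l: "l = i + e"
  shows "sym3 l (coprod_on_right Kh Mq d z) (coprod_on_right k P \<delta> x)"
proof -
  have "has_symbol k (tensor Kh Mq TM) (tensor_iota k Mq TM \<iota>q \<iota>2) (i + (0 + e))
      (tensor_map Kh Mq TM id d z) (tensor_map k P TP id \<delta> x)"
    by (rule symbol_tensor_map[OF lift1 lift1 lift1 lift2 module_maps_id(2) module_maps_id(2) _ d \<delta> d\<delta> z x])
      (simp add: L1.symbol_iota)
  from symbol_tensor_assoc[OF this module_maps_closed[OF tensor_map_module_maps[OF P_module P_module P_module L2.Q_module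
    module_maps_id(2) \<delta>] x]] show ?thesis
    by (simp add: coprod_on_right_def l)
qed

end

lemma symbol_flip_left:
  assumes z: "sym3 i z x" and x: "x \<in> carrier TP3"
  shows "sym3 i (flip_left Kh Mq z) (flip_left k P x)"
proof -
  have "sym3 (i + (0 + 0)) (flip_left Kh Mq z) (flip_left k P x)"
    unfolding flip_left_def
    by (rule symbol_tensor_map[OF lift2 lift1 lift2 lift1 tensor_flip_module_maps[OF L1.N_module]
          tensor_flip_module_maps[OF P_module] _ module_maps_id(2) module_maps_id(2) _ z x])
      (simp_all add: L1.symbol_iota symbol_flip[OF L2.symbol_iota])
  thus ?thesis by simp
qed

text \<open>
  The identities of the cocommutator on \<open>P[[h]] / h^3\<close>, in degree 2 for the co-Jacobi identity and in
  degree 1 for the co-Leibniz rule.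
\<close>

lemma cobracket_identities:
  assumes a: "a \<in> carrier P"
  shows cobracket_cojacobi: "coprod_right k P cobracket cobracket a \<ominus>\<^bsub>TP3\<^esub> coprod_right_flip k P cobracket cobracket a
        = coprod_left k P cobracket cobracket a"
    and cobracket_coleibniz: "coprod_right k P \<Delta> cobracket a
        = coprod_left k P cobracket \<Delta> a \<oplus>\<^bsub>TP3\<^esub> coprod_right_flip k P cobracket \<Delta> a"
proof -
  note ia = L1.iota_closed[OF a]
  note coassoc = q.coassoc[OF ia]
  note co = cocommutator_cojacobi[OF L1.N_module q.coprod_linear coassoc ia, unfolded coprod_on]
    cocommutator_coleibniz[OF L1.N_module q.coprod_linear coassoc ia, unfolded coprod_on]
  note sd = dq_module_maps cobracket_module_maps symbol_cobracket_iota
  note sc = q.coprod_linear coprod_linear symbol_coprod[OF L1.symbol_iota]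
  note da = symbol_cobracket_iota[OF a] module_maps_closed[OF cobracket_module_maps a]
    and ca = symbol_coprod[OF L1.symbol_iota[OF a] a] module_maps_closed[OF coprod_linear a]
  note cl = module_maps_closed[OF coprod_on_left_module_maps[OF P_module cobracket_module_maps]]
    module_maps_closed[OF coprod_on_right_module_maps[OF P_module cobracket_module_maps]]
    module_maps_closed[OF coprod_on_right_module_maps[OF P_module coprod_linear]]
    module_maps_closed[OF flip_left_module_maps[OF P_module]] da(2) ca(2)
  show "coprod_right k P cobracket cobracket a \<ominus>\<^bsub>TP3\<^esub> coprod_right_flip k P cobracket cobracket a = coprod_left k P cobracket cobracket a"
    unfolding coprod_on
  proof (rule L3.symbol_unique[where i=2])
    have r: "sym3 2 (coprod_on_right Kh Mq dq (dq (\<iota>q a))) (coprod_on_right k P cobracket (cobracket a))"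
      by (rule symbol_coprod_on_right[OF sd da]) simp_all
    show "sym3 2 (coprod_on_left Kh Mq dq (dq (\<iota>q a)))
        (coprod_on_right k P cobracket (cobracket a) \<ominus>\<^bsub>TP3\<^esub> flip_left k P (coprod_on_right k P cobracket (cobracket a)))"
      unfolding co(1)[symmetric] by (rule L3.symbol_minus[OF r symbol_flip_left[OF r]]) (simp_all add: cl)
    show "sym3 2 (coprod_on_left Kh Mq dq (dq (\<iota>q a))) (coprod_on_left k P cobracket (cobracket a))"
      by (rule symbol_coprod_on_left[OF sd da]) simp_all
  qed (simp_all add: cl)
  show "coprod_right k P \<Delta> cobracket a = coprod_left k P cobracket \<Delta> a \<oplus>\<^bsub>TP3\<^esub> coprod_right_flip k P cobracket \<Delta> a"
    unfolding coprod_on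
  proof (rule L3.symbol_unique[where i="Suc 0"])
    show "sym3 (Suc 0) (coprod_on_right Kh Mq cq (dq (\<iota>q a))) (coprod_on_right k P \<Delta> (cobracket a))"
      by (rule symbol_coprod_on_right[OF sc da]) simp_all
    have r: "sym3 (Suc 0) (coprod_on_right Kh Mq dq (cq (\<iota>q a))) (coprod_on_right k P cobracket (\<Delta> a))"
      by (rule symbol_coprod_on_right[OF sd ca]) simp_all
    show "sym3 (Suc 0) (coprod_on_right Kh Mq cq (dq (\<iota>q a)))
        (coprod_on_left k P cobracket (\<Delta> a) \<oplus>\<^bsub>TP3\<^esub> flip_left k P (coprod_on_right k P cobracket (\<Delta> a)))"
      unfolding co(2) by (rule L3.symbol_add[OF symbol_coprod_on_left[OF sd ca] symbol_flip_left[OF r]]) (simp_all add: cl)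
  qed (simp_all add: cl)
qed

lemma poisson_conformal_bialgebra_brackets:
  assumes Q: "rational_scalars Kh"
  shows "poisson_conformal_bialgebra k P D bracket mul cobracket \<Delta>"
proof (intro poisson_conformal_bialgebra.intro poisson_conformal_algebra.intro poisson_conformal_coalgebra.intro
    lie_conformal_algebra.intro lie_conformal_coalgebra.intro)
  show "lambda_product k P D bracket" by (rule bracket_lambda_product)
  show "coproduct k P D cobracket" unfolding cobracket_def by (rule coproduct_cocommutator[OF coprod1])
  show "lie_conformal_algebra_axioms P D bracket"
    by (rule lie_conformal_algebra_axioms.intro[OF bracket_skew[OF Q] bracket_jacobi[OF Q]])
  show "poisson_conformal_algebra_axioms P bracket mul"
    by (rule poisson_conformal_algebra_axioms.intro[OF bracket_leibniz[OF Q]])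
  show "lie_conformal_coalgebra_axioms k P cobracket"
    by (rule lie_conformal_coalgebra_axioms.intro[OF cocommutator_coskew[OF coprod1, folded cobracket_def] cobracket_cojacobi])
  show "poisson_conformal_coalgebra_axioms k P cobracket \<Delta>"
    by (rule poisson_conformal_coalgebra_axioms.intro[OF cobracket_coleibniz])
  show "poisson_conformal_bialgebra_axioms k P D bracket mul cobracket \<Delta>"
    by (rule poisson_conformal_bialgebra_axioms.intro[OF bialgebra_cobracket_bracket[OF Q] bialgebra_cobracket_mult[OF Q]
        bialgebra_coproduct_bracket[OF Q]])
qed (fact comm_assoc_conformal_algebra_axioms cocomm_assoc_conformal_coalgebra_axioms
      comm_cocomm_ASI_conformal_bialgebra_axioms)+

end

theorem theorem4p9:
  fixes k :: "'k ring" and P :: "('k, 'p) module" and D :: "'p \<Rightarrow> 'p"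
    and mul :: "'p \<Rightarrow> 'p \<Rightarrow> nat \<Rightarrow> 'p" and \<Delta> :: "'p \<Rightarrow> ('p \<times> 'p \<Rightarrow> 'k) set"
    and mulh :: "(nat \<Rightarrow> 'p) \<Rightarrow> (nat \<Rightarrow> 'p) \<Rightarrow> nat \<Rightarrow> nat \<Rightarrow> 'p"
    and \<Delta>h :: "(nat \<Rightarrow> 'p) \<Rightarrow> nat \<Rightarrow> ((nat \<Rightarrow> 'p) \<times> (nat \<Rightarrow> 'p) \<Rightarrow> (nat \<Rightarrow> 'k)) set set"
    and \<mu> :: "nat \<Rightarrow> 'p \<Rightarrow> 'p \<Rightarrow> nat \<Rightarrow> 'p"
    and \<Delta>s :: "nat \<Rightarrow> 'p \<Rightarrow> ('p \<times> 'p \<Rightarrow> 'k) set"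
    and br :: "'p \<Rightarrow> 'p \<Rightarrow> nat \<Rightarrow> 'p" and \<delta> :: "'p \<Rightarrow> ('p \<times> 'p \<Rightarrow> 'k) set"
  assumes "Ring.field k"
    and "\<And>n::nat. n > 0 \<Longrightarrow> add_pow k n \<one>\<^bsub>k\<^esub> \<noteq> \<zero>\<^bsub>k\<^esub>"
    and "finitely_generated_diff_module k P D"
    and "conformal_formal_deformation k P D mul \<Delta> mulh \<Delta>h \<mu> \<Delta>s"
    and br_def: "\<And>a b n. br a b n = \<mu> 1 a b n \<ominus>\<^bsub>P\<^esub> subst_neg P D (\<mu> 1 b a) n"
    and \<delta>_def: "\<And>a. \<delta> a = \<Delta>s 1 a \<ominus>\<^bsub>tensor k P P\<^esub> tensor_flip k P (\<Delta>s 1 a)"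
  shows "(\<forall>a \<in> carrier P. \<forall>b \<in> carrier P. \<forall>n.
            \<exists>y \<in> carrier (power_series_module P).
              hadic_commutator P D mulh (const_coeff P a) (const_coeff P b) n
                = hvar k \<odot>\<^bsub>power_series_module P\<^esub> y \<and> y 0 = br a b n) \<and>
         (let K = power_series_ring k; Ph = power_series_module P; T = tensor K Ph Ph;
              C = hadic_completion K (hvar k) T in
          \<forall>a \<in> carrier P. \<exists>y \<in> carrier C.
            hadic_cocommutator K (hvar k) Ph \<Delta>h (const_coeff P a) = hvar k \<odot>\<^bsub>C\<^esub> y \<and>
            y 1 = hadic_coset K (hvar k) T 1 (tensor_embed k P (\<delta> a))) \<and>
         poisson_conformal_bialgebra k P D br mul \<delta> \<Delta>"
proof -
  interpret conformal_formal_deformation k P D mul \<Delta> mulh \<Delta>h \<mu> \<Delta>s by (rule assms(4))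
  have br: "br = bracket" by (simp add: fun_eq_iff br_def bracket_eq)
  have \<delta>: "\<delta> = cobracket" by (simp add: fun_eq_iff \<delta>_def cobracket_def cocommutator_def)
  have Q: "rational_scalars (power_series_ring k)"
    by (rule power_series_rational_scalars[OF P_module assms(1) K_cring assms(2)])
  show ?thesis
  proof (intro conjI)
    show "\<forall>a \<in> carrier P. \<forall>b \<in> carrier P. \<forall>n.
            \<exists>y \<in> carrier (power_series_module P).
              hadic_commutator P D mulh (const_coeff P a) (const_coeff P b) n
                = hvar k \<odot>\<^bsub>power_series_module P\<^esub> y \<and> y 0 = br a b n"
      using commutator_divisible[of br, OF br_def] by blast
    show "poisson_conformal_bialgebra k P D br mul \<delta> \<Delta>"
      unfolding br \<delta> by (rule poisson_conformal_bialgebra_brackets[OF Q])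
    show "let K = power_series_ring k; Ph = power_series_module P; T = tensor K Ph Ph;
              C = hadic_completion K (hvar k) T in
          \<forall>a \<in> carrier P. \<exists>y \<in> carrier C.
            hadic_cocommutator K (hvar k) Ph \<Delta>h (const_coeff P a) = hvar k \<odot>\<^bsub>C\<^esub> y \<and>
            y 1 = hadic_coset K (hvar k) T 1 (tensor_embed k P (\<delta> a))"
      unfolding Let_def using cocommutator_divisible[of \<delta>, OF \<delta>_def] by blast
  qed
qed

end
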